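(* Let $n\ge 2$ be an integer. For every real number $p$ with $0<p<n/2$ and every origin-symmetric star body $K$ in $\mathbb R^n$ we have $$\int_{S^{n-1}}\left|I_p\left(\|\cdot\|_K^{-n+p}\right)(\theta)\right|^{n/p}d\sigma(\theta)\le \left(\frac{n}{2p}\right)^{n/2}\kappa_n^{\,1-\frac np}\left(\mathrm{vol}_n(K)\right)^{\frac np-1}.$$
   Context: $S^{n-1}$ is the unit sphere of $\mathbb R^n$, $|\cdot|_2$ is the Euclidean norm, $\sigma$ is the rotation-invariant probability measure on $S^{n-1}$, $\mathrm{vol}_n$ is $n$-dimensional volume, and $\kappa_n=\pi^{n/2}/\Gamma(1+n/2)$ is the volume of the unit Euclidean ball in $\mathbb R^n$. A set $K\subset\mathbb R^n$ is star-shaped if for every $x\in K$ the closed segment from $x$ to the origin lies in $K$. A compact set $K$ is a star body if it is star-shaped and its radial function $\rho_K(\xi)=\max\{a\ge0:a\xi\in K\}$, $\xi\in S^{n-1}$, is positive and continuous. It is origin-symmetric if $K=-K$. The Minkowski functional of $K$ is $\|x\|_K=\min\{a\ge0:x\in aK\}$, $x\in\mathbb R^n$. Definition of $I_p$, $0<p<n$: for $f\in C^\infty(S^{n-1})$, the function $$\frac{\Gamma\left(\frac{n-p}{2}\right)}{2^p\pi^{n/2}\Gamma\left(\frac p2\right)}\,|x|_2^{-n+p} f\left(\frac{x}{|x|_2}\right)$$ is locally integrable on $\mathbb R^n$ and is regarded as a tempered distribution. Its Fourier transform (in the sense of distributions, with convention $\hat\phi(\xi)=\int_{\mathbb R^n}\phi(x)e^{-i\langle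 x,\xi\rangle}dx$ for test functions) is a homogeneous function of degree $-p$ which is infinitely smooth on $\mathbb R^n\setminus\{0\}$; $I_pf\in C^\infty(S^{n-1})$ is the restriction of this function to $S^{n-1}$. The normalization is such that $I_p(1)=1$. For $0<p<n/2$, $I_p$ extends by continuity from even smooth functions to a linear operator of norm $1$ on $L^2_{even}(S^{n-1})$ (the even functions in $L^2(S^{n-1},\sigma)$). $I_p(\|\cdot\|_K^{-n+p})$ denotes this operator applied to the restriction of $\|\cdot\|_K^{-n+p}$ to $S^{n-1}$, which is an even continuous function. *)

theory Defs
  imports "HOL-Probability.Probability"
begin

section \<open>The rotation-invariant probability measure on the sphere\<close>

text \<open>
  The radial projection of the uniform distribution on the unit ball. The lemmas below
  confirm that it is a probability measure on the Borel sets of the sphere and that it is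
  invariant under orthogonal maps; these two properties determine it uniquely.
\<close>

definition sphere_measure :: "(real ^ 'n) measure" where
  "sphere_measure =
     restrict_space (distr (uniform_measure lborel (ball 0 1)) borel (\<lambda>x. x /\<^sub>R norm x)) (sphere 0 1)"

lemma space_sphere_measure: "space sphere_measure = (sphere 0 1 :: (real ^ 'n) set)"
  by (simp add: sphere_measure_def space_restrict_space)

lemma sets_sphere_measure:
  "sets sphere_measure = sets (restrict_space borel (sphere 0 1 :: (real ^ 'n) set))"
  unfolding sphere_measure_def by (rule sets_restrict_space_cong) simp

lemma emeasure_lborel_unit_ball:
  "emeasure lborel (ball 0 1 :: 'a::euclidean_space set) \<noteq> 0"
  "emeasure lborel (ball 0 1 :: 'a::euclidean_space set) \<noteq> \<infinity>"
proof -
  have eq: "emeasure lborel (ball 0 1 :: 'a set) = ennreal (unit_ball_vol (real DIM('a)))"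
    by (subst emeasure_ball) auto
  show "emeasure lborel (ball 0 1 :: 'a set) \<noteq> 0"
    unfolding eq by (simp add: ennreal_eq_0_iff not_le)
  show "emeasure lborel (ball 0 1 :: 'a set) \<noteq> \<infinity>"
    unfolding eq by simp
qed

lemma emeasure_sphere_measure:
  fixes A :: "(real ^ 'n) set"
  assumes A: "A \<in> sets borel" "A \<subseteq> sphere 0 1"
  shows "emeasure sphere_measure A =
    emeasure lborel {x \<in> ball 0 1. x /\<^sub>R norm x \<in> A} / emeasure lborel (ball 0 1 :: (real ^ 'n) set)"
proof -
  have [measurable]: "(\<lambda>x::real ^ 'n. x /\<^sub>R norm x) \<in> borel_measurable borel"
    by measurable
  have "emeasure sphere_measure A =
      emeasure (distr (uniform_measure lborel (ball 0 1)) borel (\<lambda>x. x /\<^sub>R norm x)) A"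
    unfolding sphere_measure_def using A by (intro emeasure_restrict_space) auto
  also have "\<dots> = emeasure (uniform_measure lborel (ball 0 1)) ((\<lambda>x. x /\<^sub>R norm x) -` A)"
    using A by (subst emeasure_distr) auto
  also have "\<dots> = emeasure lborel (ball 0 1 \<inter> ((\<lambda>x. x /\<^sub>R norm x) -` A)) / emeasure lborel (ball 0 1 :: (real ^ 'n) set)"
    using A by (intro emeasure_uniform_measure) (auto intro!: measurable_sets_borel)
  also have "ball 0 1 \<inter> ((\<lambda>x. x /\<^sub>R norm x) -` A) = {x \<in> ball 0 1. x /\<^sub>R norm x \<in> A}"
    by auto
  finally show ?thesis .
qed

lemma prob_space_sphere_measure: "prob_space (sphere_measure :: (real ^ 'n) measure)"
proof
  have "emeasure sphere_measure (space sphere_measure :: (real ^ 'n) set)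
    = emeasure lborel {x \<in> ball 0 1. x /\<^sub>R norm x \<in> sphere (0::real^'n) 1} / emeasure lborel (ball 0 1 :: (real ^ 'n) set)"
    unfolding space_sphere_measure by (intro emeasure_sphere_measure) auto
  also have "{x \<in> ball 0 1. x /\<^sub>R norm x \<in> sphere (0::real^'n) 1} = ball 0 1 - {0}"
    by auto
  also have "emeasure lborel (ball (0::real^'n) 1 - {0}) = emeasure lborel (ball (0::real^'n) 1)"
    by (intro emeasure_Diff_null_set) auto
  also have "\<dots> / emeasure lborel (ball 0 1 :: (real ^ 'n) set) = 1"
    using emeasure_lborel_unit_ball by (auto intro!: ennreal_divide_self simp: top.not_eq_extremum)
  finally show "emeasure sphere_measure (space sphere_measure :: (real ^ 'n) set) = 1" .
qed

lemma nn_integral_lborel_translation: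
  fixes f :: "'a::euclidean_space \<Rightarrow> ennreal"
  assumes [measurable]: "f \<in> borel_measurable borel"
  shows "(\<integral>\<^sup>+x. f (x + a) \<partial>lborel) = (\<integral>\<^sup>+x. f x \<partial>lborel)"
proof -
  have "(\<integral>\<^sup>+x. f x \<partial>lborel) = (\<integral>\<^sup>+x. f x \<partial>distr lborel borel ((+) a))"
    by (simp add: lborel_distr_plus)
  also have "\<dots> = (\<integral>\<^sup>+x. f (a + x) \<partial>lborel)"
    by (subst nn_integral_distr) auto
  finally show ?thesis by (simp add: add.commute)
qed

lemma emeasure_lborel_orthogonal_vimage:
  fixes T :: "'a::euclidean_space \<Rightarrow> 'a"
  assumes T: "orthogonal_transformation T" and [measurable]: "A \<in> sets borel"
  shows "emeasure lborel (T -` A) = emeasure lborel A"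
proof -
  have lin: "linear T"
    by (rule orthogonal_transformation_linear[OF T])
  have [measurable]: "T \<in> borel_measurable borel"
    using lin by (intro borel_measurable_continuous_onI linear_continuous_on)
      (simp add: linear_conv_bounded_linear)
  have surj: "\<exists>y'. T y' = y" for y
    using orthogonal_transformation_surj[OF T] by (metis surjD)
  define B where "B = (ball 0 1 :: 'a set)"
  have [measurable]: "B \<in> sets borel"
    by (simp add: B_def)
  let ?i = "indicator :: 'a set \<Rightarrow> 'a \<Rightarrow> ennreal"
  have transT: "(\<integral>\<^sup>+x. f (T x + y) \<partial>lborel) = (\<integral>\<^sup>+x. f (T x) \<partial>lborel)"
    if [measurable]: "f \<in> borel_measurable borel" for f :: "'a \<Rightarrow> ennreal" and y
  proof -
    obtain z where "T z = y" using surj by blast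
    then have "(\<integral>\<^sup>+x. f (T x + y) \<partial>lborel) = (\<integral>\<^sup>+x. f (T (x + z)) \<partial>lborel)"
      by (simp add: linear_add[OF lin])
    also have "\<dots> = (\<integral>\<^sup>+x. f (T x) \<partial>lborel)"
      by (rule nn_integral_lborel_translation[of "\<lambda>x. f (T x)"]) measurable
    finally show ?thesis .
  qed
  have "emeasure lborel (T -` A) * emeasure lborel B
      = (\<integral>\<^sup>+x. ?i A (T x) * emeasure lborel B \<partial>lborel)"
  proof -
    have "emeasure lborel (T -` A) = (\<integral>\<^sup>+x. indicator (T -` A) x \<partial>lborel)"
      by (rule nn_integral_indicator[symmetric]) (use measurable_sets_borel[of T borel A] in simp)
    also have "\<dots> = (\<integral>\<^sup>+x. ?i A (T x) \<partial>lborel)"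
      by (intro nn_integral_cong) (auto split: split_indicator)
    finally show ?thesis
      by (simp add: nn_integral_multc)
  qed
  also have "\<dots> = (\<integral>\<^sup>+x. (\<integral>\<^sup>+y. ?i A (T x) * ?i B (y - T x) \<partial>lborel) \<partial>lborel)"
  proof (rule nn_integral_cong)
    fix x
    have "(\<integral>\<^sup>+y. ?i A (T x) * ?i B (y - T x) \<partial>lborel) = ?i A (T x) * (\<integral>\<^sup>+y. ?i B (y + (- T x)) \<partial>lborel)"
      by (subst nn_integral_cmult) auto
    also have "(\<integral>\<^sup>+y. ?i B (y + (- T x)) \<partial>lborel) = emeasure lborel B"
      by (subst nn_integral_lborel_translation) auto
    finally show "?i A (T x) * emeasure lborel B = (\<integral>\<^sup>+y. ?i A (T x) * ?i B (y - T x) \<partial>lborel)"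
      by simp
  qed
  also have "\<dots> = (\<integral>\<^sup>+y. (\<integral>\<^sup>+x. ?i A (T x) * ?i B (y - T x) \<partial>lborel) \<partial>lborel)"
    by (rule lborel_pair.Fubini'[symmetric]) measurable
  also have "\<dots> = (\<integral>\<^sup>+y. (\<integral>\<^sup>+x. ?i A (T x + y) * ?i B (- T x) \<partial>lborel) \<partial>lborel)"
  proof (rule nn_integral_cong)
    fix y
    show "(\<integral>\<^sup>+x. ?i A (T x) * ?i B (y - T x) \<partial>lborel) = (\<integral>\<^sup>+x. ?i A (T x + y) * ?i B (- T x) \<partial>lborel)"
      using transT[of "\<lambda>z. ?i A z * ?i B (y - z)" y] by simp
  qed
  also have "\<dots> = (\<integral>\<^sup>+x. (\<integral>\<^sup>+y. ?i A (T x + y) * ?i B (- T x) \<partial>lborel) \<partial>lborel)"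
    by (rule lborel_pair.Fubini'[symmetric]) measurable
  also have "\<dots> = (\<integral>\<^sup>+x. emeasure lborel A * ?i B x \<partial>lborel)"
  proof (rule nn_integral_cong)
    fix x
    have Bx: "?i B (- T x) = ?i B x"
      using orthogonal_transformation_norm[OF T, of x] by (auto simp: B_def split: split_indicator)
    have "(\<integral>\<^sup>+y. ?i A (T x + y) * ?i B (- T x) \<partial>lborel) = (\<integral>\<^sup>+y. ?i A (y + T x) \<partial>lborel) * ?i B (- T x)"
      by (subst nn_integral_multc) (auto simp: add.commute)
    also have "(\<integral>\<^sup>+y. ?i A (y + T x) \<partial>lborel) = emeasure lborel A"
      by (subst nn_integral_lborel_translation) auto
    finally show "(\<integral>\<^sup>+y. ?i A (T x + y) * ?i B (- T x) \<partial>lborel) = emeasure lborel A * ?i B x"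
      by (simp only: Bx)
  qed
  also have "\<dots> = emeasure lborel A * emeasure lborel B"
    by (subst nn_integral_cmult) auto
  finally show ?thesis
    using emeasure_lborel_unit_ball[where 'a='a]
    by (metis B_def infinity_ennreal_def mult_divide_eq_ennreal)
qed

lemma sphere_measure_rotation_invariant:
  fixes T :: "real ^ 'n \<Rightarrow> real ^ 'n"
  assumes T: "orthogonal_transformation T"
  shows "distr sphere_measure sphere_measure T = sphere_measure"
proof (rule measure_eqI)
  show "sets (distr sphere_measure sphere_measure T) = sets sphere_measure"
    by simp
  have lin: "linear T"
    by (rule orthogonal_transformation_linear[OF T])
  have [measurable]: "T \<in> borel_measurable borel"
    using lin by (intro borel_measurable_continuous_onI linear_continuous_on)
      (simp add: linear_conv_bounded_linear)
  have nT: "norm (T x) = norm x" for x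
    by (rule orthogonal_transformation_norm[OF T])
  have T_meas: "T \<in> measurable sphere_measure sphere_measure"
    unfolding measurable_cong_sets[OF sets_sphere_measure sets_sphere_measure]
    by (intro measurable_restrict_space3) (auto simp: nT)
  fix A :: "(real ^ 'n) set"
  assume "A \<in> sets (distr sphere_measure sphere_measure T)"
  then have A: "A \<in> sets sphere_measure" by simp
  then have [measurable]: "A \<in> sets borel" and A': "A \<subseteq> sphere 0 1"
    by (auto simp: sets_sphere_measure sets_restrict_space)
  have "emeasure (distr sphere_measure sphere_measure T) A = emeasure sphere_measure (T -` A \<inter> sphere 0 1)"
    using T_meas A by (simp add: emeasure_distr space_sphere_measure)
  also have "T -` A \<inter> sphere 0 1 = T -` A"
    using A' nT by force
  also have "emeasure sphere_measure (T -` A) =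
      emeasure lborel {x \<in> ball 0 1. x /\<^sub>R norm x \<in> T -` A} / emeasure lborel (ball 0 1 :: (real ^ 'n) set)"
    using A' nT by (intro emeasure_sphere_measure measurable_sets_borel[of T borel]) force+
  also have "{x \<in> ball 0 1. x /\<^sub>R norm x \<in> T -` A} = T -` {x \<in> ball 0 1. x /\<^sub>R norm x \<in> A}"
    by (auto simp: nT linear_scale[OF lin])
  also have "emeasure lborel \<dots> = emeasure lborel {x \<in> ball 0 1. x /\<^sub>R norm x \<in> A}"
    by (intro emeasure_lborel_orthogonal_vimage[OF T]) measurable
  also have "\<dots> / emeasure lborel (ball 0 1 :: (real ^ 'n) set) = emeasure sphere_measure A"
    using A' by (intro emeasure_sphere_measure[symmetric]) auto
  finally show "emeasure (distr sphere_measure sphere_measure T) A = emeasure sphere_measure A" .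
qed


section \<open>Star bodies\<close>

definition star_shaped :: "(real ^ 'n) set \<Rightarrow> bool" where
  "star_shaped K \<longleftrightarrow> (\<forall>x\<in>K. closed_segment x 0 \<subseteq> K)"

definition radial_function :: "(real ^ 'n) set \<Rightarrow> real ^ 'n \<Rightarrow> real" where
  "radial_function K \<xi> = (GREATEST a. a \<ge> 0 \<and> a *\<^sub>R \<xi> \<in> K)"

text \<open>
  Nonemptiness is implicit in the existence of the maximum defining the radial function;
  it has to be required because \<open>GREATEST\<close> is an unspecified total value otherwise.
\<close>

definition star_body :: "(real ^ 'n) set \<Rightarrow> bool" where
  "star_body K \<longleftrightarrow> compact K \<and> K \<noteq> {} \<and> star_shaped K \<and>
     (\<forall>\<xi>\<in>sphere 0 1. radial_function K \<xi> > 0) \<and>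
     continuous_on (sphere 0 1) (radial_function K)"

definition origin_symmetric :: "(real ^ 'n) set \<Rightarrow> bool" where
  "origin_symmetric K \<longleftrightarrow> K = uminus ` K"

definition minkowski_functional :: "(real ^ 'n) set \<Rightarrow> real ^ 'n \<Rightarrow> real" where
  "minkowski_functional K x = (LEAST a. a \<ge> 0 \<and> x \<in> (*\<^sub>R) a ` K)"


section \<open>Smooth functions, test functions and Fourier transforms\<close>

primrec iterated_derivative ::
  "'a list \<Rightarrow> ('a::real_normed_vector \<Rightarrow> 'b::real_normed_vector) \<Rightarrow> 'a \<Rightarrow> 'b" where
  "iterated_derivative [] f = f"
| "iterated_derivative (v # vs) f = iterated_derivative vs (\<lambda>x. frechet_derivative f (at x) v)"

text \<open>To be used for open \<open>S\<close> only.\<close>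

definition smooth_on ::
  "('a::real_normed_vector) set \<Rightarrow> ('a \<Rightarrow> 'b::real_normed_vector) \<Rightarrow> bool" where
  "smooth_on S f \<longleftrightarrow> (\<forall>vs. iterated_derivative vs f differentiable_on S)"

definition schwartz :: "(real ^ 'n \<Rightarrow> complex) \<Rightarrow> bool" where
  "schwartz \<phi> \<longleftrightarrow> smooth_on UNIV \<phi> \<and>
     (\<forall>vs m. bounded (range (\<lambda>x. norm x ^ m *\<^sub>R iterated_derivative vs \<phi> x)))"

definition fourier :: "(real ^ 'n \<Rightarrow> complex) \<Rightarrow> real ^ 'n \<Rightarrow> complex" where
  "fourier \<phi> \<xi> = (LINT x|lborel. \<phi> x * exp (- \<i> * complex_of_real (x \<bullet> \<xi>)))"

text \<open>
  Tempered distributions are represented as functionals whose values matter on Schwartz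
  functions only. Below, the functions regarded as distributions are locally integrable with
  at most polynomial growth at infinity.
\<close>

definition distribution_of ::
  "(real ^ 'n \<Rightarrow> complex) \<Rightarrow> (real ^ 'n \<Rightarrow> complex) \<Rightarrow> complex" where
  "distribution_of F \<phi> = (LINT x|lborel. F x * \<phi> x)"

definition distribution_fourier ::
  "((real ^ 'n \<Rightarrow> complex) \<Rightarrow> complex) \<Rightarrow> (real ^ 'n \<Rightarrow> complex) \<Rightarrow> complex" where
  "distribution_fourier T \<phi> = T (fourier \<phi>)"


section \<open>The operators \<open>I\<^sub>p\<close>\<close>

text \<open>
  Functions on the sphere are represented by functions on the whole space; their values
  off the sphere are irrelevant.
\<close>

definition smooth_on_sphere :: "(real ^ 'n \<Rightarrow> complex) \<Rightarrow> bool" where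
  "smooth_on_sphere f \<longleftrightarrow> smooth_on (- {0}) (\<lambda>x. f (x /\<^sub>R norm x))"

definition even_on_sphere :: "(real ^ 'n \<Rightarrow> complex) \<Rightarrow> bool" where
  "even_on_sphere f \<longleftrightarrow> (\<forall>x\<in>sphere 0 1. f (- x) = f x)"

definition Ip_kernel :: "real \<Rightarrow> (real ^ 'n \<Rightarrow> complex) \<Rightarrow> real ^ 'n \<Rightarrow> complex" where
  "Ip_kernel p f x =
     (let n = real CARD('n) in
        complex_of_real (Gamma ((n - p) / 2) / (2 powr p * pi powr (n / 2) * Gamma (p / 2))
          * norm x powr (- n + p)) * f (x /\<^sub>R norm x))"

definition homogeneous :: "real \<Rightarrow> (real ^ 'n \<Rightarrow> complex) \<Rightarrow> bool" where
  "homogeneous d g \<longleftrightarrow>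
     (\<forall>t>0. \<forall>x. x \<noteq> 0 \<longrightarrow> g (t *\<^sub>R x) = complex_of_real (t powr d) * g x)"

text \<open>
  \<open>Ip_smooth p f\<close> is the homogeneous function of degree \<open>- p\<close> on the punctured space that
  represents the Fourier transform of the distribution \<open>Ip_kernel p f\<close>; as a function on the
  sphere it is \<open>I\<^sub>p f\<close>. The value at the origin is fixed only to make the function unique.
\<close>

definition Ip_smooth :: "real \<Rightarrow> (real ^ 'n \<Rightarrow> complex) \<Rightarrow> real ^ 'n \<Rightarrow> complex" where
  "Ip_smooth p f = (THE g. g 0 = 0 \<and> homogeneous (- p) g \<and> smooth_on (- {0}) g \<and>
     (\<forall>\<phi>. schwartz \<phi> \<longrightarrow>
        distribution_fourier (distribution_of (Ip_kernel p f)) \<phi> = distribution_of g \<phi>))"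

definition L2_even :: "(real ^ 'n \<Rightarrow> complex) set" where
  "L2_even = {f. f \<in> borel_measurable sphere_measure \<and>
     integrable sphere_measure (\<lambda>x. (cmod (f x))\<^sup>2) \<and>
     (AE x in sphere_measure. f (- x) = f x)}"

definition L2_norm_sphere :: "(real ^ 'n \<Rightarrow> complex) \<Rightarrow> real" where
  "L2_norm_sphere f = sqrt (LINT x|sphere_measure. (cmod (f x))\<^sup>2)"

text \<open>
  The extension by continuity: the limit in \<open>L2\<close> of \<open>Ip_smooth p g\<close> as the even smooth
  function \<open>g\<close> tends to \<open>f\<close> in \<open>L2\<close>. Elements of \<open>L2\<close> are represented by functions, so the
  value is some representative, determined up to a null set of the sphere.
\<close>

definition Ip :: "real \<Rightarrow> (real ^ 'n \<Rightarrow> complex) \<Rightarrow> real ^ 'n \<Rightarrow> complex" where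
  "Ip p f = (SOME h. h \<in> L2_even \<and>
     (\<forall>\<epsilon>>0. \<exists>\<delta>>0. \<forall>g. smooth_on_sphere g \<longrightarrow> even_on_sphere g \<longrightarrow>
        L2_norm_sphere (\<lambda>x. g x - f x) < \<delta> \<longrightarrow>
        L2_norm_sphere (\<lambda>x. Ip_smooth p g x - h x) < \<epsilon>))"

end

theory Submission
  imports Defs "HOL-Complex_Analysis.Complex_Analysis"
begin

text \<open>
  Write \<open>q = n / (n - p)\<close> and \<open>q' = n / p\<close>, a pair of conjugate exponents. On the sphere the Minkowski
  functional is the inverse of the radial function \<open>\<rho>\<close>, so the operator is applied to
  \<open>f = \<rho> ^ (n - p)\<close>, and in polar coordinates the volume of \<open>K\<close> is \<open>\<kappa>\<^sub>n\<close> times the mean of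
  \<open>\<rho> ^ n = f ^ q\<close>. The theorem is therefore the statement that \<open>I\<^sub>p\<close> maps \<open>L\<^sup>q\<close> to its dual \<open>L\<^sup>q\<^sup>'\<close>
  with norm at most \<open>(n / 2p) powr (p / 2)\<close>; the body enters only through \<open>star_body_volume\<close>.

  The norm bound is complex interpolation for the analytic family \<open>I\<^sub>z\<close>, \<open>0 \<le> Re z \<le> n / 2\<close>.
  For \<open>z = iy\<close> the operator is integration against a constant multiple of
  \<open>\<bar>\<theta> \<bullet> \<xi>\<bar> powr - iy\<close>, a kernel of modulus one, and the constant is at most \<open>exp (\<pi> \<bar>y\<bar> / 4)\<close>:
  a bound from \<open>L\<^sup>1\<close> to \<open>L\<^sup>\<infinity>\<close>. For \<open>Re z = n / 2\<close> the operator is an isometry of \<open>L\<^sup>2\<close>, because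
  \<open>I\<^sub>z\<close> is symmetric, \<open>I\<^bsub>n - z\<^esub>\<close> inverts it, and \<open>n - z\<close> is the conjugate of \<open>z\<close>. The exponential
  growth on the left edge is cancelled exactly by the function \<open>exp (z Ln (2z / n) / 2)\<close>, which
  has modulus at most one on the right edge and whose value at \<open>p\<close> is the inverse of the constant
  \<open>(n / 2p) powr (p / 2)\<close> (\<open>three_lines_weighted\<close>).

  All of this is carried out on the span of the zonal polynomials \<open>(x \<bullet> a) ^ 2k\<close>, where \<open>I\<^sub>z\<close> is a
  triangular matrix of rational functions of \<open>z\<close>. The entries are read off from Fourier transforms
  of Gaussians times polynomials, and the same test functions show that the \<open>I\<^sub>p\<close> defined through
  distributions is the adjoint of this matrix (\<open>Ip_smooth_zonal_pairing\<close>). Zonal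
  polynomials are uniformly dense in the even continuous functions (\<open>zonal_dense\<close>), also in
  families that depend analytically on the interpolation parameter (\<open>analytic_zonal_family\<close>), so
  \<open>stein_zonal\<close> gives the bilinear inequality \<open>dual_pair_bound\<close> for continuous functions and by
  duality the norm bound for smooth functions. Since \<open>q < 2\<close>, Jensen's inequality turns the bilinear
  inequality into an \<open>L\<^sup>2\<close> bound as well, which makes the extension by continuity exist; Fatou's
  lemma along an almost everywhere convergent subsequence carries the norm bound to the extension
  (\<open>Ip_norm_bound\<close>).
\<close>

section \<open>Differentiation under the integral and translation invariance\<close>

text \<open>
  Convexity of \<open>U\<close> lets the mean value inequality dominate the difference quotients by \<open>2 w\<close>, which
  is what dominated convergence needs.
\<close>

lemma has_derivative_lebesgue_integral:
  fixes f :: "'a::real_normed_vector => 't => 'b::{banach,second_countable_topology}"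
  assumes U: "open U" "convex U" "x \<in> U"
    and int: "\<And>y. y \<in> U ==> integrable M (f y)"
    and meas: "\<And>h. (\<lambda>t. f' x t h) \<in> borel_measurable M"
    and der: "\<And>y t. y \<in> U ==> t \<in> space M ==> ((\<lambda>y. f y t) has_derivative f' y t) (at y)"
    and bound: "\<And>y t h. y \<in> U ==> t \<in> space M ==> norm (f' y t h) \<le> w t * norm h"
    and w: "integrable M w"
  shows "((\<lambda>y. LINT t|M. f y t) has_derivative (\<lambda>h. LINT t|M. f' x t h)) (at x)"
proof -
  have int': "integrable M (\<lambda>t. f' x t h)" for h
    by (rule Bochner_Integration.integrable_bound[where f="\<lambda>t. w t * norm h"])
       (use w meas bound[OF U(3)] in \<open>auto intro!: AE_I2 intro: order_trans[OF _ abs_ge_self]\<close>)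
  have lin: "bounded_linear (f' x t)" if "t \<in> space M" for t
    using der[OF U(3) that] by (rule has_derivative_bounded_linear)
  have bl: "bounded_linear (\<lambda>h. LINT t|M. f' x t h)"
  proof (rule bounded_linear_intro[where K="LINT t|M. w t"])
    show "(LINT t|M. f' x t (a + b)) = (LINT t|M. f' x t a) + (LINT t|M. f' x t b)" for a b
      by (subst Bochner_Integration.integral_add[symmetric, OF int' int'])
         (auto intro!: Bochner_Integration.integral_cong simp: linear_simps[OF lin] linear_scale[OF bounded_linear.linear[OF lin]])
    show "(LINT t|M. f' x t (r *\<^sub>R a)) = r *\<^sub>R (LINT t|M. f' x t a)" for r a
    proof -
      have "(LINT t|M. f' x t (r *\<^sub>R a)) = (LINT t|M. r *\<^sub>R f' x t a)"
        by (intro Bochner_Integration.integral_cong refl) (auto simp: linear_scale[OF bounded_linear.linear[OF lin]])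
      then show ?thesis by simp
    qed
    show "norm (LINT t|M. f' x t a) \<le> norm a * (LINT t|M. w t)" for a
    proof -
      have "norm (LINT t|M. f' x t a) \<le> (LINT t|M. norm (f' x t a))" by (rule integral_norm_bound)
      also have "... \<le> (LINT t|M. w t * norm a)"
        using int' w bound[OF U(3)] by (intro integral_mono) auto
      finally show ?thesis by (simp add: mult.commute)
    qed
  qed
  have "((\<lambda>y. norm ((LINT t|M. f y t) - (LINT t|M. f x t) - (LINT t|M. f' x t (y - x))) / norm (y - x)) \<longlongrightarrow> 0) (at x within U)"
  proof (subst tendsto_at_iff_sequentially, intro allI impI)
    fix X :: "nat => 'a" assume X: "\<forall>i. X i \<in> U - {x}" "X \<longlonglongrightarrow> x"
    define r where "r k t = (f (X k) t - f x t - f' x t (X k - x)) /\<^sub>R norm (X k - x)" for k t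
    have XU: "X k \<in> U" "X k \<noteq> x" for k using X by auto
    have "(\<lambda>k. LINT t|M. r k t) \<longlonglongrightarrow> (LINT t|M. 0)"
    proof (rule integral_dominated_convergence[where w="\<lambda>t. 2 * w t"])
      show "(\<lambda>t. 0::'b) \<in> borel_measurable M" by simp
      show "r k \<in> borel_measurable M" for k unfolding r_def
        using int[OF XU(1)] int[OF U(3)] meas
        by (intro borel_measurable_scaleR borel_measurable_diff) auto
      show "integrable M (\<lambda>t. 2 * w t)" using w by simp
      show "AE t in M. (\<lambda>k. r k t) \<longlonglongrightarrow> 0"
      proof (rule AE_I2)
        fix t assume t: "t \<in> space M"
        have "((\<lambda>y. (f y t - f x t - f' x t (y - x)) /\<^sub>R norm (y - x)) \<longlongrightarrow> 0) (at x within U)"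
          using has_derivative_at_withinI[OF der[OF U(3) t], of U]
          unfolding has_derivative_iff_norm
          by (intro tendsto_norm_zero_cancel[of "\<lambda>y. _ y /\<^sub>R _ y"]) (simp add: divide_inverse_commute)
        then show "(\<lambda>k. r k t) \<longlonglongrightarrow> 0"
          using X unfolding tendsto_at_iff_sequentially by (auto simp: r_def o_def)
      qed
      show "AE t in M. norm (r k t) \<le> 2 * w t" for k
      proof (rule AE_I2)
        fix t assume t: "t \<in> space M"
        have "0 \<le> w t * norm (X k - x)"
          using bound[OF U(3) t, of "X k - x"] norm_ge_zero order_trans by blast
        then have w0: "0 \<le> w t" using XU(2)[of k] by (simp add: zero_le_mult_iff)
        have "norm (f (X k) t - f x t) \<le> w t * norm (X k - x)"
        proof (rule differentiable_bound[OF U(2) _ _ XU(1) U(3), where f'="\<lambda>y. f' y t"])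
          show "((\<lambda>y. f y t) has_derivative f' y t) (at y within U)" if "y \<in> U" for y
            using der[OF that t] by (rule has_derivative_at_withinI)
          show "onorm (f' y t) \<le> w t" if "y \<in> U" for y
            using bound[OF that t] w0 by (intro onorm_bound) auto
        qed
        then have "norm (f (X k) t - f x t - f' x t (X k - x)) \<le> 2 * w t * norm (X k - x)"
          using bound[OF U(3) t, of "X k - x"] norm_triangle_ineq4[of "f (X k) t - f x t" "f' x t (X k - x)"]
          by linarith
        then show "norm (r k t) \<le> 2 * w t"
          using XU(2)[of k] by (simp add: r_def divide_simps mult.commute)
      qed
    qed
    then have "(\<lambda>k. norm (LINT t|M. r k t)) \<longlonglongrightarrow> 0"
      by (simp add: tendsto_norm_zero)
    moreover have "norm (LINT t|M. r k t) = norm ((LINT t|M. f (X k) t) - (LINT t|M. f x t) - (LINT t|M. f' x t (X k - x))) / norm (X k - x)" for k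
    proof -
      have "(LINT t|M. r k t) = ((LINT t|M. f (X k) t) - (LINT t|M. f x t) - (LINT t|M. f' x t (X k - x))) /\<^sub>R norm (X k - x)"
        unfolding r_def using int[OF XU(1)] int[OF U(3)] int' by simp
      then show ?thesis by (simp add: divide_simps)
    qed
    ultimately show "((\<lambda>y. norm ((LINT t|M. f y t) - (LINT t|M. f x t) - (LINT t|M. f' x t (y - x))) / norm (y - x)) \<circ> X) \<longlonglongrightarrow> 0"
      by (simp add: o_def)
  qed
  then have "((\<lambda>y. LINT t|M. f y t) has_derivative (\<lambda>h. LINT t|M. f' x t h)) (at x within U)"
    using bl by (simp add: has_derivative_iff_norm)
  then show ?thesis using at_within_open[OF U(3) U(1)] by simp
qed

lemma lborel_integral_shift:
  fixes h :: "'a::euclidean_space => 'b::{banach,second_countable_topology}"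
  assumes "h \<in> borel_measurable borel"
  shows "(LINT x|lborel. h (x + a)) = (LINT x|lborel. h x)"
proof -
  have "(LINT x|lborel. h x) = (LINT x|distr lborel borel ((+) a). h x)" by (simp add: lborel_distr_plus)
  also have "... = (LINT x|lborel. h (a + x))" using assms by (intro integral_distr) auto
  finally show ?thesis by (simp add: add.commute)
qed

lemma lborel_integrable_shift:
  fixes h :: "'a::euclidean_space => 'b::{banach,second_countable_topology}"
  assumes "integrable lborel h"
  shows "integrable lborel (\<lambda>x. h (x + a))"
proof -
  have "integrable (distr lborel borel ((+) a)) h" using assms by (simp add: lborel_distr_plus)
  then have "integrable lborel (\<lambda>x. h (a + x))"
    using assms by (subst (asm) integrable_distr_eq) auto
  then show ?thesis by (simp add: add.commute)
qed

text \<open>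
  The multivariate replacement for integration by parts. The increment of \<open>u\<close> along \<open>v\<close> is the integral
  of \<open>u'\<close> over a unit segment; integrated over the whole space it vanishes by translation
  invariance, while by Fubini it equals the integral of \<open>u'\<close>.
\<close>

lemma integral_directional_derivative:
  fixes u u' :: "'a::euclidean_space => complex"
  assumes u: "integrable lborel u" and u': "integrable lborel u'"
    and der: "\<And>x. ((\<lambda>t. u (x + t *\<^sub>R v)) has_vector_derivative u' x) (at 0)"
    and cont: "\<And>x. continuous_on UNIV (\<lambda>t::real. u' (x + t *\<^sub>R v))"
  shows "(LINT x|lborel. u' x) = 0"
proof -
  have [measurable]: "u' \<in> borel_measurable borel" using u' by auto
  have [measurable]: "u \<in> borel_measurable borel" using u by auto
  note shift = lborel_integral_shift
  have der': "((\<lambda>t. u (x + t *\<^sub>R v)) has_vector_derivative u' (x + s *\<^sub>R v)) (at s)" for x s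
  proof -
    have 1: "((\<lambda>t::real. t - s) has_vector_derivative 1) (at s)"
      by (auto intro!: derivative_eq_intros simp: has_real_derivative_iff_has_vector_derivative[symmetric])
    have 2: "((\<lambda>t. u ((x + s *\<^sub>R v) + t *\<^sub>R v)) has_vector_derivative u' (x + s *\<^sub>R v)) (at (s - s))"
      using der[of "x + s *\<^sub>R v"] by simp
    have "((\<lambda>t. u ((x + s *\<^sub>R v) + (t - s) *\<^sub>R v)) has_vector_derivative u' (x + s *\<^sub>R v)) (at s)"
      using vector_diff_chain_at[OF 1 2] by (simp add: o_def)
    then show ?thesis by (simp add: algebra_simps)
  qed
  have ftc: "(LINT s|lborel. indicator {0..1} s *\<^sub>R u' (x + s *\<^sub>R v)) = u (x + v) - u x" for x
  proof -
    have "integral {0..1} (\<lambda>s. u' (x + s *\<^sub>R v)) = u (x + 1 *\<^sub>R v) - u (x + 0 *\<^sub>R v)"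
      by (intro integral_unique fundamental_theorem_of_calculus)
         (auto intro: has_vector_derivative_at_within der')
    moreover have "set_integrable lborel {0..1} (\<lambda>s. u' (x + s *\<^sub>R v))"
      unfolding set_integrable_def
      by (intro borel_integrable_compact) (auto intro: continuous_on_subset[OF cont])
    ultimately show ?thesis
      using set_borel_integral_eq_integral(2)[of "{0..1}" "\<lambda>s. u' (x + s *\<^sub>R v)"]
      by (simp add: set_lebesgue_integral_def)
  qed
  have meas: "(\<lambda>(x, s). indicator {0..1} s *\<^sub>R u' (x + s *\<^sub>R v)) \<in> borel_measurable (lborel \<Otimes>\<^sub>M (lborel :: real measure))"
    by measurable
  have nnshift: "(\<integral>\<^sup>+x. norm (u' (x + s *\<^sub>R v)) \<partial>lborel) = (\<integral>\<^sup>+x. norm (u' x) \<partial>lborel)" for s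
    using nn_integral_lborel_translation[of "\<lambda>x. ennreal (norm (u' x))" "s *\<^sub>R v"] by simp
  have intprod: "integrable (lborel \<Otimes>\<^sub>M (lborel :: real measure)) (\<lambda>(x, s). indicator {0..1} s *\<^sub>R u' (x + s *\<^sub>R v))"
  proof (rule integrableI_bounded[OF meas])
    have "(\<integral>\<^sup>+xs. norm ((\<lambda>(x, s). indicator {0..1} s *\<^sub>R u' (x + s *\<^sub>R v)) xs) \<partial>(lborel \<Otimes>\<^sub>M lborel))
      = (\<integral>\<^sup>+s. (\<integral>\<^sup>+x. norm (indicator {0..1} s *\<^sub>R u' (x + s *\<^sub>R v)) \<partial>lborel) \<partial>(lborel::real measure))"
      by (subst lborel_pair.nn_integral_snd[symmetric]) (use meas in \<open>auto simp: split_beta'\<close>)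
    also have "... = (\<integral>\<^sup>+s. indicator {0..1} s * (\<integral>\<^sup>+x. norm (u' x) \<partial>lborel) \<partial>(lborel::real measure))"
    proof (rule nn_integral_cong)
      fix s :: real
      show "(\<integral>\<^sup>+x. norm (indicator {0..1} s *\<^sub>R u' (x + s *\<^sub>R v)) \<partial>lborel) = indicator {0..1} s * (\<integral>\<^sup>+x. norm (u' x) \<partial>lborel)"
        by (cases "s \<in> {0..1}") (simp_all add: nnshift)
    qed
    also have "... = (\<integral>\<^sup>+x. norm (u' x) \<partial>lborel)"
      by (subst nn_integral_multc) auto
    also have "... < \<infinity>" using u' by (simp add: integrable_iff_bounded)
    finally show "(\<integral>\<^sup>+xs. norm ((\<lambda>(x, s). indicator {0..1} s *\<^sub>R u' (x + s *\<^sub>R v)) xs) \<partial>(lborel \<Otimes>\<^sub>M (lborel::real measure))) < \<infinity>" .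
  qed
  have "(LINT x|lborel. u' x) = (LINT s|lborel. indicator {0..1::real} s *\<^sub>R (LINT x|lborel. u' x))"
    by simp
  also have "... = (LINT s|lborel. (LINT x|lborel. indicator {0..1::real} s *\<^sub>R u' (x + s *\<^sub>R v)))"
    by (intro Bochner_Integration.integral_cong refl) (simp add: shift[OF \<open>u' \<in> _\<close>])
  also have "... = (LINT x|lborel. (LINT s|lborel. indicator {0..1::real} s *\<^sub>R u' (x + s *\<^sub>R v)))"
    by (rule lborel_pair.Fubini_integral[OF intprod])
  also have "... = (LINT x|lborel. u (x + v) - u x)"
    by (simp add: ftc)
  also have "... = 0"
  proof -
    have "integrable lborel (\<lambda>x. u (x + v))"
      using u by (rule lborel_integrable_shift)
    then show ?thesis using u by (simp add: shift[OF \<open>u \<in> _\<close>])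
  qed
  finally show ?thesis .
qed

section \<open>Closure properties of smooth functions\<close>

lemma frechet_derivative_cong_open:
  assumes "open S" "x \<in> S" "\<And>y. y \<in> S ==> f y = g y"
  shows "frechet_derivative f (at x) = frechet_derivative g (at x)"
proof -
  have "(f has_derivative D) (at x) \<longleftrightarrow> (g has_derivative D) (at x)" for D
  proof
    show "(g has_derivative D) (at x)" if "(f has_derivative D) (at x)"
      by (rule has_derivative_transform_within_open[OF that assms])
    show "(f has_derivative D) (at x)" if "(g has_derivative D) (at x)"
      by (rule has_derivative_transform_within_open[OF that assms(1,2)]) (simp add: assms(3))
  qed
  then show ?thesis unfolding frechet_derivative_def by simp
qed

lemma differentiable_on_cong_open:
  assumes "open S" "\<And>y. y \<in> S ==> f y = g y" "f differentiable_on S"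
  shows "g differentiable_on S"
proof -
  have "(g has_derivative D) (at x within S)" if "x \<in> S" "(f has_derivative D) (at x within S)" for x D
    by (rule has_derivative_transform[OF that(1) _ that(2)]) (simp add: assms(2))
  then show ?thesis using assms(3) unfolding differentiable_on_def differentiable_def by blast
qed

lemma iterated_derivative_cong_open:
  assumes "open S" "x \<in> S" "\<And>y. y \<in> S ==> f y = g y"
  shows "iterated_derivative vs f x = iterated_derivative vs g x"
  using assms
proof (induction vs arbitrary: f g)
  case (Cons v vs)
  show ?case
    using Cons.prems frechet_derivative_cong_open[OF Cons.prems(1) _ Cons.prems(3)]
    by (auto intro!: Cons.IH)
qed auto

lemma smooth_on_cong_open:
  assumes "open S" "\<And>y. y \<in> S ==> f y = g y" "smooth_on S f"
  shows "smooth_on S g"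
  unfolding smooth_on_def
proof
  fix vs
  show "iterated_derivative vs g differentiable_on S"
    by (rule differentiable_on_cong_open[OF assms(1), of "iterated_derivative vs f"])
       (use assms(3) iterated_derivative_cong_open[OF assms(1) _ assms(2)] in \<open>auto simp: smooth_on_def\<close>)
qed

text \<open>
  Smoothness is a greatest fixed point: a class of differentiable functions that is closed under
  directional derivatives consists of smooth functions. This replaces formulas for iterated
  derivatives of products and compositions by a description of a class that contains them.
\<close>

lemma smooth_on_coinduct:
  assumes S: "open S" and "P f"
    and step: "\<And>f. P f ==> f differentiable_on S \<and>
      (\<forall>v. \<exists>h. P h \<and> (\<forall>x\<in>S. frechet_derivative f (at x) v = h x))"
  shows "smooth_on S f"
proof -
  have "iterated_derivative vs f differentiable_on S" if "P f" for vs f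
    using that
  proof (induction vs arbitrary: f)
    case Nil
    then show ?case using step by simp
  next
    case (Cons v vs)
    obtain h where h: "P h" "\<And>x. x \<in> S ==> frechet_derivative f (at x) v = h x"
      using step[OF Cons.prems] by blast
    show ?case
      by (rule differentiable_on_cong_open[OF S _ Cons.IH[OF h(1)]])
         (use iterated_derivative_cong_open[OF S _ h(2)] in auto)
  qed
  then show ?thesis using \<open>P f\<close> by (simp add: smooth_on_def)
qed

lemma smooth_on_differentiable: "smooth_on S f ==> f differentiable_on S"
  unfolding smooth_on_def by (drule spec[of _ "[]"]) simp

lemma smooth_on_derivative: "smooth_on S f ==> smooth_on S (\<lambda>x. frechet_derivative f (at x) v)"
  unfolding smooth_on_def
proof
  fix vs assume "\<forall>vs. iterated_derivative vs f differentiable_on S"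
  then have "iterated_derivative (v # vs) f differentiable_on S" by blast
  then show "iterated_derivative vs (\<lambda>x. frechet_derivative f (at x) v) differentiable_on S" by simp
qed

lemma smooth_on_has_derivative:
  assumes "smooth_on S f" "open S" "x \<in> S"
  shows "(f has_derivative frechet_derivative f (at x)) (at x)"
  using smooth_on_differentiable[OF assms(1)] assms(2,3)
  by (simp add: differentiable_on_eq_differentiable_at frechet_derivative_works)

lemma smooth_on_continuous: "smooth_on S f ==> continuous_on S f"
  by (intro differentiable_imp_continuous_on smooth_on_differentiable)

lemma smooth_on_Un:
  assumes "open S" "open T" "smooth_on S f" "smooth_on T f"
  shows "smooth_on (S \<union> T) f"
  using assms unfolding smooth_on_def
  by (auto simp: differentiable_on_eq_differentiable_at open_Un)

inductive smooth_ring :: "'a::real_normed_vector set => ('a => 'b::real_normed_algebra) => bool" for S where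
  base: "smooth_on S f ==> smooth_ring S f"
| add: "smooth_ring S f ==> smooth_ring S g ==> smooth_ring S (\<lambda>x. f x + g x)"
| mult: "smooth_ring S f ==> smooth_ring S g ==> smooth_ring S (\<lambda>x. f x * g x)"

lemma smooth_ring_step:
  assumes "open S" "smooth_ring S f"
  shows "f differentiable_on S \<and>
      (\<forall>v. \<exists>h. smooth_ring S h \<and> (\<forall>x\<in>S. frechet_derivative f (at x) v = h x))"
  using assms(2)
proof induction
  case (base f)
  then show ?case using smooth_on_differentiable smooth_on_derivative smooth_ring.base by blast
next
  case (add f g)
  have d: "(f has_derivative frechet_derivative f (at x)) (at x)"
          "(g has_derivative frechet_derivative g (at x)) (at x)" if "x \<in> S" for x
    using add that assms(1) by (auto simp: differentiable_on_eq_differentiable_at frechet_derivative_works)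
  have e: "frechet_derivative (\<lambda>x. f x + g x) (at x) = (\<lambda>h. frechet_derivative f (at x) h + frechet_derivative g (at x) h)" if "x \<in> S" for x
    by (rule frechet_derivative_at[symmetric]) (intro has_derivative_add d that)
  show ?case
  proof (intro conjI allI)
    show "(\<lambda>x. f x + g x) differentiable_on S" using add by (auto intro: differentiable_on_add)
    fix v
    obtain hf hg where h: "smooth_ring S hf" "\<And>x. x \<in> S ==> frechet_derivative f (at x) v = hf x"
      "smooth_ring S hg" "\<And>x. x \<in> S ==> frechet_derivative g (at x) v = hg x"
      using add.IH by metis
    show "\<exists>h. smooth_ring S h \<and> (\<forall>x\<in>S. frechet_derivative (\<lambda>x. f x + g x) (at x) v = h x)"
      by (rule exI[of _ "\<lambda>x. hf x + hg x"]) (simp add: smooth_ring.add h e)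
  qed
next
  case (mult f g)
  have d: "(f has_derivative frechet_derivative f (at x)) (at x)"
          "(g has_derivative frechet_derivative g (at x)) (at x)" if "x \<in> S" for x
    using mult that assms(1) by (auto simp: differentiable_on_eq_differentiable_at frechet_derivative_works)
  have dm: "((\<lambda>x. f x * g x) has_derivative (\<lambda>h. f x * frechet_derivative g (at x) h + frechet_derivative f (at x) h * g x)) (at x)" if "x \<in> S" for x
    using has_derivative_mult[OF d[OF that]] .
  have e: "frechet_derivative (\<lambda>x. f x * g x) (at x) = (\<lambda>h. f x * frechet_derivative g (at x) h + frechet_derivative f (at x) h * g x)" if "x \<in> S" for x
    by (rule frechet_derivative_at[symmetric]) (rule dm[OF that])
  show ?case
  proof (intro conjI allI)
    show "(\<lambda>x. f x * g x) differentiable_on S"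
      using dm assms(1) by (auto simp: differentiable_on_eq_differentiable_at differentiable_def)
    fix v
    obtain hf hg where h: "smooth_ring S hf" "\<And>x. x \<in> S ==> frechet_derivative f (at x) v = hf x"
      "smooth_ring S hg" "\<And>x. x \<in> S ==> frechet_derivative g (at x) v = hg x"
      using mult.IH by metis
    show "\<exists>h. smooth_ring S h \<and> (\<forall>x\<in>S. frechet_derivative (\<lambda>x. f x * g x) (at x) v = h x)"
      by (rule exI[of _ "\<lambda>x. f x * hg x + hf x * g x"]) (simp add: smooth_ring.add smooth_ring.mult mult h e)
  qed
qed

lemma smooth_on_add:
  fixes f g :: "'a::real_normed_vector => 'b::real_normed_algebra"
  assumes "open S" "smooth_on S f" "smooth_on S g"
  shows "smooth_on S (\<lambda>x. f x + g x)"
  by (rule smooth_on_coinduct[where P="smooth_ring S"])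
     (use assms in \<open>auto intro: smooth_ring.intros dest: smooth_ring_step\<close>)

lemma smooth_on_mult:
  fixes f g :: "'a::real_normed_vector => 'b::real_normed_algebra"
  assumes "open S" "smooth_on S f" "smooth_on S g"
  shows "smooth_on S (\<lambda>x. f x * g x)"
  by (rule smooth_on_coinduct[where P="smooth_ring S"])
     (use assms in \<open>auto intro: smooth_ring.intros dest: smooth_ring_step\<close>)

lemma smooth_on_const:
  assumes "open S"
  shows "smooth_on S (\<lambda>x. c)"
  by (rule smooth_on_coinduct[where P="\<lambda>f. \<exists>c. f = (\<lambda>x. c)"]) (use assms in auto)

lemma smooth_on_bounded_linear:
  assumes "open S" "bounded_linear f"
  shows "smooth_on S f"
proof (rule smooth_on_coinduct[where P="\<lambda>g. g = f \<or> (\<exists>c. g = (\<lambda>x. c))"])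
  have fd: "frechet_derivative f (at x) = f" for x
    by (rule frechet_derivative_at[symmetric]) (rule bounded_linear_imp_has_derivative[OF assms(2)])
  have "f differentiable_on S"
    using bounded_linear_imp_has_derivative[OF assms(2)] unfolding differentiable_on_def differentiable_def by blast
  then show "g differentiable_on S \<and>
      (\<forall>v. \<exists>h. (h = f \<or> (\<exists>c. h = (\<lambda>x. c))) \<and> (\<forall>x\<in>S. frechet_derivative g (at x) v = h x))"
    if "g = f \<or> (\<exists>c. g = (\<lambda>x. c))" for g
    using that by (auto simp: fd)
qed (use assms in auto)

lemma smooth_on_minus:
  fixes f g :: "'a::real_normed_vector => 'b::real_normed_algebra_1"
  assumes "open S" "smooth_on S f" "smooth_on S g"
  shows "smooth_on S (\<lambda>x. f x - g x)"
  using smooth_on_add[OF assms(1,2) smooth_on_mult[OF assms(1) smooth_on_const[OF assms(1), of "-1"] assms(3)]]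
  by simp

lemma smooth_on_sum:
  fixes f :: "'i => 'a::real_normed_vector => 'b::real_normed_algebra"
  assumes "open S" "\<And>i. i \<in> I ==> smooth_on S (f i)"
  shows "smooth_on S (\<lambda>x. \<Sum>i\<in>I. f i x)"
proof (cases "finite I")
  case True
  then show ?thesis using assms(2)
    by (induction I rule: finite_induct) (auto intro: smooth_on_const smooth_on_add assms(1))
qed (simp add: smooth_on_const assms(1))

lemma smooth_on_power:
  fixes f :: "'a::real_normed_vector => 'b::real_normed_algebra_1"
  assumes "open S" "smooth_on S f"
  shows "smooth_on S (\<lambda>x. f x ^ k)"
  by (induction k) (auto intro: smooth_on_const smooth_on_mult assms)

inductive smooth_comp :: "'a::real_normed_vector set => real set => ('a => real) => ('a => 'b::real_normed_algebra_1) => bool" for S T q where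
  base: "smooth_on S s ==> smooth_on T f ==> smooth_comp S T q (\<lambda>x. s x * f (q x))"
| add: "smooth_comp S T q f ==> smooth_comp S T q g ==> smooth_comp S T q (\<lambda>x. f x + g x)"

lemma smooth_on_of_real:
  assumes "open S" "smooth_on S (q :: 'a::real_normed_vector => real)"
  shows "smooth_on S (\<lambda>x. of_real (q x) :: 'b::real_normed_algebra_1)"
proof (rule smooth_on_coinduct[where P="\<lambda>f. \<exists>q::'a => real. smooth_on S q \<and> f = (\<lambda>x. of_real (q x))"])
  fix f :: "'a => 'b" assume "\<exists>q::'a => real. smooth_on S q \<and> f = (\<lambda>x. of_real (q x))"
  then obtain q :: "'a => real" where q: "smooth_on S q" "f = (\<lambda>x. of_real (q x))" by auto
  have d: "(f has_derivative (\<lambda>h. of_real (frechet_derivative q (at x) h))) (at x)" if "x \<in> S" for x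
    unfolding q(2) using smooth_on_has_derivative[OF q(1) assms(1) that] by (rule has_derivative_of_real)
  show "f differentiable_on S \<and> (\<forall>v. \<exists>h. (\<exists>q::'a => real. smooth_on S q \<and> h = (\<lambda>x. of_real (q x))) \<and> (\<forall>x\<in>S. frechet_derivative f (at x) v = h x))"
  proof (intro conjI allI)
    show "f differentiable_on S" using d assms(1) by (auto simp: differentiable_on_eq_differentiable_at differentiable_def)
    show "\<exists>h. (\<exists>q::'a => real. smooth_on S q \<and> h = (\<lambda>x. of_real (q x))) \<and> (\<forall>x\<in>S. frechet_derivative f (at x) v = h x)" for v
      by (rule exI[of _ "\<lambda>x. of_real (frechet_derivative q (at x) v)"])
         (auto simp: frechet_derivative_at[OF d, symmetric] intro!: exI[of _ "\<lambda>x. frechet_derivative q (at x) v"] smooth_on_derivative q(1))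
  qed
qed (use assms in auto)

lemma smooth_on_compose_real:
  fixes f :: "real => 'b::real_normed_algebra_1" and q :: "'a::real_normed_vector => real"
  assumes S: "open S" and T: "open T" and q: "smooth_on S q" "q ` S \<subseteq> T" and f: "smooth_on T f"
  shows "smooth_on S (\<lambda>x. f (q x))"
proof (rule smooth_on_coinduct[where P="smooth_comp S T q"])
  show "smooth_comp S T q (\<lambda>x. f (q x))"
    using smooth_comp.base[OF smooth_on_const[OF S, of 1] f, of q] by simp
  show "h differentiable_on S \<and> (\<forall>v. \<exists>h'. smooth_comp S T q h' \<and> (\<forall>x\<in>S. frechet_derivative h (at x) v = h' x))"
    if "smooth_comp S T q h" for h :: "'a => 'b"
    using that
  proof induction
    case (base s f)
    have d: "((\<lambda>x. s x * f (q x)) has_derivative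
        (\<lambda>h. s x * (of_real (frechet_derivative q (at x) h) * frechet_derivative f (at (q x)) 1) + frechet_derivative s (at x) h * f (q x))) (at x)"
      if "x \<in> S" for x
    proof -
      have df: "(f has_derivative frechet_derivative f (at (q x))) (at (q x))"
        using smooth_on_has_derivative[OF base(2) T] q(2) that by auto
      define d where "d = frechet_derivative f (at (q x)) 1"
      have eq: "frechet_derivative f (at (q x)) = (\<lambda>t. of_real t * d)"
      proof
        fix t :: real
        have "frechet_derivative f (at (q x)) (t *\<^sub>R 1) = t *\<^sub>R d"
          unfolding d_def by (rule linear_scale[OF has_derivative_linear[OF df]])
        then show "frechet_derivative f (at (q x)) t = of_real t * d" by (simp add: scaleR_conv_of_real)
      qed
      have "((\<lambda>x. f (q x)) has_derivative (\<lambda>h. of_real (frechet_derivative q (at x) h) * d)) (at x)"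
        using has_derivative_compose[OF smooth_on_has_derivative[OF q(1) S that] df] unfolding eq .
      then have "((\<lambda>x. f (q x)) has_derivative (\<lambda>h. of_real (frechet_derivative q (at x) h) * frechet_derivative f (at (q x)) 1)) (at x)"
        unfolding d_def .
      from has_derivative_mult[OF smooth_on_has_derivative[OF base(1) S that] this] show ?thesis .
    qed
    show ?case
    proof (intro conjI allI)
      show "(\<lambda>x. s x * f (q x)) differentiable_on S" using d S by (auto simp: differentiable_on_eq_differentiable_at differentiable_def)
      fix v
      have 1: "smooth_comp S T q (\<lambda>x. (s x * of_real (frechet_derivative q (at x) v)) * frechet_derivative f (at (q x)) 1)"
        by (rule smooth_comp.base[where f="\<lambda>t. frechet_derivative f (at t) 1"])
           (intro smooth_on_mult smooth_on_of_real smooth_on_derivative base q S)+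
      have 2: "smooth_comp S T q (\<lambda>x. frechet_derivative s (at x) v * f (q x))"
        by (intro smooth_comp.base smooth_on_derivative base)
      show "\<exists>h'. smooth_comp S T q h' \<and> (\<forall>x\<in>S. frechet_derivative (\<lambda>x. s x * f (q x)) (at x) v = h' x)"
        by (rule exI, rule conjI, rule smooth_comp.add[OF 1 2])
           (simp add: frechet_derivative_at[OF d, symmetric] mult.assoc)
    qed
  next
    case (add f g)
    have d: "(f has_derivative frechet_derivative f (at x)) (at x)"
            "(g has_derivative frechet_derivative g (at x)) (at x)" if "x \<in> S" for x
      using add that S by (auto simp: differentiable_on_eq_differentiable_at frechet_derivative_works)
    have e: "frechet_derivative (\<lambda>x. f x + g x) (at x) = (\<lambda>h. frechet_derivative f (at x) h + frechet_derivative g (at x) h)" if "x \<in> S" for x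
      by (rule frechet_derivative_at[symmetric]) (intro has_derivative_add d that)
    show ?case
    proof (intro conjI allI)
      show "(\<lambda>x. f x + g x) differentiable_on S" using add by (auto intro: differentiable_on_add)
      fix v
      obtain hf hg where h: "smooth_comp S T q hf" "\<And>x. x \<in> S ==> frechet_derivative f (at x) v = hf x"
        "smooth_comp S T q hg" "\<And>x. x \<in> S ==> frechet_derivative g (at x) v = hg x"
        using add.IH by metis
      show "\<exists>h. smooth_comp S T q h \<and> (\<forall>x\<in>S. frechet_derivative (\<lambda>x. f x + g x) (at x) v = h x)"
        by (rule exI[of _ "\<lambda>x. hf x + hg x"]) (simp add: smooth_comp.add h e)
    qed
  qed
qed (rule S)

text \<open>
  For families of real functions, such as the powers, in which the derivative of each member is a
  multiple of another member.
\<close>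

lemma smooth_on_real_chain:
  fixes f :: "'i => real => real"
  assumes "open T" "i \<in> I"
    and "\<And>i t. i \<in> I ==> t \<in> T ==> (f i has_real_derivative c i * f (d i) t) (at t)"
    and "\<And>i. i \<in> I ==> d i \<in> I"
  shows "smooth_on T (f i)"
proof (rule smooth_on_coinduct[where P="\<lambda>g. \<exists>i\<in>I. \<exists>a. g = (\<lambda>t. a * f i t)"])
  show "\<exists>j\<in>I. \<exists>a. f i = (\<lambda>t. a * f j t)" using assms(2) by (intro bexI[of _ i] exI[of _ 1]) auto
  fix g assume "\<exists>i\<in>I. \<exists>a. g = (\<lambda>t. a * f i t)"
  then obtain j a where g: "j \<in> I" "g = (\<lambda>t. a * f j t)" by blast
  have D: "(g has_derivative (\<lambda>h. a * (c j * f (d j) t) * h)) (at t)" if "t \<in> T" for t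
    using DERIV_cmult[OF assms(3)[OF g(1) that], of a] unfolding g(2) has_field_derivative_def .
  show "g differentiable_on T \<and> (\<forall>v. \<exists>h. (\<exists>i\<in>I. \<exists>a. h = (\<lambda>t. a * f i t)) \<and> (\<forall>x\<in>T. frechet_derivative g (at x) v = h x))"
  proof (intro conjI allI)
    show "g differentiable_on T" using D assms(1) by (auto simp: differentiable_on_eq_differentiable_at differentiable_def)
    fix v
    show "\<exists>h. (\<exists>i\<in>I. \<exists>a. h = (\<lambda>t. a * f i t)) \<and> (\<forall>x\<in>T. frechet_derivative g (at x) v = h x)"
      by (rule exI[of _ "\<lambda>t. (a * c j * v) * f (d j) t"])
         (use assms(4)[OF g(1)] in \<open>auto simp: frechet_derivative_at[OF D, symmetric]\<close>)
  qed
qed (rule assms(1))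

lemma smooth_on_powr: "smooth_on {0<..} (\<lambda>t::real. t powr a)"
  by (rule smooth_on_real_chain[where I=UNIV and f="\<lambda>a t. t powr a" and c="\<lambda>a. a" and d="\<lambda>a. a - 1"])
     (auto intro!: derivative_eq_intros)

lemma smooth_on_inner: "open S ==> smooth_on S (\<lambda>x. x \<bullet> a)"
  by (rule smooth_on_bounded_linear) (auto intro: bounded_linear_inner_left)

lemma smooth_on_norm_square: "open S ==> smooth_on S (\<lambda>x::'a::euclidean_space. (norm x)\<^sup>2)"
proof -
  assume S: "open S"
  have "(\<lambda>x::'a. (norm x)\<^sup>2) = (\<lambda>x. \<Sum>b\<in>Basis. (x \<bullet> b) * (x \<bullet> b))"
    by (auto simp: norm_eq_sqrt_inner fun_eq_iff intro: euclidean_inner)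
  moreover have "smooth_on S (\<lambda>x::'a. \<Sum>b\<in>Basis. (x \<bullet> b) * (x \<bullet> b))"
    by (intro smooth_on_sum smooth_on_mult smooth_on_inner S)
  ultimately show ?thesis by metis
qed

section \<open>Flat functions and bumps\<close>

text \<open>
  The derivatives of \<open>exp (- 1 / t)\<close>, continued by zero, stay in this class, so the whole class is
  smooth by coinduction.
\<close>

definition flat_poly :: "real poly => real => real" where
  "flat_poly P t = (if t > 0 then poly P (1 / t) * exp (- 1 / t) else 0)"

lemma flat_poly_tendsto_0: "(flat_poly P \<longlongrightarrow> 0) (at 0)"
proof -
  have "((\<lambda>u::real. \<Sum>i\<le>degree P. coeff P i * (u ^ i / exp u)) \<longlongrightarrow> (\<Sum>i\<le>degree P. coeff P i * 0)) at_top"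
    by (intro tendsto_sum tendsto_mult tendsto_const tendsto_power_div_exp_0)
  then have "((\<lambda>u::real. poly P u * exp (- u)) \<longlongrightarrow> 0) at_top"
    by (simp add: poly_altdef sum_distrib_right exp_minus divide_inverse mult.assoc)
  then have "((\<lambda>t::real. poly P (inverse t) * exp (- inverse t)) \<longlongrightarrow> 0) (at_right 0)"
    by (rule filterlim_compose) (rule filterlim_inverse_at_top_right)
  then have "(flat_poly P \<longlongrightarrow> 0) (at_right 0)"
    by (rule Lim_transform_eventually)
       (auto simp: flat_poly_def eventually_at_right_field field_simps intro!: exI[of _ 1])
  moreover have "(flat_poly P \<longlongrightarrow> 0) (at_left 0)"
    by (rule Lim_transform_eventually[OF tendsto_const])
       (auto simp: flat_poly_def eventually_at_left_field intro!: exI[of _ "-1"])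
  ultimately show ?thesis by (simp add: filterlim_split_at)
qed

lemma flat_poly_derivative:
  "(flat_poly P has_real_derivative flat_poly ([:0, 0, 1:] * (P - pderiv P)) t) (at t)"
proof -
  consider "t > 0" | "t = 0" | "t < 0" by linarith
  then show ?thesis
  proof cases
    case 1
    have "((\<lambda>t. poly P (1 / t) * exp (- 1 / t)) has_real_derivative flat_poly ([:0, 0, 1:] * (P - pderiv P)) t) (at t)"
      using 1 by (auto intro!: derivative_eq_intros DERIV_chain'[OF _ poly_DERIV] simp: flat_poly_def field_simps power2_eq_square)
    then show ?thesis
      by (rule has_field_derivative_transform_within_open[where S="{0<..}"]) (use 1 in \<open>auto simp: flat_poly_def\<close>)
  next
    case 2
    have "flat_poly P h / h = flat_poly (pCons 0 P) h" for h
      by (simp add: flat_poly_def)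
    then have "((\<lambda>h. (flat_poly P (0 + h) - flat_poly P 0) / h) \<longlongrightarrow> 0) (at 0)"
      using flat_poly_tendsto_0[of "pCons 0 P"] by (simp add: flat_poly_def[of P 0])
    then show ?thesis using 2 by (simp add: DERIV_def flat_poly_def[of _ 0])
  next
    case 3
    have "((\<lambda>t. 0) has_real_derivative flat_poly ([:0, 0, 1:] * (P - pderiv P)) t) (at t)"
      using 3 by (auto simp: flat_poly_def)
    then show ?thesis
      by (rule has_field_derivative_transform_within_open[where S="{..<0}"]) (use 3 in \<open>auto simp: flat_poly_def\<close>)
  qed
qed

lemma smooth_on_flat_poly: "smooth_on UNIV (flat_poly P)"
  by (rule smooth_on_real_chain[where I=UNIV and c="\<lambda>_. 1" and d="\<lambda>P. [:0, 0, 1:] * (P - pderiv P)"])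
     (auto simp only: mult_1 UNIV_I open_UNIV flat_poly_derivative)

definition flat_exp :: "real => real" where "flat_exp = flat_poly 1"

lemma smooth_on_flat_exp: "smooth_on UNIV flat_exp"
  by (simp add: flat_exp_def smooth_on_flat_poly)

lemma flat_exp_nonneg: "flat_exp t \<ge> 0"
  and flat_exp_le_1: "flat_exp t \<le> 1"
  and flat_exp_eq_0_iff: "flat_exp t = 0 \<longleftrightarrow> t \<le> 0"
  by (auto simp: flat_exp_def flat_poly_def)

section \<open>Polar coordinates\<close>

text \<open>
  The radial part of Lebesgue measure; the factor \<open>n \<kappa>\<^sub>n\<close> is the surface area that the
  normalization of the measure on the sphere leaves out.
\<close>

definition radial_measure :: "nat => real measure" where
  "radial_measure n = density lborel (\<lambda>r. ennreal (indicator {0<..} r * (real n * unit_ball_vol (real n) * r ^ (n - 1))))"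

lemma sets_radial_measure[simp, measurable_cong]: "sets (radial_measure n) = sets borel"
  and space_radial_measure[simp]: "space (radial_measure n) = UNIV"
  by (simp_all add: radial_measure_def)

lemma emeasure_radial_lessThan:
  assumes "n > 0"
  shows "emeasure (radial_measure n) {..<a} = (if a > 0 then ennreal (unit_ball_vol n * a ^ n) else 0)"
proof (cases "a > 0")
  case False
  have "emeasure (radial_measure n) {..<a} = (\<integral>\<^sup>+r. 0 \<partial>(lborel::real measure))"
    unfolding radial_measure_def
  proof (subst emeasure_density)
    show "(\<integral>\<^sup>+r. ennreal (indicator {0<..} r * (real n * unit_ball_vol (real n) * r ^ (n - 1))) * indicator {..<a} r \<partial>lborel) = (\<integral>\<^sup>+r. 0 \<partial>(lborel::real measure))"
      by (rule nn_integral_cong) (use False in \<open>auto simp: indicator_def\<close>)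
  qed auto
  then show ?thesis using False by simp
next
  case True
  have "emeasure (radial_measure n) {..<a} = (\<integral>\<^sup>+r. ennreal (real n * unit_ball_vol (real n) * r ^ (n - 1)) * indicator {0..a} r \<partial>lborel)"
  proof -
    have "emeasure (radial_measure n) {..<a} = (\<integral>\<^sup>+r. ennreal (indicator {0<..} r * (real n * unit_ball_vol (real n) * r ^ (n - 1))) * indicator {..<a} r \<partial>lborel)"
      unfolding radial_measure_def by (rule emeasure_density) auto
    also have "... = (\<integral>\<^sup>+r. ennreal (real n * unit_ball_vol (real n) * r ^ (n - 1)) * indicator {0..a} r \<partial>lborel)"
    proof (rule nn_integral_cong_AE)
      show "AE r in lborel. ennreal (indicator {0<..} r * (real n * unit_ball_vol (real n) * r ^ (n - 1))) * indicator {..<a} r = ennreal (real n * unit_ball_vol (real n) * r ^ (n - 1)) * indicator {0..a} r"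
        using AE_lborel_singleton[of "0::real"] AE_lborel_singleton[of a]
        by eventually_elim (auto simp: indicator_def)
    qed
    finally show ?thesis .
  qed
  also have "... = ennreal (unit_ball_vol n * a ^ n - unit_ball_vol n * 0 ^ n)"
    using assms True
    by (intro nn_integral_FTC_Icc) (auto intro!: derivative_eq_intros mult_nonneg_nonneg)
  finally show ?thesis using assms True by simp
qed

lemma sigma_finite_radial_measure:
  assumes "n > 0" shows "sigma_finite_measure (radial_measure n)"
proof
  show "\<exists>A. countable A \<and> A \<subseteq> sets (radial_measure n) \<and> \<Union> A = space (radial_measure n) \<and> (\<forall>a\<in>A. emeasure (radial_measure n) a \<noteq> \<infinity>)"
  proof (rule exI[of _ "range (\<lambda>k::nat. {..<real k})"], intro conjI ballI)
    show "\<Union> (range (\<lambda>k::nat. {..<real k})) = space (radial_measure n)"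
      using reals_Archimedean2 by (auto simp: space_radial_measure)
  qed (auto simp: emeasure_radial_lessThan assms split: if_splits)
qed

lemma measurable_sphere_ident: "(\<lambda>x. x) \<in> sphere_measure \<rightarrow>\<^sub>M borel"
  unfolding measurable_cong_sets[OF sets_sphere_measure refl] by (rule measurable_restrict_space1) simp

lemma borel_measurable_sphere_measure:
  "f \<in> borel_measurable borel ==> f \<in> borel_measurable sphere_measure"
  using measurable_compose[OF measurable_sphere_ident] .

lemma measurable_polar[measurable]:
  "(\<lambda>(r, \<theta>). r *\<^sub>R \<theta>) \<in> (radial_measure n \<Otimes>\<^sub>M (sphere_measure :: (real ^ 'n) measure)) \<rightarrow>\<^sub>M borel"
proof -
  have [measurable]: "(\<lambda>x. x) \<in> (sphere_measure :: (real ^ 'n) measure) \<rightarrow>\<^sub>M borel" by (rule measurable_sphere_ident)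
  have 1: "(\<lambda>p. snd p) \<in> (radial_measure n \<Otimes>\<^sub>M (sphere_measure :: (real ^ 'n) measure)) \<rightarrow>\<^sub>M borel"
    using measurable_compose[OF measurable_snd measurable_sphere_ident] .
  have 2: "(\<lambda>p. fst p) \<in> (radial_measure n \<Otimes>\<^sub>M (sphere_measure :: (real ^ 'n) measure)) \<rightarrow>\<^sub>M borel"
    using measurable_fst by (simp add: measurable_cong_sets[OF refl sets_radial_measure])
  show ?thesis unfolding split_beta' using 1 2 by measurable
qed

text \<open>
  The measure on the sphere is defined by cones in the unit ball; this is its scaling to balls of
  any radius, and hence the value on a generator of the product in polar coordinates.
\<close>

lemma emeasure_lborel_cone_lessThan:
  fixes B :: "(real ^ 'n) set"
  assumes B: "B \<in> sets borel" "B \<subseteq> sphere 0 1" and a: "a > 0"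
  shows "emeasure lborel {x. x \<noteq> 0 \<and> norm x < a \<and> x /\<^sub>R norm x \<in> B}
    = ennreal (unit_ball_vol CARD('n) * a ^ CARD('n)) * emeasure sphere_measure B"
proof -
  let ?C = "\<lambda>a. {x. x \<noteq> 0 \<and> norm x < a \<and> x /\<^sub>R norm x \<in> B}"
  have [measurable]: "?C a \<in> sets borel" for a
  proof -
    have "(\<lambda>x::real^'n. x /\<^sub>R norm x) -` B \<in> sets borel"
      by (rule measurable_sets_borel[where M=borel]) (use B in auto)
    moreover have "?C a = (- {0}) \<inter> {x. norm x < a} \<inter> (\<lambda>x. x /\<^sub>R norm x) -` B" by auto
    ultimately show ?thesis by auto
  qed
  have img: "?C a = (\<lambda>x. a *\<^sub>R x + 0) ` ?C 1"
  proof (intro equalityI subsetI)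
    fix x assume "x \<in> ?C a"
    then show "x \<in> (\<lambda>x. a *\<^sub>R x + 0) ` ?C 1"
      using a by (intro image_eqI[of _ _ "x /\<^sub>R a"]) (auto simp: field_simps)
  next
    fix x assume "x \<in> (\<lambda>x. a *\<^sub>R x + 0) ` ?C 1"
    then obtain y where y: "y \<in> ?C 1" "x = a *\<^sub>R y" by auto
    have "(a *\<^sub>R y) /\<^sub>R norm (a *\<^sub>R y) = y /\<^sub>R norm y" using a by simp
    then show "x \<in> ?C a" using y a by (auto simp del: norm_scaleR) simp
  qed
  have "emeasure lborel (?C a) = emeasure lebesgue (?C a)" by simp
  also have "... = emeasure lebesgue ((\<lambda>x. a *\<^sub>R x + 0) ` ?C 1)" by (rule arg_cong[OF img])
  also have "... = ennreal (a ^ CARD('n)) * emeasure lborel (?C 1)"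
    using a by (subst emeasure_lebesgue_affine) (simp add: ennreal_power)
  also have "?C 1 = {x \<in> ball 0 1. x /\<^sub>R norm x \<in> B}" using B(2) by (auto simp: subset_iff)
  also have "emeasure lborel {x \<in> ball 0 1. x /\<^sub>R norm x \<in> B} = emeasure sphere_measure B * emeasure lborel (ball 0 1 :: (real^'n) set)"
    unfolding emeasure_sphere_measure[OF B] using emeasure_lborel_unit_ball[where 'a="real^'n"]
    by (simp add: ennreal_divide_times ennreal_times_divide[symmetric] ennreal_mult_divide_eq top.not_eq_extremum)
  also have "emeasure lborel (ball 0 1 :: (real^'n) set) = ennreal (unit_ball_vol CARD('n))"
    by (subst emeasure_ball) auto
  finally show ?thesis using a by (simp add: ennreal_mult' mult_ac)
qed

text \<open>
  Rectangles \<open>{..<a} \<times> B\<close> correspond to truncated cones. For fixed \<open>B\<close> both sides are measures on the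
  line that agree on the half-lines \<open>{..<a}\<close>, hence on all Borel sets.
\<close>

theorem lborel_polar:
  "distr (radial_measure CARD('n) \<Otimes>\<^sub>M sphere_measure) borel (\<lambda>(r, \<theta>). r *\<^sub>R \<theta>) = (lborel :: (real ^ 'n) measure)"
proof -
  obtain e :: "real ^ 'n" where e: "norm e = 1" using norm_axis_1 by blast
  \<comment> \<open>The inverse of polar coordinates; the direction assigned to the origin is arbitrary.\<close>
  define h where "h x = (norm x, if x = 0 then e else x /\<^sub>R norm x)" for x :: "real ^ 'n"
  have h2: "(\<lambda>x. if x = 0 then e else x /\<^sub>R norm x) \<in> borel \<rightarrow>\<^sub>M (sphere_measure :: (real^'n) measure)"
    unfolding measurable_cong_sets[OF refl sets_sphere_measure]
    by (intro measurable_restrict_space2) (auto simp: e)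
  have [measurable]: "h \<in> borel \<rightarrow>\<^sub>M (borel \<Otimes>\<^sub>M (sphere_measure :: (real^'n) measure))"
    unfolding h_def using h2 by measurable
  interpret S: prob_space "sphere_measure :: (real^'n) measure" by (rule prob_space_sphere_measure)
  have "radial_measure CARD('n) \<Otimes>\<^sub>M sphere_measure = distr lborel (borel \<Otimes>\<^sub>M (sphere_measure :: (real^'n) measure)) h"
  proof (rule pair_measure_eqI)
    show "sigma_finite_measure (radial_measure CARD('n))" by (rule sigma_finite_radial_measure) simp
    show "sigma_finite_measure (sphere_measure :: (real^'n) measure)" by (rule S.sigma_finite_measure_axioms)
    show "sets (radial_measure CARD('n) \<Otimes>\<^sub>M sphere_measure) = sets (distr lborel (borel \<Otimes>\<^sub>M (sphere_measure :: (real^'n) measure)) h)"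
      by (simp cong: sets_pair_measure_cong)
    fix A :: "real set" and B :: "(real^'n) set"
    assume A: "A \<in> sets (radial_measure CARD('n))" and B: "B \<in> sets sphere_measure"
    then have [measurable]: "A \<in> sets borel" "B \<in> sets borel" and B': "B \<subseteq> sphere 0 1"
      by (auto simp: sets_sphere_measure sets_restrict_space)
    have sB: "(\<lambda>x::real^'n. x /\<^sub>R norm x) -` B \<in> sets borel"
      by (rule measurable_sets_borel[where M=borel]) auto
    define C where "C = {x. x \<noteq> 0 \<and> x /\<^sub>R norm x \<in> B}"
    have [measurable]: "C \<in> sets borel"
    proof -
      have "C = (- {0}) \<inter> (\<lambda>x. x /\<^sub>R norm x) -` B" by (auto simp: C_def)
      then show ?thesis using sB by auto
    qed
    let ?N1 = "distr (density lborel (indicator C)) borel (norm :: real^'n => real)"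
    let ?N2 = "density (radial_measure CARD('n)) (\<lambda>_. emeasure sphere_measure B)"
    have N1: "emeasure ?N1 X = emeasure lborel {x \<in> C. norm x \<in> X}" if [measurable]: "X \<in> sets borel" for X
    proof -
      have "emeasure ?N1 X = emeasure (density lborel (indicator C)) (norm -` X)"
        by (subst emeasure_distr) auto
      also have "... = (\<integral>\<^sup>+x. indicator C x * indicator (norm -` X) x \<partial>lborel)"
        by (rule emeasure_density) (use measurable_sets_borel[of "norm :: real^'n => real" borel X] in auto)
      also have "... = (\<integral>\<^sup>+x. indicator {x \<in> C. norm x \<in> X} x \<partial>lborel)"
        by (rule nn_integral_cong) (auto simp: indicator_def)
      finally show ?thesis by simp
    qed
    have N2: "emeasure ?N2 X = emeasure (radial_measure CARD('n)) X * emeasure sphere_measure B" if "X \<in> sets borel" for X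
      using that by (subst emeasure_density) (auto simp: nn_integral_multc mult.commute)
    have "?N1 = ?N2"
    proof (rule measure_eqI_generator_eq[where E="range lessThan" and \<Omega>=UNIV and A="\<lambda>i. {..<real i}"])
      show "Int_stable (range (lessThan :: real => real set))"
      proof -
        have "{..<a} \<inter> {..<b} = {..<min a b}" for a b :: real by auto
        then show ?thesis by (auto simp: Int_stable_def)
      qed
      show "range (lessThan :: real => real set) \<subseteq> Pow UNIV" by auto
      have sb: "sets (borel :: real measure) = sigma_sets UNIV (range lessThan)"
        unfolding borel_Iio by (rule sets_measure_of) auto
      show "sets ?N1 = sigma_sets UNIV (range lessThan)" "sets ?N2 = sigma_sets UNIV (range lessThan)"
        by (simp_all only: sets_distr sets_density sets_radial_measure sb)
      show "range (\<lambda>i. {..<real i}) \<subseteq> range lessThan" by auto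
      show "(\<Union>i. {..<real i}) = UNIV" using reals_Archimedean2 by auto
      have eq: "emeasure ?N1 {..<a} = emeasure ?N2 {..<a}" for a
      proof (cases "a > 0")
        case True
        have "{x \<in> C. norm x \<in> {..<a}} = {x. x \<noteq> 0 \<and> norm x < a \<and> x /\<^sub>R norm x \<in> B}"
          by (auto simp: C_def)
        then show ?thesis
          using True by (subst N1, simp, subst N2, simp) (simp add: emeasure_radial_lessThan emeasure_lborel_cone_lessThan B')
      next
        case False
        then have "\<not> norm x < a" for x :: "real^'n" by (metis norm_ge_zero not_le order.strict_trans1)
        then have 0: "{x \<in> C. norm x \<in> {..<a}} = {}" by auto
        have "emeasure ?N1 {..<a} = 0" by (subst N1) (simp_all only: 0 emeasure_empty lessThan_borel)
        moreover have "emeasure ?N2 {..<a} = 0" using False by (subst N2) (simp_all add: emeasure_radial_lessThan)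
        ultimately show ?thesis by simp
      qed
      show "emeasure ?N1 X = emeasure ?N2 X" if "X \<in> range lessThan" for X using that eq by auto
      show "emeasure ?N1 {..<real i} \<noteq> \<infinity>" for i
        unfolding eq by (subst N2) (auto simp: emeasure_radial_lessThan ennreal_mult_eq_top_iff S.emeasure_finite)
    qed
    then have "emeasure (radial_measure CARD('n)) A * emeasure sphere_measure B = emeasure lborel {x \<in> C. norm x \<in> A}"
      using N1[of A] N2[of A] by simp
    also have "... = emeasure lborel (h -` (A \<times> B))"
    proof (rule emeasure_eq_AE)
      have "AE x in lborel. x \<noteq> (0::real^'n)" by (rule AE_lborel_singleton)
      then show "AE x in lborel. (x \<in> {x \<in> C. norm x \<in> A}) = (x \<in> h -` (A \<times> B))"
        by eventually_elim (auto simp: h_def C_def)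
      show "{x \<in> C. norm x \<in> A} \<in> sets lborel" by simp
      show "h -` (A \<times> B) \<in> sets lborel"
        using measurable_sets_borel[OF \<open>h \<in> _\<close>, of "A \<times> B"] B by auto
    qed
    also have "... = emeasure (distr lborel (borel \<Otimes>\<^sub>M sphere_measure) h) (A \<times> B)"
      using B by (subst emeasure_distr) auto
    finally show "emeasure (radial_measure CARD('n)) A * emeasure sphere_measure B = emeasure (distr lborel (borel \<Otimes>\<^sub>M sphere_measure) h) (A \<times> B)" .
  qed
  then have "distr (radial_measure CARD('n) \<Otimes>\<^sub>M sphere_measure) borel (\<lambda>(r, \<theta>). r *\<^sub>R \<theta>)
    = distr (distr lborel (borel \<Otimes>\<^sub>M (sphere_measure :: (real^'n) measure)) h) borel (\<lambda>(r, \<theta>). r *\<^sub>R \<theta>)" by simp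
  also have "... = distr lborel borel ((\<lambda>(r, \<theta>). r *\<^sub>R \<theta>) \<circ> h)"
  proof (rule distr_distr)
    show "(\<lambda>(r, \<theta>). r *\<^sub>R \<theta>) \<in> borel \<Otimes>\<^sub>M (sphere_measure :: (real^'n) measure) \<rightarrow>\<^sub>M borel"
      using measurable_polar[where n="CARD('n)"] by (simp cong: measurable_cong_sets sets_pair_measure_cong)
  qed simp
  also have "(\<lambda>(r, \<theta>). r *\<^sub>R \<theta>) \<circ> h = (\<lambda>x. x)" by (auto simp: h_def fun_eq_iff)
  also have "distr lborel borel (\<lambda>x. x) = (lborel :: (real ^ 'n) measure)"
    by (rule distr_id2) simp
  finally show ?thesis .
qed

lemma AE_radial_measure_pos: "AE r in radial_measure n. r > 0"
  unfolding radial_measure_def by (subst AE_density) (auto simp: indicator_def ennreal_eq_0_iff)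

lemma integrable_radial_iff:
  fixes a :: "real => 'b::{banach,second_countable_topology}"
  assumes "a \<in> borel_measurable borel"
  shows "integrable (radial_measure n) a \<longleftrightarrow> integrable lborel (\<lambda>r. (indicator {0<..} r * (real n * unit_ball_vol (real n) * r ^ (n - 1))) *\<^sub>R a r)"
  unfolding radial_measure_def using assms
  by (intro integrable_density) (auto simp: indicator_def)

lemma integral_radial:
  fixes a :: "real => 'b::{banach,second_countable_topology}"
  assumes "a \<in> borel_measurable borel"
  shows "(LINT r|radial_measure n. a r) = (LINT r|lborel. (indicator {0<..} r * (real n * unit_ball_vol (real n) * r ^ (n - 1))) *\<^sub>R a r)"
  unfolding radial_measure_def using assms
  by (intro integral_density) (auto simp: indicator_def)

lemma integrable_times_pair:
  fixes a :: "'a => complex" and b :: "'b => complex"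
  assumes "sigma_finite_measure M" "sigma_finite_measure N" "integrable M a" "integrable N b"
  shows "integrable (M \<Otimes>\<^sub>M N) (\<lambda>p. a (fst p) * b (snd p))"
    "(LINT p|(M \<Otimes>\<^sub>M N). a (fst p) * b (snd p)) = (LINT x|M. a x) * (LINT y|N. b y)"
proof -
  interpret M: sigma_finite_measure M by fact
  interpret N: sigma_finite_measure N by fact
  interpret pair_sigma_finite M N ..
  have [measurable]: "a \<in> borel_measurable M" "b \<in> borel_measurable N" using assms by auto
  have 1: "integrable (M \<Otimes>\<^sub>M N) (\<lambda>(x, y). a x * b y)"
  proof (rule Fubini_integrable)
    have "integrable M (\<lambda>x. norm (a x) * (LINT y|N. norm (b y)))" using assms by auto
    then show "integrable M (\<lambda>x. LINT y|N. norm (case (x, y) of (x, y) => a x * b y))" by (simp add: norm_mult)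
  qed (use assms in auto)
  show "integrable (M \<Otimes>\<^sub>M N) (\<lambda>p. a (fst p) * b (snd p))" using 1 by (simp add: split_beta')
  have "(LINT p|(M \<Otimes>\<^sub>M N). (\<lambda>(x, y). a x * b y) p) = (LINT x|M. LINT y|N. a x * b y)"
    using integral_fst[OF 1] by simp
  also have "... = (LINT x|M. a x) * (LINT y|N. b y)" by simp
  finally show "(LINT p|(M \<Otimes>\<^sub>M N). a (fst p) * b (snd p)) = (LINT x|M. a x) * (LINT y|N. b y)"
    by (simp add: split_beta')
qed

lemma integral_polar_product:
  fixes f :: "real ^ 'n => complex"
  assumes f[measurable]: "f \<in> borel_measurable borel"
    and a: "integrable (radial_measure CARD('n)) a" and u: "integrable sphere_measure u"
    and eq: "\<And>r \<theta>. r > 0 ==> norm \<theta> = 1 ==> f (r *\<^sub>R \<theta>) = a r * u \<theta>"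
  shows "integrable lborel f"
    "(LINT x|lborel. f x) = (LINT r|radial_measure CARD('n). a r) * (LINT \<theta>|sphere_measure. u \<theta>)"
proof -
  interpret S: prob_space "sphere_measure :: (real^'n) measure" by (rule prob_space_sphere_measure)
  interpret R: sigma_finite_measure "radial_measure CARD('n)" by (rule sigma_finite_radial_measure) simp
  interpret P: pair_sigma_finite "radial_measure CARD('n)" "sphere_measure :: (real^'n) measure" ..
  let ?P = "radial_measure CARD('n) \<Otimes>\<^sub>M (sphere_measure :: (real^'n) measure)"
  have AE: "AE p in ?P. f (fst p *\<^sub>R snd p) = a (fst p) * u (snd p)"
  proof -
    have "AE p in ?P. fst p > 0"
    proof (rule P.AE_pair_measure)
      have "{p \<in> space ?P. 0 < fst p} = {0<..} \<times> space (sphere_measure :: (real^'n) measure)"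
        by (auto simp: space_pair_measure)
      then show "{p \<in> space ?P. 0 < fst p} \<in> sets ?P" by simp
      show "AE x in radial_measure CARD('n). AE y in (sphere_measure :: (real^'n) measure). 0 < fst (x, y)"
        using AE_radial_measure_pos by eventually_elim simp
    qed
    moreover have "AE p in ?P. norm (snd p) = 1" by (rule AE_I2) (auto simp: space_pair_measure space_sphere_measure)
    ultimately show ?thesis by eventually_elim (rule eq)
  qed
  have m: "(\<lambda>(r, \<theta>). r *\<^sub>R \<theta>) \<in> ?P \<rightarrow>\<^sub>M borel" by (rule measurable_polar)
  have m': "(\<lambda>p. f (fst p *\<^sub>R snd p)) \<in> borel_measurable ?P"
    using measurable_compose[OF m f] by (simp add: split_beta')
  have prod: "integrable ?P (\<lambda>p. a (fst p) * u (snd p))"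
    "(LINT p|?P. a (fst p) * u (snd p)) = (LINT r|radial_measure CARD('n). a r) * (LINT \<theta>|sphere_measure. u \<theta>)"
    using integrable_times_pair[OF R.sigma_finite_measure_axioms S.sigma_finite_measure_axioms a u] by auto
  have "integrable ?P (\<lambda>p. f (fst p *\<^sub>R snd p))"
    by (subst integrable_cong_AE[OF m' _ AE]) (use prod in auto)
  then have "integrable (distr ?P borel (\<lambda>(r, \<theta>). r *\<^sub>R \<theta>)) f"
    by (subst integrable_distr_eq[OF m f]) (simp add: split_beta')
  then show "integrable lborel f" by (simp add: lborel_polar)
  have "(LINT x|lborel. f x) = (LINT x|distr ?P borel (\<lambda>(r, \<theta>). r *\<^sub>R \<theta>). f x)"
    by (simp add: lborel_polar)
  also have "... = (LINT p|?P. f (fst p *\<^sub>R snd p))"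
    by (subst integral_distr[OF m f]) (simp add: split_beta')
  also have "... = (LINT p|?P. a (fst p) * u (snd p))"
    by (rule integral_cong_AE[OF m' _ AE]) (use prod in auto)
  finally show "(LINT x|lborel. f x) = (LINT r|radial_measure CARD('n). a r) * (LINT \<theta>|sphere_measure. u \<theta>)"
    using prod(2) by simp
qed

lemma nn_integral_polar:
  fixes f :: "real ^ 'n => ennreal"
  assumes f[measurable]: "f \<in> borel_measurable borel"
  shows "(\<integral>\<^sup>+x. f x \<partial>lborel) = (\<integral>\<^sup>+\<theta>. (\<integral>\<^sup>+r. f (r *\<^sub>R \<theta>) \<partial>radial_measure CARD('n)) \<partial>sphere_measure)"
proof -
  interpret S: prob_space "sphere_measure :: (real^'n) measure" by (rule prob_space_sphere_measure)
  interpret R: sigma_finite_measure "radial_measure CARD('n)" by (rule sigma_finite_radial_measure) simp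
  interpret P: pair_sigma_finite "radial_measure CARD('n)" "sphere_measure :: (real^'n) measure" ..
  let ?P = "radial_measure CARD('n) \<Otimes>\<^sub>M (sphere_measure :: (real^'n) measure)"
  have m: "(\<lambda>(r, \<theta>). r *\<^sub>R \<theta>) \<in> ?P \<rightarrow>\<^sub>M borel" by (rule measurable_polar)
  have m': "(\<lambda>(r, \<theta>). f (r *\<^sub>R \<theta>)) \<in> borel_measurable ?P"
    using measurable_compose[OF m f] by (simp add: split_beta')
  have "(\<integral>\<^sup>+x. f x \<partial>lborel) = (\<integral>\<^sup>+x. f x \<partial>distr ?P borel (\<lambda>(r, \<theta>). r *\<^sub>R \<theta>))"
    by (simp add: lborel_polar)
  also have "... = (\<integral>\<^sup>+p. (\<lambda>(r, \<theta>). f (r *\<^sub>R \<theta>)) p \<partial>?P)"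
    by (subst nn_integral_distr[OF m]) (auto simp: split_beta')
  also have "... = (\<integral>\<^sup>+\<theta>. (\<integral>\<^sup>+r. f (r *\<^sub>R \<theta>) \<partial>radial_measure CARD('n)) \<partial>sphere_measure)"
    using P.nn_integral_snd[OF m'] by simp
  finally show ?thesis .
qed

section \<open>Gaussian moments of complex order and power weights\<close>

lemma absolutely_integrable_lborel:
  fixes f :: "real => complex"
  assumes f: "f absolutely_integrable_on S" and [measurable]: "f \<in> borel_measurable borel" "S \<in> sets borel"
  shows "integrable lborel (\<lambda>x. indicator S x *\<^sub>R f x)"
    "(LINT x|lborel. indicator S x *\<^sub>R f x) = integral S f"
proof -
  have "integrable lebesgue (\<lambda>x. indicator S x *\<^sub>R f x)" using f by (simp add: set_integrable_def)
  then show 1: "integrable lborel (\<lambda>x. indicator S x *\<^sub>R f x)"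
    by (subst (asm) integrable_completion) auto
  show "(LINT x|lborel. indicator S x *\<^sub>R f x) = integral S f"
    using set_borel_integral_eq_integral(2)[of S f] 1 by (simp add: set_integrable_def set_lebesgue_integral_def)
qed

text \<open>
  The substitution \<open>t = r\<^sup>2 / 2\<close> turns the integral into Euler's integral for the Gamma function.
\<close>

lemma gaussian_mellin:
  assumes s: "Re s > 0"
  defines "f \<equiv> \<lambda>r::real. indicator {0<..} r *\<^sub>R (complex_of_real r powr (s - 1) * of_real (exp (- (r\<^sup>2 / 2))))"
  shows "integrable lborel f" "(LINT r|lborel. f r) = 2 powr (s / 2 - 1) * Gamma (s / 2)"
proof -
  define g where "g t = complex_of_real t powr (s / 2 - 1) / of_real (exp t)" for t :: real
  define q where "q r = r\<^sup>2 / 2" for r :: real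
  define h where "h r = complex_of_real r powr (s - 1) * of_real (exp (- (r\<^sup>2 / 2)))" for r :: real
  have s2: "Re (s / 2) > 0" using s by simp
  have gi: "g absolutely_integrable_on {0<..}" unfolding g_def
    by (rule absolutely_integrable_Gamma_integral'[OF s2])
  have gI: "(g has_integral Gamma (s / 2)) {0<..}" unfolding g_def by (rule Gamma_integral_complex'[OF s2])
  have der: "(q has_field_derivative r) (at r within {0<..})" if "r \<in> {0<..}" for r
    unfolding q_def using that by (auto intro!: derivative_eq_intros)
  have inj: "inj_on q {0<..}" by (auto simp: inj_on_def q_def)
  have img: "q ` {0<..} = {0<..}"
  proof (intro equalityI subsetI)
    fix t :: real assume "t \<in> {0<..}"
    then show "t \<in> q ` {0<..}" by (intro image_eqI[of _ _ "sqrt (2 * t)"]) (auto simp: q_def)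
  qed (auto simp: q_def)
  have pw: "\<bar>r\<bar> *\<^sub>R g (q r) = 2 powr (1 - s / 2) * h r" if "r \<in> {0<..}" for r
  proof -
    have "complex_of_real (r\<^sup>2 / 2) powr (s / 2 - 1) = exp ((s / 2 - 1) * of_real (ln (r\<^sup>2 / 2)))"
      using that by (simp add: powr_def Ln_of_real del: of_real_divide of_real_power)
    also have "ln (r\<^sup>2 / 2) = 2 * ln r - ln 2" using that by (simp add: ln_div ln_realpow)
    also have "exp ((s / 2 - 1) * of_real (2 * ln r - ln 2)) = exp ((s - 2) * of_real (ln r)) * exp ((1 - s / 2) * of_real (ln 2))"
      by (simp add: exp_add[symmetric] algebra_simps)
    also have "of_real \<bar>r\<bar> * ... = exp ((s - 1) * of_real (ln r)) * exp ((1 - s / 2) * of_real (ln 2))"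
    proof -
      have "of_real \<bar>r\<bar> = exp (complex_of_real (ln r))" using that by (simp add: exp_of_real)
      then show ?thesis by (simp add: exp_add[symmetric] algebra_simps)
    qed
    finally have F: "of_real \<bar>r\<bar> * complex_of_real (r\<^sup>2 / 2) powr (s / 2 - 1) = complex_of_real r powr (s - 1) * 2 powr (1 - s / 2)"
      using that Ln_of_real[of 2] by (simp add: powr_def Ln_of_real)
    have e: "complex_of_real (exp (- (r\<^sup>2 / 2))) = inverse (of_real (exp (r\<^sup>2 / 2)))"
      by (simp only: exp_minus of_real_inverse)
    show ?thesis
      unfolding g_def q_def h_def scaleR_conv_of_real times_divide_eq_right F e
      by (simp only: divide_inverse[of _ "complex_of_real (exp (r\<^sup>2 / 2))"] mult_ac)
  qed
  have one: "2 powr (s / 2 - 1) * 2 powr (1 - s / 2) = (1::complex)"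
    by (subst powr_add[symmetric]) simp
  have h_eq: "h r = 2 powr (s / 2 - 1) * (\<bar>r\<bar> *\<^sub>R g (q r))" if "r \<in> {0<..}" for r
    unfolding pw[OF that] mult.assoc[symmetric] one by simp
  have "(\<lambda>r. \<bar>r\<bar> *\<^sub>R g (q r)) absolutely_integrable_on {0<..}"
    using absolutely_integrable_change_of_variables_real[of "{0<..}" q "\<lambda>r. r" g] der inj gi img by auto
  then have "(\<lambda>r. 2 powr (s / 2 - 1) * (\<bar>r\<bar> *\<^sub>R g (q r))) absolutely_integrable_on {0<..}"
    by (rule set_integrable_mult_right)
  then have hi: "h absolutely_integrable_on {0<..}"
    by (rule absolutely_integrable_spike[where S="{}"]) (auto simp: h_eq)
  have comp: "integral {0<..} (\<lambda>r. \<bar>r\<bar> * F (g (q r))) = integral {0<..} (\<lambda>t. F (g t))"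
    if F: "bounded_linear F" for F :: "complex => real"
  proof -
    have "(\<lambda>t. F (g t)) absolutely_integrable_on {0<..}"
      using absolutely_integrable_linear[OF gi F] by (simp add: o_def)
    then have *: "(\<lambda>t. F (g t)) absolutely_integrable_on (q ` {0<..}) \<and> integral (q ` {0<..}) (\<lambda>t. F (g t)) = integral {0<..} (\<lambda>t. F (g t))"
      by (simp add: img)
    have "(\<lambda>x. \<bar>x\<bar> * F (g (q x))) absolutely_integrable_on {0<..} \<and> integral {0<..} (\<lambda>x. \<bar>x\<bar> * F (g (q x))) = integral {0<..} (\<lambda>t. F (g t))"
      by (rule has_absolute_integral_change_of_variables_1'[OF _ der inj, THEN iffD2, OF _ _ *]) auto
    then show ?thesis by simp
  qed
  have Ii: "(\<lambda>r. \<bar>r\<bar> *\<^sub>R g (q r)) integrable_on {0<..}"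
    using \<open>(\<lambda>r. \<bar>r\<bar> *\<^sub>R g (q r)) absolutely_integrable_on {0<..}\<close> by (rule set_lebesgue_integral_eq_integral(1))
  have eqI: "integral {0<..} (\<lambda>r. \<bar>r\<bar> *\<^sub>R g (q r)) = Gamma (s / 2)"
  proof (rule complex_eqI)
    have "Re (integral {0<..} (\<lambda>r. \<bar>r\<bar> *\<^sub>R g (q r))) = integral {0<..} (\<lambda>r. \<bar>r\<bar> * Re (g (q r)))"
      using integral_linear[OF Ii bounded_linear_Re] by (simp add: o_def)
    also have "... = Re (Gamma (s / 2))"
      using comp[OF bounded_linear_Re] integral_linear[OF has_integral_integrable[OF gI] bounded_linear_Re] integral_unique[OF gI]
      by (simp add: o_def)
    finally show "Re (integral {0<..} (\<lambda>r. \<bar>r\<bar> *\<^sub>R g (q r))) = Re (Gamma (s / 2))" .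
    have "Im (integral {0<..} (\<lambda>r. \<bar>r\<bar> *\<^sub>R g (q r))) = integral {0<..} (\<lambda>r. \<bar>r\<bar> * Im (g (q r)))"
      using integral_linear[OF Ii bounded_linear_Im] by (simp add: o_def)
    also have "... = Im (Gamma (s / 2))"
      using comp[OF bounded_linear_Im] integral_linear[OF has_integral_integrable[OF gI] bounded_linear_Im] integral_unique[OF gI]
      by (simp add: o_def)
    finally show "Im (integral {0<..} (\<lambda>r. \<bar>r\<bar> *\<^sub>R g (q r))) = Im (Gamma (s / 2))" .
  qed
  have hm: "h \<in> borel_measurable borel" unfolding h_def by measurable
  have f_eq: "f = (\<lambda>r. indicator {0<..} r *\<^sub>R h r)" by (simp add: f_def h_def fun_eq_iff)
  show "integrable lborel f" unfolding f_eq by (rule absolutely_integrable_lborel(1)[OF hi hm]) simp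
  have "(LINT r|lborel. f r) = integral {0<..} h" unfolding f_eq by (rule absolutely_integrable_lborel(2)[OF hi hm]) simp
  also have "... = integral {0<..} (\<lambda>r. 2 powr (s / 2 - 1) * (\<bar>r\<bar> *\<^sub>R g (q r)))"
    by (rule integral_cong) (rule h_eq)
  also have "... = 2 powr (s / 2 - 1) * Gamma (s / 2)" by (simp only: integral_mult_right eqI)
  finally show "(LINT r|lborel. f r) = 2 powr (s / 2 - 1) * Gamma (s / 2)" .
qed

lemma radial_gaussian_mellin:
  assumes "n > 0" and w: "Re w > - real n"
  shows "integrable (radial_measure n) (\<lambda>r. complex_of_real r powr w * of_real (exp (- (r\<^sup>2 / 2))))"
    "(LINT r|radial_measure n. complex_of_real r powr w * of_real (exp (- (r\<^sup>2 / 2))))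
      = of_real (real n * unit_ball_vol (real n)) * 2 powr ((of_nat n + w) / 2 - 1) * Gamma ((of_nat n + w) / 2)"
proof -
  have eq: "(indicator {0<..} r * (real n * unit_ball_vol (real n) * r ^ (n - 1))) *\<^sub>R (complex_of_real r powr w * of_real (exp (- (r\<^sup>2 / 2))))
    = of_real (real n * unit_ball_vol (real n)) * (indicator {0<..} r *\<^sub>R (complex_of_real r powr (of_nat n + w - 1) * of_real (exp (- (r\<^sup>2 / 2)))))" for r
  proof (cases "r > 0")
    case True
    have "complex_of_real r powr (of_nat n + w - 1) = complex_of_real r powr (of_nat (n - 1) + w)"
      using assms(1) by (simp add: of_nat_diff algebra_simps)
    also have "... = complex_of_real r ^ (n - 1) * complex_of_real r powr w"
      using True by (simp add: powr_add powr_nat')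
    finally show ?thesis using True by (simp add: scaleR_conv_of_real)
  qed simp
  have m: "(\<lambda>r. complex_of_real r powr w * of_real (exp (- (r\<^sup>2 / 2)))) \<in> borel_measurable borel"
    by measurable
  have w': "Re (of_nat n + w) > 0" using w by simp
  show "integrable (radial_measure n) (\<lambda>r. complex_of_real r powr w * of_real (exp (- (r\<^sup>2 / 2))))"
    unfolding integrable_radial_iff[OF m] eq by (rule integrable_mult_right[OF gaussian_mellin(1)[OF w']])
  show "(LINT r|radial_measure n. complex_of_real r powr w * of_real (exp (- (r\<^sup>2 / 2))))
      = of_real (real n * unit_ball_vol (real n)) * 2 powr ((of_nat n + w) / 2 - 1) * Gamma ((of_nat n + w) / 2)"
    unfolding integral_radial[OF m] eq integral_mult_right_zero gaussian_mellin(2)[OF w'] by (simp only: mult.assoc)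
qed

lemma nn_integral_radial_powr_decay:
  assumes "n > 0" "s < real n" "real N \<ge> real n + 1 - s"
  shows "(\<integral>\<^sup>+r. ennreal (r powr - s / (1 + r ^ N)) \<partial>radial_measure n) < \<infinity>"
proof -
  let ?B = "\<lambda>r::real. ennreal (real n * unit_ball_vol (real n)) * (ennreal (indicator {0..1} r * r powr (real n - 1 - s)) + ennreal (indicator {1..} r * r powr (- 2)))"
  have *: "(\<integral>\<^sup>+r. ennreal (r powr - s / (1 + r ^ N)) \<partial>radial_measure n)
    \<le> (\<integral>\<^sup>+r. ?B r \<partial>lborel)"
  proof -
    have "(\<integral>\<^sup>+r. ennreal (r powr - s / (1 + r ^ N)) \<partial>radial_measure n) =
      (\<integral>\<^sup>+r. ennreal (indicator {0<..} r * (real n * unit_ball_vol (real n) * r ^ (n - 1))) * ennreal (r powr - s / (1 + r ^ N)) \<partial>lborel)"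
      unfolding radial_measure_def by (rule nn_integral_density) auto
    also have "... \<le> (\<integral>\<^sup>+r. ?B r \<partial>lborel)"
    proof (rule nn_integral_mono)
      fix r :: real
      show "ennreal (indicator {0<..} r * (real n * unit_ball_vol (real n) * r ^ (n - 1))) * ennreal (r powr - s / (1 + r ^ N))
        \<le> ?B r"
      proof (cases "r > 0")
        case True
        have p: "r ^ (n - 1) * r powr - s = r powr (real n - 1 - s)"
          using True assms(1) by (simp add: powr_realpow[symmetric] powr_add[symmetric] of_nat_diff algebra_simps)
        have "r powr (real n - 1 - s) / (1 + r ^ N) \<le> indicator {0..1} r * r powr (real n - 1 - s) + indicator {1..} r * r powr (- 2)"
        proof (cases "r \<le> 1")
          case r1: True
          have "r powr (real n - 1 - s) / (1 + r ^ N) \<le> r powr (real n - 1 - s)"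
            using True by (intro divide_le_eq_1_pos[THEN iffD2] mult_imp_div_pos_le) (auto intro: add_pos_nonneg simp: algebra_simps)
          then show ?thesis using True r1 by (auto simp: indicator_def)
        next
          case False
          have "r powr (real n - 1 - s) / (1 + r ^ N) \<le> r powr (real n - 1 - s) / r ^ N"
            using True by (intro divide_left_mono mult_pos_pos add_pos_pos zero_less_power) auto
          also have "... = r powr (real n - 1 - s - real N)" using True by (simp add: powr_diff powr_realpow)
          also have "... \<le> r powr (-2)" using False assms by (intro powr_mono) auto
          finally show ?thesis using False by (auto simp: indicator_def)
        qed
        from mult_left_mono[OF this, of "real n * unit_ball_vol (real n)"]
        show ?thesis using True
          by (simp add: p[symmetric] ennreal_mult'[symmetric] ennreal_plus[symmetric] mult_ac del: ennreal_plus)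
      qed simp
    qed
    finally show ?thesis .
  qed
  have "(\<integral>\<^sup>+r. ennreal (indicator {0..1} r * r powr (real n - 1 - s)) \<partial>lborel) < \<infinity>"
    using nn_integral_has_integral_lebesgue[OF _ has_integral_powr_from_0[of "real n - 1 - s" 1]] assms by simp
  moreover have "(\<integral>\<^sup>+r. ennreal (indicator {1..} r * r powr (-2)) \<partial>lborel) < \<infinity>"
    using nn_integral_has_integral_lebesgue[OF _ has_integral_powr_to_inf[of "-2" 1]] by simp
  ultimately have "(\<integral>\<^sup>+r. ?B r \<partial>lborel) < \<infinity>"
    by (subst nn_integral_cmult) (auto simp: nn_integral_add ennreal_mult_less_top)
  with * show ?thesis by (rule le_less_trans)
qed

lemma integrable_norm_powr_decay:
  assumes "s < real CARD('n)" "real N \<ge> real CARD('n) + 1 - s"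
  shows "integrable lborel (\<lambda>x::real ^ 'n. norm x powr - s / (1 + norm x ^ N))"
proof (rule integrableI_nonneg)
  interpret S: prob_space "sphere_measure :: (real^'n) measure" by (rule prob_space_sphere_measure)
  have "(\<integral>\<^sup>+(x::real^'n). ennreal (norm x powr - s / (1 + norm x ^ N)) \<partial>lborel)
    = (\<integral>\<^sup>+\<theta>. (\<integral>\<^sup>+r. ennreal (norm (r *\<^sub>R \<theta>) powr - s / (1 + norm (r *\<^sub>R \<theta>) ^ N)) \<partial>radial_measure CARD('n)) \<partial>(sphere_measure :: (real^'n) measure))"
    by (rule nn_integral_polar) simp
  also have "... = (\<integral>\<^sup>+\<theta>. (\<integral>\<^sup>+r. ennreal (r powr - s / (1 + r ^ N)) \<partial>radial_measure CARD('n)) \<partial>(sphere_measure :: (real^'n) measure))"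
    by (rule nn_integral_cong, rule nn_integral_cong_AE, use AE_radial_measure_pos in eventually_elim)
       (auto simp: space_sphere_measure)
  also have "... < \<infinity>" using nn_integral_radial_powr_decay[OF _ assms] by (simp add: S.emeasure_space_1)
  finally show "(\<integral>\<^sup>+(x::real^'n). ennreal (norm x powr - s / (1 + norm x ^ N)) \<partial>lborel) < \<infinity>" .
qed (auto intro!: AE_I2 divide_nonneg_nonneg add_nonneg_nonneg)

section \<open>Schwartz functions\<close>

text \<open>
  Smoothness and decay of all derivatives are proved together: the class need only be closed
  under derivatives and decay itself.
\<close>

lemma schwartz_coinduct:
  assumes "P f"
    and step: "\<And>f. P f ==> f differentiable_on UNIV \<and> (\<forall>m. \<exists>C. \<forall>x. norm x ^ m * norm (f x) \<le> C) \<and>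
      (\<forall>v. \<exists>h. P h \<and> (\<forall>x. frechet_derivative f (at x) v = h x))"
  shows "schwartz f"
proof -
  have "smooth_on UNIV f"
    by (rule smooth_on_coinduct[where P=P]) (use assms in auto)
  moreover have "\<exists>C. \<forall>x. norm x ^ m * norm (iterated_derivative vs f x) \<le> C" if "P f" for vs m f
    using that
  proof (induction vs arbitrary: f)
    case (Cons v vs)
    obtain h where h: "P h" "\<And>x. frechet_derivative f (at x) v = h x"
      using step[OF Cons.prems] by blast
    then have "(\<lambda>x. frechet_derivative f (at x) v) = h" by auto
    then show ?case using Cons.IH[OF h(1)] by simp
  qed (use step in simp)
  ultimately show ?thesis
    using \<open>P f\<close> by (auto simp: schwartz_def bounded_iff)
qed

lemma schwartz_smooth: "schwartz \<phi> ==> smooth_on UNIV \<phi>"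
  by (simp add: schwartz_def)

lemma schwartz_has_derivative:
  "schwartz \<phi> ==> (\<phi> has_derivative frechet_derivative \<phi> (at x)) (at x)"
  by (rule smooth_on_has_derivative[OF schwartz_smooth]) auto

lemma schwartz_continuous: "schwartz \<phi> ==> continuous_on UNIV \<phi>"
  by (intro smooth_on_continuous schwartz_smooth)

lemma schwartz_measurable: "schwartz \<phi> ==> \<phi> \<in> borel_measurable borel"
  by (intro borel_measurable_continuous_onI schwartz_continuous)

lemma schwartz_derivative:
  assumes "schwartz \<phi>" shows "schwartz (\<lambda>x. frechet_derivative \<phi> (at x) v)"
proof -
  have "bounded (range (\<lambda>x. norm x ^ m *\<^sub>R iterated_derivative vs (\<lambda>x. frechet_derivative \<phi> (at x) v) x))" for vs m
  proof -
    have "bounded (range (\<lambda>x. norm x ^ m *\<^sub>R iterated_derivative (v # vs) \<phi> x))"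
      using assms unfolding schwartz_def by blast
    then show ?thesis by simp
  qed
  then show ?thesis using smooth_on_derivative[OF schwartz_smooth[OF assms]] by (simp add: schwartz_def)
qed

lemma schwartz_bound:
  assumes "schwartz \<phi>" shows "\<exists>C. \<forall>x. norm x ^ m * norm (\<phi> x) \<le> C"
proof -
  have "bounded (range (\<lambda>x. norm x ^ m *\<^sub>R iterated_derivative [] \<phi> x))"
    using assms unfolding schwartz_def by blast
  then show ?thesis by (auto simp: bounded_iff)
qed

lemma schwartz_decay:
  assumes "schwartz \<phi>" obtains C where "C \<ge> 0" "\<And>x. norm (\<phi> x) \<le> C / (1 + norm x ^ m)"
proof -
  obtain C0 Cm where C: "\<And>x. norm (\<phi> x) \<le> C0" "\<And>x. norm x ^ m * norm (\<phi> x) \<le> Cm"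
    using schwartz_bound[OF assms, of 0] schwartz_bound[OF assms, of m] by auto
  show ?thesis
  proof (rule that[of "C0 + Cm"])
    show "0 \<le> C0 + Cm" using C[of 0] by (meson add_nonneg_nonneg norm_ge_zero order_trans zero_le_mult_iff zero_le_power)
    fix x
    have "norm (\<phi> x) * (1 + norm x ^ m) \<le> C0 + Cm" using C[of x] by (simp add: algebra_simps)
    moreover have "1 + norm x ^ m > 0" by (intro add_pos_nonneg) auto
    ultimately show "norm (\<phi> x) \<le> (C0 + Cm) / (1 + norm x ^ m)" by (simp add: pos_le_divide_eq)
  qed
qed

lemma schwartz_integrable_powr:
  fixes \<phi> :: "real ^ 'n => complex"
  assumes "schwartz \<phi>" "s < real CARD('n)"
  shows "integrable lborel (\<lambda>x. norm x powr - s * norm (\<phi> x))"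
proof -
  obtain N :: nat where N: "real N \<ge> real CARD('n) + 1 - s" using real_nat_ceiling_ge by blast
  obtain C where C: "C \<ge> 0" "\<And>x. norm (\<phi> x) \<le> C / (1 + norm x ^ N)"
    using schwartz_decay[OF assms(1)] by blast
  have [measurable]: "\<phi> \<in> borel_measurable borel" by (rule schwartz_measurable[OF assms(1)])
  have "integrable lborel (\<lambda>x::real^'n. C * (norm x powr - s / (1 + norm x ^ N)))"
    by (intro integrable_mult_right integrable_norm_powr_decay assms N)
  then show ?thesis
  proof (rule Bochner_Integration.integrable_bound)
    show "AE x in lborel. norm (norm x powr - s * norm (\<phi> x)) \<le> norm (C * (norm x powr - s / (1 + norm x ^ N)))"
    proof (rule AE_I2)
      fix x :: "real^'n"
      have "norm x powr - s * norm (\<phi> x) \<le> norm x powr - s * (C / (1 + norm x ^ N))"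
        by (intro mult_left_mono C) auto
      also have "... = C * (norm x powr - s / (1 + norm x ^ N))" by simp
      finally show "norm (norm x powr - s * norm (\<phi> x)) \<le> norm (C * (norm x powr - s / (1 + norm x ^ N)))"
        using C(1) by (simp add: abs_mult)
    qed
  qed measurable
qed

lemma schwartz_integrable:
  fixes \<phi> :: "real ^ 'n => complex"
  assumes "schwartz \<phi>" shows "integrable lborel \<phi>"
proof -
  have [measurable]: "\<phi> \<in> borel_measurable borel" by (rule schwartz_measurable[OF assms(1)])
  have "integrable lborel (\<lambda>x. norm x powr - 0 * norm (\<phi> x))"
    by (rule schwartz_integrable_powr[OF assms]) simp
  moreover have "AE x in lborel. norm (\<phi> x) = norm x powr - 0 * norm (\<phi> x)"
    using AE_lborel_singleton[of "0::real^'n"] by eventually_elim simp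
  ultimately have "integrable lborel (\<lambda>x. norm (\<phi> x))"
    by (subst integrable_cong_AE) auto
  then show ?thesis by (subst integrable_norm_iff[symmetric]) auto
qed

text \<open>
  A class that contains the Schwartz functions and the Gaussian and is visibly closed under
  directional derivatives; coinduction shows that it is not larger than the Schwartz space.
\<close>

inductive schwartz_span :: "(real ^ 'n => complex) => bool" where
  base: "schwartz f ==> schwartz_span f"
| gauss: "schwartz_span (\<lambda>x. of_real (exp (- ((norm x)\<^sup>2 / 2))))"
| add: "schwartz_span f ==> schwartz_span g ==> schwartz_span (\<lambda>x. f x + g x)"
| lin: "schwartz_span f ==> schwartz_span (\<lambda>x. of_real (x \<bullet> v) * f x)"
| scale: "schwartz_span f ==> schwartz_span (\<lambda>x. c * f x)"

lemma power_le_fact_exp: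
  fixes t :: real
  assumes "t \<ge> 0" shows "t ^ m \<le> fact m * exp t"
proof -
  have "(\<Sum>n\<in>{m}. t ^ n /\<^sub>R fact n) \<le> (\<Sum>n. t ^ n /\<^sub>R fact n)"
    using assms by (intro sum_le_suminf summable_exp_generic) auto
  then show ?thesis by (simp add: exp_def field_simps)
qed

lemma gauss_decay:
  fixes t :: real
  assumes t: "t \<ge> 0" shows "t ^ m * exp (- (t\<^sup>2 / 2)) \<le> 1 + 2 ^ m * fact m"
proof -
  have "t ^ m \<le> 1 + t ^ (2 * m)"
  proof (cases "t \<le> 1")
    case True
    then have "t ^ m \<le> 1" using t by (simp add: power_le_one)
    moreover have "0 \<le> t ^ (2 * m)" using t by simp
    ultimately show ?thesis by linarith
  next
    case False
    then have "t ^ m \<le> t ^ (2 * m)" by (intro power_increasing) auto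
    then show ?thesis by simp
  qed
  also have "t ^ (2 * m) = 2 ^ m * (t\<^sup>2 / 2) ^ m" by (simp add: power_divide power_mult[symmetric])
  also have "1 + 2 ^ m * (t\<^sup>2 / 2) ^ m \<le> 1 + 2 ^ m * (fact m * exp (t\<^sup>2 / 2))"
    using t by (intro add_left_mono mult_left_mono power_le_fact_exp) auto
  finally have "t ^ m \<le> 1 * exp (t\<^sup>2 / 2) + 2 ^ m * fact m * exp (t\<^sup>2 / 2)"
  proof -
    have "1 \<le> exp (t\<^sup>2 / 2)" by simp
    then show "t ^ m \<le> 1 + 2 ^ m * (fact m * exp (t\<^sup>2 / 2)) ==> ?thesis"
      unfolding mult.assoc by linarith
  qed
  then have "t ^ m * exp (- (t\<^sup>2 / 2)) \<le> ((1 + 2 ^ m * fact m) * exp (t\<^sup>2 / 2)) * exp (- (t\<^sup>2 / 2))"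
    by (intro mult_right_mono) (auto simp: algebra_simps)
  also have "... = 1 + 2 ^ m * fact m" by (simp add: mult.assoc exp_add[symmetric])
  finally show ?thesis .
qed

lemma gauss_has_derivative:
  "((\<lambda>x::real^'n. complex_of_real (exp (- ((norm x)\<^sup>2 / 2)))) has_derivative
     (\<lambda>h. of_real (- (x \<bullet> h)) * of_real (exp (- ((norm x)\<^sup>2 / 2))))) (at x)"
proof -
  have "((\<lambda>x::real^'n. exp (- ((x \<bullet> x) / 2))) has_derivative (\<lambda>h. - (x \<bullet> h) * exp (- ((x \<bullet> x) / 2)))) (at x)"
    by (auto intro!: derivative_eq_intros simp: inner_commute algebra_simps)
  from has_derivative_of_real[OF this, where 'a=complex]
  show ?thesis by (simp add: power2_norm_eq_inner)
qed

lemma schwartz_span_step: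
  assumes "schwartz_span f"
  shows "f differentiable_on UNIV \<and> (\<forall>m. \<exists>C. \<forall>x. norm x ^ m * norm (f x) \<le> C) \<and>
      (\<forall>v. \<exists>h. schwartz_span h \<and> (\<forall>x. frechet_derivative f (at x) v = h x))"
  using assms
proof induction
  case (base f)
  then show ?case
    using smooth_on_differentiable[OF schwartz_smooth] schwartz_bound schwartz_derivative schwartz_span.base by blast
next
  case gauss
  let ?g = "\<lambda>x::real^'n. complex_of_real (exp (- ((norm x)\<^sup>2 / 2)))"
  have "?g differentiable_on UNIV"
    unfolding differentiable_on_def differentiable_def using has_derivative_at_withinI[OF gauss_has_derivative] by blast
  moreover have "\<forall>x. norm x ^ m * norm (?g x) \<le> 1 + 2 ^ m * fact m" for m
    using gauss_decay[OF norm_ge_zero] by (simp only: norm_of_real abs_exp_cancel) blast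
  moreover have "\<exists>h. schwartz_span h \<and> (\<forall>x. frechet_derivative ?g (at x) v = h x)" for v
    by (rule exI, rule conjI, rule scale[where c="-1"], rule lin[where v=v], rule schwartz_span.gauss)
       (simp only: frechet_derivative_at[OF gauss_has_derivative, symmetric], simp)
  ultimately show ?case by blast
next
  case (add f g)
  have d: "(f has_derivative frechet_derivative f (at x)) (at x)"
          "(g has_derivative frechet_derivative g (at x)) (at x)" for x
    using add by (auto simp: differentiable_on_def frechet_derivative_works)
  have e: "frechet_derivative (\<lambda>x. f x + g x) (at x) = (\<lambda>h. frechet_derivative f (at x) h + frechet_derivative g (at x) h)" for x
    by (rule frechet_derivative_at[symmetric]) (intro has_derivative_add d)
  show ?case
  proof (intro conjI allI)
    show "(\<lambda>x. f x + g x) differentiable_on UNIV" using add by (auto intro: differentiable_on_add)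
    fix m
    obtain C D where "\<And>x. norm x ^ m * norm (f x) \<le> C" "\<And>x. norm x ^ m * norm (g x) \<le> D" using add by metis
    moreover have "norm x ^ m * norm (f x + g x) \<le> norm x ^ m * norm (f x) + norm x ^ m * norm (g x)" for x
      unfolding distrib_left[symmetric] by (intro mult_left_mono norm_triangle_ineq) auto
    ultimately have "norm x ^ m * norm (f x + g x) \<le> C + D" for x
      using add_mono order_trans by blast
    then show "\<exists>C. \<forall>x. norm x ^ m * norm (f x + g x) \<le> C" by blast
  next
    fix v
    obtain hf hg where h: "schwartz_span hf" "\<And>x. frechet_derivative f (at x) v = hf x"
      "schwartz_span hg" "\<And>x. frechet_derivative g (at x) v = hg x"
      using add.IH by metis
    show "\<exists>h. schwartz_span h \<and> (\<forall>x. frechet_derivative (\<lambda>x. f x + g x) (at x) v = h x)"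
      by (rule exI[of _ "\<lambda>x. hf x + hg x"]) (simp add: schwartz_span.add h e)
  qed
next
  case (lin f w)
  have d: "(f has_derivative frechet_derivative f (at x)) (at x)" for x
    using lin by (auto simp: differentiable_on_def frechet_derivative_works)
  have dl: "((\<lambda>x. complex_of_real (x \<bullet> w)) has_derivative (\<lambda>h. of_real (h \<bullet> w))) (at x)" for x
    by (auto intro!: derivative_eq_intros)
  have dm: "((\<lambda>x. of_real (x \<bullet> w) * f x) has_derivative (\<lambda>h. of_real (x \<bullet> w) * frechet_derivative f (at x) h + of_real (h \<bullet> w) * f x)) (at x)" for x
    using has_derivative_mult[OF dl d] .
  show ?case
  proof (intro conjI allI)
    show "(\<lambda>x. of_real (x \<bullet> w) * f x) differentiable_on UNIV"
      unfolding differentiable_on_def differentiable_def using has_derivative_at_withinI[OF dm] by blast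
    fix m
    obtain C where C: "\<And>x. norm x ^ Suc m * norm (f x) \<le> C" using lin by metis
    have "norm x ^ m * norm (of_real (x \<bullet> w) * f x) \<le> norm w * C" for x
    proof -
      have "norm x ^ m * norm (of_real (x \<bullet> w) * f x) = \<bar>x \<bullet> w\<bar> * (norm x ^ m * norm (f x))"
        by (simp add: norm_mult)
      also have "... \<le> (norm x * norm w) * (norm x ^ m * norm (f x))"
        by (intro mult_right_mono Cauchy_Schwarz_ineq2) auto
      also have "... = norm w * (norm x ^ Suc m * norm (f x))" by simp
      also have "... \<le> norm w * C" by (intro mult_left_mono C) auto
      finally show ?thesis .
    qed
    then show "\<exists>C. \<forall>x. norm x ^ m * norm (of_real (x \<bullet> w) * f x) \<le> C" by blast
  next
    fix v
    obtain h where h: "schwartz_span h" "\<And>x. frechet_derivative f (at x) v = h x"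
      using lin.IH by metis
    show "\<exists>h. schwartz_span h \<and> (\<forall>x. frechet_derivative (\<lambda>x. of_real (x \<bullet> w) * f x) (at x) v = h x)"
      by (rule exI[of _ "\<lambda>x. of_real (x \<bullet> w) * h x + of_real (v \<bullet> w) * f x"])
         (simp add: schwartz_span.add schwartz_span.lin schwartz_span.scale h lin.hyps frechet_derivative_at[OF dm, symmetric])
  qed
next
  case (scale f c)
  have d: "(f has_derivative frechet_derivative f (at x)) (at x)" for x
    using scale by (auto simp: differentiable_on_def frechet_derivative_works)
  have dm: "((\<lambda>x. c * f x) has_derivative (\<lambda>h. c * frechet_derivative f (at x) h)) (at x)" for x
    using has_derivative_mult_right[OF d] .
  show ?case
  proof (intro conjI allI)
    show "(\<lambda>x. c * f x) differentiable_on UNIV"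
      unfolding differentiable_on_def differentiable_def using has_derivative_at_withinI[OF dm] by blast
    fix m
    obtain C where C: "\<And>x. norm x ^ m * norm (f x) \<le> C" using scale by metis
    then have "norm x ^ m * norm (c * f x) \<le> norm c * C" for x
      using mult_left_mono[OF C[of x], of "norm c"] by (simp add: norm_mult algebra_simps)
    then show "\<exists>C. \<forall>x. norm x ^ m * norm (c * f x) \<le> C" by blast
  next
    fix v
    obtain h where h: "schwartz_span h" "\<And>x. frechet_derivative f (at x) v = h x"
      using scale.IH by metis
    show "\<exists>h. schwartz_span h \<and> (\<forall>x. frechet_derivative (\<lambda>x. c * f x) (at x) v = h x)"
      by (rule exI[of _ "\<lambda>x. c * h x"])
         (simp add: schwartz_span.scale h frechet_derivative_at[OF dm, symmetric])
  qed
qed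

lemma schwartz_span_schwartz: "schwartz_span f ==> schwartz f"
  by (rule schwartz_coinduct[where P=schwartz_span]) (auto dest: schwartz_span_step)

lemma schwartz_gauss: "schwartz (\<lambda>x. of_real (exp (- ((norm x)\<^sup>2 / 2))))"
  by (rule schwartz_span_schwartz[OF schwartz_span.gauss])

lemma schwartz_linear_mult: "schwartz f ==> schwartz (\<lambda>x. of_real (x \<bullet> v) * f x)"
  by (rule schwartz_span_schwartz[OF schwartz_span.lin[OF schwartz_span.base]])

lemma schwartz_cmult: "schwartz f ==> schwartz (\<lambda>x. c * f x)"
  by (rule schwartz_span_schwartz[OF schwartz_span.scale[OF schwartz_span.base]])

lemma schwartz_power_mult: "schwartz f ==> schwartz (\<lambda>x. of_real ((x \<bullet> v) ^ m) * f x)"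
proof (induction m)
  case (Suc m)
  from schwartz_linear_mult[OF Suc.IH[OF Suc.prems], of v] show ?case by (simp add: mult.assoc)
qed simp

lemma schwartz_compact_support:
  assumes "smooth_on UNIV f" "\<And>x. norm x > R ==> f x = 0"
  shows "schwartz f"
proof (rule schwartz_coinduct[where P="\<lambda>f. smooth_on UNIV f \<and> (\<forall>x. norm x > R \<longrightarrow> f x = 0)"])
  fix f :: "real^'n => complex" assume f: "smooth_on UNIV f \<and> (\<forall>x. norm x > R \<longrightarrow> f x = 0)"
  show "f differentiable_on UNIV \<and> (\<forall>m. \<exists>C. \<forall>x. norm x ^ m * norm (f x) \<le> C) \<and>
      (\<forall>v. \<exists>h. (smooth_on UNIV h \<and> (\<forall>x. norm x > R \<longrightarrow> h x = 0)) \<and> (\<forall>x. frechet_derivative f (at x) v = h x))"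
  proof (intro conjI allI)
    show "f differentiable_on UNIV" using f smooth_on_differentiable by blast
    fix m
    have "continuous_on (cball 0 R) f" using f smooth_on_continuous continuous_on_subset by blast
    then have "bounded (f ` cball 0 R)" by (intro compact_imp_bounded compact_continuous_image) auto
    then obtain B where "\<forall>x\<in>cball 0 R. norm (f x) \<le> B" by (auto simp: bounded_iff)
    then have B: "norm (f x) \<le> B" if "norm x \<le> R" for x using that by auto
    have "norm x ^ m * norm (f x) \<le> \<bar>R\<bar> ^ m * \<bar>B\<bar>" for x
    proof (cases "norm x \<le> R")
      case True
      then show ?thesis using B[OF True] by (intro mult_mono power_mono) auto
    qed (use f in auto)
    then show "\<exists>C. \<forall>x. norm x ^ m * norm (f x) \<le> C" by blast
  next
    fix v
    have "frechet_derivative f (at x) v = 0" if "norm x > R" for x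
    proof -
      have "open {x::real^'n. norm x > R}" by (intro open_Collect_less continuous_intros)
      then have "frechet_derivative f (at x) = frechet_derivative (\<lambda>x. 0) (at x)"
        by (rule frechet_derivative_cong_open) (use that f in auto)
      then show ?thesis by simp
    qed
    then show "\<exists>h. (smooth_on UNIV h \<and> (\<forall>x. norm x > R \<longrightarrow> h x = 0)) \<and> (\<forall>x. frechet_derivative f (at x) v = h x)"
      using f smooth_on_derivative by blast
  qed
qed (use assms in auto)

section \<open>The Fourier transform of Schwartz functions\<close>

lemma integrable_fourier_integrand:
  fixes \<phi> :: "real ^ 'n => complex"
  assumes "integrable lborel \<phi>"
  shows "integrable lborel (\<lambda>x. \<phi> x * exp (- \<i> * complex_of_real (x \<bullet> \<xi>)))"
proof (rule Bochner_Integration.integrable_bound[OF assms])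
  show "(\<lambda>x. \<phi> x * exp (- \<i> * complex_of_real (x \<bullet> \<xi>))) \<in> borel_measurable lborel"
    using borel_measurable_integrable[OF assms] by measurable
qed (simp add: norm_mult)

lemma norm_fourier_le: "norm (fourier \<phi> \<xi>) \<le> (LINT x|lborel. norm (\<phi> x))"
proof -
  have "norm (fourier \<phi> \<xi>) \<le> (LINT x|lborel. norm (\<phi> x * exp (- \<i> * complex_of_real (x \<bullet> \<xi>))))"
    unfolding fourier_def by (rule integral_norm_bound)
  then show ?thesis by (simp add: norm_mult)
qed

lemma fourier_cmult: "fourier (\<lambda>x. c * \<phi> x) \<xi> = c * fourier \<phi> \<xi>"
  by (simp add: fourier_def mult.assoc)

lemma fourier_has_derivative:
  fixes \<phi> :: "real ^ 'n => complex"
  assumes \<phi>: "schwartz \<phi>"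
  shows "(fourier \<phi> has_derivative (\<lambda>h. fourier (\<lambda>x. (- \<i>) * (of_real (x \<bullet> h) * \<phi> x)) \<xi>)) (at \<xi>)"
proof -
  have int1: "integrable lborel (\<lambda>x. norm x * norm (\<phi> x))"
    using schwartz_integrable_powr[OF \<phi>, of "-1"] by simp
  have [measurable]: "\<phi> \<in> borel_measurable borel" by (rule schwartz_measurable[OF \<phi>])
  have "((\<lambda>\<xi>. LINT x|lborel. \<phi> x * exp (- \<i> * complex_of_real (x \<bullet> \<xi>))) has_derivative
     (\<lambda>h. LINT x|lborel. (- \<i>) * (of_real (x \<bullet> h) * \<phi> x) * exp (- \<i> * complex_of_real (x \<bullet> \<xi>)))) (at \<xi>)"
  proof (rule has_derivative_lebesgue_integral[where U=UNIV and w="\<lambda>x. norm x * norm (\<phi> x)"])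
    show "integrable lborel (\<lambda>x. \<phi> x * exp (- \<i> * complex_of_real (x \<bullet> y)))" for y
      by (rule integrable_fourier_integrand[OF schwartz_integrable[OF \<phi>]])
    show "((\<lambda>y. \<phi> x * exp (- \<i> * complex_of_real (x \<bullet> y))) has_derivative
       (\<lambda>h. (- \<i>) * (of_real (x \<bullet> h) * \<phi> x) * exp (- \<i> * complex_of_real (x \<bullet> y)))) (at y)" for x y
    proof -
      have 1: "((\<lambda>y. - \<i> * complex_of_real (x \<bullet> y)) has_derivative (\<lambda>h. - \<i> * complex_of_real (x \<bullet> h))) (at y)"
        by (intro has_derivative_mult_right has_derivative_of_real has_derivative_inner_right has_derivative_ident)
      have "((\<lambda>y. exp (- \<i> * complex_of_real (x \<bullet> y))) has_derivative (\<lambda>h. exp (- \<i> * complex_of_real (x \<bullet> y)) * (- \<i> * complex_of_real (x \<bullet> h)))) (at y)"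
        using has_derivative_compose[OF 1 DERIV_exp[unfolded has_field_derivative_def]] by simp
      from has_derivative_mult_right[OF this, of "\<phi> x"] show ?thesis by (simp add: mult_ac)
    qed
    show "norm (- \<i> * (of_real (x \<bullet> h) * \<phi> x) * exp (- \<i> * complex_of_real (x \<bullet> y))) \<le> norm x * norm (\<phi> x) * norm h" for x y h
    proof -
      have "norm (- \<i> * (of_real (x \<bullet> h) * \<phi> x) * exp (- \<i> * complex_of_real (x \<bullet> y))) = \<bar>x \<bullet> h\<bar> * norm (\<phi> x)"
        by (simp add: norm_mult)
      also have "... \<le> (norm x * norm h) * norm (\<phi> x)"
        by (intro mult_right_mono Cauchy_Schwarz_ineq2) auto
      finally show ?thesis by (simp add: mult_ac)
    qed
  qed (use int1 in auto)
  then show ?thesis unfolding fourier_def .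
qed

lemma fourier_of_derivative:
  fixes \<phi> :: "real ^ 'n => complex"
  assumes \<phi>: "schwartz \<phi>"
  shows "fourier (\<lambda>x. frechet_derivative \<phi> (at x) v) \<xi> = \<i> * of_real (v \<bullet> \<xi>) * fourier \<phi> \<xi>"
proof -
  let ?e = "\<lambda>x. exp (- \<i> * complex_of_real (x \<bullet> \<xi>))"
  have \<phi>': "schwartz (\<lambda>x. frechet_derivative \<phi> (at x) v)" by (rule schwartz_derivative[OF \<phi>])
  let ?u' = "\<lambda>x. frechet_derivative \<phi> (at x) v * ?e x + (- \<i> * of_real (v \<bullet> \<xi>)) * (\<phi> x * ?e x)"
  have int: "integrable lborel (\<lambda>x. frechet_derivative \<phi> (at x) v * ?e x)" "integrable lborel (\<lambda>x. \<phi> x * ?e x)"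
    by (intro integrable_fourier_integrand schwartz_integrable \<phi> \<phi>')+
  have "(LINT x|lborel. ?u' x) = 0"
  proof (rule integral_directional_derivative[where v=v and u="\<lambda>x. \<phi> x * ?e x"])
    show "integrable lborel (\<lambda>x. \<phi> x * ?e x)" by (rule int)
    show "integrable lborel ?u'" by (intro Bochner_Integration.integrable_add integrable_mult_right int)
    show "((\<lambda>t. \<phi> (x + t *\<^sub>R v) * ?e (x + t *\<^sub>R v)) has_vector_derivative ?u' x) (at 0)" for x
    proof -
      have "((\<lambda>t. x + t *\<^sub>R v) has_derivative (\<lambda>t. t *\<^sub>R v)) (at (0::real))"
        by (auto intro!: derivative_eq_intros)
      moreover have "(\<phi> has_derivative frechet_derivative \<phi> (at x)) (at (x + 0 *\<^sub>R v))"
        using schwartz_has_derivative[OF \<phi>] by simp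
      ultimately have "((\<lambda>t. \<phi> (x + t *\<^sub>R v)) has_derivative (\<lambda>t. frechet_derivative \<phi> (at x) (t *\<^sub>R v))) (at 0)"
        by (rule has_derivative_compose)
      moreover have "linear (frechet_derivative \<phi> (at x))"
        using schwartz_has_derivative[OF \<phi>] has_derivative_linear by blast
      ultimately have 1: "((\<lambda>t. \<phi> (x + t *\<^sub>R v)) has_vector_derivative frechet_derivative \<phi> (at x) v) (at 0)"
        by (simp add: has_vector_derivative_def linear_scale)
      have "((\<lambda>t. - \<i> * complex_of_real ((x + t *\<^sub>R v) \<bullet> \<xi>)) has_vector_derivative (- \<i> * of_real (v \<bullet> \<xi>))) (at 0)"
      proof -
        have "(\<lambda>t. - \<i> * complex_of_real ((x + t *\<^sub>R v) \<bullet> \<xi>)) = (\<lambda>t. - \<i> * of_real (x \<bullet> \<xi>) + t *\<^sub>R (- \<i> * of_real (v \<bullet> \<xi>)))"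
          by (auto simp: inner_add_left scaleR_conv_of_real[of _ "_ :: complex"] algebra_simps)
        then show ?thesis by (auto intro!: derivative_eq_intros)
      qed
      from field_vector_diff_chain_at[OF this DERIV_exp]
      have 2: "((\<lambda>t. ?e (x + t *\<^sub>R v)) has_vector_derivative (- \<i> * of_real (v \<bullet> \<xi>)) * ?e x) (at 0)"
        by (simp add: o_def)
      show ?thesis
        using has_vector_derivative_mult[OF 1 2] by (simp add: algebra_simps)
    qed
    have c1: "continuous_on UNIV ?u'"
      by (intro continuous_intros schwartz_continuous \<phi> \<phi>')
    show "continuous_on UNIV (\<lambda>t::real. ?u' (x + t *\<^sub>R v))" for x
      by (rule continuous_on_compose2[OF c1]) (auto intro!: continuous_intros)
  qed
  moreover have "(LINT x|lborel. ?u' x) = (LINT x|lborel. frechet_derivative \<phi> (at x) v * ?e x) + (- \<i> * of_real (v \<bullet> \<xi>)) * (LINT x|lborel. \<phi> x * ?e x)"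
    using int by (simp del: mult_minus_left)
  ultimately show ?thesis by (simp add: fourier_def algebra_simps)
qed

lemma fourier_decay:
  fixes \<phi> :: "real ^ 'n => complex"
  assumes "schwartz \<phi>" shows "\<exists>C. \<forall>\<xi>. norm \<xi> ^ m * norm (fourier \<phi> \<xi>) \<le> C"
  using assms
proof (induction m arbitrary: \<phi>)
  case 0
  then show ?case using norm_fourier_le[of \<phi>] by auto
next
  case (Suc m)
  have "\<forall>v. \<exists>C. \<forall>\<xi>. norm \<xi> ^ m * norm (fourier (\<lambda>x. frechet_derivative \<phi> (at x) v) \<xi>) \<le> C"
    using Suc.IH[OF schwartz_derivative[OF Suc.prems]] by blast
  then obtain C where C: "\<And>v \<xi>. norm \<xi> ^ m * norm (fourier (\<lambda>x. frechet_derivative \<phi> (at x) v) \<xi>) \<le> C v" by metis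
  have "norm \<xi> ^ Suc m * norm (fourier \<phi> \<xi>) \<le> (\<Sum>b\<in>Basis. C b)" for \<xi>
  proof -
    have "norm \<xi> ^ Suc m * norm (fourier \<phi> \<xi>) = norm \<xi> * (norm \<xi> ^ m * norm (fourier \<phi> \<xi>))" by simp
    also have "... \<le> (\<Sum>b\<in>Basis. \<bar>\<xi> \<bullet> b\<bar>) * (norm \<xi> ^ m * norm (fourier \<phi> \<xi>))"
      by (intro mult_right_mono norm_le_l1) auto
    also have "... = (\<Sum>b\<in>Basis. norm \<xi> ^ m * norm (fourier (\<lambda>x. frechet_derivative \<phi> (at x) b) \<xi>))"
      unfolding sum_distrib_right
      by (intro sum.cong refl) (simp add: fourier_of_derivative[OF Suc.prems] norm_mult inner_commute)
    also have "... \<le> (\<Sum>b\<in>Basis. C b)" by (intro sum_mono C)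
    finally show ?thesis .
  qed
  then show ?case by blast
qed

lemma schwartz_fourier:
  fixes \<phi> :: "real ^ 'n => complex"
  assumes "schwartz \<phi>" shows "schwartz (fourier \<phi>)"
proof (rule schwartz_coinduct[where P="\<lambda>f. \<exists>\<phi>. schwartz \<phi> \<and> f = fourier \<phi>"])
  show "\<exists>\<psi>. schwartz \<psi> \<and> fourier \<phi> = fourier \<psi>" using assms by blast
  fix f :: "real ^ 'n => complex" assume "\<exists>\<phi>. schwartz \<phi> \<and> f = fourier \<phi>"
  then obtain \<phi> where \<phi>: "schwartz \<phi>" "f = fourier \<phi>" by blast
  have d: "(f has_derivative (\<lambda>h. fourier (\<lambda>x. (- \<i>) * (of_real (x \<bullet> h) * \<phi> x)) \<xi>)) (at \<xi>)" for \<xi>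
    unfolding \<phi>(2) by (rule fourier_has_derivative[OF \<phi>(1)])
  have 1: "f differentiable_on UNIV"
    unfolding differentiable_on_def differentiable_def using has_derivative_at_withinI[OF d] by blast
  have 2: "\<forall>m. \<exists>C. \<forall>x. norm x ^ m * norm (f x) \<le> C" unfolding \<phi>(2) using fourier_decay[OF \<phi>(1)] by blast
  have 3: "\<exists>h. (\<exists>\<phi>. schwartz \<phi> \<and> h = fourier \<phi>) \<and> (\<forall>x. frechet_derivative f (at x) v = h x)" for v
  proof (intro exI conjI allI)
    show "schwartz (\<lambda>x. (- \<i>) * (of_real (x \<bullet> v) * \<phi> x))"
      by (rule schwartz_cmult[OF schwartz_linear_mult[OF \<phi>(1)]])
    show "fourier (\<lambda>x. (- \<i>) * (of_real (x \<bullet> v) * \<phi> x)) = fourier (\<lambda>x. (- \<i>) * (of_real (x \<bullet> v) * \<phi> x))" ..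
    show "frechet_derivative f (at x) v = fourier (\<lambda>x. (- \<i>) * (of_real (x \<bullet> v) * \<phi> x)) x" for x
      by (simp only: frechet_derivative_at[OF d, symmetric])
  qed
  show "f differentiable_on UNIV \<and> (\<forall>m. \<exists>C. \<forall>x. norm x ^ m * norm (f x) \<le> C) \<and>
      (\<forall>v. \<exists>h. (\<exists>\<phi>. schwartz \<phi> \<and> h = fourier \<phi>) \<and> (\<forall>x. frechet_derivative f (at x) v = h x))"
    using 1 2 3 by blast
qed

lemma fourier_multiplication:
  fixes \<phi> \<psi> :: "real ^ 'n => complex"
  assumes \<phi>: "integrable lborel \<phi>" and \<psi>: "integrable lborel \<psi>"
  shows "(LINT x|lborel. \<psi> x * fourier \<phi> (t *\<^sub>R x)) = (LINT x|lborel. fourier \<psi> (t *\<^sub>R x) * \<phi> x)"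
proof -
  have [measurable]: "\<phi> \<in> borel_measurable borel" "\<psi> \<in> borel_measurable borel" using assms by auto
  have prod: "integrable (lborel \<Otimes>\<^sub>M (lborel :: (real^'n) measure)) (\<lambda>p. \<psi> (fst p) * \<phi> (snd p))"
    by (rule integrable_times_pair(1)[OF _ _ \<psi> \<phi>]) (auto intro: sigma_finite_lborel)
  have int: "integrable (lborel \<Otimes>\<^sub>M (lborel :: (real^'n) measure)) (\<lambda>(x, y). \<psi> x * \<phi> y * exp (- \<i> * complex_of_real (t * (x \<bullet> y))))"
    by (rule Bochner_Integration.integrable_bound[OF prod]) (auto simp: norm_mult split_beta')
  have "(LINT x|lborel. \<psi> x * fourier \<phi> (t *\<^sub>R x)) = (LINT x|lborel. LINT y|lborel. \<psi> x * \<phi> y * exp (- \<i> * complex_of_real (t * (x \<bullet> y))))"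
    unfolding fourier_def by (intro Bochner_Integration.integral_cong refl) (simp add: mult.assoc inner_commute)
  also have "... = (LINT y|lborel. LINT x|lborel. \<psi> x * \<phi> y * exp (- \<i> * complex_of_real (t * (x \<bullet> y))))"
    by (rule lborel_pair.Fubini_integral[OF int, symmetric])
  also have "... = (LINT y|lborel. fourier \<psi> (t *\<^sub>R y) * \<phi> y)"
    unfolding fourier_def integral_mult_left_zero[symmetric]
    by (intro Bochner_Integration.integral_cong refl) (simp add: mult_ac)
  finally show ?thesis .
qed

lemma radial_gaussian_total:
  assumes "n > 0"
  shows "real n * unit_ball_vol (real n) * 2 powr (real n / 2 - 1) * Gamma (real n / 2) = (2 * pi) powr (real n / 2)"
proof -
  have G: "Gamma (real n / 2 + 1) = real n / 2 * Gamma (real n / 2)"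
    using assms by (intro Gamma_plus1) (auto simp: nonpos_Ints_def)
  have "Gamma (real n / 2) > 0" using assms by (intro Gamma_real_pos) auto
  then have "Gamma (real n / 2) \<noteq> 0" by linarith
  with assms show ?thesis
    unfolding unit_ball_vol_def G powr_diff by (simp add: powr_mult)
qed

lemma gauss_integral:
  "(LINT x|lborel. complex_of_real (exp (- ((norm (x::real^'n))\<^sup>2 / 2)))) = of_real ((2 * pi) powr (real CARD('n) / 2))"
proof -
  interpret S: prob_space "sphere_measure :: (real^'n) measure" by (rule prob_space_sphere_measure)
  have m: "(\<lambda>r::real. complex_of_real r powr 0 * of_real (exp (- (r\<^sup>2 / 2)))) \<in> borel_measurable borel" by measurable
  have "(LINT x|lborel. complex_of_real (exp (- ((norm (x::real^'n))\<^sup>2 / 2)))) =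
    (LINT r|radial_measure CARD('n). complex_of_real r powr 0 * of_real (exp (- (r\<^sup>2 / 2)))) * (LINT \<theta>|(sphere_measure :: (real^'n) measure). 1)"
  proof (rule integral_polar_product(2))
    show "integrable (radial_measure CARD('n)) (\<lambda>r::real. complex_of_real r powr 0 * of_real (exp (- (r\<^sup>2 / 2))))"
      by (rule radial_gaussian_mellin(1)) auto
  qed auto
  also have "... = of_real (real CARD('n) * unit_ball_vol (real CARD('n))) * 2 powr ((of_nat CARD('n) + 0) / 2 - 1) * Gamma ((of_nat CARD('n) + 0) / 2)"
    by (subst radial_gaussian_mellin(2)) (auto simp: S.prob_space)
  also have "... = of_real (real CARD('n) * unit_ball_vol (real CARD('n)) * 2 powr (real CARD('n) / 2 - 1) * Gamma (real CARD('n) / 2))"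
    using powr_of_real[of 2 "real CARD('n) / 2 - 1"] Gamma_complex_of_real[of "real CARD('n) / 2"] by simp
  also have "... = of_real ((2 * pi) powr (real CARD('n) / 2))" by (subst radial_gaussian_total) auto
  finally show ?thesis .
qed

lemma frechet_gauss:
  "frechet_derivative (\<lambda>x::real^'n. complex_of_real (exp (- ((norm x)\<^sup>2 / 2)))) (at x) v = - of_real (x \<bullet> v) * of_real (exp (- ((norm x)\<^sup>2 / 2)))"
  by (simp only: frechet_derivative_at[OF gauss_has_derivative, symmetric] of_real_minus)

text \<open>
  Both the Gaussian and its transform solve \<open>F' (h) = - (h \<bullet> y) F\<close>, the transform because
  derivatives and multiplication by coordinates are exchanged. So the quotient is constant, and its
  value at the origin is the total mass.
\<close>

lemma fourier_gauss:
  fixes \<xi> :: "real^'n"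
  shows "fourier (\<lambda>x. complex_of_real (exp (- ((norm x)\<^sup>2 / 2)))) \<xi> = of_real ((2 * pi) powr (real CARD('n) / 2) * exp (- ((norm \<xi>)\<^sup>2 / 2)))"
proof -
  let ?g = "\<lambda>x::real^'n. complex_of_real (exp (- ((norm x)\<^sup>2 / 2)))"
  have der: "(fourier ?g has_derivative (\<lambda>h. - of_real (h \<bullet> y) * fourier ?g y)) (at y)" for y
  proof -
    have "fourier (\<lambda>x. (- \<i>) * (of_real (x \<bullet> h) * ?g x)) y = - of_real (h \<bullet> y) * fourier ?g y" for h
    proof -
      have "fourier (\<lambda>x. (- \<i>) * (of_real (x \<bullet> h) * ?g x)) y = \<i> * fourier (\<lambda>x. frechet_derivative ?g (at x) h) y"
        unfolding frechet_gauss fourier_cmult[symmetric] by simp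
      also have "... = - of_real (h \<bullet> y) * fourier ?g y"
        by (simp add: fourier_of_derivative[OF schwartz_gauss] mult.assoc)
      finally show ?thesis .
    qed
    then show ?thesis using fourier_has_derivative[OF schwartz_gauss, of y] by simp
  qed
  have "(\<lambda>y. fourier ?g y * of_real (exp ((norm y)\<^sup>2 / 2))) \<xi> = (\<lambda>y. fourier ?g y * of_real (exp ((norm y)\<^sup>2 / 2))) 0"
  proof (rule has_derivative_zero_unique[of UNIV "\<lambda>y. fourier ?g y * of_real (exp ((norm y)\<^sup>2 / 2))" \<xi> 0])
    fix y :: "real^'n"
    have "((\<lambda>y. exp ((y \<bullet> y) / 2)) has_derivative (\<lambda>h. (h \<bullet> y) * exp ((y \<bullet> y) / 2))) (at y)"
      by (auto intro!: derivative_eq_intros simp: inner_commute algebra_simps)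
    from has_derivative_of_real[OF this, where 'a=complex]
    have "((\<lambda>y. complex_of_real (exp ((norm y)\<^sup>2 / 2))) has_derivative (\<lambda>h. of_real ((h \<bullet> y) * exp ((norm y)\<^sup>2 / 2)))) (at y)"
      by (simp only: power2_norm_eq_inner)
    from has_derivative_mult[OF der this]
    have "((\<lambda>y. fourier ?g y * of_real (exp ((norm y)\<^sup>2 / 2))) has_derivative (\<lambda>h. 0)) (at y)"
      by (rule has_derivative_eq_rhs) (simp add: algebra_simps)
    then show "((\<lambda>y. fourier ?g y * of_real (exp ((norm y)\<^sup>2 / 2))) has_derivative (\<lambda>h. 0)) (at y within UNIV)" by simp
  qed auto
  also have "... = of_real ((2 * pi) powr (real CARD('n) / 2))"
    using gauss_integral[where 'n='n] by (simp add: fourier_def)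
  finally have "fourier ?g \<xi> * of_real (exp ((norm \<xi>)\<^sup>2 / 2)) * of_real (exp (- ((norm \<xi>)\<^sup>2 / 2))) = of_real ((2 * pi) powr (real CARD('n) / 2) * exp (- ((norm \<xi>)\<^sup>2 / 2)))"
    by simp
  then show ?thesis by (simp add: mult.assoc of_real_mult[symmetric] exp_add[symmetric] del: of_real_mult)
qed

section \<open>Mellin transforms along rays\<close>

lemma lborel_integral_scale:
  fixes h :: "real ^ 'n => complex"
  assumes t: "t \<noteq> 0" and [measurable]: "h \<in> borel_measurable borel"
  shows "(LINT x|lborel. h x) = (\<bar>t\<bar> ^ CARD('n)) *\<^sub>R (LINT x|lborel. h (t *\<^sub>R x))"
proof -
  have "(LINT x|lborel. h x) = (LINT x|density (distr lborel borel (\<lambda>x::real^'n. 0 + t *\<^sub>R x)) (\<lambda>_. \<bar>t\<bar> ^ DIM(real^'n)). h x)"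
    using lborel_affine[OF t, of "0::real^'n"] by simp
  also have "... = (LINT x|distr lborel borel (\<lambda>x::real^'n. 0 + t *\<^sub>R x). (\<bar>t\<bar> ^ DIM(real^'n)) *\<^sub>R h x)"
    by (subst integral_density) auto
  also have "... = (\<bar>t\<bar> ^ CARD('n)) *\<^sub>R (LINT x|lborel. h (t *\<^sub>R x))"
    by (subst integral_distr) auto
  finally show ?thesis .
qed

text \<open>
  Integrable on the half-line for \<open>a > -1\<close>, and up to a constant a majorant of
  \<open>t powr a * norm (H (t \<xi>))\<close> that is uniform in \<open>\<xi>\<close> away from the origin.
\<close>

definition mellin_dom :: "real => real => real" where
  "mellin_dom a t = indicator {0..1} t * t powr a + indicator {1..} t * t powr (-2)"

lemma mellin_dom_integrable:
  assumes "a > -1" shows "integrable lborel (mellin_dom a)"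
proof -
  have "integrable lborel (\<lambda>t. indicator {0..1} t * t powr a)"
    using nn_integral_has_integral_lebesgue[OF _ has_integral_powr_from_0[OF assms, of 1]] assms
    by (intro integrableI_nonneg) auto
  moreover have "integrable lborel (\<lambda>t::real. indicator {1..} t * t powr (-2))"
    using nn_integral_has_integral_lebesgue[OF _ has_integral_powr_to_inf[of "-2" 1]]
    by (intro integrableI_nonneg) auto
  ultimately show ?thesis unfolding mellin_dom_def by auto
qed

lemma mellin_dom_nonneg: "mellin_dom a t \<ge> 0"
  by (simp add: mellin_dom_def)

lemma schwartz_mellin_bound:
  fixes H :: "real ^ 'n => complex"
  assumes H: "schwartz H" and \<delta>: "\<delta> > 0"
  shows "\<exists>C\<ge>0. \<forall>\<xi> t. norm \<xi> \<ge> \<delta> \<longrightarrow> t > 0 \<longrightarrow> t powr a * norm (H (t *\<^sub>R \<xi>)) \<le> C * mellin_dom a t"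
proof -
  obtain N :: nat where N: "real N \<ge> a + 2" using real_nat_ceiling_ge by blast
  obtain C0 where C0: "\<And>y. norm (H y) \<le> C0" using schwartz_bound[OF H, of 0] by auto
  obtain CN where CN: "\<And>y. norm y ^ N * norm (H y) \<le> CN" using schwartz_bound[OF H, of N] by auto
  have C0': "C0 \<ge> 0" using C0[of 0] norm_ge_zero order_trans by blast
  have CN': "CN \<ge> 0" using CN[of 0] order_trans[OF _ CN] by (meson mult_nonneg_nonneg norm_ge_zero zero_le_power)
  define C where "C = C0 + CN / \<delta> ^ N"
  have C1: "C \<ge> C0" "C \<ge> CN / \<delta> ^ N" "C \<ge> 0" using C0' CN' \<delta> by (auto simp: C_def)
  have "t powr a * norm (H (t *\<^sub>R \<xi>)) \<le> C * mellin_dom a t" if \<xi>: "norm \<xi> \<ge> \<delta>" and t: "t > 0" for \<xi> t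
  proof (cases "t \<le> 1")
    case True
    have "t powr a * norm (H (t *\<^sub>R \<xi>)) \<le> t powr a * C"
      using C0 C1(1) order_trans by (intro mult_left_mono) auto
    also have "... \<le> C * mellin_dom a t"
      using True t C1(3) by (simp add: mellin_dom_def mult.commute mult_left_mono)
    finally show ?thesis .
  next
    case False
    have "t ^ N * \<delta> ^ N * norm (H (t *\<^sub>R \<xi>)) \<le> norm (t *\<^sub>R \<xi>) ^ N * norm (H (t *\<^sub>R \<xi>))"
      using \<xi> t \<delta> by (intro mult_right_mono) (auto simp: power_mult_distrib intro!: mult_left_mono power_mono)
    also have "... \<le> CN" by (rule CN)
    finally have "norm (H (t *\<^sub>R \<xi>)) \<le> (CN / \<delta> ^ N) / t ^ N"
      using t \<delta> by (simp add: field_simps)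
    also have "... \<le> C / t ^ N" using C1 t by (intro divide_right_mono) auto
    finally have "t powr a * norm (H (t *\<^sub>R \<xi>)) \<le> t powr a * (C / t ^ N)" by (intro mult_left_mono) auto
    also have "... = C * t powr (a - real N)" using t by (simp add: powr_diff powr_realpow)
    also have "... \<le> C * t powr (-2)" using False N C1(3) by (intro mult_left_mono powr_mono) auto
    also have "... \<le> C * mellin_dom a t" using False C1(3) by (intro mult_left_mono) (auto simp: mellin_dom_def)
    finally show ?thesis .
  qed
  then show ?thesis using C1(3) by blast
qed

text \<open>
  Averaging over dilations with the weight \<open>t powr a\<close> makes any function homogeneous of degree
  \<open>- a - 1\<close>. Applied to a Schwartz function it produces all the homogeneous functions below.
\<close>

definition radial_mellin :: "real => (real ^ 'n => complex) => real ^ 'n => complex" where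
  "radial_mellin a H \<xi> = (LINT t|lborel. (indicator {0<..} t * t powr a) *\<^sub>R H (t *\<^sub>R \<xi>))"

lemma radial_mellin_integrable:
  fixes H :: "real ^ 'n => complex"
  assumes H: "schwartz H" and a: "a > -1" and \<xi>: "\<xi> \<noteq> 0"
  shows "integrable lborel (\<lambda>t. (indicator {0<..} t * t powr a) *\<^sub>R H (t *\<^sub>R \<xi>))"
proof -
  have [measurable]: "H \<in> borel_measurable borel" by (rule schwartz_measurable[OF H])
  obtain C where C: "C \<ge> 0" "\<And>y t. norm y \<ge> norm \<xi> ==> t > 0 ==> t powr a * norm (H (t *\<^sub>R y)) \<le> C * mellin_dom a t"
    using schwartz_mellin_bound[OF H, of "norm \<xi>" a] \<xi> by auto
  show ?thesis
  proof (rule Bochner_Integration.integrable_bound)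
    show "integrable lborel (\<lambda>t. C * mellin_dom a t)" using mellin_dom_integrable[OF a] by simp
    show "AE t in lborel. norm ((indicator {0<..} t * t powr a) *\<^sub>R H (t *\<^sub>R \<xi>)) \<le> norm (C * mellin_dom a t)"
      using C(2)[of \<xi>] C(1) by (auto intro!: AE_I2 simp: indicator_def mellin_dom_nonneg)
  qed measurable
qed

lemma linear_norm_le_sum_Basis:
  assumes "linear (D :: 'a::euclidean_space => 'b::real_normed_vector)"
  shows "norm (D h) \<le> norm h * (\<Sum>b\<in>Basis. norm (D b))"
proof -
  have "D h = (\<Sum>b\<in>Basis. (h \<bullet> b) *\<^sub>R D b)"
  proof -
    have "D h = D (\<Sum>b\<in>Basis. (h \<bullet> b) *\<^sub>R b)" by (simp only: euclidean_representation)
    also have "... = (\<Sum>b\<in>Basis. (h \<bullet> b) *\<^sub>R D b)"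
      by (simp only: linear_sum[OF assms] linear_scale[OF assms])
    finally show ?thesis .
  qed
  then have "norm (D h) \<le> (\<Sum>b\<in>Basis. norm ((h \<bullet> b) *\<^sub>R D b))" by (simp only: norm_sum)
  also have "... \<le> (\<Sum>b\<in>Basis. norm h * norm (D b))"
    by (intro sum_mono) (auto intro!: mult_right_mono Basis_le_norm)
  finally show ?thesis by (simp add: sum_distrib_left)
qed

text \<open>
  The derivative is again such a transform, of a derivative of \<open>H\<close> and with exponent \<open>a + 1\<close>; this
  closes the coinduction for smoothness off the origin.
\<close>

lemma radial_mellin_has_derivative:
  fixes H :: "real ^ 'n => complex"
  assumes H: "schwartz H" and a: "a > -1" and \<xi>: "\<xi> \<noteq> 0"
  shows "(radial_mellin a H has_derivative
    (\<lambda>v. radial_mellin (a + 1) (\<lambda>x. frechet_derivative H (at x) v) \<xi>)) (at \<xi>)"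
proof -
  have [measurable]: "H \<in> borel_measurable borel" by (rule schwartz_measurable[OF H])
  have H': "schwartz (\<lambda>x. frechet_derivative H (at x) v)" for v by (rule schwartz_derivative[OF H])
  have [measurable]: "(\<lambda>x. frechet_derivative H (at x) v) \<in> borel_measurable borel" for v by (rule schwartz_measurable[OF H'])
  define \<delta> where "\<delta> = norm \<xi> / 2"
  have \<delta>: "\<delta> > 0" using \<xi> by (simp add: \<delta>_def)
  have "\<forall>v. \<exists>C. C \<ge> 0 \<and> (\<forall>\<xi> t. norm \<xi> \<ge> \<delta> \<longrightarrow> t > 0 \<longrightarrow> t powr (a+1) * norm (frechet_derivative H (at (t *\<^sub>R \<xi>)) v) \<le> C * mellin_dom (a+1) t)"
    using schwartz_mellin_bound[OF H' \<delta>, of "a+1"] by blast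
  then obtain C where C: "\<And>v. C v \<ge> 0" "\<And>v \<xi> t. norm \<xi> \<ge> \<delta> ==> t > 0 ==> t powr (a+1) * norm (frechet_derivative H (at (t *\<^sub>R \<xi>)) v) \<le> C v * mellin_dom (a+1) t"
    by metis
  have far: "norm y \<ge> \<delta>" if "y \<in> ball \<xi> \<delta>" for y
    using that norm_triangle_ineq2[of \<xi> "\<xi> - y"] by (auto simp: dist_norm \<delta>_def)
  have "(radial_mellin a H has_derivative
    (\<lambda>v. LINT t|lborel. (indicator {0<..} t * t powr (a+1)) *\<^sub>R frechet_derivative H (at (t *\<^sub>R \<xi>)) v)) (at \<xi>)"
    unfolding radial_mellin_def
  proof (rule has_derivative_lebesgue_integral[where U="ball \<xi> \<delta>" and w="\<lambda>t. (\<Sum>b\<in>Basis. C b) * mellin_dom (a+1) t"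
      and f'="\<lambda>y t v. (indicator {0<..} t * t powr (a+1)) *\<^sub>R frechet_derivative H (at (t *\<^sub>R y)) v"])
    show "integrable lborel (\<lambda>t. (indicator {0<..} t * t powr a) *\<^sub>R H (t *\<^sub>R y))" if "y \<in> ball \<xi> \<delta>" for y
      using far[OF that] \<delta> by (intro radial_mellin_integrable H a) auto
    show "((\<lambda>y. (indicator {0<..} t * t powr a) *\<^sub>R H (t *\<^sub>R y)) has_derivative
       (\<lambda>v. (indicator {0<..} t * t powr (a+1)) *\<^sub>R frechet_derivative H (at (t *\<^sub>R y)) v)) (at y)" for y t
    proof (cases "t > 0")
      case True
      have "((\<lambda>y. t *\<^sub>R y) has_derivative (\<lambda>v. t *\<^sub>R v)) (at y)" by (auto intro!: derivative_eq_intros)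
      from has_derivative_compose[OF this schwartz_has_derivative[OF H]]
      have "((\<lambda>y. H (t *\<^sub>R y)) has_derivative (\<lambda>v. frechet_derivative H (at (t *\<^sub>R y)) (t *\<^sub>R v))) (at y)" .
      from has_derivative_scaleR_right[OF this, of "indicator {0<..} t * t powr a"]
      show ?thesis
        by (rule has_derivative_eq_rhs)
           (use True has_derivative_linear[OF schwartz_has_derivative[OF H]] in \<open>auto simp: linear_scale powr_add fun_eq_iff\<close>)
    qed simp
    show "norm ((indicator {0<..} t * t powr (a+1)) *\<^sub>R frechet_derivative H (at (t *\<^sub>R y)) h) \<le> (\<Sum>b\<in>Basis. C b) * mellin_dom (a+1) t * norm h"
      if y: "y \<in> ball \<xi> \<delta>" for y t h
    proof (cases "t > 0")
      case True
      have "t powr (a+1) * norm (frechet_derivative H (at (t *\<^sub>R y)) h)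
        \<le> t powr (a+1) * (norm h * (\<Sum>b\<in>Basis. norm (frechet_derivative H (at (t *\<^sub>R y)) b)))"
        by (intro mult_left_mono linear_norm_le_sum_Basis has_derivative_linear[OF schwartz_has_derivative[OF H]]) auto
      also have "... = norm h * (\<Sum>b\<in>Basis. t powr (a+1) * norm (frechet_derivative H (at (t *\<^sub>R y)) b))"
        by (simp add: sum_distrib_left mult_ac)
      also have "... \<le> norm h * (\<Sum>b\<in>Basis. C b * mellin_dom (a+1) t)"
        by (intro mult_left_mono sum_mono C far y True) auto
      finally show ?thesis using True by (simp add: sum_distrib_right mult_ac)
    qed (auto simp: mellin_dom_nonneg sum_nonneg C)
    show "integrable lborel (\<lambda>t. (\<Sum>b\<in>Basis. C b) * mellin_dom (a+1) t)"
      using mellin_dom_integrable[of "a+1"] a by simp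
  qed (use \<delta> in auto)
  then show ?thesis unfolding radial_mellin_def .
qed

lemma radial_mellin_smooth:
  fixes H :: "real ^ 'n => complex"
  assumes "schwartz H" "a > -1"
  shows "smooth_on (- {0}) (radial_mellin a H)"
proof (rule smooth_on_coinduct[where P="\<lambda>f. \<exists>a H. a > -1 \<and> schwartz H \<and> f = radial_mellin a H"])
  fix f :: "real ^ 'n => complex" assume "\<exists>a H. a > -1 \<and> schwartz H \<and> f = radial_mellin a H"
  then obtain a H where f: "a > -1" "schwartz H" "f = radial_mellin a H" by blast
  have d: "(f has_derivative (\<lambda>v. radial_mellin (a + 1) (\<lambda>x. frechet_derivative H (at x) v) \<xi>)) (at \<xi>)" if "\<xi> \<in> - {0}" for \<xi>
    unfolding f(3) using that by (intro radial_mellin_has_derivative f) auto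
  show "f differentiable_on - {0} \<and> (\<forall>v. \<exists>h. (\<exists>a H. a > -1 \<and> schwartz H \<and> h = radial_mellin a H) \<and> (\<forall>x\<in>- {0}. frechet_derivative f (at x) v = h x))"
  proof (intro conjI allI)
    show "f differentiable_on - {0}"
      unfolding differentiable_on_def differentiable_def using has_derivative_at_withinI[OF d] by blast
    fix v
    show "\<exists>h. (\<exists>a H. a > -1 \<and> schwartz H \<and> h = radial_mellin a H) \<and> (\<forall>x\<in>- {0}. frechet_derivative f (at x) v = h x)"
    proof (intro exI conjI ballI)
      show "a + 1 > -1" using f by simp
      show "schwartz (\<lambda>x. frechet_derivative H (at x) v)" by (rule schwartz_derivative[OF f(2)])
      show "radial_mellin (a+1) (\<lambda>x. frechet_derivative H (at x) v) = radial_mellin (a+1) (\<lambda>x. frechet_derivative H (at x) v)" ..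
      show "frechet_derivative f (at x) v = radial_mellin (a+1) (\<lambda>x. frechet_derivative H (at x) v) x" if "x \<in> - {0}" for x
        by (simp only: frechet_derivative_at[OF d[OF that], symmetric])
    qed
  qed
qed (use assms in auto)

lemma mellin_scale:
  fixes f :: "real => 'b::{banach,second_countable_topology}"
  assumes s: "s > 0"
  shows "(LINT t|lborel. (indicator {0<..} t * t powr a) *\<^sub>R f (s * t)) = (s powr (- a - 1)) *\<^sub>R (LINT t|lborel. (indicator {0<..} t * t powr a) *\<^sub>R f t)"
proof -
  have "(LINT t|lborel. (indicator {0<..} t * t powr a) *\<^sub>R f t) = \<bar>s\<bar> *\<^sub>R (LINT t|lborel. (indicator {0<..} (0 + s * t) * (0 + s * t) powr a) *\<^sub>R f (0 + s * t))"
    using s by (intro lborel_integral_real_affine) auto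
  also have "... = \<bar>s\<bar> *\<^sub>R (LINT t|lborel. s powr a *\<^sub>R ((indicator {0<..} t * t powr a) *\<^sub>R f (s * t)))"
    using s by (intro arg_cong[where f="\<lambda>x. \<bar>s\<bar> *\<^sub>R x"] Bochner_Integration.integral_cong refl) (auto simp: indicator_def powr_mult zero_less_mult_iff)
  also have "... = \<bar>s\<bar> *\<^sub>R (s powr a *\<^sub>R (LINT t|lborel. (indicator {0<..} t * t powr a) *\<^sub>R f (s * t)))"
    by (simp only: integral_scaleR_right)
  also have "... = (s powr (a + 1)) *\<^sub>R (LINT t|lborel. (indicator {0<..} t * t powr a) *\<^sub>R f (s * t))"
    using s by (simp add: powr_add mult.commute)
  finally show ?thesis using s by (simp add: powr_add[symmetric])
qed

lemma radial_mellin_homogeneous: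
  fixes H :: "real ^ 'n => complex"
  shows "homogeneous (- a - 1) (radial_mellin a H)"
  unfolding homogeneous_def radial_mellin_def
proof (intro allI impI)
  fix s :: real and x :: "real^'n" assume "s > 0" "x \<noteq> 0"
  then show "(LINT t|lborel. (indicator {0<..} t * t powr a) *\<^sub>R H (t *\<^sub>R s *\<^sub>R x)) = complex_of_real (s powr (- a - 1)) * (LINT t|lborel. (indicator {0<..} t * t powr a) *\<^sub>R H (t *\<^sub>R x))"
    using mellin_scale[of s a "\<lambda>t. H (t *\<^sub>R x)"] by (simp add: scaleR_conv_of_real[of _ "_::complex"] mult.commute)
qed

section \<open>Continuous functions are determined by their distributions\<close>

lemma smooth_on_bump: "smooth_on UNIV (\<lambda>x::real^'n. complex_of_real (flat_exp (r - (norm (x - x0))\<^sup>2)))"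
proof (rule smooth_on_of_real[OF open_UNIV], rule smooth_on_compose_real[OF open_UNIV open_UNIV _ _ smooth_on_flat_exp])
  have "(\<lambda>x::real^'n. r - (norm (x - x0))\<^sup>2) = (\<lambda>x. (r - (norm x0)\<^sup>2) - ((norm x)\<^sup>2 - 2 * (x \<bullet> x0)))"
    by (auto simp: power2_norm_eq_inner inner_diff_left inner_diff_right inner_commute algebra_simps)
  moreover have "smooth_on UNIV (\<lambda>x::real^'n. (r - (norm x0)\<^sup>2) - ((norm x)\<^sup>2 - 2 * (x \<bullet> x0)))"
    by (intro smooth_on_minus smooth_on_const smooth_on_norm_square smooth_on_mult smooth_on_inner open_UNIV)
  ultimately show "smooth_on UNIV (\<lambda>x::real^'n. r - (norm (x - x0))\<^sup>2)" by simp
qed auto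

lemma schwartz_bump: "schwartz (\<lambda>x::real^'n. complex_of_real (flat_exp (r\<^sup>2 - (norm (x - x0))\<^sup>2)))"
proof (rule schwartz_compact_support[OF smooth_on_bump, where R="norm x0 + \<bar>r\<bar>"])
  fix x :: "real^'n" assume "norm x0 + \<bar>r\<bar> < norm x"
  then have "\<bar>r\<bar> \<le> norm (x - x0)" using norm_triangle_ineq2[of x x0] by linarith
  then have "r\<^sup>2 \<le> (norm (x - x0))\<^sup>2" by (metis abs_norm_cancel abs_le_square_iff)
  then show "complex_of_real (flat_exp (r\<^sup>2 - (norm (x - x0))\<^sup>2)) = 0" by (simp add: flat_exp_eq_0_iff)
qed

text \<open>
  At a point where the functions differ, rotate the difference by a constant phase so that its
  real part is positive on a small ball, and test with a bump supported in that ball.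
\<close>

lemma continuous_functions_distribution_eq:
  fixes g1 g2 :: "real ^ 'n => complex"
  assumes c: "continuous_on (- {0}) g1" "continuous_on (- {0}) g2"
    and eq: "\<And>\<phi>. schwartz \<phi> ==> distribution_of g1 \<phi> = distribution_of g2 \<phi>"
    and x0: "x0 \<noteq> 0"
  shows "g1 x0 = g2 x0"
proof (rule ccontr)
  assume ne: "g1 x0 \<noteq> g2 x0"
  define d where "d x = g1 x - g2 x" for x
  define e where "e = cnj (d x0)"
  define R where "R x = Re (e * d x)" for x
  have cd: "continuous_on (- {0}) R" unfolding R_def d_def by (intro continuous_intros c)
  have "R x0 = (cmod (d x0))\<^sup>2" unfolding R_def e_def cmod_power2 by (simp add: power2_eq_square)
  then have pos: "R x0 > 0" using ne by (simp add: d_def)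
  have "open (- {0} \<inter> R -` {0<..})"
    by (rule continuous_open_preimage[OF cd]) auto
  then obtain r where r: "r > 0" "cball x0 r \<subseteq> - {0} \<inter> R -` {0<..}"
    using pos x0 open_contains_cball[THEN iffD1, rule_format, of "- {0} \<inter> R -` {0<..}" x0] by blast
  have sub: "cball x0 r \<subseteq> - {0}" and Rpos: "\<And>x. x \<in> cball x0 r ==> R x > 0" using r(2) by auto
  define \<phi> where "\<phi> x = flat_exp (r\<^sup>2 - (norm (x - x0))\<^sup>2)" for x :: "real^'n"
  have \<phi>0: "\<phi> x = 0 \<longleftrightarrow> x \<notin> ball x0 r" "\<phi> x \<ge> 0" "\<phi> x \<le> 1" for x
    using r(1) abs_le_square_iff[of r "norm (x - x0)"]
    by (auto simp: \<phi>_def flat_exp_eq_0_iff flat_exp_nonneg flat_exp_le_1 dist_norm norm_minus_commute not_less)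
  have sch: "schwartz (\<lambda>x. complex_of_real (\<phi> x))" unfolding \<phi>_def by (rule schwartz_bump)
  have int: "integrable lborel (\<lambda>x. g x * complex_of_real (\<phi> x))" if g: "continuous_on (- {0}) g" for g
  proof -
    have cg: "continuous_on (cball x0 r) (\<lambda>x. g x * complex_of_real (\<phi> x))"
      by (rule continuous_on_mult[OF continuous_on_subset[OF g sub] continuous_on_subset[OF schwartz_continuous[OF sch]]]) simp
    have "integrable lborel (\<lambda>x. indicator (cball x0 r) x *\<^sub>R (g x * complex_of_real (\<phi> x)))"
      by (rule borel_integrable_compact[OF compact_cball cg])
    moreover have "(\<lambda>x. indicator (cball x0 r) x *\<^sub>R (g x * complex_of_real (\<phi> x))) = (\<lambda>x. g x * complex_of_real (\<phi> x))"
      using \<phi>0(1) by (auto simp: indicator_def fun_eq_iff)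
    ultimately show ?thesis by simp
  qed
  have int_d: "integrable lborel (\<lambda>x. e * (d x * complex_of_real (\<phi> x)))"
    unfolding d_def left_diff_distrib by (intro integrable_mult_right Bochner_Integration.integrable_diff int c)
  have "(LINT x|lborel. d x * complex_of_real (\<phi> x)) = 0"
    unfolding d_def left_diff_distrib using eq[OF sch] int[OF c(1)] int[OF c(2)] by (simp add: distribution_of_def)
  then have "(LINT x|lborel. e * (d x * complex_of_real (\<phi> x))) = 0" by simp
  then have z: "(LINT x|lborel. Re (e * (d x * complex_of_real (\<phi> x)))) = 0"
    unfolding integral_Re[OF int_d] by (simp only: zero_complex.simps)
  have eqR: "Re (e * (d x * complex_of_real (\<phi> x))) = R x * \<phi> x" for x
    by (simp add: R_def algebra_simps)
  have iR: "integrable lborel (\<lambda>x. R x * \<phi> x)"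
    using integrable_Re[OF int_d] unfolding eqR .
  have nn: "R x * \<phi> x \<ge> 0" for x
  proof (cases "x \<in> ball x0 r")
    case True
    then have "R x > 0" by (intro Rpos) simp
    then show ?thesis using \<phi>0 by simp
  next
    case False
    then have "\<phi> x = 0" using \<phi>0(1) by blast
    then show ?thesis by simp
  qed
  have "AE x in lborel. R x * \<phi> x = 0"
    using integral_nonneg_eq_0_iff_AE[OF iR] nn z unfolding eqR by simp
  then have "AE x in lborel. x \<notin> ball x0 r"
  proof eventually_elim
    case (elim x)
    show ?case
    proof
      assume x: "x \<in> ball x0 r"
      then have "R x > 0" by (intro Rpos) simp
      then show False using elim \<phi>0(1)[of x] x by simp
    qed
  qed
  then have "emeasure lborel (ball x0 r) = 0"
    by (subst (asm) AE_iff_measurable[OF _ refl]) (auto simp: ball_def)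
  moreover have "unit_ball_vol (real CARD('n)) * r ^ CARD('n) > 0" using r(1) by (intro mult_pos_pos) auto
  ultimately show False using r(1) by (subst (asm) emeasure_ball) (auto simp: ennreal_eq_0_iff not_le)
qed

section \<open>The Fourier transform of a homogeneous function\<close>

lemma smooth_on_sphere_annulus:
  fixes g :: "real ^ 'n => complex"
  assumes g: "smooth_on_sphere g"
  shows "schwartz (\<lambda>x. complex_of_real (flat_exp ((norm x)\<^sup>2 - 1) * flat_exp (4 - (norm x)\<^sup>2)) * g (x /\<^sub>R norm x))"
    (is "schwartz ?G")
proof (rule schwartz_compact_support[where R=2])
  have o: "open (- {0::real^'n})" by auto
  have q1: "smooth_on (- {0}) (\<lambda>x::real^'n. flat_exp ((norm x)\<^sup>2 - 1))"
    by (rule smooth_on_compose_real[OF o open_UNIV _ _ smooth_on_flat_exp])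
       (auto intro!: smooth_on_minus smooth_on_norm_square smooth_on_const o)
  have q2: "smooth_on (- {0}) (\<lambda>x::real^'n. flat_exp (4 - (norm x)\<^sup>2))"
    by (rule smooth_on_compose_real[OF o open_UNIV _ _ smooth_on_flat_exp])
       (auto intro!: smooth_on_minus smooth_on_norm_square smooth_on_const o)
  have 1: "smooth_on (- {0}) ?G"
    using g unfolding smooth_on_sphere_def by (intro smooth_on_mult smooth_on_of_real q1 q2 o)
  have 2: "smooth_on (ball 0 1) ?G"
  proof (rule smooth_on_cong_open[OF open_ball _ smooth_on_const[OF open_ball]])
    fix x :: "real^'n" assume "x \<in> ball 0 1"
    then have "(norm x)\<^sup>2 \<le> 1" by (simp add: power_le_one)
    then have "flat_exp ((norm x)\<^sup>2 - 1) = 0" by (simp add: flat_exp_eq_0_iff)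
    then show "0 = ?G x" by simp
  qed
  have "- {0} \<union> ball 0 1 = (UNIV :: (real^'n) set)" by auto
  then show "smooth_on UNIV ?G" using smooth_on_Un[OF o open_ball 1 2] by simp
  fix x :: "real^'n" assume "2 < norm x"
  then have "2\<^sup>2 < (norm x)\<^sup>2" by (intro power_strict_mono) auto
  then have "flat_exp (4 - (norm x)\<^sup>2) = 0" by (simp add: flat_exp_eq_0_iff)
  then show "?G x = 0" by simp
qed

definition bump_profile :: "real => real" where
  "bump_profile t = flat_exp (t - 1) * flat_exp (4 - t)"

lemma bump_profile_nonneg: "bump_profile t \<ge> 0"
  by (simp add: bump_profile_def flat_exp_nonneg)

lemma bump_profile_eq_0: "bump_profile t = 0 \<longleftrightarrow> t \<le> 1 \<or> t \<ge> 4"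
  by (auto simp: bump_profile_def flat_exp_eq_0_iff)

lemma continuous_bump_profile: "continuous_on S bump_profile"
proof -
  have "continuous_on UNIV flat_exp" by (rule smooth_on_continuous[OF smooth_on_flat_exp])
  then have c: "continuous_on s (\<lambda>x. flat_exp (f x))" if "continuous_on s f" for s and f :: "real => real"
    using that by (rule continuous_on_compose2) auto
  show ?thesis unfolding bump_profile_def
    by (intro continuous_on_mult c continuous_on_diff continuous_on_const continuous_on_id)
qed

lemma measurable_bump_profile[measurable]: "bump_profile \<in> borel_measurable borel"
  by (intro borel_measurable_continuous_onI continuous_bump_profile)

text \<open>
  The constant by which the dilation average of the annulus cutoff differs from a pure power of the
  norm.
\<close>

definition bump_moment :: "real => real" where
  "bump_moment a = (LINT t|lborel. (indicator {0<..} t * t powr a) *\<^sub>R bump_profile (1 / t\<^sup>2))"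

lemma bump_profile_inv_eq_0:
  assumes "r > 0" "t > 0" "t \<notin> {r/2..r}" shows "bump_profile (r\<^sup>2 / t\<^sup>2) = 0"
proof -
  consider "t < r / 2" | "t > r" using assms by fastforce
  then show ?thesis
  proof cases
    case 1
    then have "(2 * t)\<^sup>2 \<le> r\<^sup>2" using assms by (intro power_mono) auto
    then show ?thesis using assms by (simp add: bump_profile_eq_0 field_simps power2_eq_square)
  next
    case 2
    then have "r\<^sup>2 \<le> t\<^sup>2" using assms by (intro power_mono) auto
    then show ?thesis using assms by (simp add: bump_profile_eq_0 field_simps)
  qed
qed

lemma bump_moment_integrable:
  assumes r: "r > 0"
  shows "integrable lborel (\<lambda>t. (indicator {0<..} t * t powr a) *\<^sub>R bump_profile (r\<^sup>2 / t\<^sup>2))"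
proof -
  have "continuous_on {r/2..r} (\<lambda>t. t powr a * bump_profile (r\<^sup>2 / t\<^sup>2))"
    using r by (intro continuous_intros continuous_on_compose2[OF continuous_bump_profile[of UNIV]]) auto
  then have "integrable lborel (\<lambda>t. indicator {r/2..r} t *\<^sub>R (t powr a * bump_profile (r\<^sup>2 / t\<^sup>2)))"
    by (intro borel_integrable_compact) auto
  moreover have "(\<lambda>t. indicator {r/2..r} t *\<^sub>R (t powr a * bump_profile (r\<^sup>2 / t\<^sup>2))) = (\<lambda>t. (indicator {0<..} t * t powr a) *\<^sub>R bump_profile (r\<^sup>2 / t\<^sup>2))"
  proof
    fix t show "indicator {r/2..r} t *\<^sub>R (t powr a * bump_profile (r\<^sup>2 / t\<^sup>2)) = (indicator {0<..} t * t powr a) *\<^sub>R bump_profile (r\<^sup>2 / t\<^sup>2)"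
      using r bump_profile_inv_eq_0[OF r, of t] by (cases "t > 0"; cases "t \<in> {r/2..r}") (auto simp: indicator_def)
  qed
  ultimately show ?thesis by simp
qed

lemma bump_moment_scale:
  assumes r: "r > 0"
  shows "(LINT t|lborel. (indicator {0<..} t * t powr a) *\<^sub>R bump_profile (r\<^sup>2 / t\<^sup>2)) = r powr (a + 1) * bump_moment a"
proof -
  have "(LINT t|lborel. (indicator {0<..} t * t powr a) *\<^sub>R bump_profile (1 / ((1 / r) * t)\<^sup>2)) = ((1 / r) powr (- a - 1)) *\<^sub>R bump_moment a"
    unfolding bump_moment_def using r by (intro mellin_scale) auto
  moreover have "(1 / r) powr (- a - 1) = r powr (a + 1)"
  proof -
    have "(1 / r) powr (- a - 1) = (r powr (- 1)) powr (- a - 1)" using r by (simp add: powr_minus divide_inverse)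
    also have "... = r powr (a + 1)" by (subst powr_powr) (simp add: algebra_simps)
    finally show ?thesis .
  qed
  ultimately show ?thesis by (simp add: power_divide power_mult_distrib)
qed

lemma bump_moment_pos: "bump_moment a > 0"
proof -
  let ?f = "\<lambda>t::real. (indicator {0<..} t * t powr a) *\<^sub>R bump_profile (1 / t\<^sup>2)"
  have i: "integrable lborel ?f" using bump_moment_integrable[of 1 a] by simp
  have nn: "?f t \<ge> 0" for t by (simp add: bump_profile_nonneg)
  have "bump_moment a \<ge> 0" unfolding bump_moment_def using nn by (intro integral_nonneg_AE) auto
  moreover have "bump_moment a \<noteq> 0"
  proof
    assume "bump_moment a = 0"
    then have "AE t in lborel. ?f t = 0" using integral_nonneg_eq_0_iff_AE[OF i] nn by (simp add: bump_moment_def)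
    then have "AE t in lborel. t \<notin> {1/2<..<1::real}"
    proof eventually_elim
      case (elim t)
      show ?case
      proof
        assume t: "t \<in> {1/2<..<1::real}"
        have "t\<^sup>2 < 1" using t by (simp add: power_less_one_iff)
        moreover have "(1/2)\<^sup>2 < t\<^sup>2" using t by (intro power_strict_mono) auto
        ultimately have "\<not> (1 / t\<^sup>2 \<le> 1 \<or> 1 / t\<^sup>2 \<ge> 4)" using t by (auto simp: field_simps power2_eq_square)
        then have "bump_profile (1 / t\<^sup>2) \<noteq> 0" using bump_profile_eq_0 by blast
        then show False using elim t by simp
      qed
    qed
    then have "emeasure lborel {1/2<..<1::real} = 0"
      by (subst (asm) AE_iff_measurable[OF _ refl]) (auto simp: greaterThanLessThan_def greaterThan_def lessThan_def Int_def)
    then show False by simp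
  qed
  ultimately show ?thesis by simp
qed

lemma smooth_on_sphere_continuous:
  assumes "smooth_on_sphere g" shows "continuous_on (- {0}) (\<lambda>x. g (x /\<^sub>R norm x))"
  using assms unfolding smooth_on_sphere_def by (rule smooth_on_continuous)

lemma continuous_punctured_measurable:
  fixes h :: "real ^ 'n => complex"
  assumes "continuous_on (- {0}) h"
  shows "(\<lambda>x. if x = 0 then 0 else h x) \<in> borel_measurable borel"
proof -
  have "(\<lambda>x. indicator (- {0}) x *\<^sub>R h x) \<in> borel_measurable borel"
    by (rule borel_measurable_continuous_on_indicator[OF _ assms]) auto
  moreover have "(\<lambda>x. indicator (- {0}) x *\<^sub>R h x) = (\<lambda>x. if x = 0 then 0 else h x)" by (auto simp: indicator_def)
  ultimately show ?thesis by simp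
qed

lemma continuous_sphere_bounded:
  fixes g :: "real ^ 'n => complex"
  assumes "continuous_on (- {0}) (\<lambda>x. g (x /\<^sub>R norm x))"
  obtains B where "B \<ge> 0" "\<And>x. x \<noteq> 0 ==> norm (g (x /\<^sub>R norm x)) \<le> B"
proof -
  have "continuous_on (sphere 0 1) (\<lambda>x. g (x /\<^sub>R norm x))" by (rule continuous_on_subset[OF assms]) auto
  then have "compact ((\<lambda>x. g (x /\<^sub>R norm x)) ` sphere 0 1)" by (intro compact_continuous_image) auto
  then obtain B where B: "\<forall>y\<in>(\<lambda>x. g (x /\<^sub>R norm x)) ` sphere 0 1. norm y \<le> B"
    using compact_imp_bounded bounded_iff by blast
  have "norm (g (x /\<^sub>R norm x)) \<le> \<bar>B\<bar>" if "x \<noteq> 0" for x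
  proof -
    have "x /\<^sub>R norm x \<in> sphere 0 1" using that by simp
    then have "norm (g ((x /\<^sub>R norm x) /\<^sub>R norm (x /\<^sub>R norm x))) \<le> B" using B by blast
    then show ?thesis using that by simp
  qed
  then show ?thesis by (intro that[of "\<bar>B\<bar>"]) auto
qed

definition Ip_const :: "nat => real => real" where
  "Ip_const n p = Gamma ((n - p) / 2) / (2 powr p * pi powr (n / 2) * Gamma (p / 2))"

lemma Ip_kernel_eq:
  fixes g :: "real ^ 'n => complex"
  shows "Ip_kernel p g x = of_real (Ip_const CARD('n) p * norm x powr (p - CARD('n))) * g (x /\<^sub>R norm x)"
  by (simp add: Ip_kernel_def Ip_const_def Let_def)

text \<open>
  A Schwartz function whose dilation average is \<open>g (x / \<bar>x\<bar>)\<close> times a power of \<open>\<bar>x\<bar>\<close>.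
\<close>

definition annulus_cutoff :: "(real ^ 'n => complex) => real ^ 'n => complex" where
  "annulus_cutoff g x = complex_of_real (bump_profile ((norm x)\<^sup>2)) * g (x /\<^sub>R norm x)"

lemma schwartz_annulus_cutoff: "smooth_on_sphere g ==> schwartz (annulus_cutoff g)"
  unfolding annulus_cutoff_def bump_profile_def by (rule smooth_on_sphere_annulus)

text \<open>
  The homogeneous kernel is the average of the dilates \<open>G (x / t)\<close> of one Schwartz function \<open>G\<close>. The
  Fourier transform can be taken under the average, where it is classical, and the scaling of the
  transform turns the average of \<open>G (x / t)\<close> into an average of \<open>fourier G (t \<xi>)\<close>. So the transform
  is again a dilation average, which is homogeneous and smooth off the origin.
\<close>

lemma distribution_fourier_Ip_kernel:
  fixes g :: "real ^ 'n => complex"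
  assumes p: "0 < p" "p < real CARD('n)" and g: "smooth_on_sphere g" and \<phi>: "schwartz \<phi>"
  shows "distribution_fourier (distribution_of (Ip_kernel p g)) \<phi> =
    (LINT \<xi>|lborel. (of_real (Ip_const CARD('n) p / bump_moment (p - CARD('n) - 1)) * radial_mellin (p - 1) (fourier (annulus_cutoff g)) \<xi>) * \<phi> \<xi>)"
proof -
  define G where "G = annulus_cutoff g"
  define n where "n = real CARD('n)"
  define c where "c = bump_moment (p - n - 1)"
  define A where "A = Ip_const CARD('n) p"
  define F where "F = fourier \<phi>"
  define k where "k t = indicator {0<..} t * t powr (p - n - 1)" for t :: real
  let ?K = "\<lambda>x t. k t *\<^sub>R G ((1 / t) *\<^sub>R x)"
  let ?M = "\<lambda>\<xi> t. (indicator {0<..} t * t powr (p - 1)) *\<^sub>R fourier G (t *\<^sub>R \<xi>)"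
  have c: "c > 0" unfolding c_def by (rule bump_moment_pos)
  have G: "schwartz G" unfolding G_def by (rule schwartz_annulus_cutoff[OF g])
  have F: "schwartz F" unfolding F_def by (rule schwartz_fourier[OF \<phi>])
  have [measurable]: "G \<in> borel_measurable borel" "F \<in> borel_measurable borel" "\<phi> \<in> borel_measurable borel"
    using G F \<phi> by (auto intro: schwartz_measurable)
  have [measurable]: "k \<in> borel_measurable borel" unfolding k_def by measurable
  define gs where "gs x = (if x = 0 then 0 else g (x /\<^sub>R norm x))" for x :: "real^'n"
  have [measurable]: "gs \<in> borel_measurable borel"
    unfolding gs_def by (rule continuous_punctured_measurable[OF smooth_on_sphere_continuous[OF g]])
  obtain B where B: "B \<ge> 0" "\<And>x. x \<noteq> 0 ==> norm (g (x /\<^sub>R norm x)) \<le> B"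
    using continuous_sphere_bounded[OF smooth_on_sphere_continuous[OF g]] by blast
  have Gt: "?K x t = ((k t) *\<^sub>R bump_profile ((norm x)\<^sup>2 / t\<^sup>2)) *\<^sub>R gs x" for t x
  proof (cases "t > 0 \<and> x \<noteq> 0")
    case True
    have nt: "norm ((1 / t) *\<^sub>R x) = norm x / t" using True by simp
    have "inverse (norm x / t) * (1 / t) = inverse (norm x)" using True by (simp add: field_simps)
    then have dir: "((1 / t) *\<^sub>R x) /\<^sub>R norm ((1 / t) *\<^sub>R x) = x /\<^sub>R norm x" by (simp only: nt scaleR_scaleR)
    show ?thesis
      unfolding G_def annulus_cutoff_def dir unfolding nt gs_def power_divide
      using True by (simp add: scaleR_conv_of_real[of _ "_::complex"])
  next
    case False
    have "bump_profile 0 = 0" by (simp add: bump_profile_eq_0)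
    then show ?thesis using False by (auto simp: k_def G_def annulus_cutoff_def)
  qed
  have intk: "integrable lborel (\<lambda>t. k t *\<^sub>R bump_profile ((norm x)\<^sup>2 / t\<^sup>2))"
    and valk: "(LINT t|lborel. k t *\<^sub>R bump_profile ((norm x)\<^sup>2 / t\<^sup>2)) = norm x powr (p - n) * c" if "x \<noteq> 0" for x :: "real^'n"
    using bump_moment_integrable[of "norm x" "p - n - 1"] bump_moment_scale[of "norm x" "p - n - 1"] that
    by (simp_all add: k_def c_def)
  have intk': "integrable lborel (\<lambda>t. ?K x t)" for x
    unfolding Gt using intk[of x] by (cases "x = 0") (auto simp: gs_def)
  have valG: "(LINT t|lborel. ?K x t) = of_real (norm x powr (p - n) * c) * gs x" for x
  proof (cases "x = 0")
    case False
    have "(LINT t|lborel. (k t *\<^sub>R bump_profile ((norm x)\<^sup>2 / t\<^sup>2)) *\<^sub>R gs x) = (LINT t|lborel. k t *\<^sub>R bump_profile ((norm x)\<^sup>2 / t\<^sup>2)) *\<^sub>R gs x"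
      by (rule integral_scaleR_left) (rule intk[OF False])
    then show ?thesis unfolding Gt valk[OF False] by (simp only: scaleR_conv_of_real)
  qed (simp only: Gt, simp add: gs_def)
  have valN: "(LINT t|lborel. norm (?K x t)) = norm x powr (p - n) * c * norm (gs x)" for x
  proof -
    have "norm (?K x t) = (k t *\<^sub>R bump_profile ((norm x)\<^sup>2 / t\<^sup>2)) * norm (gs x)" for t
      unfolding Gt by (simp add: k_def bump_profile_nonneg abs_mult)
    then show ?thesis using intk[of x] valk[of x] by (cases "x = 0") (auto simp: gs_def)
  qed
  have int1: "integrable (lborel \<Otimes>\<^sub>M (lborel :: real measure)) (\<lambda>(x, t). ?K x t * F x)"
  proof (rule lborel_pair.Fubini_integrable)
    have "integrable lborel (\<lambda>x. norm x powr (p - n) * norm (F x))"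
      using schwartz_integrable_powr[OF F, of "n - p"] p by (simp add: n_def)
    then have i: "integrable lborel (\<lambda>x. (c * B) * (norm x powr (p - n) * norm (F x)))" by simp
    show "integrable lborel (\<lambda>x. LINT t|lborel. norm (case (x, t) of (x, t) => ?K x t * F x))"
    proof (rule Bochner_Integration.integrable_bound[OF i])
      have e: "(LINT t|lborel. norm (case (x, t) of (x, t) => ?K x t * F x)) = norm x powr (p - n) * c * norm (gs x) * norm (F x)" for x
        by (simp only: prod.case norm_mult integral_mult_left_zero valN)
      show "(\<lambda>x. LINT t|lborel. norm (case (x, t) of (x, t) => ?K x t * F x)) \<in> borel_measurable lborel"
        unfolding e by measurable
      show "AE x in lborel. norm (LINT t|lborel. norm (case (x, t) of (x, t) => ?K x t * F x)) \<le> norm ((c * B) * (norm x powr (p - n) * norm (F x)))"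
      proof (rule AE_I2)
        fix x :: "real^'n"
        have "norm (gs x) \<le> B" using B by (simp add: gs_def)
        then have "c * (norm x powr (p - n) * norm (F x)) * norm (gs x) \<le> c * (norm x powr (p - n) * norm (F x)) * B"
          using c by (intro mult_left_mono) auto
        then show "norm (LINT t|lborel. norm (case (x, t) of (x, t) => ?K x t * F x)) \<le> norm ((c * B) * (norm x powr (p - n) * norm (F x)))"
          unfolding e using c B(1) by (simp add: abs_mult mult_ac)
      qed
    qed
    show "AE x in lborel. integrable lborel (\<lambda>t. case (x, t) of (x, t) => ?K x t * F x)"
      by (rule AE_I2, unfold prod.case, rule integrable_mult_left, rule intk')
    show "(\<lambda>(x, t). ?K x t * F x) \<in> borel_measurable (lborel \<Otimes>\<^sub>M lborel)" by measurable
  qed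
  have "distribution_fourier (distribution_of (Ip_kernel p g)) \<phi> = (LINT x|lborel. of_real (A / c) * (LINT t|lborel. ?K x t * F x))"
    unfolding distribution_fourier_def distribution_of_def F_def[symmetric]
  proof (rule Bochner_Integration.integral_cong[OF refl])
    fix x
    have "(LINT t|lborel. ?K x t * F x) = of_real (norm x powr (p - n) * c) * gs x * F x"
      by (simp only: integral_mult_left_zero valG)
    then show "Ip_kernel p g x * F x = of_real (A / c) * (LINT t|lborel. ?K x t * F x)"
      using c by (cases "x = 0") (auto simp: Ip_kernel_eq gs_def A_def n_def)
  qed
  also have "... = of_real (A / c) * (LINT x|lborel. LINT t|lborel. ?K x t * F x)" by simp
  also have "(LINT x|lborel. LINT t|lborel. ?K x t * F x) = (LINT t|lborel. LINT x|lborel. ?K x t * F x)"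
    by (rule lborel_pair.Fubini_integral[OF int1, symmetric])
  also have "... = (LINT t|lborel. LINT \<xi>|lborel. ?M \<xi> t * \<phi> \<xi>)"
  proof (rule Bochner_Integration.integral_cong[OF refl])
    fix t :: real
    show "(LINT x|lborel. ?K x t * F x) = (LINT \<xi>|lborel. ?M \<xi> t * \<phi> \<xi>)"
    proof (cases "t > 0")
      case True
      have "(LINT x|lborel. G ((1 / t) *\<^sub>R x) * F x) = (\<bar>t\<bar> ^ CARD('n)) *\<^sub>R (LINT x|lborel. G ((1 / t) *\<^sub>R (t *\<^sub>R x)) * F (t *\<^sub>R x))"
        using True by (intro lborel_integral_scale) auto
      also have "(LINT x|lborel. G ((1 / t) *\<^sub>R (t *\<^sub>R x)) * F (t *\<^sub>R x)) = (LINT x|lborel. G x * F (t *\<^sub>R x))" using True by simp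
      also have "... = (LINT x|lborel. fourier G (t *\<^sub>R x) * \<phi> x)"
        unfolding F_def by (rule fourier_multiplication) (intro schwartz_integrable \<phi> G)+
      finally have *: "(LINT x|lborel. G ((1 / t) *\<^sub>R x) * F x) = (\<bar>t\<bar> ^ CARD('n)) *\<^sub>R (LINT x|lborel. fourier G (t *\<^sub>R x) * \<phi> x)" .
      have "k t * \<bar>t\<bar> ^ CARD('n) = t powr (p - 1)"
        using True by (simp add: k_def n_def powr_realpow[symmetric] powr_add[symmetric])
      then show ?thesis using * True by (simp add: mult.assoc[symmetric])
    qed (simp add: k_def)
  qed
  also have "... = (LINT \<xi>|lborel. LINT t|lborel. ?M \<xi> t * \<phi> \<xi>)"
  proof (rule lborel_pair.Fubini_integral, rule lborel_pair.Fubini_integrable)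
    have H: "schwartz (fourier G)" by (rule schwartz_fourier[OF G])
    have [measurable]: "fourier G \<in> borel_measurable borel" by (rule schwartz_measurable[OF H])
    define m where "m \<xi> = (LINT t|lborel. (indicator {0<..} t * t powr (p - 1)) *\<^sub>R norm (fourier G (t *\<^sub>R \<xi>)))" for \<xi>
    have ii: "integrable lborel (\<lambda>t. ?M \<xi> t)" if "\<xi> \<noteq> 0" for \<xi>
      using p that by (intro radial_mellin_integrable H) auto
    obtain C where C: "C \<ge> 0" "\<And>\<xi> t. norm \<xi> \<ge> 1 ==> t > 0 ==> t powr (p - 1) * norm (fourier G (t *\<^sub>R \<xi>)) \<le> C * mellin_dom (p - 1) t"
      using schwartz_mellin_bound[OF H, of 1 "p - 1"] by auto
    define D where "D = C * (LINT t|lborel. mellin_dom (p - 1) t)"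
    have D: "D \<ge> 0" unfolding D_def using C(1) mellin_dom_nonneg by (intro mult_nonneg_nonneg integral_nonneg_AE) auto
    \<comment> \<open>By homogeneity the domination on the unit sphere suffices for the second use of Fubini.\<close>
    have m_unit: "m \<xi> \<le> D" if "norm \<xi> = 1" for \<xi>
    proof -
      have "m \<xi> \<le> (LINT t|lborel. C * mellin_dom (p - 1) t)"
        unfolding m_def
      proof (rule integral_mono)
        show "integrable lborel (\<lambda>t. (indicator {0<..} t * t powr (p - 1)) *\<^sub>R norm (fourier G (t *\<^sub>R \<xi>)))"
          using integrable_norm[OF ii[of \<xi>]] that by (force simp: abs_mult)
        show "integrable lborel (\<lambda>t. C * mellin_dom (p - 1) t)" using mellin_dom_integrable[of "p - 1"] p by simp
        show "(indicator {0<..} t * t powr (p - 1)) *\<^sub>R norm (fourier G (t *\<^sub>R \<xi>)) \<le> C * mellin_dom (p - 1) t" for t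
          using C(2)[of \<xi> t] that C(1) by (cases "t > 0") (auto simp: mellin_dom_nonneg)
      qed
      then show ?thesis by (simp add: D_def)
    qed
    have m_bound: "m \<xi> \<le> D * norm \<xi> powr - p" if "\<xi> \<noteq> 0" for \<xi>
    proof -
      have "m \<xi> = (LINT t|lborel. (indicator {0<..} t * t powr (p - 1)) *\<^sub>R (\<lambda>u. norm (fourier G (u *\<^sub>R (\<xi> /\<^sub>R norm \<xi>)))) (norm \<xi> * t))"
      proof -
        have "(norm \<xi> * t) *\<^sub>R (\<xi> /\<^sub>R norm \<xi>) = t *\<^sub>R \<xi>" for t using that by simp
        then show ?thesis unfolding m_def by (simp only:)
      qed
      also have "... = norm \<xi> powr (- (p - 1) - 1) *\<^sub>R m (\<xi> /\<^sub>R norm \<xi>)"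
        unfolding m_def using that by (intro mellin_scale) auto
      also have "... \<le> norm \<xi> powr - p * D"
        using m_unit[of "\<xi> /\<^sub>R norm \<xi>"] that by (simp add: mult_left_mono)
      finally show ?thesis by (simp add: mult.commute)
    qed
    have m0: "m \<xi> \<ge> 0" for \<xi> unfolding m_def by (intro integral_nonneg_AE) auto
    have e: "(LINT t|lborel. norm (case (\<xi>, t) of (\<xi>, t) => ?M \<xi> t * \<phi> \<xi>)) = m \<xi> * norm (\<phi> \<xi>)" for \<xi>
    proof -
      have "norm (?M \<xi> t * \<phi> \<xi>) = ((indicator {0<..} t * t powr (p - 1)) *\<^sub>R norm (fourier G (t *\<^sub>R \<xi>))) * norm (\<phi> \<xi>)" for t
        by (simp only: norm_mult norm_scaleR) simp
      then show ?thesis by (simp only: prod.case m_def integral_mult_left_zero)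
    qed
    have i: "integrable lborel (\<lambda>\<xi>. D * (norm \<xi> powr - p * norm (\<phi> \<xi>)))"
      using schwartz_integrable_powr[OF \<phi> p(2)] by simp
    show "integrable lborel (\<lambda>\<xi>. LINT t|lborel. norm (case (\<xi>, t) of (\<xi>, t) => ?M \<xi> t * \<phi> \<xi>))"
      unfolding e
    proof (rule Bochner_Integration.integrable_bound[OF i])
      show "(\<lambda>\<xi>. m \<xi> * norm (\<phi> \<xi>)) \<in> borel_measurable lborel" unfolding m_def by measurable
      have "AE \<xi> in lborel. \<xi> \<noteq> (0::real^'n)" by (rule AE_lborel_singleton)
      then show "AE \<xi> in lborel. norm (m \<xi> * norm (\<phi> \<xi>)) \<le> norm (D * (norm \<xi> powr - p * norm (\<phi> \<xi>)))"
      proof eventually_elim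
        case (elim \<xi>)
        show ?case using mult_right_mono[OF m_bound[OF elim], of "norm (\<phi> \<xi>)"] m0[of \<xi>] D by (simp add: abs_mult mult.assoc)
      qed
    qed
    have "AE \<xi> in lborel. \<xi> \<noteq> (0::real^'n)" by (rule AE_lborel_singleton)
    then show "AE \<xi> in lborel. integrable lborel (\<lambda>t. case (\<xi>, t) of (\<xi>, t) => ?M \<xi> t * \<phi> \<xi>)"
      by eventually_elim (unfold prod.case, rule integrable_mult_left, rule ii)
    show "(\<lambda>(\<xi>, t). ?M \<xi> t * \<phi> \<xi>) \<in> borel_measurable (lborel \<Otimes>\<^sub>M lborel)" by measurable
  qed
  also have "of_real (A / c) * (LINT \<xi>|lborel. LINT t|lborel. ?M \<xi> t * \<phi> \<xi>)
    = (LINT \<xi>|lborel. (of_real (A / c) * radial_mellin (p - 1) (fourier G) \<xi>) * \<phi> \<xi>)"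
    unfolding radial_mellin_def by (simp only: integral_mult_left_zero integral_mult_right_zero mult.assoc)
  finally show ?thesis unfolding A_def c_def G_def n_def .
qed

lemma fourier_even:
  fixes \<phi> :: "real ^ 'n => complex"
  assumes \<phi>: "schwartz \<phi>" and "\<And>x. \<phi> (- x) = \<phi> x"
  shows "fourier \<phi> (- \<xi>) = fourier \<phi> \<xi>"
proof -
  have [measurable]: "\<phi> \<in> borel_measurable borel" by (rule schwartz_measurable[OF \<phi>])
  have "(LINT x|lborel. \<phi> x * exp (- \<i> * complex_of_real (x \<bullet> - \<xi>)))
    = (\<bar>-1\<bar> ^ CARD('n)) *\<^sub>R (LINT x|lborel. \<phi> (- 1 *\<^sub>R x) * exp (- \<i> * complex_of_real ((- 1 *\<^sub>R x) \<bullet> - \<xi>)))"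
    by (rule lborel_integral_scale) auto
  then show ?thesis unfolding fourier_def by (simp add: assms(2))
qed

text \<open>
  The dilation average of the transformed cutoff satisfies the four conditions, and continuity off
  the origin makes it the only such function; hence the definite description is this function.
\<close>

theorem Ip_smooth_properties:
  fixes g :: "real ^ 'n => complex"
  assumes p: "0 < p" "p < real CARD('n)" and g: "smooth_on_sphere g"
  shows "homogeneous (- p) (Ip_smooth p g)" "smooth_on (- {0}) (Ip_smooth p g)" "Ip_smooth p g 0 = 0"
    "schwartz \<phi> ==> distribution_fourier (distribution_of (Ip_kernel p g)) \<phi> = distribution_of (Ip_smooth p g) \<phi>"
    "even_on_sphere g ==> Ip_smooth p g (- x) = Ip_smooth p g x"
proof -
  define H where "H = fourier (annulus_cutoff g)"
  define K where "K = complex_of_real (Ip_const CARD('n) p / bump_moment (p - CARD('n) - 1))"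
  \<comment> \<open>The description fixes the value 0 at the origin.\<close>
  define w where "w x = (if x = 0 then 0 else K * radial_mellin (p - 1) H x)" for x :: "real^'n"
  have H: "schwartz H" unfolding H_def by (intro schwartz_fourier schwartz_annulus_cutoff g)
  have o: "open (- {0::real^'n})" by auto
  have w1: "homogeneous (- p) w"
    using radial_mellin_homogeneous[of "p - 1" H] by (simp add: homogeneous_def w_def)
  have w2: "smooth_on (- {0}) w"
    by (rule smooth_on_cong_open[OF o _ smooth_on_mult[OF o smooth_on_const[OF o, of K] radial_mellin_smooth[OF H, of "p - 1"]]])
       (use p in \<open>auto simp: w_def\<close>)
  have w3: "w 0 = 0" by (simp add: w_def)
  have w4: "distribution_fourier (distribution_of (Ip_kernel p g)) \<phi> = distribution_of w \<phi>" if \<phi>: "schwartz \<phi>" for \<phi>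
  proof -
    have "distribution_fourier (distribution_of (Ip_kernel p g)) \<phi> = (LINT \<xi>|lborel. (K * radial_mellin (p - 1) H \<xi>) * \<phi> \<xi>)"
      unfolding K_def H_def by (rule distribution_fourier_Ip_kernel[OF p g \<phi>])
    also have "... = (LINT \<xi>|lborel. w \<xi> * \<phi> \<xi>)"
    proof (rule integral_cong_AE)
      have [measurable]: "H \<in> borel_measurable borel" "\<phi> \<in> borel_measurable borel"
        using H \<phi> by (auto intro: schwartz_measurable)
      have "w = (\<lambda>x. if x = 0 then 0 else w x)" by (auto simp: w_def)
      then have [measurable]: "w \<in> borel_measurable borel"
        using continuous_punctured_measurable[OF smooth_on_continuous[OF w2]] by simp
      show "(\<lambda>\<xi>. (K * radial_mellin (p - 1) H \<xi>) * \<phi> \<xi>) \<in> borel_measurable lborel" unfolding radial_mellin_def by measurable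
      show "(\<lambda>\<xi>. w \<xi> * \<phi> \<xi>) \<in> borel_measurable lborel" by measurable
      show "AE \<xi> in lborel. (K * radial_mellin (p - 1) H \<xi>) * \<phi> \<xi> = w \<xi> * \<phi> \<xi>"
        using AE_lborel_singleton[of "0::real^'n"] by eventually_elim (simp add: w_def)
    qed
    finally show ?thesis by (simp add: distribution_of_def)
  qed
  have uniq: "v = w" if v: "v 0 = 0 \<and> homogeneous (- p) v \<and> smooth_on (- {0}) v \<and>
     (\<forall>\<phi>. schwartz \<phi> \<longrightarrow> distribution_fourier (distribution_of (Ip_kernel p g)) \<phi> = distribution_of v \<phi>)" for v
  proof
    fix x show "v x = w x"
    proof (cases "x = 0")
      case False
      show ?thesis
        by (rule continuous_functions_distribution_eq[OF _ _ _ False]) (use v w2 w4 in \<open>auto intro: smooth_on_continuous\<close>)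
    qed (use v w3 in simp)
  qed
  have eq: "Ip_smooth p g = w"
    unfolding Ip_smooth_def by (rule the_equality) (use w1 w2 w3 w4 uniq in auto)
  show "homogeneous (- p) (Ip_smooth p g)" "smooth_on (- {0}) (Ip_smooth p g)" "Ip_smooth p g 0 = 0"
    unfolding eq by fact+
  show "schwartz \<phi> ==> distribution_fourier (distribution_of (Ip_kernel p g)) \<phi> = distribution_of (Ip_smooth p g) \<phi>"
    unfolding eq by (rule w4)
  assume ev: "even_on_sphere g"
  have "annulus_cutoff g (- x) = annulus_cutoff g x" for x
  proof (cases "x = 0")
    case False
    then have "x /\<^sub>R norm x \<in> sphere 0 1" by simp
    then have "g (- (x /\<^sub>R norm x)) = g (x /\<^sub>R norm x)" using ev unfolding even_on_sphere_def by blast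
    then show ?thesis by (simp add: annulus_cutoff_def)
  qed simp
  then have "H (- \<xi>) = H \<xi>" for \<xi> unfolding H_def by (intro fourier_even schwartz_annulus_cutoff g)
  then show "Ip_smooth p g (- x) = Ip_smooth p g x" unfolding eq w_def radial_mellin_def by simp
qed

section \<open>Fourier transforms of Gaussians times polynomials\<close>

text \<open>
  The moments of the standard normal distribution.
\<close>

fun gmom :: "nat => real" where
  "gmom 0 = 1" | "gmom (Suc 0) = 0" | "gmom (Suc (Suc l)) = real (Suc l) * gmom l"

lemma gmom_odd: "gmom (Suc (2 * l)) = 0"
  by (induction l) auto

lemma gmom_even: "gmom (2 * l) = fact (2 * l) / (2 ^ l * fact l)"
proof (induction l)
  case (Suc l)
  have "gmom (2 * Suc l) = real (Suc (2 * l)) * (fact (2 * l) / (2 ^ l * fact l))" using Suc by simp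
  also have "... = ((2 * real (Suc l)) * (real (Suc (2 * l)) * fact (2 * l))) / ((2 * real (Suc l)) * (2 ^ l * fact l))"
    by (subst mult_divide_mult_cancel_left) auto
  also have "(2 * real (Suc l)) * (real (Suc (2 * l)) * fact (2 * l)) = fact (2 * Suc l)" by simp
  also have "(2 * real (Suc l)) * (2 ^ l * fact l) = 2 ^ Suc l * fact (Suc l)" by simp
  finally show ?case .
qed simp

lemma sum_even_only:
  fixes f :: "nat => 'a::comm_monoid_add"
  assumes "\<And>l. f (Suc (2 * l)) = 0"
  shows "(\<Sum>l\<le>2 * k. f l) = (\<Sum>i\<le>k. f (2 * i))"
proof (induction k)
  case (Suc k)
  have "(\<Sum>l\<le>2 * Suc k. f l) = (\<Sum>l\<le>2 * k. f l) + f (Suc (2 * k)) + f (2 * Suc k)" by simp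
  then show ?case using Suc assms by simp
qed simp

lemma sum_gmom_even:
  fixes F :: "nat => complex"
  shows "(\<Sum>l\<le>2 * k. of_nat (2 * k choose l) * of_real (gmom l) * F l)
    = (\<Sum>i\<le>k. of_real (fact (2 * k) / (fact (2 * i) * 2 ^ (k - i) * fact (k - i))) * F (2 * (k - i)))"
proof -
  have "(\<Sum>l\<le>2 * k. of_nat (2 * k choose l) * of_real (gmom l) * F l) = (\<Sum>i\<le>k. of_nat (2 * k choose (2 * i)) * of_real (gmom (2 * i)) * F (2 * i))"
    by (rule sum_even_only) (simp add: gmom_odd)
  also have "... = (\<Sum>i\<le>k. of_nat (2 * k choose (2 * (k - i))) * of_real (gmom (2 * (k - i))) * F (2 * (k - i)))"
    by (rule sum.reindex_bij_witness[of _ "\<lambda>i. k - i" "\<lambda>i. k - i"]) auto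
  also have "... = (\<Sum>i\<le>k. of_real (fact (2 * k) / (fact (2 * i) * 2 ^ (k - i) * fact (k - i))) * F (2 * (k - i)))"
  proof (rule sum.cong[OF refl])
    fix i assume "i \<in> {..k}"
    then have i: "i \<le> k" by simp
    have "real (2 * k choose (2 * (k - i))) = fact (2 * k) / (fact (2 * (k - i)) * fact (2 * k - 2 * (k - i)))"
      by (rule binomial_fact) simp
    also have "2 * k - 2 * (k - i) = 2 * i" using i by simp
    finally have "real (2 * k choose (2 * (k - i))) * gmom (2 * (k - i)) = fact (2 * k) / (fact (2 * i) * 2 ^ (k - i) * fact (k - i))"
      unfolding gmom_even by (simp add: field_simps)
    then have "complex_of_real (real (2 * k choose (2 * (k - i))) * gmom (2 * (k - i))) = of_real (fact (2 * k) / (fact (2 * i) * 2 ^ (k - i) * fact (k - i)))" by (rule arg_cong)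
    then show "of_nat (2 * k choose (2 * (k - i))) * of_real (gmom (2 * (k - i))) * F (2 * (k - i)) = of_real (fact (2 * k) / (fact (2 * i) * 2 ^ (k - i) * fact (k - i))) * F (2 * (k - i))"
      by (simp only: of_real_mult of_real_of_nat_eq)
  qed
  finally show ?thesis .
qed

text \<open>
  The Hermite polynomials up to scaling, written as the expectation of \<open>(w + X) ^ m\<close> for a standard
  normal variable \<open>X\<close>. At an imaginary argument this is the transform of a monomial times a Gaussian.
\<close>

definition gpoly :: "nat => complex => complex" where
  "gpoly m w = (\<Sum>l\<le>m. of_nat (m choose l) * of_real (gmom l) * w ^ (m - l))"

lemma gpoly_Suc_Suc: "gpoly (Suc (Suc m)) w = w * gpoly (Suc m) w + of_nat (Suc m) * gpoly m w"
proof -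
  let ?M = "Suc m"
  have "gpoly (Suc ?M) w = w ^ Suc ?M + (\<Sum>l\<le>?M. of_nat (Suc ?M choose Suc l) * of_real (gmom (Suc l)) * w ^ (?M - l))"
    unfolding gpoly_def by (subst sum.atMost_Suc_shift) simp
  also have "(\<Sum>l\<le>?M. of_nat (Suc ?M choose Suc l) * of_real (gmom (Suc l)) * w ^ (?M - l))
    = (\<Sum>l\<le>?M. of_nat (?M choose l) * of_real (gmom (Suc l)) * w ^ (?M - l)) + (\<Sum>l\<le>?M. of_nat (?M choose Suc l) * of_real (gmom (Suc l)) * w ^ (?M - l))"
    by (simp add: sum.distrib[symmetric] algebra_simps)
  also have "(\<Sum>l\<le>?M. of_nat (?M choose l) * of_real (gmom (Suc l)) * w ^ (?M - l)) = (\<Sum>l\<le>m. of_nat (?M choose Suc l) * of_real (gmom (Suc (Suc l))) * w ^ (m - l))"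
    by (subst sum.atMost_Suc_shift) simp
  also have "... = of_nat ?M * gpoly m w"
    unfolding gpoly_def sum_distrib_left
  proof (rule sum.cong[OF refl])
    fix l
    have "of_nat (?M choose Suc l) * complex_of_real (gmom (Suc (Suc l))) = of_nat (Suc l * (?M choose Suc l)) * of_real (gmom l)"
      by (simp only: gmom.simps of_real_mult of_nat_mult of_real_of_nat_eq mult_ac)
    also have "... = of_nat (?M * (m choose l)) * of_real (gmom l)" by (simp only: Suc_times_binomial)
    finally show "of_nat (?M choose Suc l) * complex_of_real (gmom (Suc (Suc l))) * w ^ (m - l) = of_nat ?M * (of_nat (m choose l) * of_real (gmom l) * w ^ (m - l))"
      by (simp only: of_nat_mult mult.assoc)
  qed
  also have "w ^ Suc ?M + (of_nat ?M * gpoly m w + (\<Sum>l\<le>?M. of_nat (?M choose Suc l) * of_real (gmom (Suc l)) * w ^ (?M - l))) = w * gpoly ?M w + of_nat ?M * gpoly m w"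
  proof -
    have "(\<Sum>l\<le>?M. of_nat (?M choose Suc l) * of_real (gmom (Suc l)) * w ^ (?M - l)) = (\<Sum>l\<le>m. of_nat (?M choose Suc l) * of_real (gmom (Suc l)) * w ^ (?M - l))"
      by (simp add: binomial_eq_0)
    also have "... = w * (\<Sum>l\<le>m. of_nat (?M choose Suc l) * of_real (gmom (Suc l)) * w ^ (m - l))"
      unfolding sum_distrib_left by (rule sum.cong[OF refl]) (simp add: Suc_diff_le)
    finally have 1: "(\<Sum>l\<le>?M. of_nat (?M choose Suc l) * of_real (gmom (Suc l)) * w ^ (?M - l)) = w * (\<Sum>l\<le>m. of_nat (?M choose Suc l) * of_real (gmom (Suc l)) * w ^ (m - l))" .
    have 2: "gpoly ?M w = w ^ ?M + (\<Sum>l\<le>m. of_nat (?M choose Suc l) * of_real (gmom (Suc l)) * w ^ (m - l))"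
      unfolding gpoly_def by (subst sum.atMost_Suc_shift) simp
    show ?thesis unfolding 1 2 by (simp add: algebra_simps)
  qed
  finally show ?thesis .
qed

definition gauss :: "real ^ 'n => complex" where
  "gauss x = complex_of_real (exp (- ((norm x)\<^sup>2 / 2)))"

lemma schwartz_monomial_gauss:
  "schwartz (\<lambda>x. of_real ((x \<bullet> v) ^ m) * gauss x)" "schwartz gauss"
  using schwartz_gauss schwartz_power_mult[OF schwartz_gauss] unfolding gauss_def by auto

lemma gauss_deriv: "(gauss has_derivative (\<lambda>h. of_real (- (x \<bullet> h)) * gauss x)) (at x)"
  using gauss_has_derivative[of x] unfolding gauss_def .

lemma fourier_monomial_gauss:
  fixes a :: "real ^ 'n"
  assumes a: "norm a = 1"
  shows "fourier (\<lambda>x. of_real ((x \<bullet> a) ^ m) * gauss x) \<xi> = of_real ((2 * pi) powr (real CARD('n) / 2)) * gauss \<xi> * gpoly m (- \<i> * of_real (a \<bullet> \<xi>))"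
proof -
  let ?H = "\<lambda>m. fourier (\<lambda>x. of_real ((x \<bullet> a) ^ m) * gauss x) \<xi>"
  have aa: "a \<bullet> a = 1" using a by (simp add: norm_eq_1)
  have int: "integrable lborel (\<lambda>x. of_real ((x \<bullet> a) ^ m) * gauss x * exp (- \<i> * complex_of_real (x \<bullet> \<xi>)))" for m
    by (intro integrable_fourier_integrand schwartz_integrable schwartz_monomial_gauss)
  have der: "frechet_derivative (\<lambda>x. of_real ((x \<bullet> a) ^ m) * gauss x) (at x) a = of_nat m * (of_real ((x \<bullet> a) ^ (m - 1)) * gauss x) - of_real ((x \<bullet> a) ^ (Suc m)) * gauss x" for m x
  proof -
    have 1: "((\<lambda>x. complex_of_real ((x \<bullet> a) ^ m)) has_derivative (\<lambda>h. complex_of_real (of_nat m * (x \<bullet> a) ^ (m - 1) * (h \<bullet> a)))) (at x)"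
      by (rule has_derivative_of_real) (auto intro!: derivative_eq_intros)
    show ?thesis
      by (subst frechet_derivative_at[OF has_derivative_mult[OF 1 gauss_deriv], symmetric]) (simp add: aa algebra_simps)
  qed
  have rec: "\<i> * of_real (a \<bullet> \<xi>) * ?H m = of_nat m * ?H (m - 1) - ?H (Suc m)" for m
  proof -
    have "\<i> * of_real (a \<bullet> \<xi>) * ?H m = fourier (\<lambda>x. frechet_derivative (\<lambda>x. of_real ((x \<bullet> a) ^ m) * gauss x) (at x) a) \<xi>"
      by (rule fourier_of_derivative[symmetric]) (rule schwartz_monomial_gauss)
    also have "... = of_nat m * ?H (m - 1) - ?H (Suc m)"
      unfolding der fourier_def left_diff_distrib mult.assoc[of "of_nat m"]
      by (subst Bochner_Integration.integral_diff) (intro integrable_mult_right int, rule int, simp only: integral_mult_right_zero)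
    finally show ?thesis .
  qed
  have H0: "?H 0 = of_real ((2 * pi) powr (real CARD('n) / 2)) * gauss \<xi>"
    using fourier_gauss[of \<xi>] unfolding gauss_def by simp
  have "?H m = ?H 0 * gpoly m (- \<i> * of_real (a \<bullet> \<xi>)) \<and> ?H (Suc m) = ?H 0 * gpoly (Suc m) (- \<i> * of_real (a \<bullet> \<xi>))"
  proof (induction m)
    case 0
    have "gpoly 0 w = 1" "gpoly (Suc 0) w = w" for w by (simp_all add: gpoly_def)
    moreover have "?H (Suc 0) = - \<i> * of_real (a \<bullet> \<xi>) * ?H 0"
      using rec[of 0] by (simp only: of_nat_0 mult_zero_left) (simp add: algebra_simps)
    ultimately show ?case by simp
  next
    case (Suc m)
    define w where "w = - \<i> * complex_of_real (a \<bullet> \<xi>)"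
    have "?H (Suc (Suc m)) = of_nat (Suc m) * ?H m - \<i> * of_real (a \<bullet> \<xi>) * ?H (Suc m)"
      using rec[of "Suc m"] by (simp only: diff_Suc_1) (simp only: algebra_simps)
    then have "?H (Suc (Suc m)) = of_nat (Suc m) * ?H m + w * ?H (Suc m)" by (simp add: w_def)
    also have "... = of_nat (Suc m) * (?H 0 * gpoly m w) + w * (?H 0 * gpoly (Suc m) w)"
      using Suc.IH unfolding w_def[symmetric] by (simp only:)
    also have "... = ?H 0 * gpoly (Suc (Suc m)) w" unfolding gpoly_Suc_Suc by (simp only: algebra_simps)
    also have "... = ?H 0 * gpoly (Suc (Suc m)) (- \<i> * of_real (a \<bullet> \<xi>))" unfolding w_def ..
    finally show ?case using Suc.IH by blast
  qed
  then show ?thesis unfolding H0 by blast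
qed

section \<open>Marginals of the Gaussian\<close>

text \<open>
  The characteristic function of the projection to the line spanned by \<open>\<xi>\<close> is read off from the
  transform of the Gaussian; Levy's uniqueness theorem identifies the distribution.
\<close>

lemma gauss_marginal:
  fixes \<xi> :: "real ^ 'n" and f :: "real => complex"
  assumes \<xi>: "norm \<xi> = 1" and [measurable]: "f \<in> borel_measurable borel"
  shows "(LINT x|lborel. f (x \<bullet> \<xi>) * gauss x) = of_real ((2 * pi) powr (real CARD('n) / 2)) * (LINT s|lborel. std_normal_density s *\<^sub>R f s)"
proof -
  define c where "c = (2 * pi) powr (real CARD('n) / 2)"
  have c: "c > 0" by (simp add: c_def)
  \<comment> \<open>The normalized Gaussian as a probability density.\<close>
  define w where "w x = exp (- ((norm x)\<^sup>2 / 2)) / c" for x :: "real^'n"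
  have [measurable]: "w \<in> borel_measurable borel" unfolding w_def by measurable
  have w0: "w x \<ge> 0" for x using c by (simp add: w_def)
  have wi: "integrable lborel w"
  proof -
    have "integrable lborel (\<lambda>x::real^'n. Re (gauss x) / c)"
    proof -
      have "schwartz (gauss :: real^'n => complex)" by (rule schwartz_monomial_gauss)
      from integrable_Re[OF schwartz_integrable[OF this]] show ?thesis by simp
    qed
    moreover have "(\<lambda>x. Re (gauss x) / c) = w" by (auto simp: gauss_def w_def)
    ultimately show ?thesis by simp
  qed
  have wI: "(LINT x|lborel. complex_of_real (w x)) = 1"
    using gauss_integral[where 'n='n] c by (simp add: w_def c_def[symmetric])
  define M where "M = density lborel (\<lambda>x. ennreal (w x))"
  have emM: "emeasure M (space M) = 1"
  proof -
    have "emeasure M (space M) = (\<integral>\<^sup>+x. ennreal (w x) \<partial>lborel)"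
      unfolding M_def by (simp add: emeasure_density)
    also have "... = ennreal (LINT x|lborel. w x)" by (rule nn_integral_eq_integral[OF wi]) (simp add: w0)
    also have "(LINT x|lborel. w x) = 1" using wI by (simp add: of_real_eq_1_iff)
    finally show ?thesis by simp
  qed
  interpret M: prob_space M by (rule prob_spaceI[OF emM])
  have mM: "(\<lambda>x. x \<bullet> \<xi>) \<in> borel_measurable M" by (simp add: M_def)
  have intM: "(LINT x|M. g (x \<bullet> \<xi>)) = (LINT x|lborel. w x *\<^sub>R g (x \<bullet> \<xi>))" if [measurable]: "g \<in> borel_measurable borel" for g :: "real => complex"
    unfolding M_def by (rule integral_density) (auto simp: w0)
  have rd: "real_distribution (distr M borel (\<lambda>x. x \<bullet> \<xi>))"
    using M.real_distribution_distr[OF mM] .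
  have rn: "real_distribution (density lborel (\<lambda>x. ennreal (std_normal_density x)))"
    by (simp add: real_distribution_def real_distribution_axioms_def prob_space_normal_density)
  have "distr M borel (\<lambda>x. x \<bullet> \<xi>) = density lborel (\<lambda>x. ennreal (std_normal_density x))"
  proof (rule Levy_uniqueness[OF rd rn])
    show "char (distr M borel (\<lambda>x. x \<bullet> \<xi>)) = char (density lborel (\<lambda>x. ennreal (std_normal_density x)))"
    proof
      fix t
      have "char (distr M borel (\<lambda>x. x \<bullet> \<xi>)) t = (LINT x|M. iexp (t * (x \<bullet> \<xi>)))"
        unfolding char_def by (rule integral_distr[OF mM]) simp
      also have "... = (LINT x|lborel. w x *\<^sub>R iexp (t * (x \<bullet> \<xi>)))" by (rule intM[of "\<lambda>s. iexp (t * s)"]) simp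
      also have "... = (LINT x|lborel. (gauss x * exp (- \<i> * complex_of_real (x \<bullet> (- t *\<^sub>R \<xi>)))) / of_real c)"
        by (intro Bochner_Integration.integral_cong refl) (simp add: w_def gauss_def scaleR_conv_of_real[of _ "_::complex"])
      also have "... = fourier gauss (- t *\<^sub>R \<xi>) / of_real c" unfolding fourier_def by simp
      also have "... = of_real (exp (- ((norm (- t *\<^sub>R \<xi>))\<^sup>2 / 2)))"
        using fourier_gauss[of "- t *\<^sub>R \<xi>"] c unfolding gauss_def c_def[symmetric] by simp
      also have "... = char std_normal_distribution t" by (simp add: char_std_normal_distribution \<xi>)
      finally show "char (distr M borel (\<lambda>x. x \<bullet> \<xi>)) t = char (density lborel (\<lambda>x. ennreal (std_normal_density x))) t" .
    qed
  qed
  then have "(LINT s|distr M borel (\<lambda>x. x \<bullet> \<xi>). f s) = (LINT s|density lborel (\<lambda>x. ennreal (std_normal_density x)). f s)" by simp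
  also have "... = (LINT s|lborel. std_normal_density s *\<^sub>R f s)"
    by (rule integral_density) (auto simp: normal_density_nonneg)
  finally have 1: "(LINT s|distr M borel (\<lambda>x. x \<bullet> \<xi>). f s) = (LINT s|lborel. std_normal_density s *\<^sub>R f s)" .
  have "(LINT s|distr M borel (\<lambda>x. x \<bullet> \<xi>). f s) = (LINT x|M. f (x \<bullet> \<xi>))" by (rule integral_distr[OF mM]) simp
  also have "... = (LINT x|lborel. w x *\<^sub>R f (x \<bullet> \<xi>))" by (rule intM) simp
  also have "... = (LINT x|lborel. (f (x \<bullet> \<xi>) * gauss x) / of_real c)"
    by (intro Bochner_Integration.integral_cong refl) (simp add: w_def gauss_def scaleR_conv_of_real[of _ "_::complex"])
  also have "... = (LINT x|lborel. f (x \<bullet> \<xi>) * gauss x) / of_real c" by simp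
  finally show ?thesis using 1 c unfolding c_def[symmetric] by simp
qed

lemma integral_even_half:
  fixes f :: "real => complex"
  assumes f: "integrable lborel f" and ev: "\<And>s. f (- s) = f s"
  shows "(LINT s|lborel. f s) = 2 * (LINT s|lborel. indicator {0<..} s *\<^sub>R f s)"
proof -
  have [measurable]: "f \<in> borel_measurable borel" using f by auto
  have i: "integrable lborel (\<lambda>s. indicator {0<..} s *\<^sub>R f s)" "integrable lborel (\<lambda>s. indicator {..<0} s *\<^sub>R f s)"
    by (rule Bochner_Integration.integrable_bound[OF f], auto simp: indicator_def)+
  have "(LINT s|lborel. f s) = (LINT s|lborel. indicator {0<..} s *\<^sub>R f s + indicator {..<0} s *\<^sub>R f s)"
    by (rule integral_cong_AE) (use AE_lborel_singleton[of "0::real"] in \<open>auto elim!: eventually_mono simp: indicator_def\<close>)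
  also have "... = (LINT s|lborel. indicator {0<..} s *\<^sub>R f s) + (LINT s|lborel. indicator {..<0} s *\<^sub>R f s)"
    by (rule Bochner_Integration.integral_add[OF i])
  also have "(LINT s|lborel. indicator {..<0} s *\<^sub>R f s) = \<bar>-1\<bar> *\<^sub>R (LINT s|lborel. indicator {..<0} (0 + -1 * s) *\<^sub>R f (0 + -1 * s))"
    by (rule lborel_integral_real_affine) simp
  also have "... = (LINT s|lborel. indicator {0<..} s *\<^sub>R f s)"
    by (simp add: ev) (intro Bochner_Integration.integral_cong refl, auto simp: indicator_def)
  finally show ?thesis by simp
qed

section \<open>The Chu-Vandermonde sum\<close>

text \<open>
  Pascal's rule splits the sum of order \<open>j + 1\<close> into the sum of order \<open>j\<close> and one with \<open>\<alpha>\<close> and \<open>c\<close> both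
  raised by one.
\<close>

lemma chu_vandermonde:
  fixes \<alpha> c :: complex
  assumes "\<And>i::nat. c + of_nat i \<noteq> 0"
  shows "(\<Sum>i\<le>j. (-1) ^ i * of_nat (j choose i) * pochhammer \<alpha> i / pochhammer c i) = pochhammer (c - \<alpha>) j / pochhammer c j"
  using assms
proof (induction j arbitrary: \<alpha> c)
  case (Suc j)
  have c0: "c \<noteq> 0" using Suc.prems[of 0] by simp
  have nz: "pochhammer c i \<noteq> 0" for i
  proof
    assume "pochhammer c i = 0"
    then obtain k where "c = - of_nat k" by (auto simp: pochhammer_eq_0_iff)
    then have "c + of_nat k = 0" by simp
    with Suc.prems show False by blast
  qed
  have c1: "c + 1 + of_nat i \<noteq> 0" for i using Suc.prems[of "Suc i"] by (simp add: add_ac)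
  let ?t = "\<lambda>j i. (-1) ^ i * of_nat (j choose i) * pochhammer \<alpha> i / pochhammer c i"
  have "(\<Sum>i\<le>Suc j. ?t (Suc j) i) = 1 + (\<Sum>i\<le>j. ?t (Suc j) (Suc i))"
    by (subst sum.atMost_Suc_shift) simp
  also have "(\<Sum>i\<le>j. ?t (Suc j) (Suc i)) = (\<Sum>i\<le>j. (-1) ^ Suc i * of_nat (j choose Suc i) * pochhammer \<alpha> (Suc i) / pochhammer c (Suc i))
      + (\<Sum>i\<le>j. (-1) ^ Suc i * of_nat (j choose i) * pochhammer \<alpha> (Suc i) / pochhammer c (Suc i))"
    by (simp add: sum.distrib[symmetric] algebra_simps add_divide_distrib diff_divide_distrib)
  also have "(\<Sum>i\<le>j. (-1) ^ Suc i * of_nat (j choose i) * pochhammer \<alpha> (Suc i) / pochhammer c (Suc i))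
      = - (\<alpha> / c) * (\<Sum>i\<le>j. (-1) ^ i * of_nat (j choose i) * pochhammer (\<alpha> + 1) i / pochhammer (c + 1) i)"
    unfolding sum_distrib_left by (rule sum.cong[OF refl]) (simp add: pochhammer_rec)
  also have "(\<Sum>i\<le>j. (-1) ^ i * of_nat (j choose i) * pochhammer (\<alpha> + 1) i / pochhammer (c + 1) i) = pochhammer (c - \<alpha>) j / pochhammer (c + 1) j"
    using Suc.IH[of "c + 1" "\<alpha> + 1"] c1 by simp
  also have "1 + ((\<Sum>i\<le>j. (-1) ^ Suc i * of_nat (j choose Suc i) * pochhammer \<alpha> (Suc i) / pochhammer c (Suc i)) + - (\<alpha> / c) * (pochhammer (c - \<alpha>) j / pochhammer (c + 1) j))
     = (\<Sum>i\<le>j. ?t j i) - (\<alpha> / c) * (pochhammer (c - \<alpha>) j / pochhammer (c + 1) j)"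
  proof -
    have "(\<Sum>i\<le>Suc j. ?t j i) = 1 + (\<Sum>i\<le>j. ?t j (Suc i))" by (subst sum.atMost_Suc_shift) simp
    moreover have "(\<Sum>i\<le>Suc j. ?t j i) = (\<Sum>i\<le>j. ?t j i)" by simp
    ultimately show ?thesis by simp
  qed
  also have "(\<Sum>i\<le>j. ?t j i) = pochhammer (c - \<alpha>) j / pochhammer c j" by (rule Suc.IH) (rule Suc.prems)
  also have "pochhammer (c - \<alpha>) j / pochhammer c j - (\<alpha> / c) * (pochhammer (c - \<alpha>) j / pochhammer (c + 1) j)
    = pochhammer (c - \<alpha>) (Suc j) / pochhammer c (Suc j)"
  proof -
    have "c * pochhammer (c + 1) j = pochhammer c j * (c + of_nat j)" using pochhammer_rec[of c j] pochhammer_Suc[of c j] by simp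
    then have e: "(\<alpha> / c) * (pochhammer (c - \<alpha>) j / pochhammer (c + 1) j) = \<alpha> * pochhammer (c - \<alpha>) j / (pochhammer c j * (c + of_nat j))" by simp
    have "pochhammer (c - \<alpha>) j / pochhammer c j = pochhammer (c - \<alpha>) j * (c + of_nat j) / (pochhammer c j * (c + of_nat j))"
      using Suc.prems[of j] by simp
    then show ?thesis unfolding e pochhammer_Suc
      by (simp only: diff_divide_distrib[symmetric]) (simp add: algebra_simps)
  qed
  finally show ?case .
qed simp

section \<open>Zonal polynomials\<close>

text \<open>
  The factor \<open>4 ^ k / fact (2 * k)\<close>, which is \<open>1 / (fact k * pochhammer (1 / 2) k)\<close>, removes all half-integer
  factorials from the formulas for Fourier transforms and kernels.
\<close>

definition zonal :: "nat => real ^ 'n => real ^ 'n => complex" where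
  "zonal k a x = of_real (4 ^ k * (x \<bullet> a) ^ (2 * k) / fact (2 * k))"

text \<open>
  The matrix of \<open>I\<^sub>z\<close> on the zonal polynomials in one direction. Its entries are holomorphic for
  \<open>Re z < n\<close>, which includes the closed strip \<open>0 \<le> Re z \<le> n / 2\<close>.
\<close>

definition zcoef :: "nat => complex => nat => nat => complex" where
  "zcoef n z k j = (-1) ^ j * pochhammer (z / 2) j / (fact (k - j) * pochhammer ((of_nat n - z) / 2) k)"

definition Ip_zonal :: "complex => nat => real ^ 'n => real ^ 'n => complex" where
  "Ip_zonal z k a x = (\<Sum>j\<le>k. zcoef CARD('n) z k j * zonal j a x)"

lemma zonal_scale: "zonal k a (r *\<^sub>R x) = of_real (r ^ (2 * k)) * zonal k a x"
  by (simp add: zonal_def power_mult_distrib)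

lemma continuous_zonal: "continuous_on S (zonal k a)"
  unfolding zonal_def by (intro continuous_intros) auto

lemma measurable_zonal[measurable]: "zonal k a \<in> borel_measurable borel"
  by (intro borel_measurable_continuous_onI continuous_zonal)

lemma schwartz_zonal_gauss: "schwartz (\<lambda>x. zonal k a x * gauss x)"
proof -
  have "(\<lambda>x. zonal k a x * gauss x) = (\<lambda>x. of_real (4 ^ k / fact (2 * k)) * (of_real ((x \<bullet> a) ^ (2 * k)) * gauss x))"
    by (auto simp: zonal_def)
  then show ?thesis by (simp only:) (rule schwartz_cmult[OF schwartz_monomial_gauss(1)])
qed

lemma fourier_zonal_gauss:
  fixes a :: "real ^ 'n"
  assumes a: "norm a = 1"
  shows "fourier (\<lambda>x. zonal k a x * gauss x) \<xi> = of_real ((2 * pi) powr (real CARD('n) / 2)) *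
    (\<Sum>j\<le>k. (-1) ^ j * 2 ^ (k - j) / fact (k - j) * (zonal j a \<xi> * gauss \<xi>))"
proof -
  let ?c = "complex_of_real ((2 * pi) powr (real CARD('n) / 2))"
  have "(\<lambda>x. zonal k a x * gauss x) = (\<lambda>x. of_real (4 ^ k / fact (2 * k)) * (of_real ((x \<bullet> a) ^ (2 * k)) * gauss x))"
    by (auto simp: zonal_def)
  then have "fourier (\<lambda>x. zonal k a x * gauss x) \<xi> = of_real (4 ^ k / fact (2 * k)) * (?c * gauss \<xi> * gpoly (2 * k) (- \<i> * of_real (a \<bullet> \<xi>)))"
    by (simp only: fourier_cmult fourier_monomial_gauss[OF a])
  also have "gpoly (2 * k) (- \<i> * of_real (a \<bullet> \<xi>)) = (\<Sum>i\<le>k. of_real (fact (2 * k) / (fact (2 * i) * 2 ^ (k - i) * fact (k - i))) * (- \<i> * of_real (a \<bullet> \<xi>)) ^ (2 * k - 2 * (k - i)))"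
    unfolding gpoly_def by (rule sum_gmom_even)
  also have "of_real (4 ^ k / fact (2 * k)) * (?c * gauss \<xi> * ...) = ?c * (\<Sum>j\<le>k. (-1) ^ j * 2 ^ (k - j) / fact (k - j) * (zonal j a \<xi> * gauss \<xi>))"
    unfolding sum_distrib_left
  proof (rule sum.cong[OF refl])
    fix i assume "i \<in> {..k}"
    then have i: "i \<le> k" by simp
    have e: "2 * k - 2 * (k - i) = 2 * i" using i by simp
    have "(- \<i> * complex_of_real (a \<bullet> \<xi>)) ^ (2 * i) = ((- \<i> * complex_of_real (a \<bullet> \<xi>))\<^sup>2) ^ i" by (rule power_mult)
    also have "(- \<i> * complex_of_real (a \<bullet> \<xi>))\<^sup>2 = of_real (- ((a \<bullet> \<xi>)\<^sup>2))" by (simp add: power_mult_distrib)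
    also have "(of_real (- ((a \<bullet> \<xi>)\<^sup>2)) :: complex) ^ i = of_real ((-1) ^ i * (a \<bullet> \<xi>) ^ (2 * i))"
      by (simp add: power_mult power_minus[of "(complex_of_real (a \<bullet> \<xi>))\<^sup>2"])
    finally have p: "(- \<i> * complex_of_real (a \<bullet> \<xi>)) ^ (2 * i) = of_real ((-1) ^ i * (a \<bullet> \<xi>) ^ (2 * i))" .
    have "(4::real) ^ k / fact (2 * k) * (fact (2 * k) / (fact (2 * i) * 2 ^ (k - i) * fact (k - i))) = 2 ^ (k - i) / fact (k - i) * (4 ^ i / fact (2 * i))"
    proof -
      have "(4::real) ^ k = 4 ^ i * (2 ^ (k - i) * 2 ^ (k - i))"
        using i by (simp add: power_mult_distrib[symmetric] power_add[symmetric])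
      then show ?thesis by (simp add: mult_ac)
    qed
    then have "complex_of_real ((4::real) ^ k / fact (2 * k) * (fact (2 * k) / (fact (2 * i) * 2 ^ (k - i) * fact (k - i)))) = of_real (2 ^ (k - i) / fact (k - i) * (4 ^ i / fact (2 * i)))" by (rule arg_cong)
    then have q: "complex_of_real ((4::real) ^ k / fact (2 * k)) * of_real (fact (2 * k) / (fact (2 * i) * 2 ^ (k - i) * fact (k - i))) = of_real (2 ^ (k - i) / fact (k - i) * (4 ^ i / fact (2 * i)))"
      by (simp only: of_real_mult)
    have "of_real (4 ^ k / fact (2 * k)) * (?c * gauss \<xi> * (of_real (fact (2 * k) / (fact (2 * i) * 2 ^ (k - i) * fact (k - i))) * (- \<i> * of_real (a \<bullet> \<xi>)) ^ (2 * k - 2 * (k - i))))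
      = (complex_of_real ((4::real) ^ k / fact (2 * k)) * of_real (fact (2 * k) / (fact (2 * i) * 2 ^ (k - i) * fact (k - i)))) * (?c * gauss \<xi> * of_real ((-1) ^ i * (a \<bullet> \<xi>) ^ (2 * i)))"
      unfolding e p by (simp only: mult_ac)
    also have "... = ?c * ((-1) ^ i * 2 ^ (k - i) / fact (k - i) * (zonal i a \<xi> * gauss \<xi>))"
      unfolding q zonal_def by (simp add: inner_commute)
    finally show "of_real (4 ^ k / fact (2 * k)) * (?c * gauss \<xi> * (of_real (fact (2 * k) / (fact (2 * i) * 2 ^ (k - i) * fact (k - i))) * (- \<i> * of_real (a \<bullet> \<xi>)) ^ (2 * k - 2 * (k - i)))) = ?c * ((-1) ^ i * 2 ^ (k - i) / fact (k - i) * (zonal i a \<xi> * gauss \<xi>))" .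
  qed
  finally show ?thesis .
qed

lemma Gamma_plus_nat:
  assumes "Re x > 0"
  shows "Gamma (x + of_nat j) = pochhammer x j * Gamma x" "Gamma x \<noteq> 0"
proof -
  have "x \<notin> \<int>\<^sub>\<le>\<^sub>0" using assms by (auto simp: nonpos_Ints_def)
  then show "Gamma x \<noteq> 0" by (simp add: Gamma_eq_zero_iff)
  then show "Gamma (x + of_nat j) = pochhammer x j * Gamma x"
    using pochhammer_Gamma[OF \<open>x \<notin> _\<close>, of j] by simp
qed

section \<open>The distributional operator paired with zonal polynomials\<close>

lemma sphere_integrable_bounded:
  fixes u :: "real ^ 'n => 'b::{banach,second_countable_topology}"
  assumes "u \<in> borel_measurable sphere_measure" "\<And>x. norm x = 1 ==> norm (u x) \<le> B"
  shows "integrable sphere_measure u"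
proof -
  interpret S: prob_space "sphere_measure :: (real^'n) measure" by (rule prob_space_sphere_measure)
  show ?thesis by (rule S.integrable_const_bound[of _ B]) (use assms in \<open>auto intro!: AE_I2 simp: space_sphere_measure\<close>)
qed

lemma sphere_integrable:
  fixes u :: "real ^ 'n => complex"
  assumes "continuous_on (sphere 0 1) u"
  shows "u \<in> borel_measurable sphere_measure" "integrable sphere_measure u"
proof -
  have "u \<in> borel_measurable (restrict_space borel (sphere 0 1))"
    by (rule borel_measurable_continuous_on_restrict[OF assms])
  then show m: "u \<in> borel_measurable sphere_measure"
    by (simp add: measurable_cong_sets[OF sets_sphere_measure refl])
  have "compact (u ` sphere 0 1)" using assms by (intro compact_continuous_image) auto
  then obtain B where "\<forall>y\<in>u ` sphere 0 1. norm y \<le> B" using compact_imp_bounded bounded_iff by blast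
  then show "integrable sphere_measure u" by (intro sphere_integrable_bounded[OF m, of B]) auto
qed

text \<open>
  The radial integral \<open>\<integral> r powr s * exp (- r\<^sup>2 / 2)\<close> against the radial part of Lebesgue measure.
\<close>

definition gmass :: "nat => complex => complex" where
  "gmass n s = of_real (real n * unit_ball_vol (real n)) * 2 powr ((of_nat n + s) / 2 - 1) * Gamma ((of_nat n + s) / 2)"

lemma gmass_nonzero: "n > 0 ==> Re s > - real n ==> gmass n s \<noteq> 0"
proof -
  assume "n > 0" "Re s > - real n"
  moreover have "unit_ball_vol (real n) \<noteq> 0" using unit_ball_vol_pos[of "real n"] by linarith
  ultimately show ?thesis using Gamma_plus_nat(2)[of "(of_nat n + s) / 2"] by (simp add: gmass_def)
qed

text \<open>
  Polar coordinates separate the Gaussian integral of a homogeneous function times a zonal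
  polynomial; the degree of the polynomial only shifts the argument of the Gamma function.
\<close>

lemma gauss_radial_zonal:
  fixes w :: "real ^ 'n => complex" and s :: complex
  assumes w: "w \<in> borel_measurable borel" "\<And>x. norm x = 1 ==> norm (w x) \<le> B" and s: "Re s > - real CARD('n)"
    and hom: "\<And>r x. r > 0 ==> norm x = 1 ==> w (r *\<^sub>R x) = of_real r powr s * w x"
  shows "integrable lborel (\<lambda>x. w x * (zonal j a x * gauss x))"
    "(LINT x|lborel. w x * (zonal j a x * gauss x)) =
      gmass CARD('n) s * 2 ^ j * pochhammer ((of_nat CARD('n) + s) / 2) j * (LINT \<theta>|sphere_measure. w \<theta> * zonal j a \<theta>)"
proof -
  have s': "Re (s + 2 * of_nat j) > - real CARD('n)" using s by simp
  have m: "(\<lambda>x. w x * (zonal j a x * gauss x)) \<in> borel_measurable borel"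
    using w(1) unfolding gauss_def by measurable
  have u: "integrable sphere_measure (\<lambda>\<theta>. w \<theta> * zonal j a \<theta>)"
  proof (rule Bochner_Integration.integrable_bound)
    show "integrable sphere_measure (\<lambda>\<theta>. of_real B * zonal j a \<theta>)"
      by (intro sphere_integrable continuous_on_mult continuous_on_const continuous_zonal)
    show "(\<lambda>\<theta>. w \<theta> * zonal j a \<theta>) \<in> borel_measurable sphere_measure"
      by (rule borel_measurable_sphere_measure) (use w(1) in measurable)
    show "AE x in sphere_measure. norm (w x * zonal j a x) \<le> norm (of_real B * zonal j a x)"
      using w(2) by (intro AE_I2) (auto simp: space_sphere_measure norm_mult intro!: mult_right_mono intro: order_trans[OF _ abs_ge_self])
  qed
  have e: "w (r *\<^sub>R \<theta>) * (zonal j a (r *\<^sub>R \<theta>) * gauss (r *\<^sub>R \<theta>)) = (complex_of_real r powr (s + 2 * of_nat j) * of_real (exp (- (r\<^sup>2 / 2)))) * (w \<theta> * zonal j a \<theta>)"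
    if "r > 0" "norm \<theta> = 1" for r \<theta>
  proof -
    have "complex_of_real r powr (s + 2 * of_nat j) = complex_of_real r powr s * of_real (r ^ (2 * j))"
      using that powr_nat'[of "complex_of_real r" "2 * j"] by (simp add: powr_add)
    then show ?thesis using that by (simp add: hom zonal_scale gauss_def)
  qed
  note P = integral_polar_product[OF m radial_gaussian_mellin(1)[OF _ s'] u e]
  show "integrable lborel (\<lambda>x. w x * (zonal j a x * gauss x))" by (rule P(1)) auto
  have "(LINT x|lborel. w x * (zonal j a x * gauss x)) = (LINT r|radial_measure CARD('n). complex_of_real r powr (s + 2 * of_nat j) * of_real (exp (- (r\<^sup>2 / 2)))) * (LINT \<theta>|sphere_measure. w \<theta> * zonal j a \<theta>)"
    by (rule P(2)) auto
  also have "(LINT r|radial_measure CARD('n). complex_of_real r powr (s + 2 * of_nat j) * of_real (exp (- (r\<^sup>2 / 2)))) = of_real (real CARD('n) * unit_ball_vol (real CARD('n))) * 2 powr ((of_nat CARD('n) + (s + 2 * of_nat j)) / 2 - 1) * Gamma ((of_nat CARD('n) + (s + 2 * of_nat j)) / 2)"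
    by (rule radial_gaussian_mellin(2)[OF _ s']) auto
  also have "(of_nat CARD('n) + (s + 2 * of_nat j)) / 2 = (of_nat CARD('n) + s) / 2 + of_nat j" by (simp add: field_simps)
  also have "Gamma ((of_nat CARD('n) + s) / 2 + of_nat j) = pochhammer ((of_nat CARD('n) + s) / 2) j * Gamma ((of_nat CARD('n) + s) / 2)"
    using s by (intro Gamma_plus_nat) simp
  also have "(2::complex) powr ((of_nat CARD('n) + s) / 2 + of_nat j - 1) = 2 powr (((of_nat CARD('n) + s) / 2 - 1) + of_nat j)"
    by (rule arg_cong[where f="\<lambda>x. 2 powr x"]) (simp only: algebra_simps)
  also have "... = 2 powr ((of_nat CARD('n) + s) / 2 - 1) * 2 ^ j"
    by (subst powr_add) (simp add: powr_nat')
  finally show "(LINT x|lborel. w x * (zonal j a x * gauss x)) =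
      gmass CARD('n) s * 2 ^ j * pochhammer ((of_nat CARD('n) + s) / 2) j * (LINT \<theta>|sphere_measure. w \<theta> * zonal j a \<theta>)"
    unfolding gmass_def by (simp only: mult_ac)
qed

text \<open>
  This is where the normalization of \<open>I\<^sub>p\<close> is used: it makes the two radial masses in the pairing cancel.
\<close>

lemma Ip_const_gmass:
  assumes n: "n > 0" and p: "0 < p" "p < real n"
  shows "of_real ((2 * pi) powr (real n / 2)) * of_real (Ip_const n p) * gmass n (of_real (p - real n)) = gmass n (of_real (- p))"
proof -
  define N where "N = real n * unit_ball_vol (real n)"
  have r: "gmass n (of_real t) = of_real (N * 2 powr ((real n + t) / 2 - 1) * Gamma ((real n + t) / 2))" if "t > - real n" for t
  proof -
    have "(of_nat n + complex_of_real t) / 2 = of_real ((real n + t) / 2)" by simp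
    then show ?thesis unfolding gmass_def N_def
      using powr_of_real[of 2 "(real n + t) / 2 - 1"] Gamma_complex_of_real[of "(real n + t) / 2"] by simp
  qed
  have G: "Gamma (p / 2) > 0" using p by (intro Gamma_real_pos) auto
  have "(2 * pi) powr (real n / 2) * Ip_const n p * (N * 2 powr ((real n + (p - real n)) / 2 - 1) * Gamma ((real n + (p - real n)) / 2))
     = N * 2 powr ((real n + - p) / 2 - 1) * Gamma ((real n + - p) / 2)"
  proof -
    have "(2::real) powr (real n / 2) * 2 powr (p / 2 - 1) = 2 powr ((real n - p) / 2 - 1) * 2 powr p"
      by (simp add: powr_add[symmetric] field_simps)
    then show ?thesis using G unfolding Ip_const_def by (simp add: powr_mult field_simps)
  qed
  then have "complex_of_real ((2 * pi) powr (real n / 2) * Ip_const n p * (N * 2 powr ((real n + (p - real n)) / 2 - 1) * Gamma ((real n + (p - real n)) / 2)))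
     = of_real (N * 2 powr ((real n + - p) / 2 - 1) * Gamma ((real n + - p) / 2))" by (rule arg_cong)
  then show ?thesis using r[of "p - real n"] r[of "- p"] p by (simp only: of_real_mult)
qed

lemma pochhammer_nonzero: "Re c > 0 ==> pochhammer (c::complex) k \<noteq> 0"
  by (auto simp: pochhammer_eq_0_iff)

text \<open>
  Test the distributional identity with a zonal polynomial times the Gaussian. The transform of this
  test function is a combination of functions of the same form, and both sides separate in polar
  coordinates. Comparing the spherical factors identifies \<open>I\<^sub>p\<close> as the adjoint of the matrix.
\<close>

theorem Ip_smooth_zonal_pairing:
  fixes g :: "real ^ 'n => complex"
  assumes p: "0 < p" "p < real CARD('n)" and g: "smooth_on_sphere g" and a: "norm a = 1"
  shows "(LINT \<theta>|sphere_measure. Ip_smooth p g \<theta> * zonal k a \<theta>) = (LINT \<theta>|sphere_measure. g \<theta> * Ip_zonal (of_real p) k a \<theta>)"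
proof -
  let ?n = "CARD('n)"
  let ?c = "complex_of_real ((2 * pi) powr (real ?n / 2))"
  define w where "w = Ip_smooth p g"
  \<comment> \<open>\<open>w\<close> is homogeneous of degree \<open>- p\<close>, and the kernel \<open>W1\<close> below of degree \<open>p - n\<close>.\<close>
  note W = Ip_smooth_properties[OF p g, folded w_def]
  define W1 where "W1 = Ip_kernel p g"
  have cg: "continuous_on (- {0}) (\<lambda>x. g (x /\<^sub>R norm x))" by (rule smooth_on_sphere_continuous[OF g])
  obtain B where B: "B \<ge> 0" "\<And>x. x \<noteq> 0 ==> norm (g (x /\<^sub>R norm x)) \<le> B"
    using continuous_sphere_bounded[OF cg] by blast
  have gb: "norm (g x) \<le> B" if "norm x = 1" for x using B(2)[of x] that by force
  have gcont: "continuous_on (sphere 0 1) g"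
    by (rule continuous_on_eq[OF continuous_on_subset[OF cg]]) auto
  have m1: "W1 \<in> borel_measurable borel"
  proof -
    have [measurable]: "(\<lambda>x. if x = 0 then 0 else g (x /\<^sub>R norm x)) \<in> borel_measurable borel"
      by (rule continuous_punctured_measurable[OF cg])
    have "W1 = (\<lambda>x. of_real (Ip_const ?n p * norm x powr (p - ?n)) * (if x = 0 then 0 else g (x /\<^sub>R norm x)))"
      by (auto simp: W1_def Ip_kernel_eq)
    then show ?thesis by (simp only:) measurable
  qed
  have W1s: "W1 x = of_real (Ip_const ?n p) * g x" if "norm x = 1" for x
    using that by (simp add: W1_def Ip_kernel_eq)
  have h1: "W1 (r *\<^sub>R x) = of_real r powr (of_real (p - ?n)) * W1 x" if "r > 0" "norm x = 1" for r x
    using that powr_of_real[of r "p - ?n"] by (simp add: W1_def Ip_kernel_eq powr_mult del: of_real_diff)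
  have b1: "norm (W1 x) \<le> \<bar>Ip_const ?n p\<bar> * B" if "norm x = 1" for x
    using gb[OF that] that by (simp add: W1s norm_mult mult_left_mono)
  have s1: "Re (complex_of_real (p - ?n)) > - real ?n" using p by simp
  have m2: "w \<in> borel_measurable borel"
  proof -
    have "w = (\<lambda>x. if x = 0 then 0 else w x)" using W(3) by auto
    then show ?thesis using continuous_punctured_measurable[OF smooth_on_continuous[OF W(2)]] by simp
  qed
  have cw: "continuous_on (sphere 0 1) w" by (rule continuous_on_subset[OF smooth_on_continuous[OF W(2)]]) auto
  obtain B2 where b2: "\<And>x. norm x = 1 ==> norm (w x) \<le> B2"
  proof -
    have "compact (w ` sphere 0 1)" using cw by (intro compact_continuous_image) auto
    then obtain B2 where "\<forall>y\<in>w ` sphere 0 1. norm y \<le> B2" using compact_imp_bounded bounded_iff by blast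
    then show ?thesis by (intro that[of B2]) auto
  qed
  have h2: "w (r *\<^sub>R x) = of_real r powr (of_real (- p)) * w x" if "r > 0" "norm x = 1" for r x
  proof -
    have "x \<noteq> 0" using that by auto
    then have "w (r *\<^sub>R x) = of_real (r powr - p) * w x" using W(1) that unfolding homogeneous_def by blast
    then show ?thesis using powr_of_real[of r "- p"] that by (simp del: of_real_minus)
  qed
  have s2: "Re (complex_of_real (- p)) > - real ?n" using p by simp
  have half1: "(of_nat ?n + complex_of_real (p - ?n)) / 2 = of_real p / 2" by simp
  have half2: "(of_nat ?n + complex_of_real (- p)) / 2 = (of_nat ?n - of_real p) / 2" by simp
  define I where "I j = (LINT \<theta>|sphere_measure. g \<theta> * zonal j a \<theta>)" for j
  have I1: "(LINT x|lborel. W1 x * (zonal j a x * gauss x)) = gmass ?n (of_real (p - ?n)) * 2 ^ j * pochhammer (of_real p / 2) j * (of_real (Ip_const ?n p) * I j)" for j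
  proof -
    have "(LINT \<theta>|sphere_measure. W1 \<theta> * zonal j a \<theta>) = (LINT \<theta>|sphere_measure. of_real (Ip_const ?n p) * (g \<theta> * zonal j a \<theta>))"
      by (intro Bochner_Integration.integral_cong refl) (simp add: W1s space_sphere_measure)
    then show ?thesis using gauss_radial_zonal(2)[OF m1 b1 s1 h1, of j a] unfolding half1 I_def by simp
  qed
  have "distribution_fourier (distribution_of W1) (\<lambda>x. zonal k a x * gauss x) = (LINT x|lborel. (\<Sum>j\<le>k. ?c * ((-1) ^ j * 2 ^ (k - j) / fact (k - j)) * (W1 x * (zonal j a x * gauss x))))"
    unfolding distribution_fourier_def distribution_of_def fourier_zonal_gauss[OF a]
    by (intro Bochner_Integration.integral_cong refl) (simp only: sum_distrib_left mult_ac)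
  also have "... = (\<Sum>j\<le>k. ?c * ((-1) ^ j * 2 ^ (k - j) / fact (k - j)) * (LINT x|lborel. W1 x * (zonal j a x * gauss x)))"
  proof (subst Bochner_Integration.integral_sum)
    show "integrable lborel (\<lambda>x. ?c * ((-1) ^ j * 2 ^ (k - j) / fact (k - j)) * (W1 x * (zonal j a x * gauss x)))" for j
      by (rule integrable_mult_right) (rule gauss_radial_zonal(1)[OF m1 b1 s1 h1])
    show "(\<Sum>j\<le>k. LINT x|lborel. ?c * ((-1) ^ j * 2 ^ (k - j) / fact (k - j)) * (W1 x * (zonal j a x * gauss x))) = (\<Sum>j\<le>k. ?c * ((-1) ^ j * 2 ^ (k - j) / fact (k - j)) * (LINT x|lborel. W1 x * (zonal j a x * gauss x)))"
      by (rule sum.cong[OF refl]) (rule integral_mult_right_zero)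
  qed
  also have "... = (\<Sum>j\<le>k. (?c * of_real (Ip_const ?n p) * gmass ?n (of_real (p - ?n))) * (((-1) ^ j * (2 ^ (k - j) * 2 ^ j) / fact (k - j)) * pochhammer (of_real p / 2) j * I j))"
    unfolding I1 by (intro sum.cong refl) simp
  also have "?c * of_real (Ip_const ?n p) * gmass ?n (of_real (p - ?n)) = gmass ?n (of_real (- p))"
    by (rule Ip_const_gmass) (use p in auto)
  also have "(\<Sum>j\<le>k. gmass ?n (of_real (- p)) * (((-1) ^ j * (2 ^ (k - j) * 2 ^ j) / fact (k - j)) * pochhammer (of_real p / 2) j * I j))
    = gmass ?n (of_real (- p)) * 2 ^ k * (\<Sum>j\<le>k. ((-1) ^ j / fact (k - j)) * pochhammer (of_real p / 2) j * I j)"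
    unfolding sum_distrib_left by (intro sum.cong refl) (simp add: power_add[symmetric])
  finally have L: "distribution_fourier (distribution_of W1) (\<lambda>x. zonal k a x * gauss x) = gmass ?n (of_real (- p)) * 2 ^ k * (\<Sum>j\<le>k. ((-1) ^ j / fact (k - j)) * pochhammer (of_real p / 2) j * I j)" .
  have R: "distribution_of w (\<lambda>x. zonal k a x * gauss x) = gmass ?n (of_real (- p)) * 2 ^ k * pochhammer ((of_nat ?n - of_real p) / 2) k * (LINT \<theta>|sphere_measure. w \<theta> * zonal k a \<theta>)"
    unfolding distribution_of_def using gauss_radial_zonal(2)[OF m2 b2 s2 h2, of k a] unfolding half2 .
  have nz: "pochhammer ((of_nat ?n - complex_of_real p) / 2) k \<noteq> 0" using p by (intro pochhammer_nonzero) simp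
  have "gmass ?n (of_real (- p)) \<noteq> 0" using p by (intro gmass_nonzero) auto
  then have E: "(\<Sum>j\<le>k. ((-1) ^ j / fact (k - j)) * pochhammer (of_real p / 2) j * I j) = pochhammer ((of_nat ?n - of_real p) / 2) k * (LINT \<theta>|sphere_measure. w \<theta> * zonal k a \<theta>)"
    using W(4)[OF schwartz_zonal_gauss[of k a]] L R unfolding W1_def by simp
  have "(LINT \<theta>|sphere_measure. g \<theta> * Ip_zonal (of_real p) k a \<theta>) = (LINT \<theta>|sphere_measure. (\<Sum>j\<le>k. zcoef ?n (of_real p) k j * (g \<theta> * zonal j a \<theta>)))"
    unfolding Ip_zonal_def by (intro Bochner_Integration.integral_cong refl) (simp only: sum_distrib_left mult_ac)
  also have "... = (\<Sum>j\<le>k. zcoef ?n (of_real p) k j * I j)"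
    unfolding I_def
    by (subst Bochner_Integration.integral_sum) (intro integrable_mult_right sphere_integrable continuous_on_mult gcont continuous_zonal, simp only: integral_mult_right_zero)
  also have "... = (\<Sum>j\<le>k. ((-1) ^ j / fact (k - j)) * pochhammer (of_real p / 2) j * I j) / pochhammer ((of_nat ?n - of_real p) / 2) k"
    unfolding zcoef_def sum_divide_distrib by (intro sum.cong refl) simp
  also have "... = (LINT \<theta>|sphere_measure. w \<theta> * zonal k a \<theta>)" unfolding E using nz by simp
  finally show ?thesis unfolding w_def ..
qed

section \<open>The kernel on the imaginary axis\<close>

text \<open>
  Integration by parts in a direction orthogonal to \<open>\<xi>\<close>, which does not see \<open>h (x \<bullet> \<xi>)\<close>: the
  transversal coordinate contributes only its Gaussian moments.
\<close>

lemma gauss_ibp_transversal: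
  fixes \<xi> \<eta> :: "real ^ 'n" and h :: "real => complex"
  assumes h: "h \<in> borel_measurable borel" "\<And>s. norm (h s) \<le> 1" and orth: "\<eta> \<bullet> \<xi> = 0"
  defines "J \<equiv> \<lambda>l q. (LINT x|lborel. h (x \<bullet> \<xi>) * (of_real ((x \<bullet> \<xi>) ^ q * (x \<bullet> \<eta>) ^ l) * gauss x))"
  shows "integrable lborel (\<lambda>x. h (x \<bullet> \<xi>) * (of_real ((x \<bullet> \<xi>) ^ q * (x \<bullet> \<eta>) ^ l) * gauss x))"
    "J l q = of_real (gmom l * (\<eta> \<bullet> \<eta>) ^ (l div 2)) * J 0 q"
proof -
  have [measurable]: "h \<in> borel_measurable borel" by fact
  have sch: "schwartz (\<lambda>x. of_real ((x \<bullet> \<xi>) ^ q * (x \<bullet> \<eta>) ^ l) * gauss x)" for q l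
    using schwartz_power_mult[OF schwartz_monomial_gauss(1)[of \<eta> l], of \<xi> q] by (simp add: mult.assoc)
  have int: "integrable lborel (\<lambda>x. h (x \<bullet> \<xi>) * (of_real ((x \<bullet> \<xi>) ^ q * (x \<bullet> \<eta>) ^ l) * gauss x))" for q l
  proof (rule Bochner_Integration.integrable_bound[OF schwartz_integrable[OF sch]])
    have [measurable]: "(\<lambda>x. of_real ((x \<bullet> \<xi>) ^ q * (x \<bullet> \<eta>) ^ l) * gauss x) \<in> borel_measurable borel"
      by (rule schwartz_measurable[OF sch])
    show "(\<lambda>x. h (x \<bullet> \<xi>) * (of_real ((x \<bullet> \<xi>) ^ q * (x \<bullet> \<eta>) ^ l) * gauss x)) \<in> borel_measurable lborel" by measurable
    show "AE x in lborel. norm (h (x \<bullet> \<xi>) * (of_real ((x \<bullet> \<xi>) ^ q * (x \<bullet> \<eta>) ^ l) * gauss x)) \<le> norm (of_real ((x \<bullet> \<xi>) ^ q * (x \<bullet> \<eta>) ^ l) * gauss x)"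
      by (intro AE_I2) (subst norm_mult, rule mult_left_le_one_le, auto simp: h(2))
  qed
  then show "integrable lborel (\<lambda>x. h (x \<bullet> \<xi>) * (of_real ((x \<bullet> \<xi>) ^ q * (x \<bullet> \<eta>) ^ l) * gauss x))" .
  have ibp: "of_nat l * of_real (\<eta> \<bullet> \<eta>) * J (l - 1) q - J (Suc l) q = 0" for l q
  proof -
    let ?m = "\<lambda>l x. of_real ((x \<bullet> \<xi>) ^ q * (x \<bullet> \<eta>) ^ l) * gauss x"
    let ?u' = "\<lambda>x. of_nat l * of_real (\<eta> \<bullet> \<eta>) * (h (x \<bullet> \<xi>) * ?m (l - 1) x) - h (x \<bullet> \<xi>) * ?m (Suc l) x"
    have line: "(x + t *\<^sub>R \<eta>) \<bullet> \<xi> = x \<bullet> \<xi>" for x t by (simp add: inner_add_left orth)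
    have "(LINT x|lborel. ?u' x) = 0"
    proof (rule integral_directional_derivative[where v=\<eta> and u="\<lambda>x. h (x \<bullet> \<xi>) * ?m l x"])
      show "integrable lborel (\<lambda>x. h (x \<bullet> \<xi>) * ?m l x)" by (rule int)
      show "integrable lborel ?u'" by (intro Bochner_Integration.integrable_diff integrable_mult_right int)
      show "((\<lambda>t. h ((x + t *\<^sub>R \<eta>) \<bullet> \<xi>) * ?m l (x + t *\<^sub>R \<eta>)) has_vector_derivative ?u' x) (at 0)" for x
      proof -
        have 1: "((\<lambda>t. of_real ((x \<bullet> \<xi>) ^ q * (x \<bullet> \<eta> + t * (\<eta> \<bullet> \<eta>)) ^ l) :: complex) has_vector_derivative
            of_real ((x \<bullet> \<xi>) ^ q * (real l * (x \<bullet> \<eta>) ^ (l - 1) * (\<eta> \<bullet> \<eta>)))) (at 0)"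
          by (rule has_vector_derivative_of_real) (auto intro!: derivative_eq_intros simp: has_real_derivative_iff_has_vector_derivative[symmetric])
        have "((\<lambda>t. x + t *\<^sub>R \<eta>) has_derivative (\<lambda>t. t *\<^sub>R \<eta>)) (at (0::real))"
          by (auto intro!: derivative_eq_intros)
        moreover have "(gauss has_derivative (\<lambda>h. of_real (- (x \<bullet> h)) * gauss x)) (at (x + 0 *\<^sub>R \<eta>))"
          using gauss_deriv by simp
        ultimately have "((\<lambda>t. gauss (x + t *\<^sub>R \<eta>)) has_derivative (\<lambda>t. of_real (- (x \<bullet> (t *\<^sub>R \<eta>))) * gauss x)) (at 0)"
          by (rule has_derivative_compose)
        then have 2: "((\<lambda>t. gauss (x + t *\<^sub>R \<eta>)) has_vector_derivative of_real (- (x \<bullet> \<eta>)) * gauss x) (at 0)"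
          by (simp add: has_vector_derivative_def scaleR_conv_of_real[of _ "_::complex"] mult.assoc)
        from has_vector_derivative_mult_right[OF has_vector_derivative_mult[OF 1 2], of "h (x \<bullet> \<xi>)"]
        show ?thesis unfolding inner_add_left inner_scaleR_left orth mult_zero_right add_0_right by (simp add: algebra_simps)
      qed
      show "continuous_on UNIV (\<lambda>t::real. ?u' (x + t *\<^sub>R \<eta>))" for x
        unfolding inner_add_left inner_scaleR_left orth mult_zero_right add_0_right gauss_def
        by (intro continuous_on_diff continuous_on_mult continuous_on_const continuous_on_of_real continuous_on_power
            continuous_on_add continuous_on_id continuous_on_exp continuous_on_minus continuous_on_divide continuous_on_norm continuous_on_scaleR) simp_all
    qed
    then show ?thesis
      unfolding J_def
      by (subst (asm) Bochner_Integration.integral_diff) (intro integrable_mult_right int, rule int, simp only: integral_mult_right_zero)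
  qed
  have "J l q = of_real (gmom l * (\<eta> \<bullet> \<eta>) ^ (l div 2)) * J 0 q \<and> J (Suc l) q = of_real (gmom (Suc l) * (\<eta> \<bullet> \<eta>) ^ (Suc l div 2)) * J 0 q" for l
  proof (induction l)
    case 0
    show ?case using ibp[of 0 q] by simp
  next
    case (Suc l)
    have "J (Suc (Suc l)) q = of_nat (Suc l) * of_real (\<eta> \<bullet> \<eta>) * J l q" using ibp[of "Suc l" q] by simp
    also have "... = of_real (gmom (Suc (Suc l)) * (\<eta> \<bullet> \<eta>) ^ (Suc (Suc l) div 2)) * J 0 q"
      using Suc.IH by simp
    finally show ?case using Suc.IH by blast
  qed
  then show "J l q = of_real (gmom l * (\<eta> \<bullet> \<eta>) ^ (l div 2)) * J 0 q" by blast
qed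

text \<open>
  Expanding the powers of \<open>1 - X\<close> and collecting powers of \<open>X\<close> leaves for each of them one
  Chu-Vandermonde sum with \<open>c = 1 / 2\<close>.
\<close>

lemma bernstein_chu_vandermonde:
  fixes X \<alpha> :: complex
  shows "(\<Sum>i\<le>k. (4 ^ i * X ^ i / fact (2 * i)) * (1 - X) ^ (k - i) * pochhammer \<alpha> i / fact (k - i))
    = (\<Sum>j\<le>k. (-1) ^ j * (4 ^ j * X ^ j / fact (2 * j)) * pochhammer (1 / 2 - \<alpha>) j / fact (k - j))"
proof -
  have fd: "(4::complex) ^ i / fact (2 * i) = 1 / (fact i * pochhammer (1 / 2) i)" for i
    using fact_double[of i, where 'a=complex] by (simp add: power_mult)
  have half: "1 / 2 + of_nat i \<noteq> (0::complex)" for i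
  proof
    assume "1 / 2 + of_nat i = (0::complex)"
    then have "Re (1 / 2 + of_nat i) = Re 0" by (rule arg_cong)
    then show False by simp
  qed
  let ?g = "\<lambda>i l. (4 ^ i * X ^ i / fact (2 * i)) * pochhammer \<alpha> i * ((- X) ^ l / (fact l * fact (k - (i + l))))"
  have "(\<Sum>i\<le>k. (4 ^ i * X ^ i / fact (2 * i)) * (1 - X) ^ (k - i) * pochhammer \<alpha> i / fact (k - i)) = (\<Sum>i\<le>k. \<Sum>l\<le>k - i. ?g i l)"
  proof (rule sum.cong[OF refl])
    fix i assume i: "i \<in> {..k}"
    have "(1 - X) ^ (k - i) / fact (k - i) = (\<Sum>l\<le>k - i. (- X) ^ l / (fact l * fact (k - (i + l))))"
    proof -
      have "(1 - X) ^ (k - i) = (\<Sum>l\<le>k - i. of_nat (k - i choose l) * (- X) ^ l * 1 ^ (k - i - l))"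
        using binomial_ring[of "- X" 1 "k - i"] by simp
      then show ?thesis
        unfolding sum_divide_distrib
        by (simp only:, unfold sum_divide_distrib) (intro sum.cong refl, simp add: binomial_fact)
    qed
    moreover have "(4 ^ i * X ^ i / fact (2 * i)) * (1 - X) ^ (k - i) * pochhammer \<alpha> i / fact (k - i) = (4 ^ i * X ^ i / fact (2 * i)) * pochhammer \<alpha> i * ((1 - X) ^ (k - i) / fact (k - i))"
      by simp
    ultimately show "(4 ^ i * X ^ i / fact (2 * i)) * (1 - X) ^ (k - i) * pochhammer \<alpha> i / fact (k - i) = (\<Sum>l\<le>k - i. ?g i l)"
      by (simp only: sum_distrib_left)
  qed
  also have "... = (\<Sum>(i, l)\<in>Sigma {..k} (\<lambda>i. {..k - i}). ?g i l)" by (rule sum.Sigma) auto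
  also have "Sigma {..k} (\<lambda>i. {..k - i}) = {(i, l). i + l \<le> k}" by auto
  also have "(\<Sum>(i, l)\<in>{(i, l). i + l \<le> k}. ?g i l) = (\<Sum>j\<le>k. \<Sum>i\<le>j. ?g i (j - i))" by (rule sum.triangle_reindex_eq)
  also have "... = (\<Sum>j\<le>k. (-1) ^ j * (4 ^ j * X ^ j / fact (2 * j)) * pochhammer (1 / 2 - \<alpha>) j / fact (k - j))"
  proof (rule sum.cong[OF refl])
    fix j assume j: "j \<in> {..k}"
    have "(\<Sum>i\<le>j. ?g i (j - i)) = (\<Sum>i\<le>j. (-1) ^ j * X ^ j / (fact (k - j) * fact j) * ((-1) ^ i * of_nat (j choose i) * pochhammer \<alpha> i / pochhammer (1 / 2) i))"
    proof (rule sum.cong[OF refl])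
      fix i assume "i \<in> {..j}"
      then have i: "i \<le> j" by simp
      have s: "(- X) ^ (j - i) * X ^ i = (-1) ^ j * (-1) ^ i * X ^ j"
      proof -
        have "(- X) ^ (j - i) = (-1) ^ (j - i) * X ^ (j - i)" by (simp add: power_minus[of X])
        moreover have "(-1::complex) ^ (j - i) = (-1) ^ j * (-1) ^ i"
          using i by (auto simp: minus_one_power_iff)
        moreover have "X ^ (j - i) * X ^ i = X ^ j" using i by (simp add: power_add[symmetric])
        ultimately show ?thesis by (simp add: mult_ac)
      qed
      have b: "of_nat (j choose i) = (fact j / (fact i * fact (j - i)) :: complex)" by (rule binomial_fact[OF i])
      have "?g i (j - i) = ((4 ^ i / fact (2 * i)) * pochhammer \<alpha> i) * (((- X) ^ (j - i) * X ^ i) / (fact (j - i) * fact (k - j)))"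
        using i by simp
      also have "... = (-1) ^ j * X ^ j / (fact (k - j) * fact j) * ((-1) ^ i * of_nat (j choose i) * pochhammer \<alpha> i / pochhammer (1 / 2) i)"
        unfolding s fd b by (simp add: mult_ac)
      finally show "?g i (j - i) = (-1) ^ j * X ^ j / (fact (k - j) * fact j) * ((-1) ^ i * of_nat (j choose i) * pochhammer \<alpha> i / pochhammer (1 / 2) i)" .
    qed
    also have "... = (-1) ^ j * X ^ j / (fact (k - j) * fact j) * (pochhammer (1 / 2 - \<alpha>) j / pochhammer (1 / 2) j)"
      unfolding sum_distrib_left[symmetric] chu_vandermonde[OF half] ..
    also have "... = (-1) ^ j * ((4 ^ j / fact (2 * j)) * X ^ j) * pochhammer (1 / 2 - \<alpha>) j / fact (k - j)"
      unfolding fd by simp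
    finally show "(\<Sum>i\<le>j. ?g i (j - i)) = (-1) ^ j * (4 ^ j * X ^ j / fact (2 * j)) * pochhammer (1 / 2 - \<alpha>) j / fact (k - j)" by simp
  qed
  finally show ?thesis .
qed

text \<open>
  The kernel \<open>\<bar>s\<bar> powr - z\<close> at \<open>z = iy\<close>.
\<close>

definition imag_power :: "real => real => complex" where
  "imag_power y s = of_real \<bar>s\<bar> powr (- \<i> * of_real y)"

lemma norm_imag_power_le: "norm (imag_power y s) \<le> 1"
  by (cases "s = 0") (auto simp: imag_power_def norm_powr_real_powr)

lemma measurable_imag_power[measurable]: "imag_power y \<in> borel_measurable borel"
  unfolding imag_power_def by measurable

text \<open>
  The Gaussian integral of the kernel.
\<close>

definition kernel_mass :: "nat => real => complex" where
  "kernel_mass n y = of_real ((2 * pi) powr (real n / 2)) * of_real (2 / sqrt (2 * pi)) * 2 powr ((1 - \<i> * of_real y) / 2 - 1) * Gamma ((1 - \<i> * of_real y) / 2)"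

lemma gauss_imag_power_moment:
  fixes \<xi> :: "real ^ 'n"
  assumes \<xi>: "norm \<xi> = 1"
  shows "(LINT x|lborel. imag_power y (x \<bullet> \<xi>) * (of_real ((x \<bullet> \<xi>) ^ (2 * i)) * gauss x))
    = kernel_mass CARD('n) y * 2 ^ i * pochhammer ((1 - \<i> * of_real y) / 2) i"
proof -
  let ?c = "complex_of_real ((2 * pi) powr (real CARD('n) / 2))"
  define \<alpha> where "\<alpha> = (1 - \<i> * complex_of_real y) / 2"
  define f where "f s = imag_power y s * of_real (s ^ (2 * i))" for s
  have [measurable]: "f \<in> borel_measurable borel" unfolding f_def by measurable
  have "(LINT x|lborel. imag_power y (x \<bullet> \<xi>) * (of_real ((x \<bullet> \<xi>) ^ (2 * i)) * gauss x)) = (LINT x|lborel. f (x \<bullet> \<xi>) * gauss x)"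
    by (simp add: f_def mult.assoc)
  also have "... = ?c * (LINT s|lborel. std_normal_density s *\<^sub>R f s)" by (rule gauss_marginal[OF \<xi>]) simp
  also have "(LINT s|lborel. std_normal_density s *\<^sub>R f s) = 2 * (LINT s|lborel. indicator {0<..} s *\<^sub>R (std_normal_density s *\<^sub>R f s))"
  proof (rule integral_even_half)
    have "integrable lborel (\<lambda>s. std_normal_density s * s ^ (2 * i))"
      using std_normal_moment_even[of i] by (rule integrable.intros)
    then show "integrable lborel (\<lambda>s. std_normal_density s *\<^sub>R f s)"
    proof (rule Bochner_Integration.integrable_bound)
      show "AE s in lborel. norm (std_normal_density s *\<^sub>R f s) \<le> norm (std_normal_density s * s ^ (2 * i))"
        using norm_imag_power_le[of y] by (intro AE_I2) (auto simp: f_def norm_mult norm_power abs_mult power_abs intro!: mult_left_mono mult_left_le_one_le)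
    qed measurable
    show "std_normal_density (- s) *\<^sub>R f (- s) = std_normal_density s *\<^sub>R f s" for s
      by (simp add: f_def imag_power_def std_normal_density_def)
  qed
  also have "(LINT s|lborel. indicator {0<..} s *\<^sub>R (std_normal_density s *\<^sub>R f s))
     = (LINT s|lborel. of_real (1 / sqrt (2 * pi)) * (indicator {0<..} s *\<^sub>R (complex_of_real s powr (2 * \<alpha> + of_nat (2 * i) - 1) * of_real (exp (- (s\<^sup>2 / 2))))))"
  proof (rule Bochner_Integration.integral_cong[OF refl])
    fix s :: real
    show "indicator {0<..} s *\<^sub>R (std_normal_density s *\<^sub>R f s) = of_real (1 / sqrt (2 * pi)) * (indicator {0<..} s *\<^sub>R (complex_of_real s powr (2 * \<alpha> + of_nat (2 * i) - 1) * of_real (exp (- (s\<^sup>2 / 2)))))"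
    proof (cases "s > 0")
      case True
      have "2 * \<alpha> + of_nat (2 * i) - 1 = - \<i> * complex_of_real y + of_nat (2 * i)"
      proof -
        have "2 * \<alpha> = 1 - \<i> * complex_of_real y" by (simp add: \<alpha>_def)
        then show ?thesis by simp
      qed
      then have "complex_of_real s powr (2 * \<alpha> + of_nat (2 * i) - 1) = f s"
        using True by (simp only: powr_add f_def imag_power_def) (simp add: powr_nat' del: of_nat_mult)
      then show ?thesis using True by (simp add: std_normal_density_def scaleR_conv_of_real[of _ "_::complex"])
    qed simp
  qed
  also have "... = of_real (1 / sqrt (2 * pi)) * (2 powr ((2 * \<alpha> + of_nat (2 * i)) / 2 - 1) * Gamma ((2 * \<alpha> + of_nat (2 * i)) / 2))"
    unfolding integral_mult_right_zero
    by (subst gaussian_mellin(2)) (simp_all add: \<alpha>_def)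
  also have "(2 * \<alpha> + of_nat (2 * i)) / 2 = \<alpha> + of_nat i" by (simp add: field_simps)
  also have "Gamma (\<alpha> + of_nat i) = pochhammer \<alpha> i * Gamma \<alpha>" by (rule Gamma_plus_nat) (simp add: \<alpha>_def)
  also have "(2::complex) powr (\<alpha> + of_nat i - 1) = 2 powr ((\<alpha> - 1) + of_nat i)"
    by (rule arg_cong[where f="\<lambda>x. 2 powr x"]) (simp only: algebra_simps)
  also have "... = 2 powr (\<alpha> - 1) * 2 ^ i" by (subst powr_add) (simp add: powr_nat')
  finally show ?thesis unfolding kernel_mass_def \<alpha>_def[symmetric] by simp
qed

text \<open>
  Decompose \<open>a\<close> into its component \<open>\<tau>\<close> along \<open>\<xi>\<close> and an orthogonal part. The orthogonal coordinate is
  integrated out, the remaining one-dimensional moments are Gamma values, and the resulting sum in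
  Bernstein form becomes a sum of powers of \<open>\<tau>\<^sup>2\<close> with exactly the entries of the
  matrix of \<open>I\<^bsub>iy\<^esub>\<close>.
\<close>

lemma gauss_imag_power_zonal:
  fixes \<xi> a :: "real ^ 'n"
  assumes \<xi>: "norm \<xi> = 1" and a: "norm a = 1"
  shows "(LINT x|lborel. imag_power y (x \<bullet> \<xi>) * (zonal k a x * gauss x))
    = kernel_mass CARD('n) y * 2 ^ k * (\<Sum>j\<le>k. (-1) ^ j * pochhammer (\<i> * of_real y / 2) j / fact (k - j) * zonal j a \<xi>)"
proof -
  define \<tau> where "\<tau> = a \<bullet> \<xi>"
  define \<eta> where "\<eta> = a - \<tau> *\<^sub>R \<xi>"
  define \<alpha> where "\<alpha> = (1 - \<i> * complex_of_real y) / 2"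
  let ?b = "\<lambda>i. complex_of_real (fact (2 * k) / (fact (2 * i) * 2 ^ (k - i) * fact (k - i)))"
  let ?r = "\<lambda>i. complex_of_real (\<tau> ^ (2 * i) * (1 - \<tau>\<^sup>2) ^ (k - i)) * (kernel_mass CARD('n) y * 2 ^ i * pochhammer \<alpha> i)"
  have xx: "\<xi> \<bullet> \<xi> = 1" and aa: "a \<bullet> a = 1" using \<xi> a by (simp_all add: norm_eq_1)
  have orth: "\<eta> \<bullet> \<xi> = 0" by (simp add: \<eta>_def inner_diff_left \<tau>_def xx)
  have ee: "\<eta> \<bullet> \<eta> = 1 - \<tau>\<^sup>2" by (simp add: \<eta>_def inner_diff_left inner_diff_right \<tau>_def xx aa inner_commute power2_eq_square)
  have dec: "x \<bullet> a = x \<bullet> \<eta> + \<tau> * (x \<bullet> \<xi>)" for x by (simp add: \<eta>_def inner_diff_right)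
  define J where "J l q = (LINT x|lborel. imag_power y (x \<bullet> \<xi>) * (of_real ((x \<bullet> \<xi>) ^ q * (x \<bullet> \<eta>) ^ l) * gauss x))" for l q
  note T = gauss_ibp_transversal[OF measurable_imag_power norm_imag_power_le orth]
  have J: "J l q = of_real (gmom l * (1 - \<tau>\<^sup>2) ^ (l div 2)) * J 0 q" for l q
    unfolding J_def ee[symmetric] by (rule T(2))
  have J0: "J 0 (2 * i) = kernel_mass CARD('n) y * 2 ^ i * pochhammer \<alpha> i" for i
    unfolding J_def \<alpha>_def using gauss_imag_power_moment[OF \<xi>, of y i] by simp
  have "(LINT x|lborel. imag_power y (x \<bullet> \<xi>) * (of_real ((x \<bullet> a) ^ (2 * k)) * gauss x))
    = (LINT x|lborel. (\<Sum>l\<le>2 * k. of_real (of_nat (2 * k choose l) * \<tau> ^ (2 * k - l)) * (imag_power y (x \<bullet> \<xi>) * (of_real ((x \<bullet> \<xi>) ^ (2 * k - l) * (x \<bullet> \<eta>) ^ l) * gauss x))))"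
  proof (rule Bochner_Integration.integral_cong[OF refl])
    fix x
    have "(x \<bullet> a) ^ (2 * k) = (\<Sum>l\<le>2 * k. (of_nat (2 * k choose l) * \<tau> ^ (2 * k - l)) * ((x \<bullet> \<xi>) ^ (2 * k - l) * (x \<bullet> \<eta>) ^ l))"
      unfolding dec binomial_ring by (intro sum.cong refl) (simp add: power_mult_distrib mult_ac)
    then show "imag_power y (x \<bullet> \<xi>) * (of_real ((x \<bullet> a) ^ (2 * k)) * gauss x) = (\<Sum>l\<le>2 * k. of_real (of_nat (2 * k choose l) * \<tau> ^ (2 * k - l)) * (imag_power y (x \<bullet> \<xi>) * (of_real ((x \<bullet> \<xi>) ^ (2 * k - l) * (x \<bullet> \<eta>) ^ l) * gauss x)))"
      by (simp only: of_real_sum of_real_mult sum_distrib_left sum_distrib_right) (intro sum.cong refl, simp only: mult_ac)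
  qed
  also have "... = (\<Sum>l\<le>2 * k. of_real (of_nat (2 * k choose l) * \<tau> ^ (2 * k - l)) * J l (2 * k - l))"
    unfolding J_def
    by (subst Bochner_Integration.integral_sum) (intro integrable_mult_right T(1), intro sum.cong refl integral_mult_right_zero)
  also have "... = (\<Sum>l\<le>2 * k. of_nat (2 * k choose l) * of_real (gmom l) * (of_real (\<tau> ^ (2 * k - l) * (1 - \<tau>\<^sup>2) ^ (l div 2)) * J 0 (2 * k - l)))"
    by (intro sum.cong refl, subst J) (simp only: of_real_mult of_real_of_nat_eq mult_ac)
  also have "... = (\<Sum>i\<le>k. ?b i * (of_real (\<tau> ^ (2 * k - 2 * (k - i)) * (1 - \<tau>\<^sup>2) ^ (2 * (k - i) div 2)) * J 0 (2 * k - 2 * (k - i))))"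
    by (rule sum_gmom_even)
  also have "... = (\<Sum>i\<le>k. ?b i * ?r i)"
  proof (rule sum.cong[OF refl])
    fix i assume "i \<in> {..k}"
    then have e: "2 * k - 2 * (k - i) = 2 * i" "2 * (k - i) div 2 = k - i" by auto
    show "?b i * (of_real (\<tau> ^ (2 * k - 2 * (k - i)) * (1 - \<tau>\<^sup>2) ^ (2 * (k - i) div 2)) * J 0 (2 * k - 2 * (k - i)))
      = ?b i * ?r i"
      unfolding e J0 ..
  qed
  finally have M: "(LINT x|lborel. imag_power y (x \<bullet> \<xi>) * (of_real ((x \<bullet> a) ^ (2 * k)) * gauss x)) = ..." .
  have "(LINT x|lborel. imag_power y (x \<bullet> \<xi>) * (zonal k a x * gauss x)) = of_real (4 ^ k / fact (2 * k)) * (LINT x|lborel. imag_power y (x \<bullet> \<xi>) * (of_real ((x \<bullet> a) ^ (2 * k)) * gauss x))"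
    unfolding zonal_def integral_mult_right_zero[symmetric] by (intro Bochner_Integration.integral_cong refl) simp
  also have "... = kernel_mass CARD('n) y * 2 ^ k * (\<Sum>i\<le>k. (4 ^ i * (of_real (\<tau>\<^sup>2)) ^ i / fact (2 * i)) * (1 - of_real (\<tau>\<^sup>2)) ^ (k - i) * pochhammer \<alpha> i / fact (k - i))"
    unfolding M sum_distrib_left
  proof (rule sum.cong[OF refl])
    fix i assume "i \<in> {..k}"
    then have i: "i \<le> k" by simp
    have "(4::real) ^ k * 2 ^ i = 2 ^ k * 4 ^ i * 2 ^ (k - i)"
    proof -
      have four: "(4::real) ^ m = 2 ^ m * 2 ^ m" for m by (simp add: power_mult_distrib[symmetric])
      have two: "(2::real) ^ k = 2 ^ i * 2 ^ (k - i)" using i by (simp add: power_add[symmetric])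
      have "(4::real) ^ k * 2 ^ i = 2 ^ k * 2 ^ k * 2 ^ i" by (simp only: four)
      also have "... = 2 ^ k * (2 ^ i * 2 ^ (k - i)) * 2 ^ i" by (simp only: two[symmetric])
      also have "... = 2 ^ k * 4 ^ i * 2 ^ (k - i)" by (simp only: four mult_ac)
      finally show ?thesis .
    qed
    then have "(4::real) ^ k / fact (2 * k) * (fact (2 * k) / (fact (2 * i) * 2 ^ (k - i) * fact (k - i))) * 2 ^ i = 2 ^ k * (4 ^ i / (fact (2 * i) * fact (k - i)))"
      by (simp add: field_simps)
    then have "complex_of_real ((4::real) ^ k / fact (2 * k) * (fact (2 * k) / (fact (2 * i) * 2 ^ (k - i) * fact (k - i))) * 2 ^ i) = of_real (2 ^ k * (4 ^ i / (fact (2 * i) * fact (k - i))))" by (rule arg_cong)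
    then have q: "of_real ((4::real) ^ k / fact (2 * k)) * (?b i * 2 ^ i) = complex_of_real (2 ^ k * (4 ^ i / (fact (2 * i) * fact (k - i))))"
      by (simp only: of_real_mult of_real_power of_real_numeral mult.assoc)
    have "of_real (4 ^ k / fact (2 * k)) * (?b i * ?r i)
      = (of_real ((4::real) ^ k / fact (2 * k)) * (?b i * 2 ^ i)) * (of_real (\<tau> ^ (2 * i) * (1 - \<tau>\<^sup>2) ^ (k - i)) * (kernel_mass CARD('n) y * pochhammer \<alpha> i))"
      by (simp only: mult_ac)
    also have "... = kernel_mass CARD('n) y * 2 ^ k * ((4 ^ i * (of_real (\<tau>\<^sup>2)) ^ i / fact (2 * i)) * (1 - of_real (\<tau>\<^sup>2)) ^ (k - i) * pochhammer \<alpha> i / fact (k - i))"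
      unfolding q by (simp add: power_mult)
    finally show "of_real (4 ^ k / fact (2 * k)) * (?b i * ?r i)
      = kernel_mass CARD('n) y * 2 ^ k * ((4 ^ i * (of_real (\<tau>\<^sup>2)) ^ i / fact (2 * i)) * (1 - of_real (\<tau>\<^sup>2)) ^ (k - i) * pochhammer \<alpha> i / fact (k - i))" .
  qed
  also have "... = kernel_mass CARD('n) y * 2 ^ k * (\<Sum>j\<le>k. (-1) ^ j * (4 ^ j * (of_real (\<tau>\<^sup>2)) ^ j / fact (2 * j)) * pochhammer (1 / 2 - \<alpha>) j / fact (k - j))"
    unfolding bernstein_chu_vandermonde ..
  also have "1 / 2 - \<alpha> = \<i> * of_real y / 2" by (simp add: \<alpha>_def field_simps)
  also have "(\<Sum>j\<le>k. (-1) ^ j * (4 ^ j * (of_real (\<tau>\<^sup>2)) ^ j / fact (2 * j)) * pochhammer (\<i> * of_real y / 2) j / fact (k - j))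
    = (\<Sum>j\<le>k. (-1) ^ j * pochhammer (\<i> * of_real y / 2) j / fact (k - j) * zonal j a \<xi>)"
  proof (intro sum.cong refl)
    fix j
    have pw: "(complex_of_real (\<tau>\<^sup>2)) ^ j = of_real (\<tau> ^ (2 * j))" by (simp add: power_mult)
    have "zonal j a \<xi> = 4 ^ j * of_real (\<tau> ^ (2 * j)) / fact (2 * j)" by (simp add: zonal_def \<tau>_def inner_commute)
    then show "(-1) ^ j * (4 ^ j * (of_real (\<tau>\<^sup>2)) ^ j / fact (2 * j)) * pochhammer (\<i> * of_real y / 2) j / fact (k - j) = (-1) ^ j * pochhammer (\<i> * of_real y / 2) j / fact (k - j) * zonal j a \<xi>"
      unfolding pw by (simp only: times_divide_eq_left times_divide_eq_right mult_ac divide_divide_eq_left)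
  qed
  finally show ?thesis .
qed

section \<open>A three lines theorem with exponential growth on one edge\<close>

lemma tendsto_z_Ln_0:
  fixes L :: real
  assumes L: "L > 0"
  shows "((\<lambda>z. z * Ln (z / of_real L)) \<longlongrightarrow> 0) (at 0)"
proof -
  have "((\<lambda>t::real. t * (\<bar>ln (t / L)\<bar> + pi)) \<longlongrightarrow> 0) (at_right 0)" using L by real_asymp
  moreover have "filterlim norm (at_right 0) (at (0::complex))"
    by (auto simp: filterlim_at eventually_at_filter intro!: tendsto_eq_intros)
  ultimately have lim: "((\<lambda>z::complex. norm z * (\<bar>ln (norm z / L)\<bar> + pi)) \<longlongrightarrow> 0) (at 0)"
    by (rule filterlim_compose)
  show ?thesis
  proof (rule Lim_null_comparison[OF _ lim])
    have "norm (z * Ln (z / of_real L)) \<le> norm z * (\<bar>ln (norm z / L)\<bar> + pi)" if "z \<noteq> 0" for z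
    proof -
      have w: "z / of_real L \<noteq> 0" using that L by simp
      have "norm (Ln (z / of_real L)) \<le> \<bar>Re (Ln (z / of_real L))\<bar> + \<bar>Im (Ln (z / of_real L))\<bar>" by (rule cmod_le)
      also have "Re (Ln (z / of_real L)) = ln (norm z / L)" using w L by (simp add: norm_divide)
      also have "\<bar>Im (Ln (z / of_real L))\<bar> \<le> pi" using mpi_less_Im_Ln[OF w] Im_Ln_le_pi[OF w] by linarith
      finally show ?thesis by (simp add: norm_mult mult_left_mono)
    qed
    then show "\<forall>\<^sub>F z in at 0. norm (z * Ln (z / of_real L)) \<le> norm z * (\<bar>ln (norm z / L)\<bar> + pi)"
      by (auto simp: eventually_at_filter)
  qed
qed

text \<open>
  For \<open>t \<ge> 0\<close> the derivative in \<open>t\<close> is minus the argument of \<open>1 + it\<close>; negative \<open>t\<close> follow by conjugation.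
\<close>

lemma Re_z_Ln_one_plus_imag_nonpos: "Re ((1 + \<i> * of_real t) * Ln (1 + \<i> * of_real t)) \<le> 0"
proof -
  have pos: "Re ((1 + \<i> * of_real t) * Ln (1 + \<i> * of_real t)) \<le> 0" if t: "t \<ge> 0" for t
  proof -
    let ?k = "\<lambda>t. Re ((1 + \<i> * complex_of_real t) * Ln (1 + \<i> * of_real t))"
    have "?k t \<le> ?k 0"
    proof (rule DERIV_nonpos_imp_nonincreasing[OF t])
      fix x :: real assume x: "0 \<le> x" "x \<le> t"
      have nz: "1 + \<i> * complex_of_real x \<notin> \<real>\<^sub>\<le>\<^sub>0" by (auto simp: complex_nonpos_Reals_iff)
      then have nz': "1 + \<i> * complex_of_real x \<noteq> 0" by auto
      have "((\<lambda>w. (1 + \<i> * w) * Ln (1 + \<i> * w)) has_field_derivative (\<i> * Ln (1 + \<i> * of_real x) + \<i>)) (at (of_real x))"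
      proof -
        have d1: "((\<lambda>w. 1 + \<i> * w) has_field_derivative \<i>) (at (of_real x))" by (auto intro!: derivative_eq_intros)
        have d2: "((\<lambda>w. Ln (1 + \<i> * w)) has_field_derivative (inverse (1 + \<i> * of_real x) * \<i>)) (at (of_real x))"
          by (rule DERIV_chain2[OF has_field_derivative_Ln[OF nz] d1])
        show ?thesis by (rule DERIV_cong[OF DERIV_mult'[OF d1 d2]]) (use nz' in \<open>simp add: mult.assoc[symmetric]\<close>)
      qed
      then have "((\<lambda>t. (1 + \<i> * complex_of_real t) * Ln (1 + \<i> * of_real t)) has_vector_derivative (\<i> * Ln (1 + \<i> * of_real x) + \<i>)) (at x)"
        by (rule has_vector_derivative_real_field)
      from has_derivative_Re[OF this[unfolded has_vector_derivative_def]]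
      have "(?k has_real_derivative (- Im (Ln (1 + \<i> * of_real x)))) (at x)"
        unfolding has_field_derivative_def by (rule has_derivative_eq_rhs) (auto simp: algebra_simps)
      moreover have "Im (Ln (1 + \<i> * of_real x)) \<ge> 0"
        using Im_Ln_pos_le[OF nz'] x by simp
      ultimately show "\<exists>D. (?k has_real_derivative D) (at x) \<and> D \<le> 0" by (intro exI conjI) auto
    qed
    then show ?thesis by simp
  qed
  show ?thesis
  proof (cases "t \<ge> 0")
    case False
    have nz: "1 + \<i> * complex_of_real t \<notin> \<real>\<^sub>\<le>\<^sub>0" by (auto simp: complex_nonpos_Reals_iff)
    have "Re ((1 + \<i> * of_real t) * Ln (1 + \<i> * of_real t)) = Re (cnj ((1 + \<i> * of_real t) * Ln (1 + \<i> * of_real t)))" by simp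
    also have "cnj ((1 + \<i> * of_real t) * Ln (1 + \<i> * of_real t)) = (1 + \<i> * of_real (- t)) * Ln (1 + \<i> * of_real (- t))"
      using nz by (simp add: cnj_Ln)
    also have "Re ... \<le> 0" using False by (intro pos) simp
    finally show ?thesis .
  qed (rule pos)
qed

text \<open>
  Multiply by \<open>E z = exp (z Ln (z / L) / 2)\<close>. On the imaginary axis the argument of \<open>z / L\<close> is \<open>\<plusminus> \<pi> / 2\<close>,
  so \<open>\<bar>E (iy)\<bar> = exp (- \<pi> \<bar>y\<bar> / 4)\<close> cancels the growth; on the right edge \<open>\<bar>E\<bar> \<le> 1\<close>; and \<open>1 / E p\<close> is
  the constant \<open>(L / p) powr (p / 2)\<close> of the conclusion.
\<close>

lemma three_lines_weighted:
  fixes \<Phi> :: "complex => complex"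
  assumes L: "L > 0" and hol: "\<Phi> holomorphic_on S" and S: "open S" "{z. 0 \<le> Re z \<and> Re z \<le> L} \<subseteq> S"
    and M: "\<And>z. 0 \<le> Re z ==> Re z \<le> L ==> norm (\<Phi> z) \<le> M"
    and N: "N0 > 0" "N1 > 0"
    and b0: "\<And>y. norm (\<Phi> (\<i> * of_real y)) \<le> N0 * exp (pi * \<bar>y\<bar> / 4)"
    and b1: "\<And>y. norm (\<Phi> (of_real L + \<i> * of_real y)) \<le> N1"
    and p: "0 < p" "p < L"
  shows "norm (\<Phi> (of_real p)) \<le> (L / p) powr (p / 2) * N0 powr (1 - p / L) * N1 powr (p / L)"
proof -
  define E where "E z = exp (z * Ln (z / of_real L) / 2)" for z :: complex
  \<comment> \<open>\<open>W\<close> normalizes both edge bounds to 1, and the Gaussian factor in \<open>\<Psi>\<close> forces decay at infinity.\<close>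
  define W where "W z = exp (- ((1 - z / of_real L) * of_real (ln N0) + (z / of_real L) * of_real (ln N1)))" for z :: complex
  let ?G = "\<lambda>\<epsilon> z :: complex. exp (complex_of_real \<epsilon> * (z\<^sup>2 - of_real (L\<^sup>2)))"
  define \<Psi> where "\<Psi> \<epsilon> z = \<Phi> z * E z * W z * ?G \<epsilon> z" for \<epsilon> z
  have normW: "norm (W z) = exp (- ((1 - Re z / L) * ln N0 + (Re z / L) * ln N1))" for z
    unfolding W_def norm_exp_eq_Re by simp
  have normG: "norm (?G \<epsilon> z) = exp (\<epsilon> * ((Re z)\<^sup>2 - (Im z)\<^sup>2 - L\<^sup>2))" for \<epsilon> z
    unfolding norm_exp_eq_Re by (simp add: power2_eq_square)
  have G1: "\<epsilon> * ((Re z)\<^sup>2 - (Im z)\<^sup>2 - L\<^sup>2) \<le> - \<epsilon> * (Im z)\<^sup>2" if "\<epsilon> > 0" "0 \<le> Re z" "Re z \<le> L" for \<epsilon> z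
  proof -
    have "(Re z)\<^sup>2 \<le> L\<^sup>2" using that by (intro power_mono) auto
    then have "\<epsilon> * ((Re z)\<^sup>2 - (Im z)\<^sup>2 - L\<^sup>2) \<le> \<epsilon> * (- (Im z)\<^sup>2)" using that by (intro mult_left_mono) auto
    then show ?thesis by simp
  qed
  \<comment> \<open>A crude bound inside the strip, needed only to beat it with the Gaussian factor.\<close>
  have reE: "norm (E z) \<le> exp (\<bar>Im z\<bar> / 2)" if z: "0 \<le> Re z" "Re z \<le> L" for z
  proof (cases "z = 0")
    case False
    define w where "w = z / of_real L"
    have w: "w \<noteq> 0" using False L by (simp add: w_def)
    have reL: "Re (Ln w) = ln (norm w)" using w by simp
    have sgn: "Im z * Im (Ln w) \<ge> 0"
    proof (cases "Im z \<ge> 0")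
      case True
      then have "Im w \<ge> 0" using L by (simp add: w_def)
      then have "Im (Ln w) \<ge> 0" using Im_Ln_pos_le[OF w] by simp
      then show ?thesis using True by simp
    next
      case False
      then have "\<not> Im w \<ge> 0" using L by (simp add: w_def zero_le_divide_iff)
      then have "\<not> (0 \<le> Im (Ln w) \<and> Im (Ln w) \<le> pi)" using Im_Ln_pos_le[OF w] by simp
      then have "Im (Ln w) < 0" using Im_Ln_le_pi[OF w] by auto
      then show ?thesis using False by (simp add: mult_nonpos_nonpos)
    qed
    have "Re z * ln (norm w) \<le> \<bar>Im z\<bar>"
    proof (cases "norm w \<le> 1")
      case True
      then have "ln (norm w) \<le> 0" using w by simp
      then have "Re z * ln (norm w) \<le> 0" using z by (simp add: mult_nonneg_nonpos)
      then show ?thesis by simp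
    next
      case False
      have "norm z \<le> Re z + \<bar>Im z\<bar>" using cmod_le[of z] z by simp
      then have "norm z \<le> L + \<bar>Im z\<bar>" using z by simp
      then have "norm w \<le> 1 + \<bar>Im z\<bar> / L" using L by (simp add: w_def norm_divide field_simps)
      then have "ln (norm w) \<le> \<bar>Im z\<bar> / L" using ln_le_minus_one[of "norm w"] w by simp
      then have "Re z * ln (norm w) \<le> L * (\<bar>Im z\<bar> / L)" using z False by (intro mult_mono) auto
      then show ?thesis using L by simp
    qed
    then have "Re (z * Ln w / 2) \<le> \<bar>Im z\<bar> / 2" using sgn reL by simp
    then show ?thesis by (simp add: E_def w_def norm_exp_eq_Re)
  qed (simp add: E_def)
  have E0: "norm (E (\<i> * of_real y)) = exp (- (pi * \<bar>y\<bar> / 4))" for y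
  proof -
    have "Re (\<i> * of_real y * Ln (\<i> * of_real y / of_real L)) = - (pi * \<bar>y\<bar> / 2)"
    proof -
      consider "y = 0" | "y > 0" | "y < 0" by linarith
      then show ?thesis
      proof cases
        case 2
        have "Ln (\<i> * of_real y / of_real L) = Ln (of_real (y / L) * \<i>)" by (simp add: mult.commute)
        also have "... = of_real (ln (y / L)) + Ln \<i>" using 2 L Ln_of_real[of "y / L"] by (subst Ln_times_of_real) auto
        finally show ?thesis using 2 by simp
      next
        case 3
        have "Ln (\<i> * of_real y / of_real L) = Ln (of_real (- y / L) * (- \<i>))" by (simp add: mult.commute)
        also have "... = of_real (ln (- y / L)) + Ln (- \<i>)" using 3 L Ln_of_real[of "- y / L"] by (subst Ln_times_of_real) (auto simp: divide_neg_pos)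
        finally show ?thesis using 3 by simp
      qed simp
    qed
    then show ?thesis unfolding E_def norm_exp_eq_Re by simp
  qed
  have E1: "norm (E (of_real L + \<i> * of_real y)) \<le> 1" for y
  proof -
    have e: "(of_real L + \<i> * of_real y) / of_real L = 1 + \<i> * complex_of_real (y / L)" using L by (simp add: field_simps)
    have "(of_real L + \<i> * of_real y) = of_real L * (1 + \<i> * complex_of_real (y / L))" using L by (simp add: field_simps)
    then have "(of_real L + \<i> * of_real y) * Ln ((of_real L + \<i> * of_real y) / of_real L) = of_real L * ((1 + \<i> * complex_of_real (y / L)) * Ln (1 + \<i> * complex_of_real (y / L)))"
      unfolding e by simp
    then have "Re ((of_real L + \<i> * of_real y) * Ln ((of_real L + \<i> * of_real y) / of_real L)) = L * Re ((1 + \<i> * complex_of_real (y / L)) * Ln (1 + \<i> * complex_of_real (y / L)))"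
      by (simp only:) (simp only: times_complex.simps Re_complex_of_real Im_complex_of_real mult_zero_left diff_zero)
    also have "... \<le> 0" using L by (intro mult_nonneg_nonpos Re_z_Ln_one_plus_imag_nonpos) simp
    finally show ?thesis unfolding E_def norm_exp_eq_Re by simp
  qed
  \<comment> \<open>\<open>E\<close> is continuous up to the boundary point 0, where the logarithm is singular.\<close>
  have contE: "continuous_on {z. 0 \<le> Re z} (\<lambda>z. z * Ln (z / of_real L))"
    unfolding continuous_on_def
  proof
    fix z assume z: "z \<in> {z. 0 \<le> Re z}"
    show "((\<lambda>z. z * Ln (z / of_real L)) \<longlongrightarrow> z * Ln (z / of_real L)) (at z within {z. 0 \<le> Re z})"
    proof (cases "z = 0")
      case True
      then show ?thesis using tendsto_within_subset[OF tendsto_z_Ln_0[OF L]] by auto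
    next
      case False
      have "z / of_real L \<notin> \<real>\<^sub>\<le>\<^sub>0" using z False L by (auto simp: complex_nonpos_Reals_iff complex_eq_iff divide_le_0_iff)
      then show ?thesis using L by (intro tendsto_intros) auto
    qed
  qed
  have contE': "continuous_on {z. 0 \<le> Re z} E" unfolding E_def by (intro continuous_intros contE) auto
  have holE: "E holomorphic_on {z. Re z > 0}"
  proof -
    have "z / of_real L \<notin> \<real>\<^sub>\<le>\<^sub>0" if "Re z > 0" for z
      using that L by (auto simp: complex_nonpos_Reals_iff divide_le_0_iff)
    then show ?thesis unfolding E_def using L by (intro holomorphic_intros) auto
  qed
  have holW: "W holomorphic_on A" for A unfolding W_def using L by (intro holomorphic_intros) auto
  have \<Psi>1: "norm (\<Psi> \<epsilon> (of_real p)) \<le> 1" if \<epsilon>: "\<epsilon> > 0" for \<epsilon>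
  proof -
    define C where "C = \<bar>M\<bar> * exp (\<bar>ln N0\<bar> + \<bar>ln N1\<bar>)"
    have C: "C \<ge> 0" by (simp add: C_def)
    have "((\<lambda>T::real. C * exp (T / 2 - \<epsilon> * T\<^sup>2)) \<longlongrightarrow> 0) at_top"
    proof -
      have "((\<lambda>T::real. exp (T / 2 - \<epsilon> * T\<^sup>2)) \<longlongrightarrow> 0) at_top" using \<epsilon> by real_asymp
      from tendsto_mult_right_zero[OF this] show ?thesis .
    qed
    then have "\<forall>\<^sub>F T in at_top. C * exp (T / 2 - \<epsilon> * T\<^sup>2) < 1" by (rule order_tendstoD) simp
    then obtain T where T: "T > 0" "C * exp (T / 2 - \<epsilon> * T\<^sup>2) < 1"
      using eventually_conj[OF eventually_gt_at_top[of 0]] eventually_happens[of _ "at_top :: real filter"] by (metis (mono_tags, lifting) trivial_limit_at_top_linorder)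
    \<comment> \<open>Maximum principle on a rectangle so tall that its horizontal edges contribute less than 1.\<close>
    let ?R = "cbox (Complex 0 (- T)) (Complex L T)"
    have Rmem: "z \<in> ?R \<longleftrightarrow> 0 \<le> Re z \<and> Re z \<le> L \<and> - T \<le> Im z \<and> Im z \<le> T" for z by (auto simp: in_cbox_complex_iff)
    show ?thesis
    proof (rule maximum_modulus_frontier[where f="\<Psi> \<epsilon>" and S="?R" and \<xi>="of_real p" and B=1])
      have "interior ?R = box (Complex 0 (- T)) (Complex L T)" by (rule interior_cbox)
      then have sub: "interior ?R \<subseteq> {z. Re z > 0} \<inter> S" using S(2) by (auto simp: in_box_complex_iff)
      show "\<Psi> \<epsilon> holomorphic_on interior ?R"
        unfolding \<Psi>_def
        by (intro holomorphic_intros holomorphic_on_subset[OF hol] holomorphic_on_subset[OF holE] holW) (use sub in auto)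
      have "?R \<subseteq> S" "?R \<subseteq> {z. 0 \<le> Re z}" using S(2) by (auto simp: Rmem)
      then have "continuous_on ?R (\<Psi> \<epsilon>)"
        unfolding \<Psi>_def
        by (intro continuous_intros continuous_on_subset[OF holomorphic_on_imp_continuous_on[OF hol]] continuous_on_subset[OF contE'] holomorphic_on_imp_continuous_on[OF holW]) auto
      then show "continuous_on (closure ?R) (\<Psi> \<epsilon>)" by simp
      show "bounded ?R" by simp
      show "of_real p \<in> ?R" using p T by (simp add: Rmem)
      fix z assume "z \<in> frontier ?R"
      then have z: "z \<in> ?R" "z \<notin> box (Complex 0 (- T)) (Complex L T)" by (auto simp: frontier_cbox)
      then have zs: "0 \<le> Re z" "Re z \<le> L" by (auto simp: Rmem)
      have Gle: "norm (?G \<epsilon> z) \<le> exp (- \<epsilon> * (Im z)\<^sup>2)"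
        unfolding normG using G1[OF \<epsilon> zs] by simp
      then have Gle1: "norm (?G \<epsilon> z) \<le> 1"
      proof -
        have "exp (- \<epsilon> * (Im z)\<^sup>2) \<le> 1" using \<epsilon> by simp
        then show ?thesis using Gle by linarith
      qed
      consider "Re z = 0" | "Re z = L" | "\<bar>Im z\<bar> = T"
        using z by (auto simp: in_box_complex_iff in_cbox_complex_iff)
      then show "norm (\<Psi> \<epsilon> z) \<le> 1"
      proof cases
        case 1
        then have zi: "z = \<i> * of_real (Im z)" by (simp add: complex_eq_iff)
        have a: "norm (\<Phi> z) \<le> N0 * exp (pi * \<bar>Im z\<bar> / 4)" using b0[of "Im z"] zi by simp
        have b: "norm (E z) = exp (- (pi * \<bar>Im z\<bar> / 4))" using E0[of "Im z"] zi by simp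
        have c: "norm (W z) = inverse N0" unfolding normW using 1 N by (simp add: exp_minus)
        have "norm (\<Phi> z) * norm (E z) * norm (W z) \<le> N0 * exp (pi * \<bar>Im z\<bar> / 4) * exp (- (pi * \<bar>Im z\<bar> / 4)) * inverse N0"
          unfolding b c using N a by (intro mult_right_mono) auto
        also have "... = N0 * (exp (pi * \<bar>Im z\<bar> / 4) * exp (- (pi * \<bar>Im z\<bar> / 4))) * inverse N0" by (simp only: mult.assoc)
        also have "... = 1" unfolding exp_minus_inverse using N by simp
        finally have "norm (\<Phi> z) * norm (E z) * norm (W z) \<le> 1" .
        from mult_mono[OF this Gle1] show ?thesis unfolding \<Psi>_def norm_mult by simp
      next
        case 2
        then have zi: "z = of_real L + \<i> * of_real (Im z)" by (simp add: complex_eq_iff)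
        have a: "norm (\<Phi> z) \<le> N1" using b1[of "Im z"] zi by simp
        have b: "norm (E z) \<le> 1" using E1[of "Im z"] zi by simp
        have c: "norm (W z) = inverse N1" unfolding normW using 2 N L by (simp add: exp_minus)
        have "norm (\<Phi> z) * norm (E z) * norm (W z) \<le> N1 * 1 * inverse N1"
          unfolding c using N a b by (intro mult_right_mono mult_mono) auto
        also have "... = 1" using N by simp
        finally have "norm (\<Phi> z) * norm (E z) * norm (W z) \<le> 1" .
        from mult_mono[OF this Gle1] show ?thesis unfolding \<Psi>_def norm_mult by simp
      next
        case 3
        have a: "norm (\<Phi> z) \<le> \<bar>M\<bar>" using M[OF zs] by simp
        have b: "norm (E z) \<le> exp (T / 2)" using reE[OF zs] 3 by simp
        have c: "norm (W z) \<le> exp (\<bar>ln N0\<bar> + \<bar>ln N1\<bar>)"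
        proof -
          have r: "0 \<le> Re z / L" "Re z / L \<le> 1" using zs L by auto
          have "\<bar>(1 - Re z / L) * ln N0\<bar> \<le> 1 * \<bar>ln N0\<bar>" unfolding abs_mult using r by (intro mult_right_mono) auto
          moreover have "\<bar>(Re z / L) * ln N1\<bar> \<le> 1 * \<bar>ln N1\<bar>" unfolding abs_mult using r by (intro mult_right_mono) auto
          ultimately show ?thesis unfolding normW exp_le_cancel_iff by linarith
        qed
        have "(Im z)\<^sup>2 = T\<^sup>2" using 3 by (metis power2_abs)
        then have d: "norm (?G \<epsilon> z) \<le> exp (- \<epsilon> * T\<^sup>2)" using Gle by simp
        have "norm (\<Psi> \<epsilon> z) \<le> \<bar>M\<bar> * exp (T / 2) * exp (\<bar>ln N0\<bar> + \<bar>ln N1\<bar>) * exp (- \<epsilon> * T\<^sup>2)"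
          unfolding \<Psi>_def norm_mult by (intro mult_mono a b c d mult_nonneg_nonneg) auto
        also have "... = C * exp (T / 2 - \<epsilon> * T\<^sup>2)"
        proof -
          have "exp (T / 2 - \<epsilon> * T\<^sup>2) = exp (T / 2) * exp (- \<epsilon> * T\<^sup>2)" by (simp add: exp_add[symmetric])
          then show ?thesis by (simp only: C_def mult_ac)
        qed
        finally show ?thesis using T by simp
      qed
    qed
  qed
  define X where "X = norm (\<Phi> (of_real p)) * norm (E (of_real p)) * norm (W (of_real p))"
  have "X * exp (\<epsilon> * (p\<^sup>2 - L\<^sup>2)) \<le> 1" if "\<epsilon> > 0" for \<epsilon>
    using \<Psi>1[OF that] unfolding \<Psi>_def norm_mult normG X_def by simp
  then have "\<forall>\<^sub>F \<epsilon> in at_right 0. X * exp (\<epsilon> * (p\<^sup>2 - L\<^sup>2)) \<le> 1"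
    by (auto simp: eventually_at_right_field intro!: exI[of _ 1])
  moreover have "((\<lambda>\<epsilon>. X * exp (\<epsilon> * (p\<^sup>2 - L\<^sup>2))) \<longlongrightarrow> X * exp (0 * (p\<^sup>2 - L\<^sup>2))) (at_right 0)"
    by (intro tendsto_intros)
  ultimately have X1: "X \<le> 1" using tendsto_upperbound[of "\<lambda>\<epsilon>. X * exp (\<epsilon> * (p\<^sup>2 - L\<^sup>2))" X "at_right 0" 1] by simp
  have "E (of_real p) = exp (of_real (p * ln (p / L) / 2))"
    unfolding E_def using p L Ln_of_real[of "p / L"] by simp
  then have En: "norm (E (of_real p)) = exp (p * ln (p / L) / 2)" by (simp add: norm_exp_eq_Re)
  have Wn: "norm (W (of_real p)) = exp (- ((1 - p / L) * ln N0 + (p / L) * ln N1))" unfolding normW by simp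
  have "exp u * exp (- v) * (exp (- u) * exp v) = (1::real)" for u v by (simp add: exp_add[symmetric])
  from this[of "p * ln (p / L) / 2" "(1 - p / L) * ln N0 + (p / L) * ln N1"]
  have "norm (\<Phi> (of_real p)) = X * (exp (- (p * ln (p / L) / 2)) * exp ((1 - p / L) * ln N0 + (p / L) * ln N1))"
    unfolding X_def En Wn mult.assoc by (simp only: mult.assoc mult_1_right)
  also have "... \<le> 1 * (exp (- (p * ln (p / L) / 2)) * exp ((1 - p / L) * ln N0 + (p / L) * ln N1))"
    using X1 by (intro mult_right_mono) auto
  also have "... = (L / p) powr (p / 2) * N0 powr (1 - p / L) * N1 powr (p / L)"
  proof -
    have "ln (L / p) = - ln (p / L)" using p L by (simp add: ln_div)
    then have e: "exp (- (p * ln (p / L) / 2)) = (L / p) powr (p / 2)" using p L by (simp add: powr_def)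
    show ?thesis unfolding e exp_add using N by (simp add: powr_def)
  qed
  finally show ?thesis .
qed

section \<open>Kernel bound, symmetry and inversion of the family\<close>

lemma norm_gmass_imag_le:
  assumes n: "n > 0"
  shows "norm (gmass n (- \<i> * of_real y)) \<le> (2 * pi) powr (real n / 2)"
proof -
  have r: "Re (- \<i> * complex_of_real y) > - real n" "Re (0::complex) > - real n" using n by auto
  have "gmass n (- \<i> * of_real y) = (LINT r|radial_measure n. complex_of_real r powr (- \<i> * of_real y) * of_real (exp (- (r\<^sup>2 / 2))))"
    unfolding gmass_def using radial_gaussian_mellin(2)[OF n r(1)] by simp
  also have "norm ... \<le> (LINT r|radial_measure n. norm (complex_of_real r powr (- \<i> * of_real y) * of_real (exp (- (r\<^sup>2 / 2)))))"
    by (rule integral_norm_bound)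
  also have "... = (LINT r|radial_measure n. Re (complex_of_real r powr 0 * of_real (exp (- (r\<^sup>2 / 2)))))"
  proof (rule integral_cong_AE)
    show "AE r in radial_measure n. norm (complex_of_real r powr (- \<i> * of_real y) * of_real (exp (- (r\<^sup>2 / 2)))) = Re (complex_of_real r powr 0 * of_real (exp (- (r\<^sup>2 / 2))))"
      using AE_radial_measure_pos by eventually_elim (simp add: norm_mult norm_powr_real_powr)
  qed measurable
  also have "... = Re (LINT r|radial_measure n. complex_of_real r powr 0 * of_real (exp (- (r\<^sup>2 / 2))))"
    by (rule integral_Re[OF radial_gaussian_mellin(1)[OF n r(2)]])
  also have "(LINT r|radial_measure n. complex_of_real r powr 0 * of_real (exp (- (r\<^sup>2 / 2)))) = of_real (real n * unit_ball_vol (real n) * 2 powr (real n / 2 - 1) * Gamma (real n / 2))"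
    using radial_gaussian_mellin(2)[OF n r(2)] powr_of_real[of 2 "real n / 2 - 1"] Gamma_complex_of_real[of "real n / 2"] by simp
  also have "... = of_real ((2 * pi) powr (real n / 2))" by (subst radial_gaussian_total[OF n]) simp
  finally show ?thesis by simp
qed

text \<open>
  The reflection formula on the line \<open>Re z = 1 / 2\<close>, where \<open>1 - z\<close> is the conjugate of \<open>z\<close>.
\<close>

lemma norm_Gamma_half_imag:
  "norm (Gamma ((1 - \<i> * complex_of_real y) / 2)) \<ge> sqrt pi * exp (- (pi * \<bar>y\<bar> / 4))"
proof -
  define z where "z = (1 - \<i> * complex_of_real y) / 2"
  have cz: "1 - z = cnj z" by (simp add: z_def field_simps complex_eq_iff)
  have "Gamma z * Gamma (cnj z) = of_real pi / sin (of_real pi * z)"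
    using Gamma_reflection_complex[of z] unfolding cz .
  then have "norm (Gamma z * cnj (Gamma z)) = pi / norm (sin (of_real pi * z))"
    by (simp add: cnj_Gamma norm_divide)
  then have e: "(norm (Gamma z))\<^sup>2 = pi / norm (sin (of_real pi * z))"
    by (simp add: norm_mult power2_eq_square)
  have pos: "norm (Gamma z) > 0" using Gamma_plus_nat(2)[of z] by (simp add: z_def)
  have snz: "norm (sin (of_real pi * z)) > 0"
  proof (rule ccontr)
    assume "\<not> norm (sin (of_real pi * z)) > 0"
    then have "norm (sin (of_real pi * z)) = 0" by simp
    with e pos show False by simp
  qed
  have s: "norm (sin (of_real pi * z)) \<le> exp (pi * \<bar>y\<bar> / 2)"
  proof -
    define w where "w = of_real pi * z"
    have Iw: "\<bar>Im w\<bar> = pi * \<bar>y\<bar> / 2" by (simp add: w_def z_def abs_mult)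
    have "norm (sin w) = norm (exp (\<i> * w) - exp (- (\<i> * w))) / 2"
      by (simp add: sin_exp_eq norm_divide norm_mult)
    also have "... \<le> (norm (exp (\<i> * w)) + norm (exp (- (\<i> * w)))) / 2"
      by (intro divide_right_mono norm_triangle_ineq4) auto
    also have "... \<le> (exp \<bar>Im w\<bar> + exp \<bar>Im w\<bar>) / 2"
      by (intro divide_right_mono add_mono) (auto simp: norm_exp_eq_Re)
    finally have "norm (sin w) \<le> exp \<bar>Im w\<bar>" by simp
    then show ?thesis unfolding Iw by (simp only: w_def)
  qed
  have "(sqrt pi * exp (- (pi * \<bar>y\<bar> / 4)))\<^sup>2 = pi / exp (pi * \<bar>y\<bar> / 2)"
  proof -
    define t where "t = pi * \<bar>y\<bar> / 4"
    have t2: "pi * \<bar>y\<bar> / 2 = 2 * t" by (simp add: t_def)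
    have "(exp (- t))\<^sup>2 = inverse (exp (2 * t))" by (simp add: exp_minus exp_double power_inverse)
    then show ?thesis unfolding t2 t_def[symmetric] power_mult_distrib by (simp add: divide_inverse)
  qed
  also have "... \<le> (norm (Gamma z))\<^sup>2" unfolding e using s snz by (intro divide_left_mono) auto
  finally show ?thesis unfolding z_def[symmetric] by (rule power2_le_imp_le) simp
qed

text \<open>
  The constant that multiplies the kernel in the integral representation of \<open>I\<^bsub>iy\<^esub>\<close>.
\<close>

definition kernel_const :: "nat => real => complex" where
  "kernel_const n y = gmass n (- \<i> * of_real y) / kernel_mass n y"

lemma kernel_mass_nonzero: "kernel_mass n y \<noteq> 0"
  using Gamma_plus_nat(2)[of "(1 - \<i> * complex_of_real y) / 2"] by (simp add: kernel_mass_def)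

lemma norm_kernel_const_le:
  assumes "n > 0" shows "norm (kernel_const n y) \<le> exp (pi * \<bar>y\<bar> / 4)"
proof -
  define c where "c = (2 * pi) powr (real n / 2)"
  have c: "c > 0" by (simp add: c_def)
  have "norm ((2::complex) powr ((1 - \<i> * of_real y) / 2 - 1)) = 2 powr (- 1 / 2)"
    by (simp add: norm_powr_real_powr)
  then have "norm (kernel_mass n y) = c * (2 / sqrt (2 * pi)) * 2 powr (- 1 / 2) * norm (Gamma ((1 - \<i> * complex_of_real y) / 2))"
    unfolding kernel_mass_def c_def norm_mult by (simp only: norm_of_real) simp
  also have "(2::real) powr (- 1 / 2) = 1 / sqrt 2" by (simp add: powr_minus_divide powr_half_sqrt)
  also have "c * (2 / sqrt (2 * pi)) * (1 / sqrt 2) = c / sqrt pi" by (simp add: real_sqrt_mult field_simps)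
  finally have m: "norm (kernel_mass n y) = c / sqrt pi * norm (Gamma ((1 - \<i> * complex_of_real y) / 2))" .
  have "c / sqrt pi * (sqrt pi * exp (- (pi * \<bar>y\<bar> / 4))) \<le> norm (kernel_mass n y)"
    unfolding m using c by (intro mult_left_mono norm_Gamma_half_imag) auto
  then have m2: "c * exp (- (pi * \<bar>y\<bar> / 4)) \<le> norm (kernel_mass n y)" by simp
  have "norm (kernel_const n y) = norm (gmass n (- \<i> * of_real y)) / norm (kernel_mass n y)"
    by (simp add: kernel_const_def norm_divide)
  also have "... \<le> c / (c * exp (- (pi * \<bar>y\<bar> / 4)))"
    using norm_gmass_imag_le[OF assms, of y] m2 c by (intro frac_le) (auto simp: c_def)
  also have "... = exp (pi * \<bar>y\<bar> / 4)" using c by (simp add: exp_minus field_simps)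
  finally show ?thesis .
qed

text \<open>
  The same Gaussian integral evaluated twice: in polar coordinates, where it gives the spherical
  integral against the kernel, and by \<open>gauss_imag_power_zonal\<close>.
\<close>

lemma Ip_zonal_imag_kernel:
  fixes a \<xi> :: "real ^ 'n"
  assumes a: "norm a = 1" and \<xi>: "norm \<xi> = 1"
  shows "Ip_zonal (\<i> * of_real y) k a \<xi> = kernel_const CARD('n) y * (LINT \<theta>|sphere_measure. imag_power y (\<theta> \<bullet> \<xi>) * zonal k a \<theta>)"
proof -
  let ?n = "CARD('n)"
  let ?I = "LINT \<theta>|sphere_measure. imag_power y (\<theta> \<bullet> \<xi>) * zonal k a \<theta>"
  let ?S = "\<Sum>j\<le>k. (-1) ^ j * pochhammer (\<i> * of_real y / 2) j / fact (k - j) * zonal j a \<xi>"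
  let ?P = "pochhammer ((of_nat ?n - \<i> * complex_of_real y) / 2) k"
  have hom: "imag_power y (r * (x \<bullet> \<xi>)) = of_real r powr (- \<i> * of_real y) * imag_power y (x \<bullet> \<xi>)" if "r > 0" for r x
    using that powr_times_real[of "of_real r" "of_real \<bar>x \<bullet> \<xi>\<bar>" "- \<i> * complex_of_real y"] by (simp add: imag_power_def abs_mult)
  have "(LINT x|lborel. imag_power y (x \<bullet> \<xi>) * (zonal k a x * gauss x)) =
      gmass ?n (- \<i> * of_real y) * 2 ^ k * pochhammer ((of_nat ?n + (- \<i> * of_real y)) / 2) k * ?I"
    by (rule gauss_radial_zonal(2)[where B=1 and w="\<lambda>x. imag_power y (x \<bullet> \<xi>)"]) (auto simp: norm_imag_power_le hom)
  then have "kernel_mass ?n y * ?S = gmass ?n (- \<i> * of_real y) * ?P * ?I"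
    unfolding gauss_imag_power_zonal[OF \<xi> a] by simp
  then have S: "?S = kernel_const ?n y * ?P * ?I"
    using kernel_mass_nonzero[of ?n y] by (simp add: kernel_const_def field_simps)
  have nz: "?P \<noteq> 0" by (rule pochhammer_nonzero) simp
  have "Ip_zonal (\<i> * of_real y) k a \<xi> = ?S / ?P"
    unfolding Ip_zonal_def zcoef_def sum_divide_distrib by (intro sum.cong refl) simp
  then show ?thesis unfolding S using nz by simp
qed

lemma continuous_Ip_zonal: "continuous_on S (Ip_zonal z k a)"
  unfolding Ip_zonal_def by (intro continuous_intros continuous_zonal)

lemma zonal_pair_integrable:
  fixes u v :: "real ^ 'n => complex"
  assumes "continuous_on (sphere 0 1) u" "continuous_on (sphere 0 1) v"
  shows "integrable sphere_measure (\<lambda>x. u x * v x)"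
  by (intro sphere_integrable continuous_on_mult assms)

lemma Ip_zonal_symmetric_imag:
  fixes a b :: "real ^ 'n"
  assumes a: "norm a = 1" and b: "norm b = 1"
  shows "(LINT \<xi>|sphere_measure. Ip_zonal (\<i> * of_real y) k a \<xi> * zonal l b \<xi>) = (LINT \<xi>|sphere_measure. zonal k a \<xi> * Ip_zonal (\<i> * of_real y) l b \<xi>)"
proof -
  let ?S = "sphere_measure :: (real^'n) measure"
  let ?C = "kernel_const CARD('n) y"
  interpret S: prob_space ?S by (rule prob_space_sphere_measure)
  interpret P: pair_sigma_finite ?S ?S ..
  have m1: "(\<lambda>p. fst p) \<in> ?S \<Otimes>\<^sub>M ?S \<rightarrow>\<^sub>M borel" "(\<lambda>p. snd p) \<in> ?S \<Otimes>\<^sub>M ?S \<rightarrow>\<^sub>M borel"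
    using measurable_compose[OF measurable_fst measurable_sphere_ident] measurable_compose[OF measurable_snd measurable_sphere_ident] by auto
  have int: "integrable (?S \<Otimes>\<^sub>M ?S) (\<lambda>(\<theta>, \<xi>). imag_power y (\<theta> \<bullet> \<xi>) * zonal k a \<theta> * zonal l b \<xi>)"
  proof (rule Bochner_Integration.integrable_bound)
    show "integrable (?S \<Otimes>\<^sub>M ?S) (\<lambda>p. zonal k a (fst p) * zonal l b (snd p))"
      by (intro integrable_times_pair(1) S.sigma_finite_measure_axioms sphere_integrable continuous_zonal)
    show "(\<lambda>(\<theta>, \<xi>). imag_power y (\<theta> \<bullet> \<xi>) * zonal k a \<theta> * zonal l b \<xi>) \<in> borel_measurable (?S \<Otimes>\<^sub>M ?S)"
      unfolding split_beta' using m1 by measurable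
    show "AE p in ?S \<Otimes>\<^sub>M ?S. norm (case p of (\<theta>, \<xi>) => imag_power y (\<theta> \<bullet> \<xi>) * zonal k a \<theta> * zonal l b \<xi>) \<le> norm (zonal k a (fst p) * zonal l b (snd p))"
    proof (rule AE_I2)
      fix p
      have "norm (imag_power y (fst p \<bullet> snd p)) * norm (zonal k a (fst p) * zonal l b (snd p)) \<le> 1 * norm (zonal k a (fst p) * zonal l b (snd p))"
        by (intro mult_right_mono norm_imag_power_le) auto
      then show "norm (case p of (\<theta>, \<xi>) => imag_power y (\<theta> \<bullet> \<xi>) * zonal k a \<theta> * zonal l b \<xi>) \<le> norm (zonal k a (fst p) * zonal l b (snd p))"
        by (simp add: split_beta' norm_mult mult.assoc)
    qed
  qed
  have "(LINT \<xi>|?S. Ip_zonal (\<i> * of_real y) k a \<xi> * zonal l b \<xi>) = (LINT \<xi>|?S. ?C * (LINT \<theta>|?S. imag_power y (\<theta> \<bullet> \<xi>) * zonal k a \<theta> * zonal l b \<xi>))"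
  proof (rule Bochner_Integration.integral_cong[OF refl])
    fix \<xi> assume "\<xi> \<in> space ?S"
    then have n: "norm \<xi> = 1" by (simp add: space_sphere_measure)
    show "Ip_zonal (\<i> * of_real y) k a \<xi> * zonal l b \<xi> = ?C * (LINT \<theta>|?S. imag_power y (\<theta> \<bullet> \<xi>) * zonal k a \<theta> * zonal l b \<xi>)"
      unfolding integral_mult_left_zero Ip_zonal_imag_kernel[OF a n] by (simp only: mult.assoc)
  qed
  also have "... = ?C * (LINT \<theta>|?S. LINT \<xi>|?S. imag_power y (\<theta> \<bullet> \<xi>) * zonal k a \<theta> * zonal l b \<xi>)"
    unfolding integral_mult_right_zero using P.Fubini_integral[OF int] by simp
  also have "... = (LINT \<theta>|?S. zonal k a \<theta> * Ip_zonal (\<i> * of_real y) l b \<theta>)"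
    unfolding integral_mult_right_zero[symmetric]
  proof (rule Bochner_Integration.integral_cong[OF refl])
    fix \<theta> assume "\<theta> \<in> space ?S"
    then have t: "norm \<theta> = 1" by (simp add: space_sphere_measure)
    have "(LINT \<xi>|?S. imag_power y (\<theta> \<bullet> \<xi>) * zonal k a \<theta> * zonal l b \<xi>) = zonal k a \<theta> * (LINT \<xi>|?S. imag_power y (\<xi> \<bullet> \<theta>) * zonal l b \<xi>)"
      unfolding integral_mult_right_zero[symmetric] by (intro Bochner_Integration.integral_cong refl) (simp add: inner_commute)
    then have "?C * (LINT \<xi>|?S. imag_power y (\<theta> \<bullet> \<xi>) * zonal k a \<theta> * zonal l b \<xi>) = zonal k a \<theta> * Ip_zonal (\<i> * of_real y) l b \<theta>"
      by (simp add: Ip_zonal_imag_kernel[OF b t])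
    then show "(LINT \<xi>|?S. ?C * (imag_power y (\<theta> \<bullet> \<xi>) * zonal k a \<theta> * zonal l b \<xi>)) = zonal k a \<theta> * Ip_zonal (\<i> * of_real y) l b \<theta>"
      by (simp only: integral_mult_right_zero)
  qed
  finally show ?thesis .
qed

lemma holomorphic_pochhammer:
  "f holomorphic_on A ==> (\<lambda>z. pochhammer (f z) k) holomorphic_on A"
  unfolding pochhammer_prod by (intro holomorphic_intros)

lemma holomorphic_zcoef: "(\<lambda>z. zcoef n z k j) holomorphic_on {z. Re z < real n}"
  unfolding zcoef_def
  by (intro holomorphic_intros holomorphic_pochhammer) (auto intro!: pochhammer_nonzero)

definition zpair :: "nat \<times> (real ^ 'n) => nat \<times> (real ^ 'n) => complex" where
  "zpair i j = (LINT \<xi>|sphere_measure. zonal (fst i) (snd i) \<xi> * zonal (fst j) (snd j) \<xi>)"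

lemma Ip_zonal_pair_left:
  fixes a b :: "real ^ 'n"
  shows "(LINT \<xi>|sphere_measure. Ip_zonal z k a \<xi> * zonal l b \<xi>) = (\<Sum>j\<le>k. zcoef CARD('n) z k j * zpair (j, a) (l, b))"
proof -
  have "(LINT \<xi>|sphere_measure. Ip_zonal z k a \<xi> * zonal l b \<xi>) = (LINT \<xi>|sphere_measure. (\<Sum>j\<le>k. zcoef CARD('n) z k j * (zonal j a \<xi> * zonal l b \<xi>)))"
    unfolding Ip_zonal_def by (intro Bochner_Integration.integral_cong refl) (simp only: sum_distrib_right mult.assoc)
  also have "... = (\<Sum>j\<le>k. LINT \<xi>|sphere_measure. zcoef CARD('n) z k j * (zonal j a \<xi> * zonal l b \<xi>))"
    by (rule Bochner_Integration.integral_sum) (intro integrable_mult_right zonal_pair_integrable continuous_zonal)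
  also have "... = (\<Sum>j\<le>k. zcoef CARD('n) z k j * zpair (j, a) (l, b))"
    unfolding zpair_def fst_conv snd_conv by (rule sum.cong[OF refl]) (rule integral_mult_right_zero)
  finally show ?thesis .
qed

lemma holomorphic_Ip_zonal_pair:
  fixes a b :: "real ^ 'n"
  shows "(\<lambda>z. LINT \<xi>|sphere_measure. Ip_zonal z k a \<xi> * zonal l b \<xi>) holomorphic_on {z. Re z < real CARD('n)}"
  unfolding Ip_zonal_pair_left by (intro holomorphic_intros holomorphic_zcoef)

text \<open>
  On the imaginary axis the kernel is symmetric in \<open>\<theta>\<close> and \<open>\<xi>\<close>; both sides are holomorphic in \<open>z\<close>, so the
  identity continues to the half-plane.
\<close>

theorem Ip_zonal_symmetric:
  fixes a b :: "real ^ 'n"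
  assumes a: "norm a = 1" and b: "norm b = 1" and z: "Re z < real CARD('n)"
  shows "(LINT \<xi>|sphere_measure. Ip_zonal z k a \<xi> * zonal l b \<xi>) = (LINT \<xi>|sphere_measure. zonal k a \<xi> * Ip_zonal z l b \<xi>)"
proof -
  let ?H = "{z. Re z < real CARD('n)}"
  let ?f = "\<lambda>z. (LINT \<xi>|sphere_measure. Ip_zonal z k a \<xi> * zonal l b \<xi>) - (LINT \<xi>|sphere_measure. Ip_zonal z l b \<xi> * zonal k a \<xi>)"
  have "?f z = 0"
  proof (rule analytic_continuation[where f="?f" and S="?H" and U="range (\<lambda>y. \<i> * complex_of_real y)" and \<xi>=0])
    show "?f holomorphic_on ?H" by (intro holomorphic_intros holomorphic_Ip_zonal_pair)
    show "open ?H" by (rule open_halfspace_Re_lt)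
    show "connected ?H" by (intro convex_connected convex_halfspace_Re_lt)
    show "range (\<lambda>y. \<i> * complex_of_real y) \<subseteq> ?H" "0 \<in> ?H" by auto
    \<comment> \<open>The imaginary axis accumulates at 0, so the identity theorem applies.\<close>
    show "0 islimpt range (\<lambda>y. \<i> * complex_of_real y)"
    proof (subst islimpt_approachable, intro allI impI)
      fix e :: real assume e: "e > 0"
      show "\<exists>x'\<in>range (\<lambda>y. \<i> * complex_of_real y). x' \<noteq> 0 \<and> dist x' 0 < e"
      proof (rule bexI)
        show "\<i> * complex_of_real (e / 2) \<in> range (\<lambda>y. \<i> * complex_of_real y)" by (rule rangeI)
      qed (use e in \<open>auto simp: norm_mult norm_divide\<close>)
    qed
    show "?f w = 0" if "w \<in> range (\<lambda>y. \<i> * complex_of_real y)" for w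
      using that Ip_zonal_symmetric_imag[OF a b] by (auto simp: mult.commute[of "zonal _ _ _"])
    show "z \<in> ?H" using z by simp
  qed
  then show ?thesis by (simp add: mult.commute[of "zonal k a _"])
qed

text \<open>
  The entries of the product matrix are alternating sums of binomial coefficients.
\<close>

lemma zcoef_inversion:
  assumes z: "0 < Re z" "Re z < real n" and j: "i \<le> k"
  shows "(\<Sum>j\<in>{i..k}. zcoef n (of_nat n - z) k j * zcoef n z j i) = (if i = k then 1 else 0)"
proof -
  have p1: "pochhammer ((of_nat n - z) / 2) m \<noteq> 0" "pochhammer (z / 2) m \<noteq> 0" for m
    using z by (auto intro!: pochhammer_nonzero)
  have "(\<Sum>j\<in>{i..k}. zcoef n (of_nat n - z) k j * zcoef n z j i)
    = (\<Sum>j\<in>{i..k}. (pochhammer (z / 2) i / pochhammer (z / 2) k * (-1) ^ i) * ((-1) ^ j / (fact (k - j) * fact (j - i))))"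
    unfolding zcoef_def using p1 by (intro sum.cong refl) (simp add: field_simps)
  also have "... = (pochhammer (z / 2) i / pochhammer (z / 2) k * (-1) ^ i) * (\<Sum>j\<in>{i..k}. (-1) ^ j / (fact (k - j) * fact (j - i)))"
    by (simp only: sum_distrib_left)
  also have "(\<Sum>j\<in>{i..k}. (-1) ^ j / (fact (k - j) * fact (j - i)) :: complex) = (\<Sum>m\<le>k - i. (-1) ^ (m + i) / (fact (k - i - m) * fact m))"
    by (rule sum.reindex_bij_witness[of _ "\<lambda>m. m + i" "\<lambda>j. j - i"]) (use j in auto)
  also have "... = (\<Sum>m\<le>k - i. (-1) ^ i / fact (k - i) * ((-1) ^ m * of_nat (k - i choose m)))"
    by (intro sum.cong refl) (simp add: binomial_fact power_add field_simps)
  also have "... = (-1) ^ i / fact (k - i) * (\<Sum>m\<le>k - i. (-1) ^ m * of_nat (k - i choose m))"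
    by (simp only: sum_distrib_left)
  also have "(\<Sum>m\<le>k - i. (-1) ^ m * of_nat (k - i choose m) :: complex) = (if i = k then 1 else 0)"
    using j choose_alternating_sum[of "k - i", where 'a=complex] by (cases "i = k") auto
  finally show ?thesis using p1 by auto
qed

lemma Ip_zonal_inversion:
  fixes a :: "real ^ 'n"
  assumes z: "0 < Re z" "Re z < real CARD('n)"
  shows "(\<Sum>j\<le>k. zcoef CARD('n) (of_nat CARD('n) - z) k j * Ip_zonal z j a x) = zonal k a x"
proof -
  let ?n = "CARD('n)"
  have "(\<Sum>j\<le>k. zcoef ?n (of_nat ?n - z) k j * Ip_zonal z j a x) = (\<Sum>j\<le>k. \<Sum>i\<le>j. zcoef ?n (of_nat ?n - z) k j * zcoef ?n z j i * zonal i a x)"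
    unfolding Ip_zonal_def by (simp only: sum_distrib_left mult.assoc)
  also have "... = (\<Sum>(j, i)\<in>Sigma {..k} (\<lambda>j. {..j}). zcoef ?n (of_nat ?n - z) k j * zcoef ?n z j i * zonal i a x)"
    by (rule sum.Sigma) auto
  also have "... = (\<Sum>(i, j)\<in>Sigma {..k} (\<lambda>i. {i..k}). zcoef ?n (of_nat ?n - z) k j * zcoef ?n z j i * zonal i a x)"
    by (rule sum.reindex_bij_witness[of _ "\<lambda>(i, j). (j, i)" "\<lambda>(j, i). (i, j)"]) auto
  also have "... = (\<Sum>i\<le>k. \<Sum>j\<in>{i..k}. zcoef ?n (of_nat ?n - z) k j * zcoef ?n z j i * zonal i a x)"
    by (rule sum.Sigma[symmetric]) auto
  also have "... = (\<Sum>i\<le>k. (if i = k then 1 else 0) * zonal i a x)"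
    unfolding sum_distrib_right[symmetric] by (intro sum.cong refl) (simp add: zcoef_inversion[OF z])
  also have "... = zonal k a x" by (subst sum.remove[of _ k]) auto
  finally show ?thesis .
qed

text \<open>
  Move one operator to the other side by symmetry; there it meets its inverse.
\<close>

lemma Ip_zonal_isometry:
  fixes a b :: "real ^ 'n"
  assumes a: "norm a = 1" and b: "norm b = 1" and z: "0 < Re z" "Re z < real CARD('n)"
  shows "(LINT \<xi>|sphere_measure. Ip_zonal z k a \<xi> * Ip_zonal (of_nat CARD('n) - z) l b \<xi>) = (LINT \<xi>|sphere_measure. zonal k a \<xi> * zonal l b \<xi>)"
proof -
  let ?n = "CARD('n)"
  have "(LINT \<xi>|sphere_measure. Ip_zonal z k a \<xi> * Ip_zonal (of_nat ?n - z) l b \<xi>)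
    = (LINT \<xi>|sphere_measure. (\<Sum>j\<le>l. zcoef ?n (of_nat ?n - z) l j * (Ip_zonal z k a \<xi> * zonal j b \<xi>)))"
    unfolding Ip_zonal_def[of "of_nat ?n - z"] by (intro Bochner_Integration.integral_cong refl) (simp only: sum_distrib_left mult_ac)
  also have "... = (\<Sum>j\<le>l. LINT \<xi>|sphere_measure. zcoef ?n (of_nat ?n - z) l j * (Ip_zonal z k a \<xi> * zonal j b \<xi>))"
    by (rule Bochner_Integration.integral_sum) (intro integrable_mult_right zonal_pair_integrable continuous_zonal continuous_Ip_zonal)
  also have "... = (\<Sum>j\<le>l. LINT \<xi>|sphere_measure. zcoef ?n (of_nat ?n - z) l j * (zonal k a \<xi> * Ip_zonal z j b \<xi>))"
    unfolding integral_mult_right_zero using Ip_zonal_symmetric[OF a b z(2)] by simp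
  also have "... = (LINT \<xi>|sphere_measure. (\<Sum>j\<le>l. zcoef ?n (of_nat ?n - z) l j * (zonal k a \<xi> * Ip_zonal z j b \<xi>)))"
    by (rule Bochner_Integration.integral_sum[symmetric]) (intro integrable_mult_right zonal_pair_integrable continuous_zonal continuous_Ip_zonal)
  also have "... = (LINT \<xi>|sphere_measure. zonal k a \<xi> * zonal l b \<xi>)"
    by (intro Bochner_Integration.integral_cong refl) (simp only: mult.left_commute[of "zcoef _ _ _ _"] sum_distrib_left[symmetric] Ip_zonal_inversion[OF z])
  finally show ?thesis .
qed

lemma cnj_pochhammer: "cnj (pochhammer z k) = pochhammer (cnj z) k"
  by (simp add: pochhammer_prod)

lemma cnj_Ip_zonal: "cnj (Ip_zonal z k a x) = Ip_zonal (cnj z) k a x"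
  by (simp add: Ip_zonal_def zcoef_def zonal_def cnj_pochhammer)

text \<open>
  In the strip \<open>Re z \<le> Re (n - z)\<close>, and the imaginary parts agree up to sign, so each factor of
  \<open>pochhammer (z / 2) j\<close> is dominated by the corresponding factor of the denominator. The remaining
  factors have modulus at least \<open>1 / 4\<close>.
\<close>

lemma norm_zcoef_le:
  assumes n: "n > 0" and z: "0 \<le> Re z" "Re z \<le> real n / 2" and j: "j \<le> k"
  shows "norm (zcoef n z k j) \<le> 4 ^ k"
proof -
  define w where "w = (of_nat n - z) / 2"
  have 1: "norm (pochhammer (z / 2) j) \<le> norm (pochhammer w j)"
    unfolding pochhammer_prod prod_norm[symmetric]
  proof (intro prod_mono conjI)
    fix i
    have "(Re (z / 2) + real i)\<^sup>2 \<le> (Re w + real i)\<^sup>2" using z by (intro power_mono) (auto simp: w_def)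
    moreover have "(Im w)\<^sup>2 = (Im (z / 2))\<^sup>2" by (simp add: w_def)
    ultimately have "(norm (z / 2 + of_nat i))\<^sup>2 \<le> (norm (w + of_nat i))\<^sup>2" by (simp add: cmod_power2)
    then show "norm (z / 2 + of_nat i) \<le> norm (w + of_nat i)" by (rule power2_le_imp_le) simp
  qed simp
  have Rw: "Re w \<ge> 1 / 4" using z n by (simp add: w_def)
  have 2: "(1 / 4) ^ (k - j) \<le> norm (pochhammer (w + of_nat j) (k - j))"
  proof -
    have "(\<Prod>i = 0..<k - j. (1 / 4 :: real)) \<le> (\<Prod>i = 0..<k - j. norm (w + of_nat j + of_nat i))"
    proof (intro prod_mono conjI)
      fix i
      have "1 / 4 \<le> Re (w + of_nat j + of_nat i)" using Rw by simp
      also have "... \<le> norm (w + of_nat j + of_nat i)" by (rule complex_Re_le_cmod)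
      finally show "1 / 4 \<le> norm (w + of_nat j + of_nat i)" .
    qed simp
    then show ?thesis by (simp add: pochhammer_prod prod_norm)
  qed
  have wj: "norm (pochhammer w j) > 0" using pochhammer_nonzero[of w j] Rw by simp
  have pr: "pochhammer w k = pochhammer w j * pochhammer (w + of_nat j) (k - j)" by (rule pochhammer_product[OF j])
  have "norm (zcoef n z k j) = norm (pochhammer (z / 2) j) / (fact (k - j) * (norm (pochhammer w j) * norm (pochhammer (w + of_nat j) (k - j))))"
    by (simp add: zcoef_def w_def[symmetric] pr norm_divide norm_mult norm_power)
  also have "... \<le> norm (pochhammer w j) / (1 * (norm (pochhammer w j) * (1 / 4) ^ (k - j)))"
    using 1 2 wj by (intro frac_le mult_mono mult_left_mono mult_pos_pos) auto
  also have "... = 4 ^ (k - j)" using wj by (simp add: power_divide)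
  also have "... \<le> 4 ^ k" by (intro power_increasing) auto
  finally show ?thesis .
qed

section \<open>Interpolation on the span of the zonal polynomials\<close>

lemma norm_integral_le_integral:
  fixes f :: "'a => 'b::{banach,second_countable_topology}"
  assumes g: "integrable M g" and le: "AE x in M. norm (f x) \<le> g x"
  shows "norm (LINT x|M. f x) \<le> (LINT x|M. g x)"
proof (cases "integrable M f")
  case True
  have "norm (LINT x|M. f x) \<le> (LINT x|M. norm (f x))" by (rule integral_norm_bound)
  also have "... \<le> (LINT x|M. g x)" using True g le by (intro integral_mono_AE) auto
  finally show ?thesis .
next
  case False
  have "AE x in M. 0 \<le> g x" using le by eventually_elim (rule order_trans[OF norm_ge_zero])
  then show ?thesis using False by (simp add: not_integrable_integral_eq integral_nonneg_AE)
qed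

lemma cauchy_schwarz_lebesgue:
  fixes f g :: "'a => complex"
  assumes m[measurable]: "f \<in> borel_measurable M" "g \<in> borel_measurable M"
    and f: "integrable M (\<lambda>x. (norm (f x))\<^sup>2)" and g: "integrable M (\<lambda>x. (norm (g x))\<^sup>2)"
  shows "norm (LINT x|M. f x * g x) \<le> sqrt (LINT x|M. (norm (f x))\<^sup>2) * sqrt (LINT x|M. (norm (g x))\<^sup>2)"
proof (cases "integrable M (\<lambda>x. f x * g x)")
  case True
  let ?F = "LINT x|M. (norm (f x))\<^sup>2" and ?G = "LINT x|M. (norm (g x))\<^sup>2"
  have nn: "?F \<ge> 0" "?G \<ge> 0" by (auto intro!: integral_nonneg_AE)
  have sq: "(\<integral>\<^sup>+x. (ennreal (norm (h x)))\<^sup>2 \<partial>M) = ennreal (LINT x|M. (norm (h x))\<^sup>2)"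
    if "integrable M (\<lambda>x. (norm (h x))\<^sup>2)" for h :: "'a => complex"
    using nn_integral_eq_integral[OF that] by (simp add: ennreal_power)
  have "ennreal (norm (LINT x|M. f x * g x)) \<le> (\<integral>\<^sup>+x. ennreal (norm (f x)) * ennreal (norm (g x)) \<partial>M)"
    using integral_norm_bound_ennreal[OF True] by (simp add: norm_mult ennreal_mult)
  then have "(ennreal (norm (LINT x|M. f x * g x)))\<^sup>2 \<le> (\<integral>\<^sup>+x. ennreal (norm (f x)) * ennreal (norm (g x)) \<partial>M)\<^sup>2"
    by (rule power_mono) simp
  also have "... \<le> ennreal ?F * ennreal ?G"
    using Cauchy_Schwarz_nn_integral[of "\<lambda>x. ennreal (norm (f x))" M "\<lambda>x. ennreal (norm (g x))"] by (simp add: sq f g)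
  finally have "(norm (LINT x|M. f x * g x))\<^sup>2 \<le> ?F * ?G"
    using nn by (simp add: ennreal_power ennreal_mult[symmetric] ennreal_le_iff)
  then show ?thesis using real_le_rsqrt by (simp add: real_sqrt_mult[symmetric])
qed (simp add: not_integrable_integral_eq integral_nonneg_AE)

definition zsum :: "(nat \<times> (real ^ 'n)) set => (nat \<times> (real ^ 'n) => complex) => real ^ 'n => complex" where
  "zsum A \<alpha> x = (\<Sum>i\<in>A. \<alpha> i * zonal (fst i) (snd i) x)"

definition Ip_zsum :: "complex => (nat \<times> (real ^ 'n)) set => (nat \<times> (real ^ 'n) => complex) => real ^ 'n => complex" where
  "Ip_zsum z A \<alpha> x = (\<Sum>i\<in>A. \<alpha> i * Ip_zonal z (fst i) (snd i) x)"

lemma continuous_zsum: "continuous_on S (zsum A \<alpha>)"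
  unfolding zsum_def by (intro continuous_intros continuous_zonal)

lemma continuous_Ip_zsum: "continuous_on S (Ip_zsum z A \<alpha>)"
  unfolding Ip_zsum_def by (intro continuous_intros continuous_Ip_zonal)

definition unit_directions :: "(nat \<times> (real ^ 'n)) set => bool" where
  "unit_directions A \<longleftrightarrow> finite A \<and> (\<forall>i\<in>A. norm (snd i) = 1)"

lemma Ip_zsum_imag_bound:
  fixes v :: "real ^ 'n => complex"
  assumes A: "unit_directions A" and v: "continuous_on (sphere 0 1) v"
  shows "norm (LINT x|sphere_measure. Ip_zsum (\<i> * of_real y) A \<alpha> x * v x)
    \<le> (LINT x|sphere_measure. norm (zsum A \<alpha> x)) * (LINT x|sphere_measure. norm (v x)) * exp (pi * \<bar>y\<bar> / 4)"
proof -
  let ?S = "sphere_measure :: (real^'n) measure"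
  let ?C = "kernel_const CARD('n) y"
  let ?U = "LINT x|?S. norm (zsum A \<alpha> x)"
  have intz: "integrable ?S (\<lambda>\<theta>. imag_power y (\<theta> \<bullet> \<xi>) * h \<theta>)" if "continuous_on (sphere 0 1) h" for h \<xi>
  proof (rule Bochner_Integration.integrable_bound[OF sphere_integrable(2)[OF that]])
    have [measurable]: "h \<in> borel_measurable ?S" by (rule sphere_integrable(1)[OF that])
    have [measurable]: "(\<lambda>\<theta>. imag_power y (\<theta> \<bullet> \<xi>)) \<in> borel_measurable ?S" by (rule borel_measurable_sphere_measure) measurable
    show "(\<lambda>\<theta>. imag_power y (\<theta> \<bullet> \<xi>) * h \<theta>) \<in> borel_measurable ?S" by measurable
    show "AE \<theta> in ?S. norm (imag_power y (\<theta> \<bullet> \<xi>) * h \<theta>) \<le> norm (h \<theta>)"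
      by (intro AE_I2) (subst norm_mult, rule mult_left_le_one_le, auto simp: norm_imag_power_le)
  qed
  have pt: "norm (Ip_zsum (\<i> * of_real y) A \<alpha> \<xi>) \<le> norm ?C * ?U" if \<xi>: "norm \<xi> = 1" for \<xi>
  proof -
    have "Ip_zsum (\<i> * of_real y) A \<alpha> \<xi> = (\<Sum>i\<in>A. \<alpha> i * (?C * (LINT \<theta>|?S. imag_power y (\<theta> \<bullet> \<xi>) * zonal (fst i) (snd i) \<theta>)))"
      unfolding Ip_zsum_def using A by (intro sum.cong refl) (simp add: unit_directions_def Ip_zonal_imag_kernel \<xi>)
    also have "... = ?C * (\<Sum>i\<in>A. LINT \<theta>|?S. \<alpha> i * (imag_power y (\<theta> \<bullet> \<xi>) * zonal (fst i) (snd i) \<theta>))"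
      by (simp add: sum_distrib_left mult_ac)
    also have "(\<Sum>i\<in>A. LINT \<theta>|?S. \<alpha> i * (imag_power y (\<theta> \<bullet> \<xi>) * zonal (fst i) (snd i) \<theta>)) = (LINT \<theta>|?S. (\<Sum>i\<in>A. \<alpha> i * (imag_power y (\<theta> \<bullet> \<xi>) * zonal (fst i) (snd i) \<theta>)))"
      by (rule Bochner_Integration.integral_sum[symmetric]) (intro integrable_mult_right intz continuous_zonal)
    also have "... = (LINT \<theta>|?S. imag_power y (\<theta> \<bullet> \<xi>) * zsum A \<alpha> \<theta>)"
      unfolding zsum_def by (intro Bochner_Integration.integral_cong refl) (simp only: sum_distrib_left mult_ac)
    finally have "norm (Ip_zsum (\<i> * of_real y) A \<alpha> \<xi>) = norm ?C * norm (LINT \<theta>|?S. imag_power y (\<theta> \<bullet> \<xi>) * zsum A \<alpha> \<theta>)" by (simp add: norm_mult)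
    also have "norm (LINT \<theta>|?S. imag_power y (\<theta> \<bullet> \<xi>) * zsum A \<alpha> \<theta>) \<le> ?U"
    proof (rule norm_integral_le_integral)
      show "integrable ?S (\<lambda>x. norm (zsum A \<alpha> x))" by (intro integrable_norm sphere_integrable continuous_zsum)
      show "AE \<theta> in ?S. norm (imag_power y (\<theta> \<bullet> \<xi>) * zsum A \<alpha> \<theta>) \<le> norm (zsum A \<alpha> \<theta>)"
        by (intro AE_I2) (subst norm_mult, rule mult_left_le_one_le, auto simp: norm_imag_power_le)
    qed
    finally show ?thesis by (simp add: mult_left_mono)
  qed
  have U: "?U \<ge> 0" by (intro integral_nonneg_AE) auto
  have V: "(LINT x|?S. norm (v x)) \<ge> 0" by (intro integral_nonneg_AE) auto
  have "norm (LINT x|?S. Ip_zsum (\<i> * of_real y) A \<alpha> x * v x) \<le> (LINT x|?S. (norm ?C * ?U) * norm (v x))"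
  proof (rule norm_integral_le_integral)
    show "integrable ?S (\<lambda>x. (norm ?C * ?U) * norm (v x))" by (intro integrable_mult_right integrable_norm sphere_integrable v)
    show "AE x in ?S. norm (Ip_zsum (\<i> * of_real y) A \<alpha> x * v x) \<le> (norm ?C * ?U) * norm (v x)"
      using pt by (intro AE_I2) (auto simp: space_sphere_measure norm_mult intro!: mult_right_mono)
  qed
  also have "... = (?U * (LINT x|?S. norm (v x))) * norm ?C" by simp
  also have "... \<le> (?U * (LINT x|?S. norm (v x))) * exp (pi * \<bar>y\<bar> / 4)"
    using U V by (intro mult_left_mono norm_kernel_const_le) auto
  finally show ?thesis .
qed

lemma zsum_pair_sum:
  fixes f g :: "nat => real ^ 'n => real ^ 'n => complex"
  assumes "\<And>k a. continuous_on (sphere 0 1) (f k a)" "\<And>k a. continuous_on (sphere 0 1) (g k a)"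
  shows "(LINT x|sphere_measure. (\<Sum>i\<in>A. \<alpha> i * f (fst i) (snd i) x) * (\<Sum>j\<in>B. \<beta> j * g (fst j) (snd j) x))
     = (\<Sum>i\<in>A. \<Sum>j\<in>B. \<alpha> i * \<beta> j * (LINT x|sphere_measure. f (fst i) (snd i) x * g (fst j) (snd j) x))"
proof -
  have "(LINT x|sphere_measure. (\<Sum>i\<in>A. \<alpha> i * f (fst i) (snd i) x) * (\<Sum>j\<in>B. \<beta> j * g (fst j) (snd j) x))
    = (LINT x|sphere_measure. (\<Sum>i\<in>A. \<Sum>j\<in>B. (\<alpha> i * \<beta> j) * (f (fst i) (snd i) x * g (fst j) (snd j) x)))"
    unfolding sum_product by (intro Bochner_Integration.integral_cong refl sum.cong) (simp only: mult_ac)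
  also have "... = (\<Sum>i\<in>A. LINT x|sphere_measure. (\<Sum>j\<in>B. (\<alpha> i * \<beta> j) * (f (fst i) (snd i) x * g (fst j) (snd j) x)))"
    by (rule Bochner_Integration.integral_sum) (intro Bochner_Integration.integrable_sum integrable_mult_right zonal_pair_integrable assms)
  also have "... = (\<Sum>i\<in>A. \<Sum>j\<in>B. LINT x|sphere_measure. (\<alpha> i * \<beta> j) * (f (fst i) (snd i) x * g (fst j) (snd j) x))"
    by (intro sum.cong refl Bochner_Integration.integral_sum integrable_mult_right zonal_pair_integrable assms)
  also have "... = (\<Sum>i\<in>A. \<Sum>j\<in>B. \<alpha> i * \<beta> j * (LINT x|sphere_measure. f (fst i) (snd i) x * g (fst j) (snd j) x))"
    by (simp only: integral_mult_right_zero)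
  finally show ?thesis .
qed

lemma Ip_zsum_isometry:
  fixes A :: "(nat \<times> (real ^ 'n)) set"
  assumes A: "unit_directions A" and z: "Re z = real CARD('n) / 2"
  shows "(LINT x|sphere_measure. (norm (Ip_zsum z A \<alpha> x))\<^sup>2) = (LINT x|sphere_measure. (norm (zsum A \<alpha> x))\<^sup>2)"
proof -
  let ?S = "sphere_measure :: (real^'n) measure"
  let ?n = "CARD('n)"
  have c: "cnj z = of_nat ?n - z" using z by (simp add: complex_eq_iff)
  have npos: "real ?n > 0" by simp
  have z': "0 < Re z" "Re z < real ?n" using z npos by linarith+
  have cz: "cnj (zonal k a x) = zonal k a x" for k and a x :: "real^'n" by (simp add: zonal_def)
  have sq: "complex_of_real ((norm w)\<^sup>2) = w * cnj w" for w :: complex by (rule complex_norm_square)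
  have "complex_of_real (LINT x|?S. (norm (Ip_zsum z A \<alpha> x))\<^sup>2) = (LINT x|?S. complex_of_real ((norm (Ip_zsum z A \<alpha> x))\<^sup>2))"
    by (rule integral_complex_of_real[symmetric])
  also have "... = (LINT x|?S. (\<Sum>i\<in>A. \<alpha> i * Ip_zonal z (fst i) (snd i) x) * (\<Sum>j\<in>A. cnj (\<alpha> j) * Ip_zonal (of_nat ?n - z) (fst j) (snd j) x))"
    unfolding sq Ip_zsum_def cnj_sum complex_cnj_mult cnj_Ip_zonal c ..
  also have "... = (\<Sum>i\<in>A. \<Sum>j\<in>A. \<alpha> i * cnj (\<alpha> j) * (LINT x|?S. Ip_zonal z (fst i) (snd i) x * Ip_zonal (of_nat ?n - z) (fst j) (snd j) x))"
    by (rule zsum_pair_sum) (rule continuous_Ip_zonal)+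
  also have "... = (\<Sum>i\<in>A. \<Sum>j\<in>A. \<alpha> i * cnj (\<alpha> j) * (LINT x|?S. zonal (fst i) (snd i) x * zonal (fst j) (snd j) x))"
    using A by (intro sum.cong refl) (simp add: Ip_zonal_isometry[OF _ _ z'] unit_directions_def)
  also have "... = (LINT x|?S. (\<Sum>i\<in>A. \<alpha> i * zonal (fst i) (snd i) x) * (\<Sum>j\<in>A. cnj (\<alpha> j) * zonal (fst j) (snd j) x))"
    by (rule zsum_pair_sum[symmetric]) (rule continuous_zonal)+
  also have "... = (LINT x|?S. complex_of_real ((norm (zsum A \<alpha> x))\<^sup>2))"
    unfolding sq zsum_def cnj_sum complex_cnj_mult cz ..
  also have "... = complex_of_real (LINT x|?S. (norm (zsum A \<alpha> x))\<^sup>2)"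
    by (rule integral_complex_of_real)
  finally show ?thesis by (simp only: of_real_eq_iff)
qed

lemma sphere_integrable_real:
  fixes u :: "real ^ 'n => real"
  assumes "continuous_on (sphere 0 1) u"
  shows "integrable sphere_measure u"
proof -
  have "integrable sphere_measure (\<lambda>x. complex_of_real (u x))"
    by (intro sphere_integrable continuous_intros assms)
  from integrable_Re[OF this] show ?thesis by simp
qed

lemma Ip_zsum_half_bound:
  fixes v :: "real ^ 'n => complex"
  assumes A: "unit_directions A" and v: "continuous_on (sphere 0 1) v" and z: "Re z = real CARD('n) / 2"
  shows "norm (LINT x|sphere_measure. Ip_zsum z A \<alpha> x * v x)
    \<le> sqrt (LINT x|sphere_measure. (norm (zsum A \<alpha> x))\<^sup>2) * sqrt (LINT x|sphere_measure. (norm (v x))\<^sup>2)"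
  unfolding Ip_zsum_isometry[OF A z, symmetric]
  by (intro cauchy_schwarz_lebesgue sphere_integrable(1) sphere_integrable_real continuous_intros continuous_Ip_zsum v)

text \<open>
  The edge bounds in the form in which the three lines theorem takes them: \<open>L\<^sup>1\<close> norms on the
  imaginary axis, where the kernel is bounded, and \<open>L\<^sup>2\<close> norms at \<open>Re z = n / 2\<close>. The coefficients may
  depend on \<open>z\<close>, as Stein's version of interpolation requires.
\<close>

theorem stein_zonal:
  fixes A B :: "(nat \<times> (real ^ 'n)) set"
  assumes A: "unit_directions A" and B: "unit_directions B"
    and hol: "\<And>i. i \<in> A ==> \<alpha> i holomorphic_on UNIV" "\<And>i. i \<in> B ==> \<beta> i holomorphic_on UNIV"
    and bdd: "\<And>i z. i \<in> A ==> 0 \<le> Re z ==> Re z \<le> real CARD('n) / 2 ==> norm (\<alpha> i z) \<le> C"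
      "\<And>i z. i \<in> B ==> 0 \<le> Re z ==> Re z \<le> real CARD('n) / 2 ==> norm (\<beta> i z) \<le> C"
    and N: "N0 > 0" "N1 > 0" "M0 > 0" "M1 > 0"
    and n0: "\<And>y. (LINT x|sphere_measure. norm (zsum A (\<lambda>i. \<alpha> i (\<i> * of_real y)) x)) \<le> N0"
    and m0: "\<And>y. (LINT x|sphere_measure. norm (zsum B (\<lambda>i. \<beta> i (\<i> * of_real y)) x)) \<le> M0"
    and n1: "\<And>z. Re z = real CARD('n) / 2 ==> (LINT x|sphere_measure. (norm (zsum A (\<lambda>i. \<alpha> i z) x))\<^sup>2) \<le> N1"
    and m1: "\<And>z. Re z = real CARD('n) / 2 ==> (LINT x|sphere_measure. (norm (zsum B (\<lambda>i. \<beta> i z) x))\<^sup>2) \<le> M1"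
    and p: "0 < p" "p < real CARD('n) / 2"
  shows "norm (LINT x|sphere_measure. Ip_zsum (of_real p) A (\<lambda>i. \<alpha> i (of_real p)) x * zsum B (\<lambda>i. \<beta> i (of_real p)) x)
    \<le> (real CARD('n) / 2 / p) powr (p / 2) * (N0 * M0) powr (1 - p / (real CARD('n) / 2)) * (sqrt N1 * sqrt M1) powr (p / (real CARD('n) / 2))"
proof -
  let ?n = "CARD('n)"
  let ?S = "sphere_measure :: (real^'n) measure"
  define \<Phi> where "\<Phi> z = (LINT x|?S. Ip_zsum z A (\<lambda>i. \<alpha> i z) x * zsum B (\<lambda>i. \<beta> i z) x)" for z
  have \<Phi>: "\<Phi> z = (\<Sum>i\<in>A. \<Sum>j\<in>B. \<alpha> i z * \<beta> j z * (\<Sum>l\<le>fst i. zcoef ?n z (fst i) l * zpair (l, snd i) j))" for z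
    unfolding \<Phi>_def Ip_zsum_def zsum_def
    by (subst zsum_pair_sum) (auto intro!: continuous_Ip_zonal continuous_zonal sum.cong simp: Ip_zonal_pair_left)
  let ?P = "\<Sum>i\<in>A. \<Sum>j\<in>B. \<bar>C\<bar> * \<bar>C\<bar> * (\<Sum>l\<le>fst i. 4 ^ fst i * norm (zpair (l, snd i) j))"
  have "norm (\<Phi> (of_real p)) \<le> (real ?n / 2 / p) powr (p / 2) * (N0 * M0) powr (1 - p / (real ?n / 2)) * (sqrt N1 * sqrt M1) powr (p / (real ?n / 2))"
  proof (rule three_lines_weighted[where S="{z. Re z < real ?n}" and M="?P"])
    show "real ?n / 2 > 0" by simp
    show "\<Phi> holomorphic_on {z. Re z < real ?n}"
      unfolding \<Phi> by (intro holomorphic_intros holomorphic_zcoef holomorphic_on_subset[OF hol(1)] holomorphic_on_subset[OF hol(2)]) auto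
    show "open {z. Re z < real ?n}" by (rule open_halfspace_Re_lt)
    show "{z. 0 \<le> Re z \<and> Re z \<le> real ?n / 2} \<subseteq> {z. Re z < real ?n}"
    proof safe
      fix z assume "Re z \<le> real ?n / 2"
      moreover have "real ?n > 0" by simp
      ultimately show "Re z < real ?n" by linarith
    qed
    show "norm (\<Phi> z) \<le> ?P" if z: "0 \<le> Re z" "Re z \<le> real ?n / 2" for z
    proof -
      have "norm (\<alpha> i z * \<beta> j z * (\<Sum>l\<le>fst i. zcoef ?n z (fst i) l * zpair (l, snd i) j)) \<le> \<bar>C\<bar> * \<bar>C\<bar> * (\<Sum>l\<le>fst i. 4 ^ fst i * norm (zpair (l, snd i) j))"
        if i: "i \<in> A" and j: "j \<in> B" for i j
      proof -
        have "norm (\<Sum>l\<le>fst i. zcoef ?n z (fst i) l * zpair (l, snd i) j) \<le> (\<Sum>l\<le>fst i. 4 ^ fst i * norm (zpair (l, snd i) j))"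
          by (intro sum_norm_le) (auto simp: norm_mult intro!: mult_right_mono norm_zcoef_le z)
        moreover have "norm (\<alpha> i z) \<le> \<bar>C\<bar>" "norm (\<beta> j z) \<le> \<bar>C\<bar>" using bdd(1)[OF i z] bdd(2)[OF j z] by auto
        ultimately show ?thesis unfolding norm_mult by (intro mult_mono) auto
      qed
      then show ?thesis unfolding \<Phi> by (intro sum_norm_le) auto
    qed
    show "N0 * M0 > 0" "sqrt N1 * sqrt M1 > 0" using N by auto
    show "norm (\<Phi> (\<i> * of_real y)) \<le> N0 * M0 * exp (pi * \<bar>y\<bar> / 4)" for y
    proof -
      have "norm (\<Phi> (\<i> * of_real y)) \<le> (LINT x|?S. norm (zsum A (\<lambda>i. \<alpha> i (\<i> * of_real y)) x)) * (LINT x|?S. norm (zsum B (\<lambda>i. \<beta> i (\<i> * of_real y)) x)) * exp (pi * \<bar>y\<bar> / 4)"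
        unfolding \<Phi>_def by (rule Ip_zsum_imag_bound[OF A continuous_zsum])
      also have "... \<le> N0 * M0 * exp (pi * \<bar>y\<bar> / 4)"
        using n0[of y] m0[of y] N by (intro mult_right_mono mult_mono) (auto intro!: integral_nonneg_AE)
      finally show ?thesis .
    qed
    show "norm (\<Phi> (of_real (real ?n / 2) + \<i> * of_real y)) \<le> sqrt N1 * sqrt M1" for y
    proof -
      let ?z = "of_real (real ?n / 2) + \<i> * complex_of_real y"
      have z: "Re ?z = real ?n / 2" by simp
      have "norm (\<Phi> ?z) \<le> sqrt (LINT x|?S. (norm (zsum A (\<lambda>i. \<alpha> i ?z) x))\<^sup>2) * sqrt (LINT x|?S. (norm (zsum B (\<lambda>i. \<beta> i ?z) x))\<^sup>2)"
        unfolding \<Phi>_def by (rule Ip_zsum_half_bound[OF A continuous_zsum z])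
      also have "... \<le> sqrt N1 * sqrt M1"
        using n1[OF z] m1[OF z] N by (intro mult_mono real_sqrt_le_mono) auto
      finally show ?thesis .
    qed
  qed (use p in auto)
  then show ?thesis unfolding \<Phi>_def .
qed

section \<open>Density of the zonal polynomials\<close>

definition zonal_span :: "(real ^ 'n => complex) => bool" where
  "zonal_span u \<longleftrightarrow> (\<exists>A \<alpha>. unit_directions A \<and> u = zsum A \<alpha>)"

lemma zsum_mono_neutral:
  assumes "finite B" "A \<subseteq> B" "\<And>i. i \<in> B - A ==> \<alpha> i = 0"
  shows "zsum A \<alpha> = zsum B \<alpha>"
  unfolding zsum_def fun_eq_iff using assms by (auto intro!: sum.mono_neutral_left)

lemma zonal_span_add: "zonal_span u ==> zonal_span v ==> zonal_span (\<lambda>x. u x + v x)"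
proof -
  assume "zonal_span u" "zonal_span v"
  then obtain A \<alpha> B \<beta> where A: "unit_directions A" "u = zsum A \<alpha>" and B: "unit_directions B" "v = zsum B \<beta>"
    unfolding zonal_span_def by blast
  let ?a = "\<lambda>i. if i \<in> A then \<alpha> i else 0" and ?b = "\<lambda>i. if i \<in> B then \<beta> i else 0"
  have f: "finite (A \<union> B)" using A B by (simp add: unit_directions_def)
  have "zsum A \<alpha> = zsum A ?a" "zsum B \<beta> = zsum B ?b" by (simp_all add: zsum_def fun_eq_iff)
  moreover have "zsum A ?a = zsum (A \<union> B) ?a" "zsum B ?b = zsum (A \<union> B) ?b" by (rule zsum_mono_neutral[OF f]; auto)+
  moreover have "(\<lambda>x. zsum (A \<union> B) ?a x + zsum (A \<union> B) ?b x) = zsum (A \<union> B) (\<lambda>i. ?a i + ?b i)"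
    by (simp add: zsum_def fun_eq_iff sum.distrib[symmetric] distrib_right)
  ultimately have "(\<lambda>x. u x + v x) = zsum (A \<union> B) (\<lambda>i. ?a i + ?b i)" using A B by simp
  moreover have "unit_directions (A \<union> B)" using A B by (auto simp: unit_directions_def)
  ultimately show ?thesis unfolding zonal_span_def by blast
qed

lemma zonal_span_cmult: "zonal_span u ==> zonal_span (\<lambda>x. c * u x)"
proof -
  assume "zonal_span u"
  then obtain A \<alpha> where A: "unit_directions A" "u = zsum A \<alpha>" unfolding zonal_span_def by blast
  have "(\<lambda>x. c * u x) = zsum A (\<lambda>i. c * \<alpha> i)" by (simp add: A zsum_def fun_eq_iff sum_distrib_left mult.assoc)
  then show ?thesis using A unfolding zonal_span_def by blast
qed

lemma zonal_span_0: "zonal_span (\<lambda>x. 0)"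
proof -
  have "unit_directions {}" "(\<lambda>x. 0) = zsum {} (\<lambda>_. 0)" by (simp_all add: unit_directions_def zsum_def fun_eq_iff)
  then show ?thesis unfolding zonal_span_def by blast
qed

lemma zonal_span_sum: "finite I ==> (\<And>i. i \<in> I ==> zonal_span (f i)) ==> zonal_span (\<lambda>x. \<Sum>i\<in>I. f i x)"
  by (induction I rule: finite_induct) (auto intro: zonal_span_0 zonal_span_add)

lemma zonal_span_zonal: "norm a = 1 ==> zonal_span (zonal k a)"
proof -
  assume "norm a = 1"
  then have "unit_directions {(k, a)}" "zonal k a = zsum {(k, a)} (\<lambda>_. 1)" by (simp_all add: unit_directions_def zsum_def fun_eq_iff)
  then show ?thesis unfolding zonal_span_def by blast
qed

lemma zonal_span_even_power: "zonal_span (\<lambda>x::real^'n. of_real ((x \<bullet> a) ^ (2 * k)))"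
proof (cases "a = 0")
  case True
  obtain e :: "real ^ 'n" where e: "norm e = 1" using norm_axis_1 by blast
  show ?thesis
  proof (cases "k = 0")
    case k: True
    have "(\<lambda>x::real^'n. of_real ((x \<bullet> a) ^ (2 * k))) = zonal 0 e" using k by (simp add: zonal_def fun_eq_iff)
    then show ?thesis using zonal_span_zonal[OF e] by simp
  next
    case False
    then have "(\<lambda>x::real^'n. complex_of_real ((x \<bullet> a) ^ (2 * k))) = (\<lambda>x. 0)" using True by (simp add: fun_eq_iff power_0_left)
    then show ?thesis using zonal_span_0 by simp
  qed
next
  case False
  have "(\<lambda>x::real^'n. complex_of_real ((x \<bullet> a) ^ (2 * k))) = (\<lambda>x. of_real (norm a ^ (2 * k) * fact (2 * k) / 4 ^ k) * zonal k (a /\<^sub>R norm a) x)"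
  proof
    fix x :: "real^'n"
    have "(x \<bullet> a) ^ (2 * k) = norm a ^ (2 * k) * fact (2 * k) / 4 ^ k * (4 ^ k * (x \<bullet> (a /\<^sub>R norm a)) ^ (2 * k) / fact (2 * k))"
      using False by (simp add: power_mult_distrib power_inverse field_simps)
    then have "complex_of_real ((x \<bullet> a) ^ (2 * k)) = of_real (norm a ^ (2 * k) * fact (2 * k) / 4 ^ k * (4 ^ k * (x \<bullet> (a /\<^sub>R norm a)) ^ (2 * k) / fact (2 * k)))" by (rule arg_cong)
    then show "complex_of_real ((x \<bullet> a) ^ (2 * k)) = of_real (norm a ^ (2 * k) * fact (2 * k) / 4 ^ k) * zonal k (a /\<^sub>R norm a) x"
      unfolding zonal_def by (simp only: of_real_mult)
  qed
  moreover have "norm (a /\<^sub>R norm a) = 1" using False by simp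
  ultimately show ?thesis using zonal_span_cmult[OF zonal_span_zonal] by metis
qed

lemma abs_average_less:
  fixes a b s t e :: real
  assumes "\<bar>a - s\<bar> < e" "\<bar>b - t\<bar> < e" shows "\<bar>(a + b) / 2 - (s + t) / 2\<bar> < e"
proof -
  have "a - s < e" "s - a < e" "b - t < e" "t - b < e" using assms by linarith+
  then have "(a + b) / 2 - (s + t) / 2 < e" "(s + t) / 2 - (a + b) / 2 < e" unfolding add_divide_distrib by linarith+
  then show ?thesis by linarith
qed

definition zonal_limit :: "(real ^ 'n => complex) => bool" where
  "zonal_limit f \<longleftrightarrow> (\<forall>e>0. \<exists>u. zonal_span u \<and> (\<forall>x\<in>sphere 0 1. norm (f x - u x) < e))"

lemma zonal_limit_add: "zonal_limit f ==> zonal_limit g ==> zonal_limit (\<lambda>x. f x + g x)"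
  unfolding zonal_limit_def
proof (intro allI impI)
  fix e :: real assume "e > 0" and f: "\<forall>e>0. \<exists>u. zonal_span u \<and> (\<forall>x\<in>sphere 0 1. norm (f x - u x) < e)"
    and g: "\<forall>e>0. \<exists>u. zonal_span u \<and> (\<forall>x\<in>sphere 0 1. norm (g x - u x) < e)"
  then have "e / 2 > 0" by simp
  then obtain u v where u: "zonal_span u" "\<And>x. x \<in> sphere 0 1 ==> norm (f x - u x) < e / 2" and v: "zonal_span v" "\<And>x. x \<in> sphere 0 1 ==> norm (g x - v x) < e / 2"
    using f g by blast
  have "norm ((f x + g x) - (u x + v x)) < e" if "x \<in> sphere 0 1" for x
    using norm_triangle_ineq[of "f x - u x" "g x - v x"] u(2)[OF that] v(2)[OF that] by (simp add: algebra_simps)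
  then show "\<exists>u. zonal_span u \<and> (\<forall>x\<in>sphere 0 1. norm (f x + g x - u x) < e)"
    using zonal_span_add[OF u(1) v(1)] by blast
qed

lemma zonal_limit_cmult:
  assumes "zonal_limit f" shows "zonal_limit (\<lambda>x. c * f x)"
  unfolding zonal_limit_def
proof (intro allI impI)
  fix e :: real assume e: "e > 0"
  have "e / (norm c + 1) > 0" using e by (simp add: add_nonneg_pos)
  then obtain u where u: "zonal_span u" "\<And>x. x \<in> sphere 0 1 ==> norm (f x - u x) < e / (norm c + 1)"
    using assms unfolding zonal_limit_def by blast
  have "norm (c * f x - c * u x) < e" if "x \<in> sphere 0 1" for x
  proof -
    have "norm (c * f x - c * u x) = norm c * norm (f x - u x)" by (simp add: right_diff_distrib[symmetric] norm_mult)
    also have "... \<le> norm c * (e / (norm c + 1))" using u(2)[OF that] by (intro mult_left_mono) auto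
    also have "... < e"
    proof -
      have "norm c + 1 > 0" by (simp add: add_nonneg_pos)
      then show ?thesis using e by (simp add: pos_divide_less_eq distrib_left)
    qed
    finally show ?thesis .
  qed
  then show "\<exists>u. zonal_span u \<and> (\<forall>x\<in>sphere 0 1. norm (c * f x - u x) < e)" using zonal_span_cmult[OF u(1)] by blast
qed

lemma zonal_limit_uniform:
  assumes "\<And>e. e > 0 ==> \<exists>g. zonal_limit g \<and> (\<forall>x\<in>sphere 0 1. norm (f x - g x) < e)"
  shows "zonal_limit f"
  unfolding zonal_limit_def
proof (intro allI impI)
  fix e :: real assume "e > 0"
  then have e: "e / 2 > 0" by simp
  obtain g where g: "zonal_limit g" "\<And>x. x \<in> sphere 0 1 ==> norm (f x - g x) < e / 2" using assms[OF e] by blast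
  obtain u where u: "zonal_span u" "\<And>x. x \<in> sphere 0 1 ==> norm (g x - u x) < e / 2" using g(1) e unfolding zonal_limit_def by blast
  have "norm (f x - u x) < e" if "x \<in> sphere 0 1" for x
    using norm_triangle_ineq[of "f x - g x" "g x - u x"] g(2)[OF that] u(2)[OF that] by simp
  then show "\<exists>u. zonal_span u \<and> (\<forall>x\<in>sphere 0 1. norm (f x - u x) < e)" using u(1) by blast
qed

lemma zonal_limit_even_exp: "zonal_limit (\<lambda>x::real^'n. of_real ((exp (x \<bullet> a) + exp (- (x \<bullet> a))) / 2))"
  unfolding zonal_limit_def
proof (intro allI impI)
  fix e :: real assume e: "e > 0"
  have "uniform_limit {-norm a..norm a} (\<lambda>N t. \<Sum>m<N. t ^ m / fact m) (\<lambda>t. \<Sum>m. t ^ m / fact m) sequentially"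
  proof (rule Weierstrass_m_test[where M="\<lambda>m. norm a ^ m / fact m"])
    show "norm (t ^ m / fact m) \<le> norm a ^ m / fact m" if "t \<in> {-norm a..norm a}" for m t
      using that by (auto simp: power_abs abs_mult intro!: divide_right_mono power_mono)
    show "summable (\<lambda>m. norm a ^ m / fact m)" using summable_exp_generic[of "norm a"] by (simp add: divide_inverse mult.commute)
  qed
  moreover have "(\<lambda>t::real. \<Sum>m. t ^ m / fact m) = exp" by (simp add: exp_def divide_inverse mult.commute fun_eq_iff)
  ultimately have "uniform_limit {-norm a..norm a} (\<lambda>N t. \<Sum>m<N. t ^ m / fact m) exp sequentially" by simp
  then have "\<forall>\<^sub>F N in sequentially. \<forall>t\<in>{-norm a..norm a}. dist (\<Sum>m<N. t ^ m / fact m) (exp t) < e"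
    using e by (rule uniform_limitD)
  then obtain N where N': "\<forall>t\<in>{-norm a..norm a}. dist (\<Sum>m<N. t ^ m / fact m) (exp t) < e"
    unfolding eventually_sequentially by blast
  have N: "\<bar>(\<Sum>m<N. t ^ m / fact m) - exp t\<bar> < e" if "\<bar>t\<bar> \<le> norm a" for t
    using N'[rule_format, of t] that by (simp add: dist_real_def abs_le_iff)
  define u where "u x = (\<Sum>m<N. complex_of_real (((x \<bullet> a) ^ m / fact m + (- (x \<bullet> a)) ^ m / fact m) / 2))" for x :: "real^'n"
  have "zonal_span u"
    unfolding u_def
  proof (rule zonal_span_sum)
    fix m
    show "zonal_span (\<lambda>x. complex_of_real (((x \<bullet> a) ^ m / fact m + (- (x \<bullet> a)) ^ m / fact m) / 2))"
    proof (cases "even m")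
      case True
      then obtain k where k: "m = 2 * k" by blast
      have "(\<lambda>x. complex_of_real (((x \<bullet> a) ^ m / fact m + (- (x \<bullet> a)) ^ m / fact m) / 2)) = (\<lambda>x. of_real (1 / fact m) * of_real ((x \<bullet> a) ^ (2 * k)))"
        by (simp add: k fun_eq_iff)
      then show ?thesis using zonal_span_cmult[OF zonal_span_even_power[of a k], of "of_real (1 / fact m)"] by simp
    next
      case False
      then have "(\<lambda>x. complex_of_real (((x \<bullet> a) ^ m / fact m + (- (x \<bullet> a)) ^ m / fact m) / 2)) = (\<lambda>x. 0)" by (simp add: fun_eq_iff)
      then show ?thesis using zonal_span_0 by simp
    qed
  qed simp
  moreover have "norm (of_real ((exp (x \<bullet> a) + exp (- (x \<bullet> a))) / 2) - u x) < e" if "x \<in> sphere 0 1" for x :: "real^'n"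
  proof -
    have "\<bar>x \<bullet> a\<bar> \<le> norm a" using Cauchy_Schwarz_ineq2[of x a] that by simp
    then have 1: "\<bar>(\<Sum>m<N. (x \<bullet> a) ^ m / fact m) - exp (x \<bullet> a)\<bar> < e" "\<bar>(\<Sum>m<N. (- (x \<bullet> a)) ^ m / fact m) - exp (- (x \<bullet> a))\<bar> < e"
      using N[of "x \<bullet> a"] N[of "- (x \<bullet> a)"] by auto
    have "u x = of_real (((\<Sum>m<N. (x \<bullet> a) ^ m / fact m) + (\<Sum>m<N. (- (x \<bullet> a)) ^ m / fact m)) / 2)"
      unfolding u_def of_real_sum[symmetric] by (simp only: sum.distrib sum_divide_distrib[symmetric])
    then have "norm (of_real ((exp (x \<bullet> a) + exp (- (x \<bullet> a))) / 2) - u x) = \<bar>(exp (x \<bullet> a) + exp (- (x \<bullet> a))) / 2 - ((\<Sum>m<N. (x \<bullet> a) ^ m / fact m) + (\<Sum>m<N. (- (x \<bullet> a)) ^ m / fact m)) / 2\<bar>"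
      by (simp only: of_real_diff[symmetric] norm_of_real)
    also have "... < e" using 1 by (intro abs_average_less) (auto simp: abs_minus_commute)
    finally show ?thesis .
  qed
  ultimately show "\<exists>u. zonal_span u \<and> (\<forall>x\<in>sphere 0 1. norm (of_real ((exp (x \<bullet> a) + exp (- (x \<bullet> a))) / 2) - u x) < e)" by blast
qed

text \<open>
  An algebra that separates points, to which the Stone-Weierstrass theorem applies. Exponentials are
  chosen because the even part of \<open>exp (x \<bullet> a)\<close> is a power series in zonal polynomials.
\<close>

inductive exp_span :: "(real ^ 'n => real) => bool" where
  base: "exp_span (\<lambda>x. c * exp (x \<bullet> a))"
| add: "exp_span f ==> exp_span g ==> exp_span (\<lambda>x. f x + g x)"

lemma exp_span_mult: "exp_span f ==> exp_span g ==> exp_span (\<lambda>x. f x * g x)"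
proof (induction f rule: exp_span.induct)
  case (base c a)
  show ?case using base
  proof (induction g rule: exp_span.induct)
    case (base d b)
    have "(\<lambda>x. (c * exp (x \<bullet> a)) * (d * exp (x \<bullet> b))) = (\<lambda>x. (c * d) * exp (x \<bullet> (a + b)))"
      by (simp add: inner_add_right exp_add fun_eq_iff)
    then show ?case using exp_span.base by metis
  next
    case (add g h)
    then show ?case using exp_span.add[OF add.IH] by (simp add: distrib_left)
  qed
next
  case (add f h)
  then show ?case using exp_span.add[of "\<lambda>x. f x * g x" "\<lambda>x. h x * g x"] by (simp add: distrib_right)
qed

lemma exp_span_continuous: "exp_span f ==> continuous_on S f"
  by (induction rule: exp_span.induct) (auto intro!: continuous_intros)

lemma exp_span_even_limit: "exp_span f ==> zonal_limit (\<lambda>x. of_real ((f x + f (- x)) / 2))"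
proof (induction rule: exp_span.induct)
  case (base c a)
  have "(\<lambda>x. complex_of_real ((c * exp (x \<bullet> a) + c * exp (- x \<bullet> a)) / 2)) = (\<lambda>x. of_real c * of_real ((exp (x \<bullet> a) + exp (- (x \<bullet> a))) / 2))"
    by (simp add: fun_eq_iff algebra_simps add_divide_distrib)
  then show ?case using zonal_limit_cmult[OF zonal_limit_even_exp[of a], of "of_real c"] by simp
next
  case (add f g)
  have "(\<lambda>x. complex_of_real ((f x + g x + (f (- x) + g (- x))) / 2)) = (\<lambda>x. of_real ((f x + f (- x)) / 2) + of_real ((g x + g (- x)) / 2))"
    by (simp add: fun_eq_iff add_divide_distrib)
  then show ?case using zonal_limit_add[OF add.IH] by simp
qed

lemma zonal_dense_real:
  fixes f :: "real ^ 'n => real"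
  assumes f: "continuous_on (sphere 0 1) f" and ev: "\<And>x. norm x = 1 ==> f (- x) = f x"
  shows "zonal_limit (\<lambda>x. of_real (f x))"
proof (rule zonal_limit_uniform)
  fix e :: real assume e: "e > 0"
  have "\<exists>g. exp_span g \<and> (\<forall>x\<in>sphere 0 1. \<bar>f x - g x\<bar> < e)"
  proof (rule Stone_Weierstrass_HOL[where P=exp_span])
    show "compact (sphere 0 (1::real) :: (real^'n) set)" by (rule compact_sphere)
    show "exp_span (\<lambda>x. c)" for c using exp_span.base[of c 0] by simp
    show "continuous_on (sphere 0 1) g" if "exp_span g" for g :: "real^'n => real" using that by (rule exp_span_continuous)
    show "exp_span (\<lambda>x. f x + g x)" if "exp_span f \<and> exp_span g" for f g :: "real^'n => real" using that exp_span.add by blast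
    show "exp_span (\<lambda>x. f x * g x)" if "exp_span f \<and> exp_span g" for f g :: "real^'n => real" using that exp_span_mult by blast
    show "\<exists>f. exp_span f \<and> f x \<noteq> f y" if "x \<in> sphere 0 1 \<and> y \<in> sphere 0 1 \<and> x \<noteq> y" for x y :: "real^'n"
    proof (intro exI conjI)
      show "exp_span (\<lambda>z. 1 * exp (z \<bullet> (x - y)))" by (rule exp_span.base)
      have "(x - y) \<bullet> (x - y) \<noteq> 0" using that by simp
      then show "1 * exp (x \<bullet> (x - y)) \<noteq> 1 * exp (y \<bullet> (x - y))" by (simp add: inner_diff_left)
    qed
  qed (use f e in auto)
  then obtain g where g: "exp_span g" "\<And>x. x \<in> sphere 0 1 ==> \<bar>f x - g x\<bar> < e" by blast
  have "norm (complex_of_real (f x) - of_real ((g x + g (- x)) / 2)) < e" if "x \<in> sphere 0 1" for x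
  proof -
    have "\<bar>f x - g x\<bar> < e" "\<bar>f x - g (- x)\<bar> < e" using g(2)[of x] g(2)[of "- x"] ev[of x] that by auto
    then have "\<bar>f x - (g x + g (- x)) / 2\<bar> < e" using abs_average_less[of "f x" "g x" e "f x" "g (- x)"] by simp
    then show ?thesis by (simp only: of_real_diff[symmetric] norm_of_real)
  qed
  then show "\<exists>g. zonal_limit g \<and> (\<forall>x\<in>sphere 0 1. norm (complex_of_real (f x) - g x) < e)"
    using exp_span_even_limit[OF g(1)] by blast
qed

theorem zonal_dense:
  fixes f :: "real ^ 'n => complex"
  assumes f: "continuous_on (sphere 0 1) f" and ev: "\<And>x. norm x = 1 ==> f (- x) = f x"
  shows "zonal_limit f"
proof -
  have "zonal_limit (\<lambda>x. of_real (Re (f x)) + \<i> * of_real (Im (f x)))"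
    by (intro zonal_limit_add zonal_limit_cmult zonal_dense_real continuous_intros f) (simp_all add: ev)
  moreover have "(\<lambda>x. of_real (Re (f x)) + \<i> * of_real (Im (f x))) = f" by (simp add: complex_eq[symmetric])
  ultimately show ?thesis by simp
qed

section \<open>Analytic families of zonal polynomials\<close>

lemma zonal_span_common:
  assumes C: "finite C" and f: "\<And>c. c \<in> C ==> zonal_span (f c)"
  shows "\<exists>A \<gamma>. unit_directions A \<and> (\<forall>c\<in>C. f c = zsum A (\<gamma> c))"
proof -
  have "\<forall>c\<in>C. \<exists>A \<alpha>. unit_directions A \<and> f c = zsum A \<alpha>" using f unfolding zonal_span_def by blast
  then obtain A \<alpha> where A: "\<And>c. c \<in> C ==> unit_directions (A c)" "\<And>c. c \<in> C ==> f c = zsum (A c) (\<alpha> c)" by metis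
  let ?A = "\<Union>c\<in>C. A c" and ?g = "\<lambda>c i. if i \<in> A c then \<alpha> c i else 0"
  have fin: "finite ?A" using C A(1) by (auto simp: unit_directions_def)
  have "f c = zsum ?A (?g c)" if "c \<in> C" for c
  proof -
    have "f c = zsum (A c) (?g c)" by (simp add: A(2)[OF that] zsum_def fun_eq_iff)
    also have "... = zsum ?A (?g c)" by (rule zsum_mono_neutral[OF fin]) (use that in auto)
    finally show ?thesis .
  qed
  moreover have "unit_directions ?A" using fin A(1) by (auto simp: unit_directions_def)
  ultimately show ?thesis by (intro exI[of _ ?A] exI[of _ ?g]) auto
qed

text \<open>
  A partition of unity indexed by a finite net of values of \<open>u\<close>. It depends on \<open>x\<close> only through
  \<open>u x\<close>, so that evenness is inherited.
\<close>

lemma value_partition: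
  fixes u :: "real ^ 'n => complex"
  assumes u: "continuous_on (sphere 0 1) u" and ev: "\<And>x. norm x = 1 ==> u (- x) = u x" and e: "e > 0"
  obtains C and P :: "complex => real ^ 'n => real" where "finite C"
    "\<And>c. continuous_on (sphere 0 1) (P c)" "\<And>c x. norm x = 1 ==> P c (- x) = P c x"
    "\<And>c x. P c x \<ge> 0" "\<And>x. norm x = 1 ==> (\<Sum>c\<in>C. P c x) = 1" "\<And>c x. norm x = 1 ==> P c x \<noteq> 0 ==> norm (u x - c) < e"
proof -
  have "compact (u ` sphere 0 1)" by (intro compact_continuous_image u compact_sphere)
  then obtain C where C: "finite C" "u ` sphere 0 1 \<subseteq> (\<Union>c\<in>C. ball c e)"
    using e unfolding compact_eq_totally_bounded by blast
  define b where "b c x = max 0 (e - norm (u x - c))" for c x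
  define D where "D x = (\<Sum>c\<in>C. b c x)" for x
  have b0: "b c x \<ge> 0" for c x by (simp add: b_def)
  have D: "D x > 0" if "norm x = 1" for x
  proof -
    have "u x \<in> (\<Union>c\<in>C. ball c e)" by (rule subsetD[OF C(2)]) (use that in auto)
    then obtain c where c: "c \<in> C" "norm (u x - c) < e" by (auto simp: dist_norm norm_minus_commute)
    then have "b c x > 0" by (simp add: b_def)
    also have "b c x \<le> D x" unfolding D_def by (rule member_le_sum) (use c C b0 in auto)
    finally show ?thesis .
  qed
  show ?thesis
  proof (rule that[of C "\<lambda>c x. b c x / D x"])
    have cb: "continuous_on (sphere 0 1) (b c)" for c unfolding b_def by (intro continuous_intros u)
    then show "continuous_on (sphere 0 1) (\<lambda>x. b c x / D x)" for c
      unfolding D_def by (intro continuous_intros) (use D in \<open>auto simp: D_def less_imp_neq[symmetric]\<close>)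
    show "b c (- x) / D (- x) = b c x / D x" if "norm x = 1" for c x using ev[OF that] by (simp add: D_def b_def)
    show "b c x / D x \<ge> 0" for c x using b0 by (simp add: D_def sum_nonneg)
    show "(\<Sum>c\<in>C. b c x / D x) = 1" if "norm x = 1" for x
      using D[OF that] by (simp add: sum_divide_distrib[symmetric] D_def)
    show "norm (u x - c) < e" if "norm x = 1" "b c x / D x \<noteq> 0" for c x
      using that by (auto simp: b_def max_def split: if_splits)
  qed (use C in auto)
qed

text \<open>
  The complex power of the modulus with the phase kept, as in the standard proof of interpolation.
\<close>

definition phase_powr :: "complex => complex => complex" where
  "phase_powr s c = (if c = 0 then 0 else sgn c * of_real (norm c) powr s)"

lemma norm_phase_powr: "norm (phase_powr s c) = norm c powr Re s"
  by (simp add: phase_powr_def norm_mult norm_sgn norm_powr_real_powr)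

lemma phase_powr_1: "phase_powr 1 c = c"
  by (simp add: phase_powr_def complex_eq_iff sgn_div_norm)

lemma holomorphic_phase_powr: "f holomorphic_on S ==> (\<lambda>z. phase_powr (f z) c) holomorphic_on S"
  unfolding phase_powr_def by (cases "c = 0") (auto intro!: holomorphic_intros)

text \<open>
  The family used in complex interpolation is \<open>sgn u \<bar>u\<bar> powr s\<close> with \<open>s = q (1 - z / n)\<close>, which is \<open>u\<close> itself at
  \<open>z = p\<close>. It is replaced by a finite sum of analytic coefficients times zonal
  polynomials: the values of \<open>u\<close> are discretized by a partition of unity, and the functions of the
  partition are approximated once and for all.
\<close>

theorem analytic_zonal_family:
  fixes u :: "real ^ 'n => complex"
  assumes u: "continuous_on (sphere 0 1) u" and ev: "\<And>x. norm x = 1 ==> u (- x) = u x" and e: "e > 0"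
    and q: "q > 0" and pq: "q * (1 - p / real CARD('n)) = 1"
  obtains A \<alpha> C where "unit_directions A" "\<And>i. \<alpha> i holomorphic_on UNIV"
    "\<And>i z. i \<in> A ==> 0 \<le> Re z ==> Re z \<le> real CARD('n) / 2 ==> norm (\<alpha> i z) \<le> C"
    "\<And>z x. 0 \<le> Re z ==> Re z \<le> real CARD('n) / 2 ==> norm x = 1 ==> norm (zsum A (\<lambda>i. \<alpha> i z) x) \<le> (norm (u x) + e) powr (q * (1 - Re z / real CARD('n))) + e"
    "\<And>x. norm x = 1 ==> 0 \<le> p ==> p \<le> real CARD('n) / 2 ==> norm (u x - zsum A (\<lambda>i. \<alpha> i (of_real p)) x) \<le> 2 * e"
proof -
  let ?n = "real CARD('n)"
  have n: "?n > 0" by simp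
  obtain C and P :: "complex => real ^ 'n => real" where C: "finite C"
    and P: "\<And>c. continuous_on (sphere 0 1) (P c)" "\<And>c x. norm x = 1 ==> P c (- x) = P c x"
    "\<And>c x. P c x \<ge> 0" "\<And>x. norm x = 1 ==> (\<Sum>c\<in>C. P c x) = 1" "\<And>c x. norm x = 1 ==> P c x \<noteq> 0 ==> norm (u x - c) < e"
    using value_partition[OF u ev e] by metis
  define s where "s z = of_real q * (1 - z / of_real ?n)" for z :: complex
  have Re_s: "Re (s z) = q * (1 - Re z / ?n)" for z by (simp add: s_def)
  have sr: "0 \<le> Re (s z)" "Re (s z) \<le> q" if "0 \<le> Re z" "Re z \<le> ?n / 2" for z
  proof -
    have t: "0 \<le> Re z / ?n" "Re z / ?n \<le> 1" using that n by (auto simp: divide_le_eq)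
    show "0 \<le> Re (s z)" unfolding Re_s using t q by simp
    show "Re (s z) \<le> q" unfolding Re_s using t q mult_left_mono[of "1 - Re z / ?n" 1 q] by simp
  qed
  have sp: "s (of_real p) = 1"
  proof -
    have "s (of_real p) = of_real (q * (1 - p / ?n))" by (simp add: s_def)
    then show ?thesis by (simp only: pq of_real_1)
  qed
  have big: "norm (phase_powr (s z) c) \<le> (1 + norm c) powr q" if "0 \<le> Re z" "Re z \<le> ?n / 2" for z c
  proof -
    have "norm (phase_powr (s z) c) \<le> (1 + norm c) powr Re (s z)"
      unfolding norm_phase_powr using sr[OF that] by (intro powr_mono2) auto
    also have "... \<le> (1 + norm c) powr q" using sr[OF that] by (intro powr_mono) auto
    finally show ?thesis .
  qed
  \<comment> \<open>\<open>K\<close> bounds the sum of the coefficients throughout the strip, so partition functions that are accurate to \<open>e / K\<close> suffice.\<close>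
  define K where "K = 1 + (\<Sum>c\<in>C. (1 + norm c) powr q)"
  have K: "K \<ge> 1" by (simp add: K_def sum_nonneg)
  have eK: "e / K > 0" using e K by simp
  have "\<exists>w. zonal_span w \<and> (\<forall>x\<in>sphere 0 1. norm (of_real (P c x) - w x) < e / K)" for c
    using zonal_dense_real[of "P c"] P eK unfolding zonal_limit_def by blast
  then obtain \<zeta> where \<zeta>: "\<And>c. zonal_span (\<zeta> c)" "\<And>c x. norm x = 1 ==> norm (of_real (P c x) - \<zeta> c x) < e / K"
    by (metis mem_sphere_0)
  obtain A \<gamma> where A: "unit_directions A" and \<gamma>: "\<And>c. c \<in> C ==> \<zeta> c = zsum A (\<gamma> c)"
    using zonal_span_common[of C \<zeta>, OF C \<zeta>(1)] by blast
  define \<alpha> where "\<alpha> i z = (\<Sum>c\<in>C. phase_powr (s z) c * \<gamma> c i)" for i z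
  have zs: "zsum A (\<lambda>i. \<alpha> i z) x = (\<Sum>c\<in>C. phase_powr (s z) c * \<zeta> c x)" for z x
  proof -
    have "zsum A (\<lambda>i. \<alpha> i z) x = (\<Sum>i\<in>A. \<Sum>c\<in>C. phase_powr (s z) c * (\<gamma> c i * zonal (fst i) (snd i) x))"
      unfolding zsum_def \<alpha>_def sum_distrib_right by (simp only: mult.assoc)
    also have "... = (\<Sum>c\<in>C. \<Sum>i\<in>A. phase_powr (s z) c * (\<gamma> c i * zonal (fst i) (snd i) x))" by (rule sum.swap)
    also have "... = (\<Sum>c\<in>C. phase_powr (s z) c * \<zeta> c x)"
      using \<gamma> by (intro sum.cong refl) (simp add: zsum_def sum_distrib_left)
    finally show ?thesis .
  qed
  define F where "F z x = (\<Sum>c\<in>C. phase_powr (s z) c * of_real (P c x))" for z x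
  have err: "norm (F z x - zsum A (\<lambda>i. \<alpha> i z) x) \<le> e" if z: "0 \<le> Re z" "Re z \<le> ?n / 2" and x: "norm x = 1" for z x
  proof -
    have "F z x - zsum A (\<lambda>i. \<alpha> i z) x = (\<Sum>c\<in>C. phase_powr (s z) c * (of_real (P c x) - \<zeta> c x))"
      unfolding F_def zs by (simp only: sum_subtractf right_diff_distrib)
    also have "norm ... \<le> (\<Sum>c\<in>C. (1 + norm c) powr q * (e / K))"
      using big[OF z] \<zeta>(2)[OF x] unfolding norm_mult by (intro sum_norm_le) (simp only: norm_mult, intro mult_mono, auto intro: less_imp_le)
    also have "... = (K - 1) * (e / K)" unfolding sum_distrib_right[symmetric] by (simp add: K_def)
    also have "... \<le> K * (e / K)" using eK by (intro mult_right_mono) auto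
    also have "... = e" using K by simp
    finally show ?thesis .
  qed
  \<comment> \<open>Convexity: only values \<open>c\<close> within \<open>e\<close> of \<open>u x\<close> carry weight at \<open>x\<close>.\<close>
  have wgt: "norm (\<Sum>c\<in>C. g c * of_real (P c x)) \<le> b" if "norm x = 1" "\<And>c. norm (u x - c) < e ==> norm (g c) \<le> b" for g :: "complex => complex" and x b
  proof -
    have "norm (g c * of_real (P c x)) \<le> b * P c x" for c
      using that P(3)[of c x] P(5)[of x c] by (cases "P c x = 0") (auto simp: norm_mult intro!: mult_right_mono)
    then have "norm (\<Sum>c\<in>C. g c * of_real (P c x)) \<le> (\<Sum>c\<in>C. b * P c x)" by (intro sum_norm_le) auto
    also have "... = b" using P(4)[of x] that by (simp add: sum_distrib_left[symmetric])
    finally show ?thesis .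
  qed
  show ?thesis
  proof (rule that[of A \<alpha> "\<Sum>i\<in>A. \<Sum>c\<in>C. (1 + norm c) powr q * norm (\<gamma> c i)"])
    show "unit_directions A" by (rule A)
    show "\<alpha> i holomorphic_on UNIV" for i
      unfolding \<alpha>_def s_def using n by (intro holomorphic_intros holomorphic_phase_powr) auto
    show "norm (\<alpha> i z) \<le> (\<Sum>i\<in>A. \<Sum>c\<in>C. (1 + norm c) powr q * norm (\<gamma> c i))"
      if i: "i \<in> A" and z: "0 \<le> Re z" "Re z \<le> ?n / 2" for i z
    proof -
      have "norm (\<alpha> i z) \<le> (\<Sum>c\<in>C. (1 + norm c) powr q * norm (\<gamma> c i))"
        unfolding \<alpha>_def using big[OF z] by (intro sum_norm_le) (auto simp: norm_mult intro!: mult_right_mono)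
      also have "... \<le> (\<Sum>i\<in>A. \<Sum>c\<in>C. (1 + norm c) powr q * norm (\<gamma> c i))"
        by (rule member_le_sum[OF i]) (use A in \<open>auto simp: unit_directions_def intro!: sum_nonneg\<close>)
      finally show ?thesis .
    qed
    show "norm (zsum A (\<lambda>i. \<alpha> i z) x) \<le> (norm (u x) + e) powr (q * (1 - Re z / ?n)) + e"
      if z: "0 \<le> Re z" "Re z \<le> ?n / 2" and x: "norm x = 1" for z x
    proof -
      have "norm (F z x) \<le> (norm (u x) + e) powr Re (s z)"
        unfolding F_def
      proof (rule wgt[OF x])
        fix c assume "norm (u x - c) < e"
        then have "norm c \<le> norm (u x) + e" using norm_triangle_ineq2[of c "u x"] by (simp add: norm_minus_commute)
        then show "norm (phase_powr (s z) c) \<le> (norm (u x) + e) powr Re (s z)"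
          unfolding norm_phase_powr using sr[OF z] by (intro powr_mono2) auto
      qed
      moreover have "norm (zsum A (\<lambda>i. \<alpha> i z) x) \<le> norm (F z x) + norm (F z x - zsum A (\<lambda>i. \<alpha> i z) x)"
        using norm_triangle_ineq2[of "zsum A (\<lambda>i. \<alpha> i z) x" "F z x"] by (simp add: norm_minus_commute)
      ultimately show ?thesis using err[OF z x] unfolding Re_s by linarith
    qed
    show "norm (u x - zsum A (\<lambda>i. \<alpha> i (of_real p)) x) \<le> 2 * e" if x: "norm x = 1" and p: "0 \<le> p" "p \<le> ?n / 2" for x
    proof -
      have "u x = (\<Sum>c\<in>C. u x * of_real (P c x))"
        using P(4)[OF x] by (simp only: sum_distrib_left[symmetric] of_real_sum[symmetric]) simp
      then have "u x - F (of_real p) x = (\<Sum>c\<in>C. (u x - c) * of_real (P c x))"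
        unfolding F_def sp phase_powr_1 by (simp add: sum_subtractf left_diff_distrib)
      also have "norm ... \<le> e" by (rule wgt[OF x]) simp
      finally have "norm (u x - F (of_real p) x) \<le> e" .
      then show ?thesis
        using err[of "of_real p", OF _ _ x] p norm_triangle_ineq[of "u x - F (of_real p) x" "F (of_real p) x - zsum A (\<lambda>i. \<alpha> i (of_real p)) x"] by simp
    qed
  qed
qed

section \<open>The bilinear inequality and its consequences\<close>

definition reg0 :: "real => real => (real ^ 'n => complex) => real" where
  "reg0 q e f = (LINT x|sphere_measure. (norm (f x) + e) powr q + e)"

definition reg1 :: "real => real => (real ^ 'n => complex) => real" where
  "reg1 q e f = (LINT x|sphere_measure. ((norm (f x) + e) powr (q / 2) + e)\<^sup>2)"

text \<open>
  With \<open>t = 2p / n\<close> this is the factor that \<open>stein_zonal\<close> produces from a family approximating \<open>f\<close> within \<open>e\<close>.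
  As \<open>e\<close> tends to 0 it becomes a power of the \<open>L\<^sup>q\<close> norm of \<open>f\<close>.
\<close>

definition reg :: "real => real => real => (real ^ 'n => complex) => real" where
  "reg q t e f = reg0 q e f powr (1 - t) * sqrt (reg1 q e f) powr t"

lemma continuous_norm_powr:
  fixes f :: "'a::topological_space => 'b::real_normed_vector"
  assumes "continuous_on S f" "q > 0" "e \<ge> 0" shows "continuous_on S (\<lambda>x. (norm (f x) + e) powr q)"
  using assms by (intro continuous_on_powr' continuous_intros) auto

lemma continuous_norm_powr_0:
  fixes f :: "'a::topological_space => 'b::real_normed_vector"
  assumes "continuous_on S f" "q > 0" shows "continuous_on S (\<lambda>x. norm (f x) powr q)"
  using continuous_norm_powr[OF assms, of 0] by simp

lemma sphere_integral_ge_const: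
  fixes g :: "real ^ 'n => real"
  assumes "integrable sphere_measure g" "\<And>x. norm x = 1 ==> c \<le> g x"
  shows "c \<le> (LINT x|sphere_measure. g x)"
proof -
  interpret S: prob_space "sphere_measure :: (real^'n) measure" by (rule prob_space_sphere_measure)
  have "(LINT x|(sphere_measure :: (real^'n) measure). c) \<le> (LINT x|sphere_measure. g x)"
    using assms by (intro integral_mono) (auto simp: space_sphere_measure)
  then show ?thesis by (simp add: S.prob_space)
qed

lemma reg0_integrable:
  assumes "continuous_on (sphere 0 1) f" "q > 0" "e \<ge> 0"
  shows "integrable sphere_measure (\<lambda>x. (norm (f x) + e) powr q + e)"
  by (intro sphere_integrable_real continuous_on_add continuous_norm_powr continuous_on_const assms)

lemma reg1_integrable:
  assumes "continuous_on (sphere 0 1) f" "q > 0" "e \<ge> 0"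
  shows "integrable sphere_measure (\<lambda>x. ((norm (f x) + e) powr (q / 2) + e)\<^sup>2)"
  using assms by (intro sphere_integrable_real continuous_on_power continuous_on_add continuous_norm_powr continuous_on_const) auto

lemma reg_pos:
  fixes f :: "real ^ 'n => complex"
  assumes f: "continuous_on (sphere 0 1) f" and q: "q > 0" and e: "e > 0"
  shows "reg0 q e f > 0" "reg1 q e f > 0"
proof -
  have "e \<le> reg0 q e f" unfolding reg0_def by (rule sphere_integral_ge_const) (use reg0_integrable[OF f q] e in auto)
  then show "reg0 q e f > 0" using e by linarith
  have "e\<^sup>2 \<le> reg1 q e f" unfolding reg1_def by (rule sphere_integral_ge_const) (use reg1_integrable[OF f q] e in \<open>auto intro!: power_mono\<close>)
  moreover have "e\<^sup>2 > 0" using e by simp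
  ultimately show "reg1 q e f > 0" by linarith
qed

lemma reg_tendsto:
  fixes f :: "real ^ 'n => complex"
  assumes f: "continuous_on (sphere 0 1) f" and q: "q > 0" and t: "0 < t" "t < 1"
  shows "(\<lambda>k. reg q t (inverse (real (Suc k))) f) \<longlonglongrightarrow> (LINT x|sphere_measure. norm (f x) powr q) powr (1 - t / 2)"
proof -
  let ?S = "sphere_measure :: (real^'n) measure"
  let ?N = "LINT x|?S. norm (f x) powr q"
  let ?e = "\<lambda>k. inverse (real (Suc k))"
  have [measurable]: "f \<in> borel_measurable ?S" by (rule sphere_integrable(1)[OF f])
  have e0: "?e \<longlonglongrightarrow> 0" by (rule LIMSEQ_inverse_real_of_nat)
  have e1: "0 < ?e k" "?e k \<le> 1" for k by (auto simp: field_simps)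
  have lim: "(\<lambda>k. (norm (f x) + ?e k) powr r) \<longlonglongrightarrow> (norm (f x) + 0) powr r" if "r > 0" for x r
    using that e1 by (intro tendsto_powr' tendsto_intros e0 disjI2 conjI eventuallyI) (auto intro: less_imp_le add_nonneg_nonneg)
  have N: "?N \<ge> 0" by (intro integral_nonneg_AE) auto
  have l0: "(\<lambda>k. reg0 q (?e k) f) \<longlonglongrightarrow> ?N"
    unfolding reg0_def
  proof (rule integral_dominated_convergence[where w="\<lambda>x. (norm (f x) + 1) powr q + 1"])
    show "integrable ?S (\<lambda>x. (norm (f x) + 1) powr q + 1)" by (rule reg0_integrable[OF f q]) simp
    show "AE x in ?S. (\<lambda>k. (norm (f x) + ?e k) powr q + ?e k) \<longlonglongrightarrow> norm (f x) powr q"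
      using tendsto_add[OF lim[OF q] e0] by simp
    show "AE x in ?S. norm ((norm (f x) + ?e k) powr q + ?e k) \<le> (norm (f x) + 1) powr q + 1" for k
    proof (rule AE_I2)
      fix x
      have "(norm (f x) + ?e k) powr q \<le> (norm (f x) + 1) powr q" using e1[of k] q by (intro powr_mono2) auto
      then show "norm ((norm (f x) + ?e k) powr q + ?e k) \<le> (norm (f x) + 1) powr q + 1" using e1[of k] by simp
    qed
  qed measurable
  have l1: "(\<lambda>k. reg1 q (?e k) f) \<longlonglongrightarrow> ?N"
    unfolding reg1_def
  proof (rule integral_dominated_convergence[where w="\<lambda>x. ((norm (f x) + 1) powr (q / 2) + 1)\<^sup>2"])
    show "integrable ?S (\<lambda>x. ((norm (f x) + 1) powr (q / 2) + 1)\<^sup>2)" by (rule reg1_integrable[OF f q]) simp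
    have q2: "q / 2 > 0" using q by simp
    have sq: "(norm (f x) powr (q / 2))\<^sup>2 = norm (f x) powr q" for x
      by (simp add: power2_eq_square powr_add[symmetric])
    show "AE x in ?S. (\<lambda>k. ((norm (f x) + ?e k) powr (q / 2) + ?e k)\<^sup>2) \<longlonglongrightarrow> norm (f x) powr q"
      using tendsto_power[OF tendsto_add[OF lim[OF q2] e0], of _ 2] by (simp add: sq)
    show "AE x in ?S. norm (((norm (f x) + ?e k) powr (q / 2) + ?e k)\<^sup>2) \<le> ((norm (f x) + 1) powr (q / 2) + 1)\<^sup>2" for k
    proof (rule AE_I2)
      fix x
      have "(norm (f x) + ?e k) powr (q / 2) \<le> (norm (f x) + 1) powr (q / 2)" using e1[of k] q by (intro powr_mono2) auto
      then have "((norm (f x) + ?e k) powr (q / 2) + ?e k)\<^sup>2 \<le> ((norm (f x) + 1) powr (q / 2) + 1)\<^sup>2"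
        using e1[of k] by (intro power_mono add_mono) auto
      then show "norm (((norm (f x) + ?e k) powr (q / 2) + ?e k)\<^sup>2) \<le> ((norm (f x) + 1) powr (q / 2) + 1)\<^sup>2" by simp
    qed
  qed measurable
  have p0: "reg0 q (?e k) f \<ge> 0" "reg1 q (?e k) f \<ge> 0" for k using reg_pos[OF f q e1(1), of k] by (auto intro: less_imp_le)
  have "(\<lambda>k. reg q t (?e k) f) \<longlonglongrightarrow> ?N powr (1 - t) * sqrt ?N powr t"
    unfolding reg_def using t p0
    by (intro tendsto_mult tendsto_powr' tendsto_real_sqrt l0 l1 tendsto_const disjI2 conjI eventuallyI) auto
  also have "?N powr (1 - t) * sqrt ?N powr t = ?N powr (1 - t / 2)"
  proof -
    have "sqrt ?N powr t = ?N powr (t / 2)" unfolding powr_half_sqrt[OF N, symmetric] powr_powr by simp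
    then show ?thesis by (simp add: powr_add[symmetric])
  qed
  finally show ?thesis .
qed

text \<open>
  What interpolation needs to know about an analytic family that approximates \<open>f\<close> at \<open>z = p\<close>.
\<close>

definition stein_family :: "real => (real ^ 'n => complex) => real => (nat \<times> (real ^ 'n)) set => (nat \<times> (real ^ 'n) => complex => complex) => bool" where
  "stein_family p f e A \<alpha> \<longleftrightarrow> unit_directions A \<and> (\<forall>i. \<alpha> i holomorphic_on UNIV)
    \<and> (\<exists>C. \<forall>i\<in>A. \<forall>z. 0 \<le> Re z \<longrightarrow> Re z \<le> real CARD('n) / 2 \<longrightarrow> norm (\<alpha> i z) \<le> C)
    \<and> (\<forall>y. (LINT x|sphere_measure. norm (zsum A (\<lambda>i. \<alpha> i (\<i> * of_real y)) x)) \<le> reg0 (real CARD('n) / (real CARD('n) - p)) e f)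
    \<and> (\<forall>z. Re z = real CARD('n) / 2 \<longrightarrow> (LINT x|sphere_measure. (norm (zsum A (\<lambda>i. \<alpha> i z) x))\<^sup>2) \<le> reg1 (real CARD('n) / (real CARD('n) - p)) e f)
    \<and> (\<forall>x. norm x = 1 \<longrightarrow> norm (f x - zsum A (\<lambda>i. \<alpha> i (of_real p)) x) \<le> 2 * e)"

lemma stein_family_exists:
  fixes f :: "real ^ 'n => complex"
  assumes f: "continuous_on (sphere 0 1) f" and ev: "\<And>x. norm x = 1 ==> f (- x) = f x" and e: "e > 0"
    and p: "0 < p" "p < real CARD('n) / 2"
  shows "\<exists>A \<alpha>. stein_family p f e A \<alpha>"
proof -
  let ?n = "real CARD('n)"
  let ?S = "sphere_measure :: (real^'n) measure"
  define q where "q = ?n / (?n - p)"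
  have n: "?n > 0" "?n - p > 0" using p by auto
  have q: "q > 0" using n by (simp add: q_def)
  have pq: "q * (1 - p / ?n) = 1" using n by (simp add: q_def field_simps)
  show ?thesis
  proof (rule analytic_zonal_family[OF f _ e q pq])
  show "f (- x) = f x" if "norm x = 1" for x by (rule ev[OF that])
  fix A \<alpha> C assume A: "unit_directions A" and hol: "\<And>i. \<alpha> i holomorphic_on UNIV"
    and bd: "\<And>i z. i \<in> A ==> 0 \<le> Re z ==> Re z \<le> ?n / 2 ==> norm (\<alpha> i z) \<le> C"
    and le: "\<And>z x. 0 \<le> Re z ==> Re z \<le> ?n / 2 ==> norm x = 1 ==> norm (zsum A (\<lambda>i. \<alpha> i z) x) \<le> (norm (f x) + e) powr (q * (1 - Re z / ?n)) + e"
    and ap: "\<And>x. norm x = 1 ==> 0 \<le> p ==> p \<le> ?n / 2 ==> norm (f x - zsum A (\<lambda>i. \<alpha> i (of_real p)) x) \<le> 2 * e"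
  have "(LINT x|?S. norm (zsum A (\<lambda>i. \<alpha> i (\<i> * of_real y)) x)) \<le> reg0 q e f" for y
    unfolding reg0_def
  proof (rule integral_mono)
    show "integrable ?S (\<lambda>x. norm (zsum A (\<lambda>i. \<alpha> i (\<i> * of_real y)) x))"
      by (intro sphere_integrable_real continuous_intros continuous_zsum)
    show "norm (zsum A (\<lambda>i. \<alpha> i (\<i> * of_real y)) x) \<le> (norm (f x) + e) powr q + e" if "x \<in> space ?S" for x
      using le[of "\<i> * of_real y" x] that by (simp add: space_sphere_measure)
  qed (use reg0_integrable[OF f q] e in auto)
  moreover have "(LINT x|?S. (norm (zsum A (\<lambda>i. \<alpha> i z) x))\<^sup>2) \<le> reg1 q e f" if z: "Re z = ?n / 2" for z
    unfolding reg1_def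
  proof (rule integral_mono)
    show "integrable ?S (\<lambda>x. (norm (zsum A (\<lambda>i. \<alpha> i z) x))\<^sup>2)"
      by (intro sphere_integrable_real continuous_intros continuous_zsum)
    have half: "q * (1 - Re z / ?n) = q / 2" using n unfolding z by simp
    show "(norm (zsum A (\<lambda>i. \<alpha> i z) x))\<^sup>2 \<le> ((norm (f x) + e) powr (q / 2) + e)\<^sup>2" if "x \<in> space ?S" for x
      using le[of z x] that z n unfolding half by (intro power_mono) (auto simp: space_sphere_measure)
  qed (use reg1_integrable[OF f q] e in auto)
  ultimately show "\<exists>A \<alpha>. stein_family p f e A \<alpha>"
    unfolding stein_family_def q_def[symmetric] using A hol bd ap p by (intro exI[of _ A] exI[of _ \<alpha>] conjI exI[of _ C]) auto
  qed
qed

lemma stein_family_pair: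
  fixes f h :: "real ^ 'n => complex"
  assumes A: "stein_family p f e A \<alpha>" and B: "stein_family p h d B \<beta>"
    and f: "continuous_on (sphere 0 1) f" "continuous_on (sphere 0 1) h" and e: "e > 0" "d > 0"
    and p: "0 < p" "p < real CARD('n) / 2"
  shows "norm (LINT x|sphere_measure. Ip_zsum (of_real p) A (\<lambda>i. \<alpha> i (of_real p)) x * zsum B (\<lambda>i. \<beta> i (of_real p)) x)
    \<le> (real CARD('n) / 2 / p) powr (p / 2) * reg (real CARD('n) / (real CARD('n) - p)) (p / (real CARD('n) / 2)) e f
        * reg (real CARD('n) / (real CARD('n) - p)) (p / (real CARD('n) / 2)) d h"
proof -
  let ?n = "real CARD('n)"
  define q where "q = ?n / (?n - p)"
  have n: "?n > 0" "?n - p > 0" using p by auto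
  have q: "q > 0" using n by (simp add: q_def)
  obtain C1 C2 where C1: "\<And>i z. i \<in> A ==> 0 \<le> Re z ==> Re z \<le> ?n / 2 ==> norm (\<alpha> i z) \<le> C1"
    and C2: "\<And>i z. i \<in> B ==> 0 \<le> Re z ==> Re z \<le> ?n / 2 ==> norm (\<beta> i z) \<le> C2"
    using A[unfolded stein_family_def] B[unfolded stein_family_def] by metis
  note pos = reg_pos[OF f(1) q e(1)] reg_pos[OF f(2) q e(2)]
  have "norm (LINT x|sphere_measure. Ip_zsum (of_real p) A (\<lambda>i. \<alpha> i (of_real p)) x * zsum B (\<lambda>i. \<beta> i (of_real p)) x)
    \<le> (?n / 2 / p) powr (p / 2) * (reg0 q e f * reg0 q d h) powr (1 - p / (?n / 2)) * (sqrt (reg1 q e f) * sqrt (reg1 q d h)) powr (p / (?n / 2))"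
  proof (rule stein_zonal[where C="max C1 C2"])
    show "norm (\<alpha> i z) \<le> max C1 C2" if "i \<in> A" "0 \<le> Re z" "Re z \<le> ?n / 2" for i z using C1[OF that] by simp
    show "norm (\<beta> i z) \<le> max C1 C2" if "i \<in> B" "0 \<le> Re z" "Re z \<le> ?n / 2" for i z using C2[OF that] by simp
  qed (use A B pos p in \<open>auto simp: stein_family_def q_def\<close>)
  also have "... = (?n / 2 / p) powr (p / 2) * reg q (p / (?n / 2)) e f * reg q (p / (?n / 2)) d h"
    unfolding reg_def using pos by (simp add: powr_mult)
  finally show ?thesis unfolding q_def .
qed

lemma norm_pairing_perturb:
  fixes a b c :: "real ^ 'n => complex"
  assumes cont: "continuous_on (sphere 0 1) a" "continuous_on (sphere 0 1) b" "continuous_on (sphere 0 1) c"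
    and d: "\<And>x. norm x = 1 ==> norm (a x - c x) \<le> d"
  shows "norm (LINT x|sphere_measure. b x * a x) \<le> norm (LINT x|sphere_measure. b x * c x) + d * (LINT x|sphere_measure. norm (b x))"
proof -
  let ?S = "sphere_measure :: (real^'n) measure"
  have "(LINT x|?S. b x * a x) - (LINT x|?S. b x * c x) = (LINT x|?S. b x * a x - b x * c x)"
    by (rule Bochner_Integration.integral_diff[symmetric]) (intro zonal_pair_integrable cont)+
  also have "norm ... \<le> (LINT x|?S. d * norm (b x))"
  proof (rule norm_integral_le_integral)
    show "integrable ?S (\<lambda>x. d * norm (b x))" by (intro sphere_integrable_real continuous_intros cont)
    show "AE x in ?S. norm (b x * a x - b x * c x) \<le> d * norm (b x)"
      using d by (intro AE_I2) (auto simp: space_sphere_measure right_diff_distrib[symmetric] norm_mult mult.commute[of d] intro!: mult_left_mono)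
  qed
  finally have "norm ((LINT x|?S. b x * a x) - (LINT x|?S. b x * c x)) \<le> d * (LINT x|?S. norm (b x))" by simp
  then show ?thesis using norm_triangle_ineq2[of "LINT x|?S. b x * a x" "LINT x|?S. b x * c x"] by linarith
qed

text \<open>
  Being the image of \<open>g\<close> under \<open>I\<^sub>p\<close>, expressed only through pairings with zonal polynomials. In this form
  the relation is linear and makes sense for continuous functions.
\<close>

definition dual_pair :: "real => (real ^ 'n => complex) => (real ^ 'n => complex) => bool" where
  "dual_pair p w g \<longleftrightarrow> continuous_on (sphere 0 1) w \<and> continuous_on (sphere 0 1) g
    \<and> (\<forall>x. norm x = 1 \<longrightarrow> w (- x) = w x) \<and> (\<forall>x. norm x = 1 \<longrightarrow> g (- x) = g x)
    \<and> (\<forall>k a. norm a = 1 \<longrightarrow> (LINT x|sphere_measure. w x * zonal k a x) = (LINT x|sphere_measure. g x * Ip_zonal (of_real p) k a x))"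

lemma dual_pair_zsum:
  assumes "dual_pair p w g" "unit_directions A"
  shows "(LINT x|sphere_measure. w x * zsum A \<alpha> x) = (LINT x|sphere_measure. g x * Ip_zsum (of_real p) A \<alpha> x)"
proof -
  have c: "continuous_on (sphere 0 1) w" "continuous_on (sphere 0 1) g" using assms by (auto simp: dual_pair_def)
  have "(LINT x|sphere_measure. w x * zsum A \<alpha> x) = (LINT x|sphere_measure. (\<Sum>i\<in>A. \<alpha> i * (w x * zonal (fst i) (snd i) x)))"
    unfolding zsum_def by (simp only: sum_distrib_left mult.left_commute)
  also have "... = (\<Sum>i\<in>A. LINT x|sphere_measure. \<alpha> i * (w x * zonal (fst i) (snd i) x))"
    by (rule Bochner_Integration.integral_sum) (intro integrable_mult_right zonal_pair_integrable continuous_zonal c)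
  also have "... = (\<Sum>i\<in>A. LINT x|sphere_measure. \<alpha> i * (g x * Ip_zonal (of_real p) (fst i) (snd i) x))"
    unfolding integral_mult_right_zero using assms by (intro sum.cong refl) (auto simp: dual_pair_def unit_directions_def)
  also have "... = (LINT x|sphere_measure. (\<Sum>i\<in>A. \<alpha> i * (g x * Ip_zonal (of_real p) (fst i) (snd i) x)))"
    by (rule Bochner_Integration.integral_sum[symmetric]) (intro integrable_mult_right zonal_pair_integrable continuous_Ip_zonal c)
  also have "... = (LINT x|sphere_measure. g x * Ip_zsum (of_real p) A \<alpha> x)"
    unfolding Ip_zsum_def by (simp only: sum_distrib_left mult.left_commute)
  finally show ?thesis .
qed

text \<open>
  First \<open>v\<close> is fixed as a zonal combination while the approximation of \<open>g\<close> is refined, because the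
  error there is measured against \<open>I\<^sub>p\<close> of that combination; then the approximation of \<open>v\<close> is refined.
\<close>

theorem dual_pair_bound:
  fixes w g v :: "real ^ 'n => complex"
  assumes wg: "dual_pair p w g" and v: "continuous_on (sphere 0 1) v" and ev: "\<And>x. norm x = 1 ==> v (- x) = v x"
    and p: "0 < p" "p < real CARD('n) / 2" and q: "q = real CARD('n) / (real CARD('n) - p)"
  shows "norm (LINT x|sphere_measure. w x * v x) \<le> (real CARD('n) / 2 / p) powr (p / 2)
    * (LINT x|sphere_measure. norm (v x) powr q) powr (1 - p / real CARD('n))
    * (LINT x|sphere_measure. norm (g x) powr q) powr (1 - p / real CARD('n))"
proof -
  let ?n = "real CARD('n)"
  let ?S = "sphere_measure :: (real^'n) measure"
  let ?c = "(?n / 2 / p) powr (p / 2)"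
  define t where "t = p / (?n / 2)"
  let ?e = "\<lambda>k. inverse (real (Suc k))"
  have n: "?n > 0" "?n - p > 0" using p by auto
  have q0: "q > 0" using n by (simp add: q)
  have t: "0 < t" "t < 1" using p n by (auto simp: t_def field_simps)
  have t2: "1 - t / 2 = 1 - p / ?n" by (simp add: t_def)
  have w: "continuous_on (sphere 0 1) w" and g: "continuous_on (sphere 0 1) g" and eg: "\<And>x. norm x = 1 ==> g (- x) = g x"
    using wg by (auto simp: dual_pair_def)
  have e0: "?e \<longlonglongrightarrow> 0" by (rule LIMSEQ_inverse_real_of_nat)
  have e1: "0 < ?e k" for k by simp
  obtain A \<alpha> where A: "\<And>l. stein_family p v (?e l) (A l) (\<alpha> l)"
    using stein_family_exists[OF v ev e1 p] by metis
  obtain B \<beta> where B: "\<And>k. stein_family p g (?e k) (B k) (\<beta> k)"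
    using stein_family_exists[OF g eg e1 p] by metis
  have main: "norm (LINT x|?S. w x * v x) \<le> ?c * reg q t (?e l) v * (LINT x|?S. norm (g x) powr q) powr (1 - t / 2) + 2 * ?e l * (LINT x|?S. norm (w x))" for l
  proof -
    define Z where "Z = zsum (A l) (\<lambda>i. \<alpha> l i (of_real p))"
    define J where "J = Ip_zsum (of_real p) (A l) (\<lambda>i. \<alpha> l i (of_real p))"
    have J: "continuous_on (sphere 0 1) J" unfolding J_def by (rule continuous_Ip_zsum)
    have "norm (LINT x|?S. w x * v x) \<le> norm (LINT x|?S. w x * Z x) + 2 * ?e l * (LINT x|?S. norm (w x))"
      unfolding Z_def using A[of l] by (intro norm_pairing_perturb v w continuous_zsum) (auto simp: stein_family_def)
    moreover have "(LINT x|?S. w x * Z x) = (LINT x|?S. J x * g x)"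
      unfolding Z_def J_def using A[of l] by (subst dual_pair_zsum[OF wg]) (auto simp: stein_family_def mult.commute)
    moreover have "norm (LINT x|?S. J x * g x) \<le> ?c * reg q t (?e l) v * (LINT x|?S. norm (g x) powr q) powr (1 - t / 2)"
    proof (rule LIMSEQ_le[OF tendsto_const])
      show "(\<lambda>k. ?c * reg q t (?e l) v * reg q t (?e k) g + 2 * ?e k * (LINT x|?S. norm (J x))) \<longlonglongrightarrow> ?c * reg q t (?e l) v * (LINT x|?S. norm (g x) powr q) powr (1 - t / 2)"
        using tendsto_add[OF tendsto_mult[OF tendsto_const reg_tendsto[OF g q0 t]] tendsto_mult[OF tendsto_mult[OF tendsto_const e0] tendsto_const]] by simp
      have "norm (LINT x|?S. J x * g x) \<le> ?c * reg q t (?e l) v * reg q t (?e k) g + 2 * ?e k * (LINT x|?S. norm (J x))" for k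
      proof -
        have "norm (LINT x|?S. J x * g x) \<le> norm (LINT x|?S. J x * zsum (B k) (\<lambda>i. \<beta> k i (of_real p)) x) + 2 * ?e k * (LINT x|?S. norm (J x))"
          using B[of k] by (intro norm_pairing_perturb g J continuous_zsum) (auto simp: stein_family_def)
        moreover have "norm (LINT x|?S. J x * zsum (B k) (\<lambda>i. \<beta> k i (of_real p)) x) \<le> ?c * reg q t (?e l) v * reg q t (?e k) g"
          unfolding J_def q t_def by (rule stein_family_pair[OF A B v g e1 e1 p])
        ultimately show ?thesis by linarith
      qed
      then show "\<exists>N. \<forall>k\<ge>N. norm (LINT x|?S. J x * g x) \<le> ?c * reg q t (?e l) v * reg q t (?e k) g + 2 * ?e k * (LINT x|?S. norm (J x))" by blast
    qed
    ultimately show ?thesis by simp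
  qed
  have "norm (LINT x|?S. w x * v x) \<le> ?c * (LINT x|?S. norm (v x) powr q) powr (1 - t / 2) * (LINT x|?S. norm (g x) powr q) powr (1 - t / 2)"
  proof (rule LIMSEQ_le[OF tendsto_const])
    show "(\<lambda>l. ?c * reg q t (?e l) v * (LINT x|?S. norm (g x) powr q) powr (1 - t / 2) + 2 * ?e l * (LINT x|?S. norm (w x)))
      \<longlonglongrightarrow> ?c * (LINT x|?S. norm (v x) powr q) powr (1 - t / 2) * (LINT x|?S. norm (g x) powr q) powr (1 - t / 2)"
      using tendsto_add[OF tendsto_mult[OF tendsto_mult[OF tendsto_const reg_tendsto[OF v q0 t]] tendsto_const] tendsto_mult[OF tendsto_mult[OF tendsto_const e0] tendsto_const]] by simp
  qed (use main in blast)
  then show ?thesis unfolding t2 .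
qed

text \<open>
  The extremal test function of Hoelder's inequality, \<open>v = cnj w * \<bar>w\<bar> powr (q' - 2)\<close>, for which both
  \<open>w v\<close> and \<open>\<bar>v\<bar> powr q\<close> are \<open>\<bar>w\<bar> powr q'\<close>.
\<close>

theorem dual_pair_norm_bound:
  fixes w g :: "real ^ 'n => complex"
  assumes wg: "dual_pair p w g" and p: "0 < p" "p < real CARD('n) / 2"
  shows "(LINT x|sphere_measure. norm (w x) powr (real CARD('n) / p)) \<le> (real CARD('n) / (2 * p)) powr (real CARD('n) / 2)
    * (LINT x|sphere_measure. norm (g x) powr (real CARD('n) / (real CARD('n) - p))) powr (real CARD('n) / p - 1)"
proof -
  let ?n = "real CARD('n)"
  let ?S = "sphere_measure :: (real^'n) measure"
  define q where "q = ?n / (?n - p)"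
  define r where "r = ?n / p"
  have n: "?n > 0" "?n - p > 0" using p by auto
  have r: "r > 2" using p by (simp add: r_def field_simps)
  have w: "continuous_on (sphere 0 1) w" and ew: "\<And>x. norm x = 1 ==> w (- x) = w x"
    using wg by (auto simp: dual_pair_def)
  define v where "v x = cnj (w x) * of_real (norm (w x) powr (r - 2))" for x
  have v: "continuous_on (sphere 0 1) v"
    unfolding v_def using r by (intro continuous_intros continuous_norm_powr_0 w) auto
  define W where "W = (LINT x|?S. norm (w x) powr r)"
  define G where "G = (LINT x|?S. norm (g x) powr q)"
  have W0: "W \<ge> 0" and G0: "G \<ge> 0" unfolding W_def G_def by (auto intro!: integral_nonneg_AE)
  have rq: "(r - 1) * q = r" using n p by (simp add: r_def q_def field_simps)
  have nv: "norm (v x) powr q = norm (w x) powr r" for x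
  proof -
    have "norm (v x) = norm (w x) powr 1 * norm (w x) powr (r - 2)" by (simp add: v_def norm_mult)
    also have "... = norm (w x) powr (r - 1)" by (subst powr_add[symmetric]) simp
    finally show ?thesis by (simp add: powr_powr rq)
  qed
  have wv: "w x * v x = of_real (norm (w x) powr r)" for x
  proof -
    have "w x * v x = of_real ((norm (w x))\<^sup>2) * of_real (norm (w x) powr (r - 2))"
      unfolding complex_norm_square v_def by (simp only: mult.assoc)
    also have "... = of_real (norm (w x) powr 2 * norm (w x) powr (r - 2))" by (cases "w x = 0") (simp_all add: powr_realpow)
    also have "norm (w x) powr 2 * norm (w x) powr (r - 2) = norm (w x) powr r" by (subst powr_add[symmetric]) simp
    finally show ?thesis .
  qed
  let ?c = "(?n / 2 / p) powr (p / 2)"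
  have "norm (LINT x|?S. w x * v x) \<le> ?c * (LINT x|?S. norm (v x) powr q) powr (1 - p / ?n) * (LINT x|?S. norm (g x) powr q) powr (1 - p / ?n)"
    by (rule dual_pair_bound[OF wg v _ p q_def]) (simp add: v_def ew)
  also have "(LINT x|?S. w x * v x) = of_real W" unfolding wv W_def by (rule integral_complex_of_real)
  finally have le: "W \<le> ?c * W powr (1 - p / ?n) * G powr (1 - p / ?n)"
    using W0 by (simp only: nv W_def[symmetric] G_def[symmetric] norm_of_real abs_of_nonneg)
  have "W \<le> (?n / (2 * p)) powr (?n / 2) * G powr (r - 1)"
  proof (cases "W = 0")
    case True
    then show ?thesis by simp
  next
    case False
    then have W: "W > 0" using W0 by simp
    \<comment> \<open>The exponents \<open>1 - p / n\<close> and \<open>p / n\<close> are \<open>1 / q\<close> and \<open>1 / q\'\<close>; divide by the first power.\<close>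
    have "W powr (1 - p / ?n) * W powr (p / ?n) = W" using W by (simp add: powr_add[symmetric])
    then have "W powr (1 - p / ?n) * W powr (p / ?n) \<le> W powr (1 - p / ?n) * (?c * G powr (1 - p / ?n))" using le by (simp only: mult_ac)
    then have "W powr (p / ?n) \<le> ?c * G powr (1 - p / ?n)" using W by (simp add: mult_le_cancel_left)
    then have "(W powr (p / ?n)) powr r \<le> (?c * G powr (1 - p / ?n)) powr r" using r by (intro powr_mono2) auto
    also have "(W powr (p / ?n)) powr r = W" using W p n by (simp add: powr_powr r_def)
    also have "(?c * G powr (1 - p / ?n)) powr r = (?n / 2 / p) powr (p / 2 * r) * G powr ((1 - p / ?n) * r)"
      by (simp add: powr_mult powr_powr)
    also have "p / 2 * r = ?n / 2" using p by (simp add: r_def)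
    also have "(1 - p / ?n) * r = r - 1" using p n by (simp add: r_def field_simps)
    finally show ?thesis by (simp add: mult.commute)
  qed
  then show ?thesis unfolding W_def G_def q_def r_def .
qed

lemma jensen_powr:
  fixes X :: "real ^ 'n => real"
  assumes X: "continuous_on (sphere 0 1) X" "\<And>x. X x \<ge> 0" and s: "0 < s" "s < 1"
  shows "(LINT x|sphere_measure. X x powr s) \<le> (LINT x|sphere_measure. X x) powr s"
proof -
  let ?S = "sphere_measure :: (real^'n) measure"
  interpret S: prob_space ?S by (rule prob_space_sphere_measure)
  define m where "m = (LINT x|?S. X x)"
  have iX: "integrable ?S X" by (rule sphere_integrable_real[OF X(1)])
  have [measurable]: "X \<in> borel_measurable ?S" using iX by simp
  have iXs: "integrable ?S (\<lambda>x. X x powr s)"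
    using X s by (intro sphere_integrable_real continuous_on_powr' continuous_intros) auto
  have m0: "m \<ge> 0" unfolding m_def using X by (intro integral_nonneg_AE) auto
  show ?thesis
  proof (cases "m = 0")
    case True
    then have "AE x in ?S. X x = 0" using integral_nonneg_eq_0_iff_AE[OF iX] X by (auto simp: m_def)
    then have "AE x in ?S. X x powr s = 0" by eventually_elim simp
    then have "(LINT x|?S. X x powr s) = (LINT x|?S. 0)" by (intro integral_cong_AE) auto
    then show ?thesis by simp
  next
    case False
    then have m: "m > 0" using m0 by simp
    \<comment> \<open>The tangent at the mean of the concave function \<open>t powr s\<close>.\<close>
    have "X x powr s \<le> m powr s * (s * (X x / m) + (1 - s))" for x
    proof (cases "X x = 0")
      case True
      then show ?thesis using s m by simp
    next
      case False
      then have x: "X x > 0" using X(2)[of x] by simp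
      have "(X x / m) powr s * 1 powr (1 - s) \<le> s * (X x / m) + (1 - s) * 1"
        using s x m by (intro Youngs_inequality_0) auto
      then have "m powr s * (X x / m) powr s \<le> m powr s * (s * (X x / m) + (1 - s))" by (intro mult_left_mono) auto
      moreover have "m powr s * (X x / m) powr s = X x powr s" using x m by (simp add: powr_mult[symmetric])
      ultimately show ?thesis by simp
    qed
    then have "(LINT x|?S. X x powr s) \<le> (LINT x|?S. m powr s * (s * (X x / m) + (1 - s)))"
      using iX iXs by (intro integral_mono) auto
    also have "... = m powr s * (s * (m / m) + (1 - s))"
      using iX by (simp add: m_def S.prob_space)
    also have "... = m powr s" using m by simp
    finally show ?thesis unfolding m_def .
  qed
qed

text \<open>
  The test function \<open>cnj w\<close>, together with \<open>L\<^sup>q\<close> norms being at most \<open>L\<^sup>2\<close> norms since \<open>q < 2\<close>.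
\<close>

theorem dual_pair_L2_bound:
  fixes w g :: "real ^ 'n => complex"
  assumes wg: "dual_pair p w g" and p: "0 < p" "p < real CARD('n) / 2"
  shows "(LINT x|sphere_measure. (norm (w x))\<^sup>2) \<le> (real CARD('n) / 2 / p) powr p * (LINT x|sphere_measure. (norm (g x))\<^sup>2)"
proof -
  let ?n = "real CARD('n)"
  let ?S = "sphere_measure :: (real^'n) measure"
  define q where "q = ?n / (?n - p)"
  have n: "?n > 0" "?n - p > 0" using p by auto
  have q: "0 < q / 2" "q / 2 < 1" using p n by (auto simp: q_def field_simps)
  have pq: "q / 2 * (1 - p / ?n) = 1 / 2" using n by (simp add: q_def field_simps)
  have w: "continuous_on (sphere 0 1) w" and g: "continuous_on (sphere 0 1) g" and ew: "\<And>x. norm x = 1 ==> w (- x) = w x"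
    using wg by (auto simp: dual_pair_def)
  have J: "(LINT x|?S. norm (f x) powr q) powr (1 - p / ?n) \<le> sqrt (LINT x|?S. (norm (f x))\<^sup>2)"
    if f: "continuous_on (sphere 0 1) f" for f :: "real^'n => complex"
  proof -
    have nn: "(LINT x|?S. (norm (f x))\<^sup>2) \<ge> 0" by (intro integral_nonneg_AE) auto
    have eq: "((norm (f x))\<^sup>2) powr (q / 2) = norm (f x) powr q" for x
    proof -
      have "((norm (f x))\<^sup>2) powr (q / 2) = norm (f x) powr (q / 2) * norm (f x) powr (q / 2)"
        unfolding power2_eq_square by (rule powr_mult)
      also have "... = norm (f x) powr q" by (subst powr_add[symmetric]) simp
      finally show ?thesis .
    qed
    have "(LINT x|?S. norm (f x) powr q) \<le> (LINT x|?S. (norm (f x))\<^sup>2) powr (q / 2)"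
      using jensen_powr[OF _ _ q, of "\<lambda>x. (norm (f x))\<^sup>2"] continuous_on_power[OF continuous_on_norm[OF f], of 2] unfolding eq by simp
    then have "(LINT x|?S. norm (f x) powr q) powr (1 - p / ?n) \<le> ((LINT x|?S. (norm (f x))\<^sup>2) powr (q / 2)) powr (1 - p / ?n)"
      using n by (intro powr_mono2) (auto intro!: integral_nonneg_AE simp: field_simps)
    also have "... = sqrt (LINT x|?S. (norm (f x))\<^sup>2)" unfolding powr_powr pq using nn by (rule powr_half_sqrt)
    finally show ?thesis .
  qed
  define W where "W = (LINT x|?S. (norm (w x))\<^sup>2)"
  define G where "G = (LINT x|?S. (norm (g x))\<^sup>2)"
  have W0: "W \<ge> 0" and G0: "G \<ge> 0" unfolding W_def G_def by (auto intro!: integral_nonneg_AE)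
  define c where "c = (?n / 2 / p) powr (p / 2)"
  have "norm (LINT x|?S. w x * cnj (w x)) \<le> c * (LINT x|?S. norm (cnj (w x)) powr q) powr (1 - p / ?n) * (LINT x|?S. norm (g x) powr q) powr (1 - p / ?n)"
    unfolding c_def by (rule dual_pair_bound[OF wg _ _ p q_def]) (auto intro!: continuous_intros w simp: ew)
  also have "... \<le> c * sqrt W * sqrt G"
    using J[OF w] J[OF g] W0 G0 unfolding W_def G_def c_def by (intro mult_mono) auto
  also have "(LINT x|?S. w x * cnj (w x)) = of_real W" unfolding complex_norm_square[symmetric] W_def by (rule integral_complex_of_real)
  finally have "sqrt W * sqrt W \<le> sqrt W * (c * sqrt G)" using W0 by (simp add: mult_ac)
  then have "sqrt W \<le> c * sqrt G"
  proof (cases "W = 0")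
    case True
    then show ?thesis using G0 by (simp add: c_def)
  next
    case False
    then have "sqrt W > 0" using W0 by simp
    then show ?thesis using \<open>sqrt W * sqrt W \<le> sqrt W * (c * sqrt G)\<close> by (simp only: mult_le_cancel_left_pos)
  qed
  then have "(sqrt W)\<^sup>2 \<le> (c * sqrt G)\<^sup>2" using W0 by (intro power_mono) auto
  also have "... = c\<^sup>2 * G" using G0 by (simp add: power_mult_distrib)
  also have "c\<^sup>2 = (?n / 2 / p) powr p" unfolding c_def power2_eq_square by (subst powr_add[symmetric]) simp
  finally show ?thesis using W0 by (simp add: W_def G_def)
qed

lemma dual_pair_diff:
  assumes "dual_pair p w g" "dual_pair p w' g'"
  shows "dual_pair p (\<lambda>x. w x - w' x) (\<lambda>x. g x - g' x)"
proof -
  have c: "continuous_on (sphere 0 1) w" "continuous_on (sphere 0 1) w'" "continuous_on (sphere 0 1) g" "continuous_on (sphere 0 1) g'"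
    using assms by (auto simp: dual_pair_def)
  have "(LINT x|sphere_measure. (w x - w' x) * zonal k a x) = (LINT x|sphere_measure. (g x - g' x) * Ip_zonal (of_real p) k a x)" if "norm a = 1" for k a
  proof -
    have "(LINT x|sphere_measure. (w x - w' x) * zonal k a x) = (LINT x|sphere_measure. w x * zonal k a x) - (LINT x|sphere_measure. w' x * zonal k a x)"
      unfolding left_diff_distrib by (intro Bochner_Integration.integral_diff zonal_pair_integrable c continuous_zonal)
    also have "... = (LINT x|sphere_measure. g x * Ip_zonal (of_real p) k a x) - (LINT x|sphere_measure. g' x * Ip_zonal (of_real p) k a x)"
      using assms that by (simp add: dual_pair_def)
    also have "... = (LINT x|sphere_measure. (g x - g' x) * Ip_zonal (of_real p) k a x)"
      unfolding left_diff_distrib by (intro Bochner_Integration.integral_diff[symmetric] zonal_pair_integrable c continuous_Ip_zonal)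
    finally show ?thesis .
  qed
  then show ?thesis using assms by (auto simp: dual_pair_def intro!: continuous_intros)
qed

lemma dual_pair_Ip_smooth:
  fixes g :: "real ^ 'n => complex"
  assumes p: "0 < p" "p < real CARD('n)" and g: "smooth_on_sphere g" "even_on_sphere g"
  shows "dual_pair p (Ip_smooth p g) g"
proof -
  have "continuous_on (sphere 0 1) (Ip_smooth p g)"
    by (rule continuous_on_subset[OF smooth_on_continuous[OF Ip_smooth_properties(2)[OF p g(1)]]]) auto
  moreover have "continuous_on (sphere 0 1) g"
  proof -
    have "continuous_on (sphere 0 1) (\<lambda>x. g (x /\<^sub>R norm x))"
      by (rule continuous_on_subset[OF smooth_on_sphere_continuous[OF g(1)]]) auto
    then show ?thesis by (rule continuous_on_eq) auto
  qed
  ultimately show ?thesis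
    using Ip_smooth_properties(5)[OF p g] Ip_smooth_zonal_pairing[OF p g(1)] g(2)
    by (auto simp: dual_pair_def even_on_sphere_def)
qed

section \<open>The extension by continuity\<close>

lemma smooth_on_sphere_zonal: "smooth_on_sphere (zonal k a :: real ^ 'n => complex)"
  unfolding smooth_on_sphere_def
proof (rule smooth_on_cong_open)
  let ?S = "- {0} :: (real ^ 'n) set"
  let ?f = "\<lambda>x::real^'n. 4 ^ k / fact (2 * k) * ((x \<bullet> a) ^ (2 * k) * ((norm x)\<^sup>2) powr (- real k))"
  show o: "open ?S" by auto
  have "smooth_on ?S (\<lambda>x. ((norm x)\<^sup>2) powr (- real k))"
    by (rule smooth_on_compose_real[where T="{0<..}"]) (auto intro!: smooth_on_norm_square smooth_on_powr o)
  then show "smooth_on ?S (\<lambda>x. complex_of_real (?f x))"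
    by (intro smooth_on_of_real smooth_on_mult smooth_on_const smooth_on_power smooth_on_inner o)
  show "complex_of_real (?f x) = zonal k a (x /\<^sub>R norm x)" if "x \<in> ?S" for x
  proof -
    have "((norm x)\<^sup>2) powr (- real k) = inverse (norm x ^ (2 * k))"
      using that by (simp add: powr_minus powr_realpow power_mult)
    then have "4 ^ k * ((x /\<^sub>R norm x) \<bullet> a) ^ (2 * k) / fact (2 * k) = ?f x"
      by (simp add: power_mult_distrib power_inverse)
    then show ?thesis unfolding zonal_def by simp
  qed
qed

lemma zonal_span_smooth:
  assumes "zonal_span (u :: real ^ 'n => complex)" shows "smooth_on_sphere u" "even_on_sphere u"
proof -
  obtain A \<alpha> where A: "unit_directions A" "u = zsum A \<alpha>" using assms unfolding zonal_span_def by blast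
  have "open (- {0::real^'n})" by auto
  then show "smooth_on_sphere u"
    unfolding smooth_on_sphere_def A(2) zsum_def
    by (intro smooth_on_sum smooth_on_mult smooth_on_const smooth_on_sphere_zonal[unfolded smooth_on_sphere_def])
  show "even_on_sphere u" unfolding even_on_sphere_def A(2) zsum_def zonal_def by simp
qed

lemma smooth_approximation_sequence:
  fixes f :: "real ^ 'n => complex"
  assumes f: "continuous_on (sphere 0 1) f" "\<And>x. norm x = 1 ==> f (- x) = f x"
  obtains g where "\<And>k. smooth_on_sphere (g k)" "\<And>k. even_on_sphere (g k)" "\<And>k x. norm x = 1 ==> norm (f x - g k x) < (1 / 2) ^ k"
proof -
  have "\<exists>u. zonal_span u \<and> (\<forall>x\<in>sphere 0 1. norm (f x - u x) < (1 / 2) ^ k)" for k :: nat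
  proof -
    have "(1 / 2 :: real) ^ k > 0" by simp
    then show ?thesis using zonal_dense[OF f] unfolding zonal_limit_def by blast
  qed
  then obtain g where g: "\<And>k. zonal_span (g k)" "\<And>k x. x \<in> sphere 0 1 ==> norm (f x - g k x) < (1 / 2) ^ k" by metis
  show ?thesis
  proof (rule that[of g])
    show "smooth_on_sphere (g k)" "even_on_sphere (g k)" for k by (rule zonal_span_smooth[OF g(1)])+
  qed (use g(2) in auto)
qed

lemma norm_diff_square_le: "(norm (a - b))\<^sup>2 \<le> 2 * (norm (a - c))\<^sup>2 + 2 * (norm (c - b :: 'a::real_normed_vector))\<^sup>2"
proof -
  have "(norm (a - b))\<^sup>2 \<le> (norm (a - c) + norm (c - b))\<^sup>2"
    using norm_triangle_ineq[of "a - c" "c - b"] by (intro power_mono) auto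
  also have "... \<le> 2 * (norm (a - c))\<^sup>2 + 2 * (norm (c - b))\<^sup>2"
    using sum_squares_bound[of "norm (a - c)" "norm (c - b)"] by (simp add: power2_sum)
  finally show ?thesis .
qed

lemma integral_le_of_nn_integral_le:
  fixes F :: "'a => real"
  assumes "F \<in> borel_measurable M" "\<And>x. F x \<ge> 0" "(\<integral>\<^sup>+x. ennreal (F x) \<partial>M) \<le> ennreal B" "B \<ge> 0"
  shows "integrable M F" "(LINT x|M. F x) \<le> B"
proof -
  show i: "integrable M F"
    using assms by (intro integrableI_nonneg) (auto simp: le_less_trans[OF _ ennreal_less_top])
  have "ennreal (LINT x|M. F x) = (\<integral>\<^sup>+x. ennreal (F x) \<partial>M)" using assms by (intro nn_integral_eq_integral[symmetric] i) auto
  then have "ennreal (LINT x|M. F x) \<le> ennreal B" using assms(3) by (simp only:)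
  then show "(LINT x|M. F x) \<le> B" using ennreal_le_iff[OF assms(4)] by blast
qed

text \<open>
  Geometric decay of the \<open>L\<^sup>2\<close> increments makes the sum of the increments integrable, hence finite
  almost everywhere.
\<close>

lemma sphere_AE_limit:
  fixes w :: "nat => real ^ 'n => complex"
  assumes w: "\<And>k. continuous_on (sphere 0 1) (w k)" and B: "B \<ge> 0"
    and le: "\<And>k. (LINT x|sphere_measure. (norm (w (Suc k) x - w k x))\<^sup>2) \<le> B * (1 / 4) ^ k"
  shows "AE x in sphere_measure. (\<lambda>k. w k x) \<longlonglongrightarrow> lim (\<lambda>k. w k x)"
proof -
  let ?S = "sphere_measure :: (real^'n) measure"
  have [measurable]: "w k \<in> borel_measurable ?S" for k by (rule sphere_integrable(1)[OF w])
  have L1: "(\<integral>\<^sup>+x. ennreal (norm (w (Suc k) x - w k x)) \<partial>?S) \<le> ennreal (sqrt B * (1 / 2) ^ k)" for k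
  proof -
    have "(LINT x|?S. norm (w (Suc k) x - w k x)) = (LINT x|?S. ((norm (w (Suc k) x - w k x))\<^sup>2) powr (1 / 2))"
      by (simp add: powr_half_sqrt)
    also have "... \<le> (LINT x|?S. (norm (w (Suc k) x - w k x))\<^sup>2) powr (1 / 2)"
      by (rule jensen_powr) (auto intro!: continuous_intros w)
    also have "... \<le> (B * (1 / 4) ^ k) powr (1 / 2)" by (intro powr_mono2 le integral_nonneg_AE) auto
    also have "... = sqrt B * (1 / 2) ^ k"
      using B by (simp add: powr_half_sqrt real_sqrt_mult real_sqrt_power real_sqrt_divide)
    finally have "(LINT x|?S. norm (w (Suc k) x - w k x)) \<le> sqrt B * (1 / 2) ^ k" .
    moreover have "(\<integral>\<^sup>+x. ennreal (norm (w (Suc k) x - w k x)) \<partial>?S) = ennreal (LINT x|?S. norm (w (Suc k) x - w k x))"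
      by (intro nn_integral_eq_integral sphere_integrable_real continuous_intros w) auto
    ultimately show ?thesis by (simp add: ennreal_leI)
  qed
  have "(\<integral>\<^sup>+x. (\<Sum>k. ennreal (norm (w (Suc k) x - w k x))) \<partial>?S) = (\<Sum>k. \<integral>\<^sup>+x. ennreal (norm (w (Suc k) x - w k x)) \<partial>?S)"
    by (rule nn_integral_suminf) measurable
  also have "... \<le> (\<Sum>k. ennreal (sqrt B * (1 / 2) ^ k))" by (intro suminf_le L1 summableI)
  also have "... < \<infinity>"
  proof -
    have "summable (\<lambda>k. sqrt B * (1 / 2) ^ k)" by (intro summable_mult summable_geometric) simp
    then have "(\<Sum>k. ennreal (sqrt B * (1 / 2) ^ k)) = ennreal (\<Sum>k. sqrt B * (1 / 2) ^ k)" using B by (intro suminf_ennreal2) auto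
    then show ?thesis by simp
  qed
  finally have "AE x in ?S. (\<Sum>k. ennreal (norm (w (Suc k) x - w k x))) \<noteq> \<infinity>"
    by (intro nn_integral_PInf_AE) auto
  then show ?thesis
  proof eventually_elim
    case (elim x)
    then have "summable (\<lambda>k. norm (w (Suc k) x - w k x))" by (intro summable_suminf_not_top) auto
    then have "convergent (\<lambda>n. \<Sum>k<n. w (Suc k) x - w k x)" by (rule summable_norm_cancel[THEN summable_iff_convergent[THEN iffD1]])
    then have "convergent (\<lambda>n. w n x - w 0 x)" unfolding sum_lessThan_telescope[of "\<lambda>k. w k x"] .
    then have "convergent (\<lambda>n. (w n x - w 0 x) + w 0 x)" by (intro convergent_add convergent_const)
    then show ?case by (simp add: convergent_LIMSEQ_iff)
  qed
qed

lemma Ip_smooth_L2_lipschitz: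
  fixes f g :: "real ^ 'n => complex"
  assumes p: "0 < p" "p < real CARD('n) / 2" and f: "smooth_on_sphere f" "even_on_sphere f" and g: "smooth_on_sphere g" "even_on_sphere g"
  shows "(LINT x|sphere_measure. (norm (Ip_smooth p f x - Ip_smooth p g x))\<^sup>2) \<le> (real CARD('n) / 2 / p) powr p * (LINT x|sphere_measure. (norm (f x - g x))\<^sup>2)"
proof -
  have p': "p < real CARD('n)" using p by linarith
  show ?thesis by (intro dual_pair_L2_bound dual_pair_diff dual_pair_Ip_smooth p p' f g)
qed

lemma sphere_integral_le_const:
  fixes g :: "real ^ 'n => real"
  assumes "integrable sphere_measure g" "\<And>x. norm x = 1 ==> g x \<le> c"
  shows "(LINT x|sphere_measure. g x) \<le> c"
  using sphere_integral_ge_const[of "\<lambda>x. - g x" "- c"] assms by simp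

text \<open>
  The limit is taken pointwise along rapidly converging smooth approximations, so that evenness
  holds exactly. Fatou's lemma bounds the distance to the limit, and the \<open>L\<^sup>2\<close> Lipschitz bound makes it
  independent of the approximating sequence.
\<close>

lemma Ip_extension_exists:
  fixes f :: "real ^ 'n => complex"
  assumes p: "0 < p" "p < real CARD('n) / 2"
    and f: "continuous_on (sphere 0 1) f" "\<And>x. norm x = 1 ==> f (- x) = f x"
  shows "\<exists>h. h \<in> L2_even \<and> (\<forall>\<epsilon>>0. \<exists>\<delta>>0. \<forall>g. smooth_on_sphere g \<longrightarrow> even_on_sphere g \<longrightarrow>
        L2_norm_sphere (\<lambda>x. g x - f x) < \<delta> \<longrightarrow> L2_norm_sphere (\<lambda>x. Ip_smooth p g x - h x) < \<epsilon>)"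
proof -
  let ?S = "sphere_measure :: (real^'n) measure"
  let ?D = "\<lambda>u v. LINT x|?S. (norm (u x - v x))\<^sup>2"
  define c where "c = (real CARD('n) / 2 / p) powr p"
  have c: "c \<ge> 0" by (simp add: c_def)
  have p': "p < real CARD('n)" using p by linarith
  obtain g where g: "\<And>k. smooth_on_sphere (g k)" "\<And>k. even_on_sphere (g k)" "\<And>k x. norm x = 1 ==> norm (f x - g k x) < (1 / 2) ^ k"
    using smooth_approximation_sequence[OF f] by metis
  define w where "w k = Ip_smooth p (g k)" for k
  have cont: "continuous_on (sphere 0 1) (Ip_smooth p u)" "continuous_on (sphere 0 1) u" if "smooth_on_sphere u" "even_on_sphere u" for u :: "real^'n => complex"
    using dual_pair_Ip_smooth[OF p(1) p' that] by (auto simp: dual_pair_def)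
  have cw: "continuous_on (sphere 0 1) (w k)" for k unfolding w_def by (rule cont(1)[OF g(1,2)])
  have [measurable]: "w k \<in> borel_measurable ?S" for k by (rule sphere_integrable(1)[OF cw])
  have fg: "?D f (g k) \<le> (1 / 4) ^ k" for k
  proof (rule sphere_integral_le_const)
    show "integrable ?S (\<lambda>x. (norm (f x - g k x))\<^sup>2)" by (intro sphere_integrable_real continuous_intros f cont(2) g)
    show "(norm (f x - g k x))\<^sup>2 \<le> (1 / 4) ^ k" if "norm x = 1" for x
    proof -
      have "(norm (f x - g k x))\<^sup>2 \<le> ((1 / 2) ^ k)\<^sup>2" using g(3)[OF that, of k] by (intro power_mono) auto
      also have "((1 / 2 :: real) ^ k)\<^sup>2 = (1 / 4) ^ k" by (simp add: power2_eq_square power_mult_distrib[symmetric])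
      finally show ?thesis .
    qed
  qed
  have mid: "?D u v \<le> 2 * ?D u z + 2 * ?D z v"
    if "integrable ?S (\<lambda>x. (norm (u x - v x))\<^sup>2)" "integrable ?S (\<lambda>x. (norm (u x - z x))\<^sup>2)" "integrable ?S (\<lambda>x. (norm (z x - v x))\<^sup>2)" for u v z :: "real^'n => complex"
  proof -
    have "?D u v \<le> (LINT x|?S. 2 * (norm (u x - z x))\<^sup>2 + 2 * (norm (z x - v x))\<^sup>2)"
      using that by (intro integral_mono norm_diff_square_le) auto
    then show ?thesis using that by simp
  qed
  have ww: "?D (w j) (w k) \<le> 4 * c * (1 / 4) ^ j" if "j \<le> k" for j k
  proof -
    have "?D (g j) (g k) \<le> 2 * ?D (g j) f + 2 * ?D f (g k)"
      by (intro mid sphere_integrable_real continuous_intros f cont(2) g)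
    also have "... \<le> 2 * (1 / 4) ^ j + 2 * (1 / 4) ^ k" using fg[of j] fg[of k] by (simp add: norm_minus_commute)
    also have "... \<le> 4 * (1 / 4) ^ j" using power_decreasing[OF that, of "1 / 4 :: real"] by simp
    finally have "c * ?D (g j) (g k) \<le> c * (4 * (1 / 4) ^ j)" using c by (rule mult_left_mono)
    moreover have "?D (w j) (w k) \<le> c * ?D (g j) (g k)"
      unfolding w_def c_def by (rule Ip_smooth_L2_lipschitz[OF p g(1,2) g(1,2)])
    ultimately show ?thesis by simp
  qed
  define h where "h x = lim (\<lambda>k. w k x)" for x
  have [measurable]: "h \<in> borel_measurable ?S" unfolding h_def by measurable
  have lim: "AE x in ?S. (\<lambda>k. w k x) \<longlonglongrightarrow> h x"
    unfolding h_def
  proof (rule sphere_AE_limit[OF cw])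
    show "(LINT x|?S. (norm (w (Suc k) x - w k x))\<^sup>2) \<le> (4 * c) * (1 / 4) ^ k" for k
      using ww[of k "Suc k"] by (simp add: norm_minus_commute)
  qed (use c in simp)
  have wh: "integrable ?S (\<lambda>x. (norm (w j x - h x))\<^sup>2)" "?D (w j) h \<le> 4 * c * (1 / 4) ^ j" for j
  proof -
    have "(\<integral>\<^sup>+x. ennreal ((norm (w j x - h x))\<^sup>2) \<partial>?S) = (\<integral>\<^sup>+x. liminf (\<lambda>k. ennreal ((norm (w j x - w k x))\<^sup>2)) \<partial>?S)"
    proof (rule nn_integral_cong_AE)
      show "AE x in ?S. ennreal ((norm (w j x - h x))\<^sup>2) = liminf (\<lambda>k. ennreal ((norm (w j x - w k x))\<^sup>2))"
        using lim
      proof eventually_elim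
        case (elim x)
        have "(\<lambda>k. ennreal ((norm (w j x - w k x))\<^sup>2)) \<longlonglongrightarrow> ennreal ((norm (w j x - h x))\<^sup>2)"
          by (intro tendsto_ennrealI tendsto_intros elim)
        then show ?case by (intro lim_imp_Liminf[symmetric]) auto
      qed
    qed
    also have "... \<le> liminf (\<lambda>k. \<integral>\<^sup>+x. ennreal ((norm (w j x - w k x))\<^sup>2) \<partial>?S)" by (rule nn_integral_liminf) measurable
    also have "... \<le> liminf (\<lambda>k. ennreal (4 * c * (1 / 4) ^ j))"
    proof (rule Liminf_mono)
      have "(\<integral>\<^sup>+x. ennreal ((norm (w j x - w k x))\<^sup>2) \<partial>?S) \<le> ennreal (4 * c * (1 / 4) ^ j)" if "j \<le> k" for k
      proof -
        have "(\<integral>\<^sup>+x. ennreal ((norm (w j x - w k x))\<^sup>2) \<partial>?S) = ennreal (?D (w j) (w k))"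
          by (intro nn_integral_eq_integral sphere_integrable_real continuous_intros cw) auto
        then show ?thesis using ww[OF that] by (simp add: ennreal_leI)
      qed
      then show "\<forall>\<^sub>F k in sequentially. (\<integral>\<^sup>+x. ennreal ((norm (w j x - w k x))\<^sup>2) \<partial>?S) \<le> ennreal (4 * c * (1 / 4) ^ j)"
        by (auto simp: eventually_sequentially)
    qed
    finally have "(\<integral>\<^sup>+x. ennreal ((norm (w j x - h x))\<^sup>2) \<partial>?S) \<le> ennreal (4 * c * (1 / 4) ^ j)" by (simp add: Liminf_const)
    then show "integrable ?S (\<lambda>x. (norm (w j x - h x))\<^sup>2)" "?D (w j) h \<le> 4 * c * (1 / 4) ^ j"
      using integral_le_of_nn_integral_le[of "\<lambda>x. (norm (w j x - h x))\<^sup>2" ?S] c by auto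
  qed
  have ih: "integrable ?S (\<lambda>x. (norm (u x - h x))\<^sup>2)" if u: "continuous_on (sphere 0 1) u" for u
  proof (rule Bochner_Integration.integrable_bound)
    show "integrable ?S (\<lambda>x. 2 * (norm (u x - w 0 x))\<^sup>2 + 2 * (norm (w 0 x - h x))\<^sup>2)"
      by (intro Bochner_Integration.integrable_add integrable_mult_right wh sphere_integrable_real continuous_intros u cw)
    have [measurable]: "u \<in> borel_measurable ?S" by (rule sphere_integrable(1)[OF u])
    show "(\<lambda>x. (norm (u x - h x))\<^sup>2) \<in> borel_measurable ?S" by measurable
    show "AE x in ?S. norm ((norm (u x - h x))\<^sup>2) \<le> norm (2 * (norm (u x - w 0 x))\<^sup>2 + 2 * (norm (w 0 x - h x))\<^sup>2)"
      by (intro AE_I2) (simp add: norm_diff_square_le)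
  qed
  have L2: "h \<in> L2_even"
  proof -
    have "h (- x) = h x" if "norm x = 1" for x
    proof -
      have "w k (- x) = w k x" for k unfolding w_def by (rule Ip_smooth_properties(5)[OF p(1) p' g(1,2)])
      then show ?thesis by (simp add: h_def)
    qed
    then have "AE x in ?S. h (- x) = h x" by (intro AE_I2) (simp add: space_sphere_measure)
    moreover have "integrable ?S (\<lambda>x. (norm (h x))\<^sup>2)" using ih[of "\<lambda>_. 0"] by simp
    ultimately show ?thesis by (simp add: L2_even_def)
  qed
  have lip: "L2_norm_sphere (\<lambda>x. Ip_smooth p u x - h x) \<le> 2 * sqrt c * L2_norm_sphere (\<lambda>x. u x - f x)"
    if u: "smooth_on_sphere u" "even_on_sphere u" for u
  proof -
    let ?E = "LINT x|?S. (norm (u x - f x))\<^sup>2"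
    have "?D (Ip_smooth p u) h \<le> 4 * c * ?E"
    proof (rule LIMSEQ_le[OF tendsto_const])
      have "(\<lambda>j. (1 / 4 :: real) ^ j) \<longlonglongrightarrow> 0" by (rule LIMSEQ_realpow_zero) auto
      from tendsto_add[OF tendsto_const tendsto_mult[OF tendsto_const this]]
      show "(\<lambda>j. 4 * c * ?E + 12 * c * (1 / 4) ^ j) \<longlonglongrightarrow> 4 * c * ?E" by force
      have "?D (Ip_smooth p u) h \<le> 4 * c * ?E + 12 * c * (1 / 4) ^ j" for j
      proof -
        have "?D (Ip_smooth p u) h \<le> 2 * ?D (Ip_smooth p u) (w j) + 2 * ?D (w j) h"
          by (intro mid ih sphere_integrable_real continuous_intros cont[OF u] cw)
        moreover have "?D (Ip_smooth p u) (w j) \<le> c * ?D u (g j)"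
          unfolding w_def c_def by (rule Ip_smooth_L2_lipschitz[OF p u g(1,2)])
        moreover have "c * ?D u (g j) \<le> c * (2 * ?E + 2 * (1 / 4) ^ j)"
        proof (rule mult_left_mono[OF _ c])
        have "?D u (g j) \<le> 2 * ?E + 2 * ?D f (g j)"
          by (intro mid sphere_integrable_real continuous_intros f cont(2) u g)
        also have "... \<le> 2 * ?E + 2 * (1 / 4) ^ j" using fg[of j] by simp
        finally show "?D u (g j) \<le> 2 * ?E + 2 * (1 / 4) ^ j" .
        qed
        ultimately show ?thesis using wh(2)[of j] by (simp add: algebra_simps)
      qed
      then show "\<exists>N. \<forall>j\<ge>N. ?D (Ip_smooth p u) h \<le> 4 * c * ?E + 12 * c * (1 / 4) ^ j" by blast
    qed
    then have "L2_norm_sphere (\<lambda>x. Ip_smooth p u x - h x) \<le> sqrt (4 * c * ?E)"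
      unfolding L2_norm_sphere_def by (rule real_sqrt_le_mono)
    also have "... = 2 * sqrt c * L2_norm_sphere (\<lambda>x. u x - f x)" unfolding L2_norm_sphere_def by (simp add: real_sqrt_mult)
    finally show ?thesis .
  qed
  have "\<exists>\<delta>>0. \<forall>g. smooth_on_sphere g \<longrightarrow> even_on_sphere g \<longrightarrow>
        L2_norm_sphere (\<lambda>x. g x - f x) < \<delta> \<longrightarrow> L2_norm_sphere (\<lambda>x. Ip_smooth p g x - h x) < \<epsilon>" if e: "\<epsilon> > 0" for \<epsilon>
  proof (intro exI conjI allI impI)
    let ?d = "\<epsilon> / (2 * sqrt c + 1)"
    have c1: "2 * sqrt c + 1 > 0" using c by (simp add: add_nonneg_pos)
    then show "?d > 0" using e by simp
    fix u :: "real^'n => complex" assume u: "smooth_on_sphere u" "even_on_sphere u" and d: "L2_norm_sphere (\<lambda>x. u x - f x) < ?d"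
    have "L2_norm_sphere (\<lambda>x. Ip_smooth p u x - h x) \<le> 2 * sqrt c * ?d"
      using lip[OF u] mult_left_mono[OF less_imp_le[OF d], of "2 * sqrt c"] c by simp
    also have "... < (2 * sqrt c + 1) * ?d" using \<open>?d > 0\<close> by (simp add: distrib_right del: times_divide_eq_right)
    also have "... = \<epsilon>" using c1 by simp
    finally show "L2_norm_sphere (\<lambda>x. Ip_smooth p u x - h x) < \<epsilon>" .
  qed
  then show ?thesis using L2 by blast
qed

text \<open>
  The chosen representative is an \<open>L\<^sup>2\<close> limit of \<open>I\<^sub>p\<close> of smooth approximations of \<open>f\<close>, hence an almost
  everywhere limit of a subsequence; the norm bound passes to it by Fatou's lemma.
\<close>

theorem Ip_norm_bound:
  fixes f :: "real ^ 'n => complex"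
  assumes p: "0 < p" "p < real CARD('n) / 2"
    and f: "continuous_on (sphere 0 1) f" "\<And>x. norm x = 1 ==> f (- x) = f x"
  shows "(\<integral>\<^sup>+x. ennreal (norm (Ip p f x) powr (real CARD('n) / p)) \<partial>sphere_measure)
    \<le> ennreal ((real CARD('n) / (2 * p)) powr (real CARD('n) / 2)
        * (LINT x|sphere_measure. norm (f x) powr (real CARD('n) / (real CARD('n) - p))) powr (real CARD('n) / p - 1))"
proof -
  let ?n = "real CARD('n)"
  let ?S = "sphere_measure :: (real^'n) measure"
  define q where "q = ?n / (?n - p)"
  define r where "r = ?n / p"
  define C where "C = (?n / (2 * p)) powr (?n / 2)"
  have p': "p < ?n" using p by linarith
  have q: "q > 0" using p p' by (simp add: q_def)
  have r: "r > 1" using p p' by (simp add: r_def)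
  define h where "h = Ip p f"
  have "h \<in> L2_even \<and> (\<forall>\<epsilon>>0. \<exists>\<delta>>0. \<forall>g. smooth_on_sphere g \<longrightarrow> even_on_sphere g \<longrightarrow>
        L2_norm_sphere (\<lambda>x. g x - f x) < \<delta> \<longrightarrow> L2_norm_sphere (\<lambda>x. Ip_smooth p g x - h x) < \<epsilon>)"
    unfolding h_def Ip_def by (rule someI_ex[OF Ip_extension_exists[OF p f]])
  then have L2: "h \<in> L2_even" and ext: "\<And>\<epsilon>. \<epsilon> > 0 ==> \<exists>\<delta>>0. \<forall>g. smooth_on_sphere g \<longrightarrow> even_on_sphere g \<longrightarrow>
        L2_norm_sphere (\<lambda>x. g x - f x) < \<delta> \<longrightarrow> L2_norm_sphere (\<lambda>x. Ip_smooth p g x - h x) < \<epsilon>"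
    by blast+
  have [measurable]: "h \<in> borel_measurable ?S" and h2: "integrable ?S (\<lambda>x. (norm (h x))\<^sup>2)"
    using L2 by (auto simp: L2_even_def)
  obtain g where g: "\<And>k. smooth_on_sphere (g k)" "\<And>k. even_on_sphere (g k)" "\<And>k x. norm x = 1 ==> norm (f x - g k x) < (1 / 2) ^ k"
    using smooth_approximation_sequence[OF f] by metis
  define w where "w k = Ip_smooth p (g k)" for k
  have dp: "dual_pair p (w k) (g k)" for k unfolding w_def by (rule dual_pair_Ip_smooth[OF p(1) p' g(1,2)])
  have cw: "continuous_on (sphere 0 1) (w k)" and cg: "continuous_on (sphere 0 1) (g k)" for k
    using dp[of k] by (auto simp: dual_pair_def)
  have [measurable]: "w k \<in> borel_measurable ?S" "g k \<in> borel_measurable ?S" "f \<in> borel_measurable ?S" for k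
    by (rule sphere_integrable(1); rule cw cg f)+
  have half: "(\<lambda>k. (1 / 2 :: real) ^ k) \<longlonglongrightarrow> 0" by (rule LIMSEQ_realpow_zero) auto
  have int: "integrable ?S (\<lambda>x. (norm (w k x - h x))\<^sup>2)" for k
  proof (rule Bochner_Integration.integrable_bound)
    show "integrable ?S (\<lambda>x. 2 * (norm (w k x - 0))\<^sup>2 + 2 * (norm (0 - h x))\<^sup>2)"
    proof (intro Bochner_Integration.integrable_add integrable_mult_right)
      show "integrable ?S (\<lambda>x. (norm (w k x - 0))\<^sup>2)" by (intro sphere_integrable_real continuous_intros cw)
      show "integrable ?S (\<lambda>x. (norm (0 - h x))\<^sup>2)" using h2 by simp
    qed
    show "AE x in ?S. norm ((norm (w k x - h x))\<^sup>2) \<le> norm (2 * (norm (w k x - 0))\<^sup>2 + 2 * (norm (0 - h x))\<^sup>2)"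
      using norm_diff_square_le[of _ _ 0] by (intro AE_I2) simp
  qed measurable
  have conv: "(\<lambda>k. L2_norm_sphere (\<lambda>x. w k x - h x)) \<longlonglongrightarrow> 0"
  proof (rule LIMSEQ_I)
    fix e :: real assume "e > 0"
    then obtain d where d: "d > 0" "\<And>u. smooth_on_sphere u ==> even_on_sphere u ==> L2_norm_sphere (\<lambda>x. u x - f x) < d ==> L2_norm_sphere (\<lambda>x. Ip_smooth p u x - h x) < e"
      using ext by blast
    obtain N where N: "\<And>k. k \<ge> N ==> norm ((1 / 2 :: real) ^ k - 0) < d" using LIMSEQ_D[OF half d(1)] by blast
    have "norm (L2_norm_sphere (\<lambda>x. w k x - h x) - 0) < e" if k: "k \<ge> N" for k
    proof -
      have "(LINT x|?S. (norm (g k x - f x))\<^sup>2) \<le> ((1 / 2) ^ k)\<^sup>2"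
      proof (rule sphere_integral_le_const)
        show "integrable ?S (\<lambda>x. (norm (g k x - f x))\<^sup>2)" by (intro sphere_integrable_real continuous_intros f cg)
        show "(norm (g k x - f x))\<^sup>2 \<le> ((1 / 2) ^ k)\<^sup>2" if "norm x = 1" for x
          using g(3)[OF that, of k] by (intro power_mono) (auto simp: norm_minus_commute)
      qed
      then have "L2_norm_sphere (\<lambda>x. g k x - f x) \<le> sqrt (((1 / 2) ^ k)\<^sup>2)" unfolding L2_norm_sphere_def by (rule real_sqrt_le_mono)
      also have "... = (1 / 2) ^ k" by simp
      also have "... < d" using N[OF k] by simp
      finally have "L2_norm_sphere (\<lambda>x. w k x - h x) < e" unfolding w_def by (rule d(2)[OF g(1,2)])
      moreover have "L2_norm_sphere (\<lambda>x. w k x - h x) \<ge> 0" unfolding L2_norm_sphere_def by (auto intro!: integral_nonneg_AE)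
      ultimately show ?thesis by simp
    qed
    then show "\<exists>N. \<forall>k\<ge>N. norm (L2_norm_sphere (\<lambda>x. w k x - h x) - 0) < e" by blast
  qed
  have "(\<lambda>k. LINT x|?S. norm ((norm (w k x - h x))\<^sup>2)) \<longlonglongrightarrow> 0"
  proof -
    have "(LINT x|?S. norm ((norm (w k x - h x))\<^sup>2)) = (L2_norm_sphere (\<lambda>x. w k x - h x))\<^sup>2" for k
      unfolding L2_norm_sphere_def by (simp add: integral_nonneg_AE)
    then show ?thesis using tendsto_power[OF conv, of 2] by simp
  qed
  from tendsto_L1_AE_subseq[OF int this] obtain s where s: "strict_mono s" and AE0: "AE x in ?S. (\<lambda>k. (norm (w (s k) x - h x))\<^sup>2) \<longlonglongrightarrow> 0" by blast
  from AE0 have lim: "AE x in ?S. (\<lambda>k. w (s k) x) \<longlonglongrightarrow> h x"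
  proof eventually_elim
    case (elim x)
    have "(\<lambda>k. sqrt ((norm (w (s k) x - h x))\<^sup>2)) \<longlonglongrightarrow> sqrt 0" by (rule tendsto_real_sqrt[OF elim])
    then have "(\<lambda>k. norm (w (s k) x - h x)) \<longlonglongrightarrow> 0" by simp
    then show ?case by (simp only: tendsto_norm_zero_iff LIM_zero_iff)
  qed
  define G where "G k = (LINT x|?S. norm (g k x) powr q)" for k
  have G: "G \<longlonglongrightarrow> (LINT x|?S. norm (f x) powr q)"
    unfolding G_def
  proof (rule integral_dominated_convergence[where w="\<lambda>x. (norm (f x) + 1) powr q"])
    show "integrable ?S (\<lambda>x. (norm (f x) + 1) powr q)" by (intro sphere_integrable_real continuous_norm_powr f q) auto
    show "AE x in ?S. (\<lambda>k. norm (g k x) powr q) \<longlonglongrightarrow> norm (f x) powr q"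
    proof (rule AE_I2)
      fix x assume "x \<in> space ?S"
      then have x: "norm x = 1" by (simp add: space_sphere_measure)
      have "(\<lambda>k. f x - g k x) \<longlonglongrightarrow> 0"
        by (rule Lim_null_comparison[OF _ half]) (use g(3)[OF x] in \<open>auto intro!: always_eventually less_imp_le\<close>)
      then have "(\<lambda>k. f x - (f x - g k x)) \<longlonglongrightarrow> f x - 0" by (intro tendsto_diff tendsto_const)
      then have "(\<lambda>k. g k x) \<longlonglongrightarrow> f x" by simp
      then show "(\<lambda>k. norm (g k x) powr q) \<longlonglongrightarrow> norm (f x) powr q"
        using q by (intro tendsto_powr' tendsto_norm tendsto_const) auto
    qed
    show "AE x in ?S. norm (norm (g k x) powr q) \<le> (norm (f x) + 1) powr q" for k
    proof (rule AE_I2)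
      fix x assume "x \<in> space ?S"
      then have x: "norm x = 1" by (simp add: space_sphere_measure)
      have "norm (g k x) \<le> norm (f x) + norm (f x - g k x)" using norm_triangle_ineq2[of "g k x" "f x"] by (simp add: norm_minus_commute)
      also have "norm (f x - g k x) \<le> 1" using g(3)[OF x, of k] power_le_one[of "1 / 2 :: real" k] by simp
      finally show "norm (norm (g k x) powr q) \<le> (norm (f x) + 1) powr q" using q by (simp add: powr_mono2)
    qed
  qed measurable
  have wG: "(\<integral>\<^sup>+x. ennreal (norm (w k x) powr r) \<partial>?S) \<le> ennreal (C * G k powr (r - 1))" for k
  proof -
    have "(\<integral>\<^sup>+x. ennreal (norm (w k x) powr r) \<partial>?S) = ennreal (LINT x|?S. norm (w k x) powr r)"
      using r by (intro nn_integral_eq_integral sphere_integrable_real continuous_norm_powr_0 cw) auto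
    also have "... \<le> ennreal (C * G k powr (r - 1))"
      using dual_pair_norm_bound[OF dp p, of k] by (intro ennreal_leI) (simp add: C_def G_def r_def q_def)
    finally show ?thesis .
  qed
  have "(\<integral>\<^sup>+x. ennreal (norm (h x) powr r) \<partial>?S) = (\<integral>\<^sup>+x. liminf (\<lambda>k. ennreal (norm (w (s k) x) powr r)) \<partial>?S)"
  proof (rule nn_integral_cong_AE)
    show "AE x in ?S. ennreal (norm (h x) powr r) = liminf (\<lambda>k. ennreal (norm (w (s k) x) powr r))"
      using lim
    proof eventually_elim
      case (elim x)
      have "(\<lambda>k. ennreal (norm (w (s k) x) powr r)) \<longlonglongrightarrow> ennreal (norm (h x) powr r)"
        using r by (intro tendsto_ennrealI tendsto_powr' tendsto_norm elim tendsto_const) auto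
      then show ?case by (intro lim_imp_Liminf[symmetric]) auto
    qed
  qed
  also have "... \<le> liminf (\<lambda>k. \<integral>\<^sup>+x. ennreal (norm (w (s k) x) powr r) \<partial>?S)" by (rule nn_integral_liminf) measurable
  also have "... \<le> liminf (\<lambda>k. ennreal (C * G (s k) powr (r - 1)))" by (intro Liminf_mono always_eventually allI wG)
  also have "... = ennreal (C * (LINT x|?S. norm (f x) powr q) powr (r - 1))"
  proof (rule lim_imp_Liminf)
    have "(\<lambda>k. G (s k)) \<longlonglongrightarrow> (LINT x|?S. norm (f x) powr q)" using LIMSEQ_subseq_LIMSEQ[OF G s] by (simp add: comp_def)
    moreover have "G k \<ge> 0" for k unfolding G_def by (intro integral_nonneg_AE) auto
    ultimately show "(\<lambda>k. ennreal (C * G (s k) powr (r - 1))) \<longlonglongrightarrow> ennreal (C * (LINT x|?S. norm (f x) powr q) powr (r - 1))"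
      using r by (intro tendsto_ennrealI tendsto_mult tendsto_powr' tendsto_const) auto
  qed simp
  finally show ?thesis unfolding h_def r_def q_def C_def .
qed

section \<open>Star bodies in polar coordinates\<close>

lemma star_body_radial:
  fixes K :: "(real ^ 'n) set"
  assumes K: "star_body K" and \<xi>: "norm \<xi> = 1" and a: "a \<ge> 0"
  shows "a *\<^sub>R \<xi> \<in> K \<longleftrightarrow> a \<le> radial_function K \<xi>"
proof -
  have comp: "compact K" and ne: "K \<noteq> {}" and star: "\<And>x. x \<in> K ==> closed_segment x 0 \<subseteq> K"
    using K by (auto simp: star_body_def star_shaped_def)
  define T where "T = {a. a \<ge> 0 \<and> a *\<^sub>R \<xi> \<in> K}"
  obtain y where "y \<in> K" using ne by blast
  then have z: "0 \<in> K" using star[of y] by auto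
  have "compact T"
  proof (rule compact_eq_bounded_closed[THEN iffD2], rule conjI)
    obtain B where B: "\<And>x. x \<in> K ==> norm x \<le> B" using compact_imp_bounded[OF comp] unfolding bounded_iff by blast
    show "bounded T" unfolding bounded_iff using B \<xi> by (intro exI[of _ B]) (force simp: T_def)
    have "T = {0..} \<inter> (\<lambda>a. a *\<^sub>R \<xi>) -` K" by (auto simp: T_def)
    also have "closed ..." by (intro closed_Int closed_vimage compact_imp_closed[OF comp] continuous_intros closed_atLeast)
    finally show "closed T" .
  qed
  moreover have "0 \<in> T" using z by (simp add: T_def)
  ultimately obtain m where m: "m \<in> T" "\<And>b. b \<in> T ==> b \<le> m" using compact_attains_sup[of T] by blast
  have r: "radial_function K \<xi> = m"
    unfolding radial_function_def by (rule Greatest_equality) (use m in \<open>auto simp: T_def\<close>)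
  show ?thesis
  proof
    assume "a *\<^sub>R \<xi> \<in> K"
    then show "a \<le> radial_function K \<xi>" unfolding r using m(2)[of a] a by (simp add: T_def)
  next
    assume "a \<le> radial_function K \<xi>"
    then have am: "a \<le> m" by (simp add: r)
    have mK: "m *\<^sub>R \<xi> \<in> K" "m \<ge> 0" using m(1) by (auto simp: T_def)
    have "a *\<^sub>R \<xi> \<in> closed_segment (m *\<^sub>R \<xi>) 0"
    proof (cases "m = 0")
      case True
      then show ?thesis using a am by simp
    next
      case False
      then have "m > 0" using mK by simp
      then show ?thesis unfolding closed_segment_def using a am
        by (auto intro!: exI[of _ "1 - a / m"])
    qed
    then show "a *\<^sub>R \<xi> \<in> K" using star[OF mK(1)] by blast
  qed
qed

lemma minkowski_functional_eq:
  fixes K :: "(real ^ 'n) set"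
  assumes K: "star_body K" and \<xi>: "norm \<xi> = 1"
  shows "minkowski_functional K \<xi> = inverse (radial_function K \<xi>)"
proof -
  have pos: "radial_function K \<xi> > 0" using K \<xi> by (auto simp: star_body_def)
  have iff: "a \<ge> 0 \<and> \<xi> \<in> (*\<^sub>R) a ` K \<longleftrightarrow> inverse (radial_function K \<xi>) \<le> a" for a
  proof (cases "a > 0")
    case True
    have "\<xi> \<in> (*\<^sub>R) a ` K \<longleftrightarrow> inverse a *\<^sub>R \<xi> \<in> K"
    proof
      assume "\<xi> \<in> (*\<^sub>R) a ` K"
      then obtain k where k: "k \<in> K" "\<xi> = a *\<^sub>R k" by blast
      have "inverse a *\<^sub>R \<xi> = k" unfolding k(2) using True by simp
      then show "inverse a *\<^sub>R \<xi> \<in> K" using k by simp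
    next
      assume "inverse a *\<^sub>R \<xi> \<in> K"
      then show "\<xi> \<in> (*\<^sub>R) a ` K" using True by (intro image_eqI[of _ _ "inverse a *\<^sub>R \<xi>"]) auto
    qed
    also have "... \<longleftrightarrow> inverse a \<le> radial_function K \<xi>" using True by (intro star_body_radial[OF K \<xi>]) simp
    also have "... \<longleftrightarrow> inverse (radial_function K \<xi>) \<le> a" using True pos by (simp add: field_simps)
    finally show ?thesis using True by simp
  next
    case False
    have "inverse (radial_function K \<xi>) > 0" using pos by simp
    then have "\<not> inverse (radial_function K \<xi>) \<le> a" using False by linarith
    moreover have "\<not> (a \<ge> 0 \<and> \<xi> \<in> (*\<^sub>R) a ` K)"
    proof
      assume "a \<ge> 0 \<and> \<xi> \<in> (*\<^sub>R) a ` K"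
      then have "\<xi> = 0" using False by auto
      then show False using \<xi> by simp
    qed
    ultimately show ?thesis by blast
  qed
  show ?thesis unfolding minkowski_functional_def iff by (rule Least_equality) auto
qed

lemma star_body_volume:
  fixes K :: "(real ^ 'n) set"
  assumes K: "star_body K"
  shows "measure lborel K = unit_ball_vol (real CARD('n)) * (LINT \<theta>|sphere_measure. radial_function K \<theta> powr real CARD('n))"
proof -
  let ?S = "sphere_measure :: (real^'n) measure"
  let ?\<rho> = "radial_function K"
  let ?v = "unit_ball_vol (real CARD('n))"
  have comp: "compact K" and cont: "continuous_on (sphere 0 1) ?\<rho>" and pos: "\<And>\<xi>. norm \<xi> = 1 ==> ?\<rho> \<xi> > 0"
    using K by (auto simp: star_body_def)
  have [measurable]: "K \<in> sets borel" using comp by (simp add: borel_closed compact_imp_closed)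
  have v: "?v \<ge> 0" by simp
  have cn: "continuous_on (sphere 0 1) (\<lambda>\<theta>. ?\<rho> \<theta> powr real CARD('n))"
    by (intro continuous_on_powr' cont continuous_intros) (auto intro!: less_imp_le[OF pos])
  have inner: "(\<integral>\<^sup>+r. indicator K (r *\<^sub>R \<theta>) \<partial>radial_measure CARD('n)) = ennreal (?v * ?\<rho> \<theta> powr real CARD('n))" if \<theta>: "norm \<theta> = 1" for \<theta>
  proof -
    have "AE r in radial_measure CARD('n). r \<noteq> ?\<rho> \<theta>"
      unfolding radial_measure_def by (subst AE_density) (use AE_lborel_singleton[of "?\<rho> \<theta>"] in \<open>auto elim: eventually_mono\<close>)
    moreover have "AE r in radial_measure CARD('n). r > 0" by (rule AE_radial_measure_pos)
    ultimately have "(\<integral>\<^sup>+r. indicator K (r *\<^sub>R \<theta>) \<partial>radial_measure CARD('n)) = (\<integral>\<^sup>+r. indicator {..<?\<rho> \<theta>} r \<partial>radial_measure CARD('n))"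
    proof (intro nn_integral_cong_AE, eventually_elim)
      case (elim r)
      then show "indicator K (r *\<^sub>R \<theta>) = (indicator {..<?\<rho> \<theta>} r :: ennreal)"
        by (simp add: indicator_def star_body_radial[OF K \<theta>] order_less_le)
    qed
    also have "... = emeasure (radial_measure CARD('n)) {..<?\<rho> \<theta>}" by (rule nn_integral_indicator) simp
    also have "... = ennreal (?v * ?\<rho> \<theta> powr real CARD('n))"
      using pos[OF \<theta>] by (subst emeasure_radial_lessThan) (auto simp: powr_realpow)
    finally show ?thesis .
  qed
  have "emeasure lborel K = (\<integral>\<^sup>+x. indicator K x \<partial>lborel)" by simp
  also have "... = (\<integral>\<^sup>+\<theta>. (\<integral>\<^sup>+r. indicator K (r *\<^sub>R \<theta>) \<partial>radial_measure CARD('n)) \<partial>?S)" by (rule nn_integral_polar) measurable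
  also have "... = (\<integral>\<^sup>+\<theta>. ennreal (?v * ?\<rho> \<theta> powr real CARD('n)) \<partial>?S)" by (intro nn_integral_cong inner) (simp add: space_sphere_measure)
  also have "... = ennreal (LINT \<theta>|?S. ?v * ?\<rho> \<theta> powr real CARD('n))"
    using v by (intro nn_integral_eq_integral sphere_integrable_real continuous_on_mult continuous_on_const cn) auto
  also have "... = ennreal (?v * (LINT \<theta>|?S. ?\<rho> \<theta> powr real CARD('n)))" by simp
  finally show ?thesis unfolding measure_def by (simp add: integral_nonneg_AE)
qed

theorem theorem3:
  fixes K :: "(real ^ 'n) set" and p :: real
  assumes "CARD('n) \<ge> 2"
    and "0 < p" and "p < real CARD('n) / 2"
    and "star_body K" and "origin_symmetric K"
  shows "(\<integral>\<^sup>+\<theta>. ennreal (cmod (Ip p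
            (\<lambda>x. complex_of_real (minkowski_functional K x powr (- real CARD('n) + p))) \<theta>)
              powr (real CARD('n) / p)) \<partial>sphere_measure)
         \<le> ennreal ((real CARD('n) / (2 * p)) powr (real CARD('n) / 2)
              * unit_ball_vol (real CARD('n)) powr (1 - real CARD('n) / p)
              * measure lborel K powr (real CARD('n) / p - 1))"
proof -
  let ?n = "real CARD('n)"
  let ?S = "sphere_measure :: (real^'n) measure"
  let ?\<rho> = "radial_function K"
  let ?v = "unit_ball_vol ?n"
  note p = assms(2,3) and K = assms(4)
  define f where "f x = complex_of_real (minkowski_functional K x powr (- ?n + p))" for x
  have n: "?n > 0" "?n - p > 0" using p by auto
  have cont: "continuous_on (sphere 0 1) ?\<rho>" and pos: "\<And>\<xi>. norm \<xi> = 1 \<Longrightarrow> ?\<rho> \<xi> > 0"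
    using K by (auto simp: star_body_def)
  have f: "f x = complex_of_real (?\<rho> x powr (?n - p))" if x: "norm x = 1" for x
  proof -
    have "inverse (?\<rho> x) powr (- ?n + p) = inverse (?\<rho> x powr (- ?n + p))" by (rule inverse_powr)
    also have "\<dots> = ?\<rho> x powr (?n - p)" by (simp add: powr_minus[symmetric])
    finally show ?thesis by (simp add: f_def minkowski_functional_eq[OF K x])
  qed
  have cf: "continuous_on (sphere 0 1) f"
  proof (rule continuous_on_eq)
    show "continuous_on (sphere 0 1) (\<lambda>x. complex_of_real (?\<rho> x powr (?n - p)))"
      using n by (intro continuous_on_of_real continuous_on_powr' cont continuous_on_const) (auto intro!: less_imp_le[OF pos])
  qed (simp add: f)
  \<comment> \<open>Evenness of \<open>f\<close> is the symmetry of the body.\<close>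
  have ef: "f (- x) = f x" if x: "norm x = 1" for x
  proof -
    have "y \<in> K \<longleftrightarrow> - y \<in> K" for y
      using assms(5) unfolding origin_symmetric_def by (metis image_eqI minus_minus image_iff)
    then have "?\<rho> (- x) = ?\<rho> x" unfolding radial_function_def by simp
    then show ?thesis using f[of x] f[of "- x"] x by simp
  qed
  define R where "R = (LINT \<theta>|?S. ?\<rho> \<theta> powr ?n)"
  have R: "R \<ge> 0" unfolding R_def by (intro integral_nonneg_AE) auto
  have fR: "(LINT x|?S. norm (f x) powr (?n / (?n - p))) = R"
    unfolding R_def using n by (intro Bochner_Integration.integral_cong refl) (simp add: f space_sphere_measure powr_powr)
  have v: "?v > 0" by simp
  have vnz: "?v \<noteq> 0" using v by (rule less_imp_neq[symmetric])
  have "R powr (?n / p - 1) = ?v powr (1 - ?n / p) * (?v * R) powr (?n / p - 1)"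
  proof -
    have "?v powr (1 - ?n / p) * (?v * R) powr (?n / p - 1) = (?v powr (1 - ?n / p) * ?v powr (?n / p - 1)) * R powr (?n / p - 1)"
      using v R by (simp add: powr_mult)
    also have "?v powr (1 - ?n / p) * ?v powr (?n / p - 1) = 1" by (subst powr_add[symmetric]) (simp add: vnz)
    finally show ?thesis by simp
  qed
  then have "(?n / (2 * p)) powr (?n / 2) * R powr (?n / p - 1) = (?n / (2 * p)) powr (?n / 2) * ?v powr (1 - ?n / p) * measure lborel K powr (?n / p - 1)"
    unfolding star_body_volume[OF K] R_def by simp
  then show ?thesis
    using Ip_norm_bound[OF p cf ef] unfolding fR unfolding f_def by (simp only:)
qed

end
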